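(* Let $P=\bigoplus_{i=1}^r M_{m_i}$ and $Q=\bigoplus_{i=1}^s M_{n_i}$, where $\sum_i m_i=\sum_i n_i=N$, and let $\mathbb C^N$ be identified with the diagonal matrices of $P$ and with the diagonal matrices of $Q$. Let $W_1,\dots,W_p$ be the connected components of the graph associated to $P$ and $Q$ (defined in the context), let $k_i$ be the number of edges of $W_i$, and let $q_i$ be the number of edges left over after removing a spanning tree from $W_i$. Then \[ P \ast_{\mathbb C^N} Q \cong \bigoplus_{i=1}^p M_{k_i}\bigl(C^*(F_{q_i})\bigr). \]
   Context: $M_m=M_m(\mathbb C)$. $\mathbb C^N$ is identified with the natural abelian subalgebra of diagonal matrices in $P$ and in $Q$, the diagonal positions of the successive blocks being listed in order; thus each of the $N$ minimal projections of $\mathbb C^N$ corresponds to one diagonal matrix unit of $P$ and one diagonal matrix unit of $Q$. $P\ast_{\mathbb C^N}Q$ is the amalgamated free product in the category of $C^*$-algebras and $*$-homomorphisms, i.e. the pushout of the inclusions $\mathbb C^N\to P$ and $\mathbb C^N\to Q$. The graph associated to $P$ and $Q$: it is an undirected graph (multiple edges allowed) with $r+s$ vertices, one for each summand $M_{m_i}$ of $P$ and one for each summand $M_{n_i}$ of $Q$, and $N$ edges, one for each minimal diagonal projection (diagonal matrix unit) $e$ of $\mathbb C^N$; the edge associated to $e$ connects the vertex of the summand of $P$ containing $e$ to the vertex of the summand of $Q$ containing $e$. $F_q$ denotes the free group of rank $q$ ($F_0$ is trivial), and $C^*(F_q)$ is its full group $C^*$-algebra. *)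

theory Defs
  imports Complex_Main "HOL-Library.FuncSet" "HOL-Algebra.Module"
begin

section \<open>C*-algebras\<close>

text \<open>
  Algebras are carrier-based, because direct sums of matrix algebras of different sizes are needed.
  They extend the library's module records over the complex numbers. A C*-algebra is not required
  to be unital: the field \<^const>\<open>one\<close> is part of the record but no axiom below mentions it.
\<close>

record 'a star_alg = "(complex, 'a) module" +
  adj :: "'a \<Rightarrow> 'a"

record 'a cstar = "'a star_alg" +
  cnorm :: "'a \<Rightarrow> real"

definition complex_alg :: "complex cstar" where
  "complex_alg = \<lparr>carrier = UNIV, mult = (*), one = 1, zero = 0, add = (+), smult = (*),
     adj = cnj, cnorm = cmod\<rparr>"

locale star_algebra = module complex_alg A for A :: "('a, 'm) star_alg_scheme" +
  assumes mult_closed: "x \<in> carrier A \<Longrightarrow> y \<in> carrier A \<Longrightarrow> x \<otimes>\<^bsub>A\<^esub> y \<in> carrier A"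
    and mult_assoc: "x \<in> carrier A \<Longrightarrow> y \<in> carrier A \<Longrightarrow> z \<in> carrier A \<Longrightarrow>
      (x \<otimes>\<^bsub>A\<^esub> y) \<otimes>\<^bsub>A\<^esub> z = x \<otimes>\<^bsub>A\<^esub> (y \<otimes>\<^bsub>A\<^esub> z)"
    and distrib_right: "x \<in> carrier A \<Longrightarrow> y \<in> carrier A \<Longrightarrow> z \<in> carrier A \<Longrightarrow>
      (x \<oplus>\<^bsub>A\<^esub> y) \<otimes>\<^bsub>A\<^esub> z = x \<otimes>\<^bsub>A\<^esub> z \<oplus>\<^bsub>A\<^esub> y \<otimes>\<^bsub>A\<^esub> z"
    and distrib_left: "x \<in> carrier A \<Longrightarrow> y \<in> carrier A \<Longrightarrow> z \<in> carrier A \<Longrightarrow>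
      x \<otimes>\<^bsub>A\<^esub> (y \<oplus>\<^bsub>A\<^esub> z) = x \<otimes>\<^bsub>A\<^esub> y \<oplus>\<^bsub>A\<^esub> x \<otimes>\<^bsub>A\<^esub> z"
    and smult_mult_left: "x \<in> carrier A \<Longrightarrow> y \<in> carrier A \<Longrightarrow>
      (c \<odot>\<^bsub>A\<^esub> x) \<otimes>\<^bsub>A\<^esub> y = c \<odot>\<^bsub>A\<^esub> (x \<otimes>\<^bsub>A\<^esub> y)"
    and smult_mult_right: "x \<in> carrier A \<Longrightarrow> y \<in> carrier A \<Longrightarrow>
      x \<otimes>\<^bsub>A\<^esub> (c \<odot>\<^bsub>A\<^esub> y) = c \<odot>\<^bsub>A\<^esub> (x \<otimes>\<^bsub>A\<^esub> y)"
    and adj_closed: "x \<in> carrier A \<Longrightarrow> adj A x \<in> carrier A"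
    and adj_adj: "x \<in> carrier A \<Longrightarrow> adj A (adj A x) = x"
    and adj_add: "x \<in> carrier A \<Longrightarrow> y \<in> carrier A \<Longrightarrow> adj A (x \<oplus>\<^bsub>A\<^esub> y) = adj A x \<oplus>\<^bsub>A\<^esub> adj A y"
    and adj_smult: "x \<in> carrier A \<Longrightarrow> adj A (c \<odot>\<^bsub>A\<^esub> x) = cnj c \<odot>\<^bsub>A\<^esub> adj A x"
    and adj_mult: "x \<in> carrier A \<Longrightarrow> y \<in> carrier A \<Longrightarrow> adj A (x \<otimes>\<^bsub>A\<^esub> y) = adj A y \<otimes>\<^bsub>A\<^esub> adj A x"

definition cstar_seminorm :: "('a, 'm) star_alg_scheme \<Rightarrow> ('a \<Rightarrow> real) \<Rightarrow> bool" where
  "cstar_seminorm A p \<longleftrightarrow>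
     (\<forall>x\<in>carrier A. 0 \<le> p x) \<and>
     (\<forall>x\<in>carrier A. \<forall>y\<in>carrier A. p (x \<oplus>\<^bsub>A\<^esub> y) \<le> p x + p y) \<and>
     (\<forall>c. \<forall>x\<in>carrier A. p (c \<odot>\<^bsub>A\<^esub> x) = cmod c * p x) \<and>
     (\<forall>x\<in>carrier A. \<forall>y\<in>carrier A. p (x \<otimes>\<^bsub>A\<^esub> y) \<le> p x * p y) \<and>
     (\<forall>x\<in>carrier A. p (adj A x \<otimes>\<^bsub>A\<^esub> x) = (p x)\<^sup>2)"

definition cauchy_in :: "('a, 'm) star_alg_scheme \<Rightarrow> ('a \<Rightarrow> real) \<Rightarrow> (nat \<Rightarrow> 'a) \<Rightarrow> bool" where
  "cauchy_in A p s \<longleftrightarrow> range s \<subseteq> carrier A \<and>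
     (\<forall>e>0. \<exists>M. \<forall>i\<ge>M. \<forall>j\<ge>M. p (s i \<ominus>\<^bsub>A\<^esub> s j) < e)"

locale cstar_algebra = star_algebra A for A :: "'a cstar" +
  assumes seminorm: "cstar_seminorm A (cnorm A)"
    and definite: "x \<in> carrier A \<Longrightarrow> cnorm A x = 0 \<Longrightarrow> x = \<zero>\<^bsub>A\<^esub>"
    and complete: "cauchy_in A (cnorm A) s \<Longrightarrow>
      \<exists>x\<in>carrier A. (\<lambda>n. cnorm A (s n \<ominus>\<^bsub>A\<^esub> x)) \<longlonglongrightarrow> 0"

text \<open>*-homomorphisms need not preserve units; they are relevant on the carrier only.\<close>

definition star_hom :: "'a cstar \<Rightarrow> 'b cstar \<Rightarrow> ('a \<Rightarrow> 'b) set" where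
  "star_hom A B = {f \<in> carrier A \<rightarrow> carrier B.
     (\<forall>x\<in>carrier A. \<forall>y\<in>carrier A. f (x \<oplus>\<^bsub>A\<^esub> y) = f x \<oplus>\<^bsub>B\<^esub> f y) \<and>
     (\<forall>c. \<forall>x\<in>carrier A. f (c \<odot>\<^bsub>A\<^esub> x) = c \<odot>\<^bsub>B\<^esub> f x) \<and>
     (\<forall>x\<in>carrier A. \<forall>y\<in>carrier A. f (x \<otimes>\<^bsub>A\<^esub> y) = f x \<otimes>\<^bsub>B\<^esub> f y) \<and>
     (\<forall>x\<in>carrier A. f (adj A x) = adj B (f x))}"

definition star_isomorphic :: "'a cstar \<Rightarrow> 'b cstar \<Rightarrow> bool" where
  "star_isomorphic A B \<longleftrightarrow> (\<exists>f\<in>star_hom A B. bij_betw f (carrier A) (carrier B))"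

text \<open>
  \<open>cstar_pushout TYPE('t) D P Q \<alpha> \<beta> A f g\<close>: the C*-algebra \<open>A\<close> with the maps \<open>f : P \<rightarrow> A\<close> and
  \<open>g : Q \<rightarrow> A\<close> is a pushout of \<open>\<alpha> : D \<rightarrow> P\<close> and \<open>\<beta> : D \<rightarrow> Q\<close>, the universal property being tested
  on the C*-algebras whose elements have type \<open>'t\<close> (types cannot be quantified over in a formula).
\<close>

definition cstar_pushout :: "'t itself \<Rightarrow> 'd cstar \<Rightarrow> 'p cstar \<Rightarrow> 'q cstar \<Rightarrow> ('d \<Rightarrow> 'p) \<Rightarrow> ('d \<Rightarrow> 'q) \<Rightarrow>
    'a cstar \<Rightarrow> ('p \<Rightarrow> 'a) \<Rightarrow> ('q \<Rightarrow> 'a) \<Rightarrow> bool" where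
  "cstar_pushout (_ :: 't itself) D P Q \<alpha> \<beta> A f g \<longleftrightarrow>
     cstar_algebra A \<and> f \<in> star_hom P A \<and> g \<in> star_hom Q A \<and>
     (\<forall>d\<in>carrier D. f (\<alpha> d) = g (\<beta> d)) \<and>
     (\<forall>X :: 't cstar. cstar_algebra X \<longrightarrow>
       (\<forall>f'\<in>star_hom P X. \<forall>g'\<in>star_hom Q X. (\<forall>d\<in>carrier D. f' (\<alpha> d) = g' (\<beta> d)) \<longrightarrow>
         (\<exists>h\<in>star_hom A X.
            (\<forall>x\<in>carrier P. h (f x) = f' x) \<and> (\<forall>y\<in>carrier Q. h (g y) = g' y) \<and>
            (\<forall>h'\<in>star_hom A X.
               (\<forall>x\<in>carrier P. h' (f x) = f' x) \<and> (\<forall>y\<in>carrier Q. h' (g y) = g' y) \<longrightarrow>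
               (\<forall>a\<in>carrier A. h' a = h a)))))"


section \<open>Direct sums and matrix algebras\<close>

text \<open>Meant for finite index sets.\<close>

definition direct_sum :: "'i set \<Rightarrow> ('i \<Rightarrow> 'a cstar) \<Rightarrow> ('i \<Rightarrow> 'a) cstar" where
  "direct_sum I A =
     \<lparr>carrier = (\<Pi>\<^sub>E i\<in>I. carrier (A i)),
      mult = (\<lambda>x y. \<lambda>i\<in>I. x i \<otimes>\<^bsub>A i\<^esub> y i),
      one = (\<lambda>i\<in>I. \<one>\<^bsub>A i\<^esub>),
      zero = (\<lambda>i\<in>I. \<zero>\<^bsub>A i\<^esub>),
      add = (\<lambda>x y. \<lambda>i\<in>I. x i \<oplus>\<^bsub>A i\<^esub> y i),
      smult = (\<lambda>c x. \<lambda>i\<in>I. c \<odot>\<^bsub>A i\<^esub> x i),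
      adj = (\<lambda>x. \<lambda>i\<in>I. adj (A i) (x i)),
      cnorm = (\<lambda>x. Max (insert 0 ((\<lambda>i. cnorm (A i) (x i)) ` I)))\<rparr>"

text \<open>
  The C*-norm of a \<open>k\<close> by \<open>k\<close> matrix over \<open>A\<close> is its operator norm on the Hilbert \<open>A\<close>-module
  \<open>A\<^sup>k\<close>, whose norm is \<open>\<parallel>v\<parallel>\<^sup>2 = \<parallel>\<Sum>\<^sub>i v\<^sub>i\<^sup>* v\<^sub>i\<parallel>\<close>. For \<open>A\<close> the complex numbers it is the
  usual operator norm on \<open>k\<close>-dimensional Hilbert space.
\<close>

definition col_norm :: "nat \<Rightarrow> 'a cstar \<Rightarrow> (nat \<Rightarrow> 'a) \<Rightarrow> real" where
  "col_norm k A v = sqrt (cnorm A (\<Oplus>\<^bsub>A\<^esub>i\<in>{..<k}. adj A (v i) \<otimes>\<^bsub>A\<^esub> v i))"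

definition matrix_norm :: "nat \<Rightarrow> 'a cstar \<Rightarrow> (nat \<times> nat \<Rightarrow> 'a) \<Rightarrow> real" where
  "matrix_norm k A X =
     Sup {col_norm k A (\<lambda>i. \<Oplus>\<^bsub>A\<^esub>j\<in>{..<k}. X (i, j) \<otimes>\<^bsub>A\<^esub> v j) | v.
            v \<in> {..<k} \<rightarrow> carrier A \<and> col_norm k A v \<le> 1}"

definition matrix_alg :: "nat \<Rightarrow> 'a cstar \<Rightarrow> (nat \<times> nat \<Rightarrow> 'a) cstar" where
  "matrix_alg k A =
     \<lparr>carrier = {..<k} \<times> {..<k} \<rightarrow>\<^sub>E carrier A,
      mult = (\<lambda>X Y. \<lambda>(i, j)\<in>{..<k} \<times> {..<k}. \<Oplus>\<^bsub>A\<^esub>l\<in>{..<k}. X (i, l) \<otimes>\<^bsub>A\<^esub> Y (l, j)),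
      one = (\<lambda>(i, j)\<in>{..<k} \<times> {..<k}. if i = j then \<one>\<^bsub>A\<^esub> else \<zero>\<^bsub>A\<^esub>),
      zero = (\<lambda>ij\<in>{..<k} \<times> {..<k}. \<zero>\<^bsub>A\<^esub>),
      add = (\<lambda>X Y. \<lambda>ij\<in>{..<k} \<times> {..<k}. X ij \<oplus>\<^bsub>A\<^esub> Y ij),
      smult = (\<lambda>c X. \<lambda>ij\<in>{..<k} \<times> {..<k}. c \<odot>\<^bsub>A\<^esub> X ij),
      adj = (\<lambda>X. \<lambda>(i, j)\<in>{..<k} \<times> {..<k}. adj A (X (j, i))),
      cnorm = matrix_norm k A\<rparr>"


section \<open>Full group C*-algebras of free groups\<close>

definition seminorm_equiv :: "'a star_alg \<Rightarrow> ('a \<Rightarrow> real) \<Rightarrow> ((nat \<Rightarrow> 'a) \<times> (nat \<Rightarrow> 'a)) set" where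
  "seminorm_equiv A p =
     {(s, t). cauchy_in A p s \<and> cauchy_in A p t \<and> (\<lambda>n. p (s n \<ominus>\<^bsub>A\<^esub> t n)) \<longlonglongrightarrow> 0}"

text \<open>
  The separated completion of a *-algebra with respect to a C*-seminorm: Cauchy sequences modulo
  null sequences, with operations applied termwise to representatives.
\<close>

definition seminorm_completion :: "'a star_alg \<Rightarrow> ('a \<Rightarrow> real) \<Rightarrow> (nat \<Rightarrow> 'a) set cstar" where
  "seminorm_completion A p =
     \<lparr>carrier = {s. cauchy_in A p s} // seminorm_equiv A p,
      mult = (\<lambda>S T. \<Union>s\<in>S. \<Union>t\<in>T. seminorm_equiv A p `` {\<lambda>n. s n \<otimes>\<^bsub>A\<^esub> t n}),
      one = seminorm_equiv A p `` {\<lambda>n. \<one>\<^bsub>A\<^esub>},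
      zero = seminorm_equiv A p `` {\<lambda>n. \<zero>\<^bsub>A\<^esub>},
      add = (\<lambda>S T. \<Union>s\<in>S. \<Union>t\<in>T. seminorm_equiv A p `` {\<lambda>n. s n \<oplus>\<^bsub>A\<^esub> t n}),
      smult = (\<lambda>c S. \<Union>s\<in>S. seminorm_equiv A p `` {\<lambda>n. c \<odot>\<^bsub>A\<^esub> s n}),
      adj = (\<lambda>S. \<Union>s\<in>S. seminorm_equiv A p `` {\<lambda>n. adj A (s n)}),
      cnorm = (\<lambda>S. lim (\<lambda>n. p ((SOME s. s \<in> S) n)))\<rparr>"

text \<open>
  For a group algebra, every C*-seminorm takes values at most 1 on group elements, so the supremum
  is finite.
\<close>

definition max_cstar_seminorm :: "'a star_alg \<Rightarrow> 'a \<Rightarrow> real" where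
  "max_cstar_seminorm A x = Sup {p x | p. cstar_seminorm A p}"

text \<open>The complex group algebra of a discrete group: finitely supported functions, convolution.\<close>

definition group_algebra :: "'g monoid \<Rightarrow> ('g \<Rightarrow> complex) star_alg" where
  "group_algebra G =
     \<lparr>carrier = {a. finite {g. a g \<noteq> 0} \<and> {g. a g \<noteq> 0} \<subseteq> carrier G},
      mult = (\<lambda>a b g. if g \<in> carrier G
                then \<Sum>h | a h \<noteq> 0. a h * b (inv\<^bsub>G\<^esub> h \<otimes>\<^bsub>G\<^esub> g) else 0),
      one = (\<lambda>g. if g = \<one>\<^bsub>G\<^esub> then 1 else 0),
      zero = (\<lambda>g. 0),
      add = (\<lambda>a b g. a g + b g),
      smult = (\<lambda>c a g. c * a g),
      adj = (\<lambda>a g. if g \<in> carrier G then cnj (a (inv\<^bsub>G\<^esub> g)) else 0)\<rparr>"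

text \<open>
  The full norm is the supremum over all C*-seminorms, equivalently (each C*-seminorm comes from a
  *-representation on a Hilbert space) over all unitary representations of \<open>G\<close>.
\<close>

definition full_group_cstar :: "'g monoid \<Rightarrow> (nat \<Rightarrow> 'g \<Rightarrow> complex) set cstar" where
  "full_group_cstar G =
     seminorm_completion (group_algebra G) (max_cstar_seminorm (group_algebra G))"

text \<open>
  The free group as the group of reduced words; the letter \<open>(i, True)\<close> is the \<open>i\<close>-th generator and
  \<open>(i, False)\<close> its inverse.
\<close>

type_synonym word = "(nat \<times> bool) list"

fun push_letter :: "nat \<times> bool \<Rightarrow> word \<Rightarrow> word" where
  "push_letter x [] = [x]"
| "push_letter x (y # w) = (if fst x = fst y \<and> snd x \<noteq> snd y then w else x # y # w)"

definition reduce :: "word \<Rightarrow> word" where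
  "reduce w = foldr push_letter w []"

definition free_group :: "nat \<Rightarrow> word monoid" where
  "free_group q =
     \<lparr>carrier = {w. fst ` set w \<subseteq> {..<q} \<and> reduce w = w},
      mult = (\<lambda>u v. reduce (u @ v)),
      one = []\<rparr>"

type_synonym free_cstar_elem = "(nat \<Rightarrow> word \<Rightarrow> complex) set"


section \<open>Undirected multigraphs\<close>

record ('v, 'e) multigraph =
  verts :: "'v set"
  edges :: "'e set"
  ends :: "'e \<Rightarrow> 'v set"

definition adjacent :: "('v, 'e) multigraph \<Rightarrow> ('v \<times> 'v) set" where
  "adjacent G = {(u, v). \<exists>e\<in>edges G. ends G e = {u, v}}"

definition connected_graph :: "('v, 'e) multigraph \<Rightarrow> bool" where
  "connected_graph G \<longleftrightarrow> verts G \<noteq> {} \<and> (\<forall>u\<in>verts G. \<forall>v\<in>verts G. (u, v) \<in> (adjacent G)\<^sup>*)"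

definition component_of :: "('v, 'e) multigraph \<Rightarrow> 'v \<Rightarrow> ('v, 'e) multigraph" where
  "component_of G v =
     (let V = {w \<in> verts G. (v, w) \<in> (adjacent G)\<^sup>*}
      in G\<lparr>verts := V, edges := {e \<in> edges G. ends G e \<subseteq> V}\<rparr>)"

definition components :: "('v, 'e) multigraph \<Rightarrow> ('v, 'e) multigraph set" where
  "components G = component_of G ` verts G"

text \<open>A cycle may have length 1 (a loop) or 2 (a pair of parallel edges).\<close>

definition is_cycle :: "('v, 'e) multigraph \<Rightarrow> 'v list \<Rightarrow> 'e list \<Rightarrow> bool" where
  "is_cycle G vs es \<longleftrightarrow> es \<noteq> [] \<and> length vs = length es \<and> distinct vs \<and> distinct es \<and>
     set vs \<subseteq> verts G \<and> set es \<subseteq> edges G \<and>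
     (\<forall>i<length es. ends G (es ! i) = {vs ! i, vs ! (Suc i mod length es)})"

text \<open>A spanning tree is given by its set of edges \<open>T\<close>.\<close>

definition spanning_tree :: "('v, 'e) multigraph \<Rightarrow> 'e set \<Rightarrow> bool" where
  "spanning_tree G T \<longleftrightarrow> T \<subseteq> edges G \<and> connected_graph (G\<lparr>edges := T\<rparr>) \<and>
     \<not> (\<exists>vs es. is_cycle (G\<lparr>edges := T\<rparr>) vs es)"


section \<open>Multimatrix algebras with common diagonal\<close>

definition multimatrix :: "nat \<Rightarrow> (nat \<Rightarrow> nat) \<Rightarrow> (nat \<Rightarrow> nat \<times> nat \<Rightarrow> complex) cstar" where
  "multimatrix r m = direct_sum {..<r} (\<lambda>i. matrix_alg (m i) complex_alg)"

definition diagonal_alg :: "nat \<Rightarrow> (nat \<Rightarrow> complex) cstar" where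
  "diagonal_alg N = direct_sum {..<N} (\<lambda>_. complex_alg)"

text \<open>Block \<open>i\<close> occupies the diagonal positions from \<open>offset m i\<close> to \<open>offset m i + m i - 1\<close>.\<close>

definition offset :: "(nat \<Rightarrow> nat) \<Rightarrow> nat \<Rightarrow> nat" where
  "offset m i = (\<Sum>j<i. m j)"

definition diag_embed :: "nat \<Rightarrow> (nat \<Rightarrow> nat) \<Rightarrow> (nat \<Rightarrow> complex) \<Rightarrow> (nat \<Rightarrow> nat \<times> nat \<Rightarrow> complex)" where
  "diag_embed r m x =
     (\<lambda>i\<in>{..<r}. \<lambda>(a, b)\<in>{..<m i} \<times> {..<m i}. if a = b then x (offset m i + a) else 0)"

definition block_graph :: "nat \<Rightarrow> nat \<Rightarrow> (nat \<Rightarrow> nat) \<Rightarrow> nat \<Rightarrow> (nat \<Rightarrow> nat) \<Rightarrow> (nat + nat, nat) multigraph" where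
  "block_graph N r m s n =
     \<lparr>verts = Inl ` {..<r} \<union> Inr ` {..<s},
      edges = {..<N},
      ends = (\<lambda>e. {Inl i | i. i < r \<and> offset m i \<le> e \<and> e < offset m i + m i} \<union>
                   {Inr j | j. j < s \<and> offset n j \<le> e \<and> e < offset n j + n j})\<rparr>"

end

theory Submission
  imports Defs
begin

text \<open>
  Let \<open>E\<^sub>e\<^sub>f\<close>, for edges \<open>e\<close>, \<open>f\<close> of the same component \<open>W\<^sub>i\<close>, be the matrix units of \<open>M\<^sub>k\<^sub>i\<close>. The pushout
  maps send the matrix unit of \<open>P\<close> between two edges at the same \<open>P\<close>-vertex to \<open>E\<^sub>e\<^sub>f \<otimes> 1\<close>, and that of
  \<open>Q\<close> between two edges at the same \<open>Q\<close>-vertex to \<open>E\<^sub>e\<^sub>f \<otimes> g\<^sub>e\<^sup>* g\<^sub>f\<close>, where the holonomy \<open>g\<^sub>e\<close> is \<open>1\<close> on the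
  spanning tree and runs through the free generators on the other edges. Walking along the tree,
  the images generate every \<open>E\<^sub>e\<^sub>f \<otimes> 1\<close>, and then the remaining edges give the generators of the free
  group. Conversely, compatible matrix units \<open>F\<close> and \<open>G\<close> in a C*-algebra admit, by a choice along the
  tree, partial isometries with \<open>V\<^sub>e\<^sup>* V\<^sub>f = F\<^sub>e\<^sub>f\<close> and \<open>Z\<^sub>e\<^sup>* Z\<^sub>f = G\<^sub>e\<^sub>f\<close>, a common range projection, and
  \<open>V\<^sub>e = Z\<^sub>e\<close> for \<open>e\<close> in the tree; the unitaries \<open>Z\<^sub>e V\<^sub>e\<^sup>*\<close> off the tree represent the free group.

  The C*-theory behind this (positive elements, contractivity of *-homomorphisms, matrix norms) is
  obtained in one typed ring: the product of all C*-algebras on a given carrier type, in which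
  each of them embeds. Positivity is expressed through square roots, which are limits of a
  polynomial iteration, so that no spectral theory is needed.
\<close>

text \<open>C*-theory is forced in at two places. Continuity is not part of \<open>star_hom\<close>,
  yet a map out of a completion is pinned down by its values on the group algebra only if it is
  continuous; so contractivity has to be derived. And the operator norm on matrices over a
  C*-algebra satisfies the C*-identity only through a Cauchy-Schwarz inequality, which rests on
  positivity of \<open>star x * x\<close>. Producing maps out of the full group algebra is cheaper:
  its norm dominates every C*-seminorm, so unitaries extend at once.

  The class has no unit, since the product of all C*-algebras on a type may have nonunital factors.
  Positivity is therefore studied relative to a projection \<open>e\<close> in the place of 1. This
  also suits homomorphisms that do not preserve units, because the image of 1 is just another
  projection.

  In the existence half, the partial isometries at a vertex are determined up to one unitary acting
  from the left. The tree edges fix these unitaries relative to each other without ever imposing two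
  conditions on one of them; each further edge then contributes one unitary that is subject to no
  relation.\<close>

class cstar_ring = real_normed_algebra + complete_space +
  fixes scaleC :: "complex \<Rightarrow> 'a \<Rightarrow> 'a" (infixr "*\<^sub>C" 75)
    and star :: "'a \<Rightarrow> 'a"
  assumes scaleR_scaleC: "r *\<^sub>R x = complex_of_real r *\<^sub>C x"
    and scaleC_add_right: "c *\<^sub>C (x + y) = c *\<^sub>C x + c *\<^sub>C y"
    and scaleC_add_left: "(c + d) *\<^sub>C x = c *\<^sub>C x + d *\<^sub>C x"
    and scaleC_scaleC [simp]: "c *\<^sub>C d *\<^sub>C x = (c * d) *\<^sub>C x"
    and mult_scaleC_left [simp]: "(c *\<^sub>C x) * y = c *\<^sub>C (x * y)"
    and mult_scaleC_right [simp]: "x * (c *\<^sub>C y) = c *\<^sub>C (x * y)"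
    and norm_scaleC [simp]: "norm (c *\<^sub>C x) = cmod c * norm x"
    and star_star [simp]: "star (star x) = x"
    and star_add: "star (x + y) = star x + star y"
    and star_mult: "star (x * y) = star y * star x"
    and star_scaleC [simp]: "star (c *\<^sub>C x) = cnj c *\<^sub>C star x"
    and norm_star_mult_self: "norm (star x * x) = (norm x)\<^sup>2"
begin

subclass banach ..

end

context
  fixes x :: "'a::cstar_ring"
begin

lemma scaleC_one [simp]: "1 *\<^sub>C x = x"
  using scaleR_scaleC[of 1 x] by simp

lemma scaleC_zero_left [simp]: "0 *\<^sub>C x = 0"
  using scaleR_scaleC[of 0 x] by simp

lemma scaleC_minus_one: "(-1) *\<^sub>C x = - x"
  using scaleR_scaleC[of "-1" x] by simp

end

lemma scaleC_zero_right [simp]: "c *\<^sub>C (0::'a::cstar_ring) = 0"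
  by (metis scaleC_zero_left scaleC_scaleC mult_zero_right)

lemma scaleC_minus_right [simp]: "c *\<^sub>C (- x) = - (c *\<^sub>C (x::'a::cstar_ring))"
  by (metis scaleC_scaleC scaleC_minus_one mult.commute)

lemma scaleC_minus_left [simp]: "(- c) *\<^sub>C x = - (c *\<^sub>C (x::'a::cstar_ring))"
  by (metis scaleC_scaleC scaleC_minus_one mult_minus1)

lemma scaleC_diff_right: "c *\<^sub>C (x - y) = c *\<^sub>C x - c *\<^sub>C (y::'a::cstar_ring)"
  using scaleC_add_right[of c x "-y"] by simp

lemma scaleC_sum_right: "c *\<^sub>C sum f I = (\<Sum>i\<in>I. c *\<^sub>C (f i::'a::cstar_ring))"
  by (induction I rule: infinite_finite_induct) (auto simp: scaleC_add_right)

lemma star_zero [simp]: "star (0::'a::cstar_ring) = 0"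
  using star_add[of "0::'a" 0] by simp

lemma star_minus [simp]: "star (- x) = - star (x::'a::cstar_ring)"
  by (metis star_scaleC scaleC_minus_one complex_cnj_minus complex_cnj_one)

lemma star_diff: "star (x - y) = star x - star (y::'a::cstar_ring)"
  using star_add[of x "-y"] by simp

lemma star_scaleR [simp]: "star (r *\<^sub>R x) = r *\<^sub>R star (x::'a::cstar_ring)"
  by (simp add: scaleR_scaleC)

lemma star_sum: "star (sum f I) = (\<Sum>i\<in>I. star (f i::'a::cstar_ring))"
  by (induction I rule: infinite_finite_induct) (auto simp: star_add)

text \<open>The C*-identity and submultiplicativity give
  \<open>(norm y)^2 \<le> norm (star y) * norm y\<close>; the same inequality for
  \<open>star y\<close> supplies the other direction.\<close>

lemma norm_star [simp]: "norm (star x) = norm (x::'a::cstar_ring)"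
proof -
  have "norm y \<le> norm (star y)" for y :: 'a
  proof (cases "norm y = 0")
    case False
    have "norm y * norm y \<le> norm (star y) * norm y"
      by (metis norm_star_mult_self norm_mult_ineq power2_eq_square)
    then show ?thesis using False by (simp add: mult_le_cancel_right)
  qed simp
  from this[of x] this[of "star x"] show ?thesis by simp
qed

lemma star_mult_self_eq_0_iff [simp]: "star x * x = 0 \<longleftrightarrow> (x::'a::cstar_ring) = 0"
  by (metis norm_star_mult_self norm_eq_zero power_zero_numeral zero_eq_power2 mult_zero_right)

lemma bounded_linear_star: "bounded_linear (star :: 'a \<Rightarrow> 'a::cstar_ring)"
  by (rule bounded_linear_intro[of _ 1]) (auto simp: star_add)

lemmas tendsto_star = bounded_linear.tendsto[OF bounded_linear_star]

lemma selfadj_square_eq_0: "star x = x \<Longrightarrow> x * x = 0 \<Longrightarrow> (x::'a::cstar_ring) = 0"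
  using star_mult_self_eq_0_iff[of x] by simp

lemma selfadj_cube_eq_0:
  assumes "star x = x" "x * x * x = 0" shows "(x::'a::cstar_ring) = 0"
proof -
  have "(x * x) * (x * x) = 0" using assms(2) by (metis mult.assoc mult_zero_right)
  moreover have "star (x * x) = x * x" using assms(1) by (simp add: star_mult)
  ultimately show ?thesis using assms(1) selfadj_square_eq_0 by blast
qed

section \<open>Square roots\<close>

text \<open>The limit \<open>y\<close> of this iteration satisfies \<open>2y = a + y\<^sup>2\<close>, that is, \<open>(1 - y)\<^sup>2 = 1 - a\<close>.\<close>

primrec sqrt_iter :: "'a::real_algebra \<Rightarrow> nat \<Rightarrow> 'a" where
  "sqrt_iter a 0 = 0"
| "sqrt_iter a (Suc n) = (1/2) *\<^sub>R (a + sqrt_iter a n * sqrt_iter a n)"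

lemma sqrt_iter_real: "0 \<le> sqrt_iter (1::real) n" "sqrt_iter (1::real) n \<le> 1"
proof -
  have "0 \<le> sqrt_iter (1::real) n \<and> sqrt_iter (1::real) n \<le> 1"
    by (induction n) (auto intro: mult_le_one)
  then show "0 \<le> sqrt_iter (1::real) n" "sqrt_iter (1::real) n \<le> 1" by auto
qed

text \<open>Majorisation by the scalar case 1: the iterates are polynomials with nonnegative
  coefficients, and \<open>u * u - v * v = u * (u - v) + (u - v) * v\<close> passes the bound on
  differences from one step to the next. As the scalar sequence is increasing and bounded, this
  yields convergence even at \<open>norm a = 1\<close>, where the iteration is not a strict
  contraction.\<close>

lemma norm_sqrt_iter_diff_le:
  fixes a :: "'a::real_normed_algebra"
  assumes "norm a \<le> 1" "n \<le> m"
  shows "norm (sqrt_iter a m - sqrt_iter a n) \<le> sqrt_iter 1 m - sqrt_iter (1::real) n"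
proof -
  have b: "norm (sqrt_iter a k) \<le> sqrt_iter 1 k" for k
  proof (induction k)
    case (Suc k)
    have "norm (sqrt_iter a k * sqrt_iter a k) \<le> sqrt_iter 1 k * sqrt_iter 1 k"
      using Suc by (meson mult_mono' norm_ge_zero norm_mult_ineq order_trans)
    then have "norm (a + sqrt_iter a k * sqrt_iter a k) \<le> 1 + sqrt_iter 1 k * sqrt_iter 1 k"
      using assms(1) norm_triangle_ineq[of a "sqrt_iter a k * sqrt_iter a k"] by linarith
    then show ?case by simp
  qed simp
  show ?thesis using assms(2)
  proof (induction n arbitrary: m)
    case 0
    then show ?case using b by simp
  next
    case (Suc n)
    then obtain l where m: "m = Suc l" "n \<le> l" by (metis Suc_le_D Suc_le_mono)
    define u v where "u = sqrt_iter a l" and "v = sqrt_iter a n"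
    define s t where "s = sqrt_iter (1::real) l" and "t = sqrt_iter (1::real) n"
    have *: "norm (u - v) \<le> s - t" using Suc.IH[OF m(2)] unfolding u_def v_def s_def t_def .
    have ts: "t \<le> s" using order_trans[OF norm_ge_zero *] by simp
    have "norm (u * u - v * v) = norm (u * (u - v) + (u - v) * v)" by (simp add: algebra_simps)
    also have "\<dots> \<le> norm u * norm (u - v) + norm (u - v) * norm v"
      by (intro norm_triangle_le add_mono norm_mult_ineq)
    also have "\<dots> \<le> s * (s - t) + (s - t) * t"
      using * ts b[of l] b[of n] sqrt_iter_real[of l] sqrt_iter_real[of n]
      unfolding u_def v_def s_def t_def
      by (intro add_mono mult_mono) (auto intro: order_trans[OF norm_ge_zero])
    also have "\<dots> = s * s - t * t" by (simp add: algebra_simps)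
    finally have "norm (u * u - v * v) \<le> s * s - t * t" .
    moreover have "sqrt_iter a (Suc l) - sqrt_iter a (Suc n) = (1/2) *\<^sub>R (u * u - v * v)"
      unfolding u_def v_def by (simp flip: scaleR_diff_right)
    moreover have "sqrt_iter 1 (Suc l) - sqrt_iter (1::real) (Suc n) = (1/2) * (s * s - t * t)"
      unfolding s_def t_def by (simp add: diff_divide_distrib add_divide_distrib)
    ultimately show ?case unfolding m by (simp del: sqrt_iter.simps)
  qed
qed

definition sqrt_lim :: "'a::{real_normed_algebra,complete_space} \<Rightarrow> 'a" where
  "sqrt_lim a = lim (sqrt_iter a)"

lemma sqrt_iter_tendsto:
  fixes a :: "'a::{real_normed_algebra,complete_space}"
  assumes "norm a \<le> 1"
  shows "sqrt_iter a \<longlonglongrightarrow> sqrt_lim a"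
proof -
  have "incseq (sqrt_iter (1::real))"
  proof (rule incseq_SucI)
    fix n show "sqrt_iter (1::real) n \<le> sqrt_iter 1 (Suc n)"
      using order_trans[OF norm_ge_zero norm_sqrt_iter_diff_le[of "1::real" n "Suc n"]] by simp
  qed
  then have "convergent (sqrt_iter (1::real))"
  proof (rule incseq_convergent)
    show "\<forall>i. sqrt_iter (1::real) i \<le> 1" using sqrt_iter_real by blast
  qed (auto simp: convergent_def)
  then have C: "Cauchy (sqrt_iter (1::real))" by (rule convergent_Cauchy)
  have "Cauchy (sqrt_iter a)"
  proof (rule metric_CauchyI)
    fix r :: real assume "0 < r"
    then obtain M where M: "\<And>m n. m \<ge> M \<Longrightarrow> n \<ge> M \<Longrightarrow> \<bar>sqrt_iter 1 m - sqrt_iter (1::real) n\<bar> < r"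
      using C unfolding Cauchy_def dist_real_def by blast
    have "dist (sqrt_iter a m) (sqrt_iter a n) < r" if "m \<ge> M" "n \<ge> M" for m n
    proof (cases "n \<le> m")
      case True
      then show ?thesis using norm_sqrt_iter_diff_le[OF assms True] M[OF that] by (simp add: dist_norm)
    next
      case False
      then have mn: "m \<le> n" by simp
      show ?thesis using norm_sqrt_iter_diff_le[OF assms mn] M[OF that(2,1)]
        by (simp add: dist_norm norm_minus_commute)
    qed
    then show "\<exists>M. \<forall>m\<ge>M. \<forall>n\<ge>M. dist (sqrt_iter a m) (sqrt_iter a n) < r" by blast
  qed
  then have "convergent (sqrt_iter a)" by (rule Cauchy_convergent)
  then show ?thesis unfolding sqrt_lim_def by (rule convergent_LIMSEQ_iff[THEN iffD1])
qed

lemma sqrt_lim_eq: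
  fixes a :: "'a::{real_normed_algebra,complete_space}"
  assumes "norm a \<le> 1"
  shows "2 *\<^sub>R sqrt_lim a = a + sqrt_lim a * sqrt_lim a"
proof -
  note L = sqrt_iter_tendsto[OF assms]
  have "(\<lambda>n. (1/2) *\<^sub>R (a + sqrt_iter a n * sqrt_iter a n)) \<longlonglongrightarrow> (1/2) *\<^sub>R (a + sqrt_lim a * sqrt_lim a)"
    by (intro tendsto_intros L)
  moreover have "(\<lambda>n. (1/2) *\<^sub>R (a + sqrt_iter a n * sqrt_iter a n)) \<longlonglongrightarrow> sqrt_lim a"
    using LIMSEQ_Suc[OF L] by simp
  ultimately have "sqrt_lim a = (1/2) *\<^sub>R (a + sqrt_lim a * sqrt_lim a)"
    using LIMSEQ_unique by blast
  then have "2 *\<^sub>R sqrt_lim a = 2 *\<^sub>R ((1/2) *\<^sub>R (a + sqrt_lim a * sqrt_lim a))" by (rule arg_cong)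
  also have "\<dots> = a + sqrt_lim a * sqrt_lim a" by simp
  finally show ?thesis .
qed

lemma norm_sqrt_lim_le:
  fixes a :: "'a::{real_normed_algebra,complete_space}"
  assumes "norm a \<le> 1"
  shows "norm (sqrt_lim a) \<le> 1"
proof (rule LIMSEQ_le_const2[OF tendsto_norm[OF sqrt_iter_tendsto[OF assms]]])
  have "norm (sqrt_iter a n) \<le> 1" for n
    using norm_sqrt_iter_diff_le[OF assms, of 0 n] sqrt_iter_real[of n] by simp
  then show "\<exists>N. \<forall>n\<ge>N. norm (sqrt_iter a n) \<le> 1" by blast
qed

text \<open>The iterates are polynomials without constant term, so the relation holds for each of
  them and survives the limit. The case \<open>b = a\<close> is commutation; different
  \<open>a\<close> and \<open>b\<close> occur when \<open>y * star y\<close> is compared with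
  \<open>star y * y\<close>.\<close>

lemma sqrt_lim_intertwine:
  fixes a :: "'a::{real_normed_algebra,complete_space}"
  assumes "norm a \<le> 1" "norm b \<le> 1" "a * z = z * b"
  shows "sqrt_lim a * z = z * sqrt_lim b"
proof -
  have "sqrt_iter a n * z = z * sqrt_iter b n" for n
  proof (induction n)
    case (Suc n)
    have "sqrt_iter a n * sqrt_iter a n * z = z * (sqrt_iter b n * sqrt_iter b n)"
      by (metis Suc mult.assoc)
    then show ?case using assms(3) by (simp add: distrib_left distrib_right)
  qed simp
  moreover have "(\<lambda>n. sqrt_iter a n * z) \<longlonglongrightarrow> sqrt_lim a * z"
    by (intro tendsto_intros sqrt_iter_tendsto assms)
  moreover have "(\<lambda>n. z * sqrt_iter b n) \<longlonglongrightarrow> z * sqrt_lim b"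
    by (intro tendsto_intros sqrt_iter_tendsto assms)
  ultimately show ?thesis using LIMSEQ_unique by simp
qed

lemma star_sqrt_lim:
  fixes a :: "'a::cstar_ring"
  assumes "norm a \<le> 1" "star a = a"
  shows "star (sqrt_lim a) = sqrt_lim a"
proof -
  have "star (sqrt_iter a n) = sqrt_iter a n" for n
    by (induction n) (auto simp: star_add star_mult assms)
  then show ?thesis
    using tendsto_star[OF sqrt_iter_tendsto[OF assms(1)]] sqrt_iter_tendsto[OF assms(1)] LIMSEQ_unique
    by simp
qed

section \<open>Positive elements of a corner\<close>

text \<open>The projection \<open>e\<close> replaces the unit. It will be the embedded unit of an
  algebra, or the image of a unit under a *-homomorphism; it may be 0, so its norm is only bounded
  by 1.\<close>

locale corner =
  fixes e :: "'a::cstar_ring"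
  assumes idem [simp]: "e * e = e" and star_e [simp]: "star e = e"
begin

definition crn :: "'a \<Rightarrow> bool" where
  "crn x \<longleftrightarrow> e * x = x \<and> x * e = x"

lemma crnD: "crn x \<Longrightarrow> e * x = x" "crn x \<Longrightarrow> x * e = x"
  "crn x \<Longrightarrow> e * (x * z) = x * z" "crn x \<Longrightarrow> x * (e * z) = x * z"
  unfolding crn_def by (auto simp flip: mult.assoc)

lemma crn_intros [simp, intro]:
  "crn e" "crn 0"
  "crn x \<Longrightarrow> crn y \<Longrightarrow> crn (x + y)" "crn x \<Longrightarrow> crn y \<Longrightarrow> crn (x - y)"
  "crn x \<Longrightarrow> crn (- x)" "crn x \<Longrightarrow> crn y \<Longrightarrow> crn (x * y)"
  "crn x \<Longrightarrow> crn (r *\<^sub>R x)" "crn x \<Longrightarrow> crn (c *\<^sub>C x)" "crn x \<Longrightarrow> crn (star x)"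
proof -
  show "crn e" "crn 0" unfolding crn_def by simp_all
  show "crn (x + y)" "crn (x - y)" if "crn x" "crn y" for x y
    using that unfolding crn_def by (simp_all add: algebra_simps)
  show "crn (- x)" if "crn x" for x using that unfolding crn_def by simp
  show "crn (x * y)" if "crn x" "crn y" for x y
    using that unfolding crn_def by (metis mult.assoc)
  show "crn (r *\<^sub>R x)" if "crn x" for x r using that unfolding crn_def by simp
  show "crn (c *\<^sub>C x)" if "crn x" for x c using that unfolding crn_def by simp
  show "crn (star x)" if "crn x" for x using that unfolding crn_def by (metis star_mult star_e)
qed

lemma crn_sum: "(\<And>i. i \<in> I \<Longrightarrow> crn (f i)) \<Longrightarrow> crn (sum f I)"
  by (induction I rule: infinite_finite_induct) auto

lemma norm_e_le: "norm e \<le> 1"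
  using norm_star_mult_self[of e] by (metis idem star_e norm_ge_zero power2_eq_square
      mult_cancel_right2 zero_le_one order_refl)

text \<open>In spectral terms the norm condition places the spectrum of \<open>a\<close> in the
  interval from 0 to \<open>2 * t\<close>. This form makes sums of positive elements positive by the
  triangle inequality, and for positive \<open>t\<close> it says that
  \<open>e - a /\<^sub>R t\<close> is an admissible argument of the square root iteration.\<close>

definition pos :: "'a \<Rightarrow> bool" where
  "pos a \<longleftrightarrow> star a = a \<and> crn a \<and> (\<exists>t\<ge>0. norm (t *\<^sub>R e - a) \<le> t)"

lemma posD: "pos a \<Longrightarrow> star a = a" "pos a \<Longrightarrow> crn a"
  unfolding pos_def by auto

text \<open>Witnesses may be enlarged, so finitely many positive elements can share one, and a
  witness 0 can be replaced by a positive one.\<close>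

lemma norm_shift_mono:
  assumes "norm (t *\<^sub>R e - a) \<le> t" "t \<le> s" shows "norm (s *\<^sub>R e - a) \<le> s"
proof -
  have "s *\<^sub>R e - a = (s - t) *\<^sub>R e + (t *\<^sub>R e - a)" by (simp add: algebra_simps)
  then have "norm (s *\<^sub>R e - a) \<le> norm ((s - t) *\<^sub>R e) + norm (t *\<^sub>R e - a)"
    by (metis norm_triangle_ineq)
  also have "\<dots> \<le> (s - t) * 1 + t"
    using assms norm_e_le by (intro add_mono) (auto intro: mult_left_le)
  finally show ?thesis by simp
qed

lemma pos_add: assumes "pos a" "pos b" shows "pos (a + b)"
proof -
  obtain s t where st: "s \<ge> 0" "t \<ge> 0" "norm (s *\<^sub>R e - a) \<le> s" "norm (t *\<^sub>R e - b) \<le> t"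
    using assms unfolding pos_def by blast
  have "(s + t) *\<^sub>R e - (a + b) = (s *\<^sub>R e - a) + (t *\<^sub>R e - b)" by (simp add: algebra_simps)
  then have "norm ((s + t) *\<^sub>R e - (a + b)) \<le> s + t"
    using st by (metis norm_triangle_mono)
  then show ?thesis using st assms unfolding pos_def
    by (auto simp: star_add intro!: exI[of _ "s + t"])
qed

lemma pos_scaleR: assumes "pos a" "0 \<le> c" shows "pos (c *\<^sub>R a)"
proof -
  obtain t where t: "t \<ge> 0" "norm (t *\<^sub>R e - a) \<le> t"
    using assms unfolding pos_def by blast
  have "norm ((c * t) *\<^sub>R e - c *\<^sub>R a) = c * norm (t *\<^sub>R e - a)"
    using assms(2) by (metis norm_scaleR abs_of_nonneg scaleR_diff_right scaleR_scaleR)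
  also have "\<dots> \<le> c * t" using t assms(2) by (simp add: mult_left_mono)
  finally show ?thesis using t assms unfolding pos_def by (auto intro!: exI[of _ "c * t"])
qed

lemma pos_zero [simp]: "pos 0"
  unfolding pos_def by (auto intro: exI[of _ 0])

lemma pos_sum: "(\<And>i. i \<in> I \<Longrightarrow> pos (f i)) \<Longrightarrow> pos (sum f I)"
  by (induction I rule: infinite_finite_induct) (auto intro: pos_add)

lemma pos_norm_shift: "star s = s \<Longrightarrow> crn s \<Longrightarrow> pos (norm s *\<^sub>R e - s)"
  unfolding pos_def by (auto simp: star_diff intro!: exI[of _ "norm s"])

text \<open>Meant for \<open>t > 0\<close> with \<open>norm (t *\<^sub>R e - b) \<le> t\<close>; the value does not depend on \<open>t\<close>.\<close>

definition rt :: "real \<Rightarrow> 'a \<Rightarrow> 'a" where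
  "rt t b = sqrt t *\<^sub>R (e - sqrt_lim (e - b /\<^sub>R t))"

context
  fixes t :: real and b :: 'a
  assumes t: "t > 0" and b: "norm (t *\<^sub>R e - b) \<le> t" "crn b" "star b = b"
begin

lemma rt_arg: "norm (e - b /\<^sub>R t) \<le> 1"
proof -
  have "e - b /\<^sub>R t = (t *\<^sub>R e - b) /\<^sub>R t" using t by (simp add: scaleR_diff_right)
  then have "norm (e - b /\<^sub>R t) = norm (t *\<^sub>R e - b) / t" using t by (simp add: divide_inverse_commute)
  then show ?thesis using t b by simp
qed

text \<open>Multiplication by \<open>e\<close> from the left fixes all iterates, hence the limit; on
  the right the same follows because the limit commutes with \<open>e\<close>.\<close>

lemma crn_rt_lim: "crn (sqrt_lim (e - b /\<^sub>R t))"
proof -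
  have 1: "sqrt_lim (e - b /\<^sub>R t) * e = e * sqrt_lim (e - b /\<^sub>R t)"
    using b by (intro sqrt_lim_intertwine rt_arg) (auto simp: algebra_simps crnD)
  let ?a = "e - b /\<^sub>R t" let ?y = "sqrt_lim ?a"
  have "e * sqrt_iter ?a n = sqrt_iter ?a n" for n
    using b by (induction n) (auto simp: distrib_left right_diff_distrib crnD simp flip: mult.assoc)
  moreover have "(\<lambda>n. e * sqrt_iter ?a n) \<longlonglongrightarrow> e * ?y"
    by (intro tendsto_intros sqrt_iter_tendsto rt_arg)
  ultimately have "e * ?y = ?y"
    using sqrt_iter_tendsto[OF rt_arg] LIMSEQ_unique by simp
  with 1 show ?thesis unfolding crn_def by simp
qed

lemma crn_rt: "crn (rt t b)"
  unfolding rt_def using crn_rt_lim by auto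

lemma star_rt: "star (rt t b) = rt t b"
  unfolding rt_def using rt_arg b by (simp add: star_diff star_sqrt_lim)

lemma rt_square: "rt t b * rt t b = b"
proof -
  let ?a = "e - b /\<^sub>R t" let ?y = "sqrt_lim ?a"
  have "(e - ?y) * (e - ?y) = e - (2 *\<^sub>R ?y - ?y * ?y)"
    using crn_rt_lim by (simp add: algebra_simps crnD scaleR_2)
  also have "\<dots> = b /\<^sub>R t" using sqrt_lim_eq[OF rt_arg] by simp
  finally have "(e - ?y) * (e - ?y) = b /\<^sub>R t" .
  moreover have "sqrt t * (sqrt t * inverse t) = 1" using t by (simp flip: mult.assoc)
  ultimately show ?thesis unfolding rt_def using t by simp
qed

lemma pos_rt: "pos (rt t b)"
proof -
  have "norm (sqrt t *\<^sub>R e - rt t b) = sqrt t * norm (sqrt_lim (e - b /\<^sub>R t))"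
    unfolding rt_def using t by (simp add: scaleR_diff_right)
  also have "\<dots> \<le> sqrt t" using norm_sqrt_lim_le[OF rt_arg] t by (simp add: mult_left_le)
  finally show ?thesis unfolding pos_def using crn_rt star_rt t by (auto intro!: exI[of _ "sqrt t"])
qed

end

lemma rt_intertwine:
  assumes "t > 0" "norm (t *\<^sub>R e - b) \<le> t" "norm (t *\<^sub>R e - c) \<le> t"
    and "crn b" "crn c" "crn z" "star b = b" "star c = c" "b * z = z * c"
  shows "rt t b * z = z * rt t c"
proof -
  have "(e - b /\<^sub>R t) * z = z * (e - c /\<^sub>R t)"
    using assms by (simp add: algebra_simps crnD)
  then have "sqrt_lim (e - b /\<^sub>R t) * z = z * sqrt_lim (e - c /\<^sub>R t)"
    using assms by (intro sqrt_lim_intertwine rt_arg)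
  then show ?thesis unfolding rt_def using assms by (simp add: algebra_simps crnD)
qed

lemma pos_sqrt:
  assumes "pos b"
  obtains r where "pos r" "r * r = b" "\<And>z. crn z \<Longrightarrow> b * z = z * b \<Longrightarrow> r * z = z * r"
proof -
  obtain s where s: "s \<ge> 0" "norm (s *\<^sub>R e - b) \<le> s" using assms unfolding pos_def by blast
  \<comment> \<open>The witness \<open>s\<close> may be 0, while \<open>rt\<close> divides by its
    scale.\<close>
  define t where "t = s + 1"
  have t: "t > 0" "norm (t *\<^sub>R e - b) \<le> t"
    using s norm_shift_mono[OF s(2), of t] by (auto simp: t_def)
  note b = posD[OF assms]
  show thesis
    using that[OF pos_rt[OF t b(2,1)] rt_square[OF t b(2,1)]] rt_intertwine[OF t(1,2,2) b(2,2) _ b(1,1)]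
    by blast
qed

text \<open>The bound \<open>norm (e - k * k) \<le> 1\<close> for a self-adjoint contraction
  \<open>k\<close> is more than the triangle inequality gives. With \<open>d\<close> the square root
  of \<open>e - k * k\<close>, the element \<open>u = k + i d\<close> is a unitary of the corner,
  like cos + i sin. The real part of \<open>u * u\<close> is \<open>k * k - d * d\<close>, so the
  latter has norm at most 1, and \<open>e - k * k\<close> is half of
  \<open>e - (k * k - d * d)\<close>.\<close>

lemma pos_square: assumes "star h = h" "crn h" shows "pos (h * h)"
proof -
  define M where "M = norm h + 1"
  have M: "M > 0" "norm h \<le> M" unfolding M_def by (auto intro: add_nonneg_pos)
  define k where "k = h /\<^sub>R M"
  have k: "star k = k" "crn k" "norm k \<le> 1"
    using assms M unfolding k_def by (auto simp: divide_simps)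
  have "norm (k * k) \<le> 1" using k(3) norm_mult_ineq[of k k] by (meson mult_le_one norm_ge_zero order_trans)
  then have kk: "norm (1 *\<^sub>R e - (e - k * k)) \<le> 1" by simp
  have c: "crn (e - k * k)" "star (e - k * k) = e - k * k" using k by (auto simp: star_diff star_mult)
  define d where "d = rt 1 (e - k * k)"
  have d: "d * d = e - k * k" "star d = d" "crn d"
    unfolding d_def using rt_square[OF _ kk c] star_rt[OF _ kk c] crn_rt[OF _ kk c] by auto
  have dk: "d * k = k * d" unfolding d_def
    using k by (intro rt_intertwine kk c) (auto simp: algebra_simps crnD mult.assoc)
  define u where "u = k + \<i> *\<^sub>C d"
  have "star u * u = k * k + d * d"
    unfolding u_def using k d(2) dk by (simp add: star_add algebra_simps scaleC_diff_right)
  also have "\<dots> = e" using d by simp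
  finally have "(norm u)\<^sup>2 \<le> 1" using norm_star_mult_self[of u] norm_e_le by simp
  then have "norm u \<le> 1" by (simp add: power2_le_iff_abs_le abs_square_le_1)
  then have 1: "norm (u * u) \<le> 1" using norm_mult_ineq[of u u] by (meson mult_le_one norm_ge_zero order_trans)
  have 2: "norm (star u * star u) \<le> 1" using 1 by (metis norm_star star_mult)
  have "u * u + star u * star u = 2 *\<^sub>R (k * k - d * d)"
    unfolding u_def using k d(2) dk
    by (simp add: star_add algebra_simps scaleR_2 scaleC_diff_right scaleC_add_right)
  then have 3: "norm (2 *\<^sub>R (k * k - d * d)) \<le> 2" using norm_triangle_mono[OF 1 2] by simp
  have "e - (k * k - d * d) = 2 *\<^sub>R (e - k * k)" unfolding d(1) by (simp add: scaleR_2)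
  then have "1 *\<^sub>R e - k * k = (1/2) *\<^sub>R (e - (k * k - d * d))" by simp
  also have "norm \<dots> \<le> 1"
    using 3 norm_e_le norm_triangle_ineq4[of e "k * k - d * d"] by simp
  finally have "pos (k * k)" unfolding pos_def using k by (auto simp: star_mult intro!: exI[of _ 1])
  then have "pos ((M * M) *\<^sub>R (k * k))" using M by (intro pos_scaleR) auto
  moreover have "h = M *\<^sub>R k" using M unfolding k_def by simp
  then have "(M * M) *\<^sub>R (k * k) = h * h" by simp
  ultimately show ?thesis by simp
qed

text \<open>The element \<open>u = x + i y\<close> satisfies \<open>star u * u = c e\<close>, which
  bounds its norm, and \<open>x\<close> is its real part.\<close>

lemma norm_le_of_commuting_squares:
  assumes "star x = x" "star y = y" "x * y = y * x" "x * x + y * y = c *\<^sub>R e" "0 \<le> c"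
  shows "(norm x)\<^sup>2 \<le> c"
proof -
  define u where "u = x + \<i> *\<^sub>C y"
  have "star u * u = x * x + y * y"
    unfolding u_def using assms by (simp add: star_add algebra_simps scaleC_diff_right)
  then have "(norm u)\<^sup>2 = c * norm e" using norm_star_mult_self[of u] assms by simp
  then have "(norm u)\<^sup>2 \<le> c" using mult_left_le[OF norm_e_le assms(5)] by simp
  moreover have "x = (1/2) *\<^sub>R (u + star u)"
    unfolding u_def using assms by (simp add: star_add scaleR_2[symmetric])
  then have "norm x = norm (u + star u) / 2" by (metis norm_scaleR abs_of_nonneg
      divide_nonneg_nonneg zero_le_one zero_le_numeral mult_1 times_divide_eq_left)
  then have "norm x \<le> norm u" using norm_triangle_ineq[of u "star u"] by simp
  ultimately show ?thesis by (meson norm_ge_zero order_trans power_mono)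
qed

text \<open>The square roots \<open>x\<close> of \<open>c\<close> and \<open>y\<close> of
  \<open>t e - c\<close> commute, and their squares add up to \<open>t e\<close>. This bounds
  \<open>norm x\<close> and hence the norm of \<open>c = x * x\<close>.\<close>

lemma norm_le_if_pos_shift:
  assumes "pos c" "pos (t *\<^sub>R e - c)" "0 \<le> t" shows "norm c \<le> t"
proof -
  obtain x where x: "pos x" "x * x = c" by (rule pos_sqrt[OF assms(1)])
  obtain y where y: "pos y" "y * y = t *\<^sub>R e - c"
    "\<And>z. crn z \<Longrightarrow> (t *\<^sub>R e - c) * z = z * (t *\<^sub>R e - c) \<Longrightarrow> y * z = z * y"
    using pos_sqrt[OF assms(2)] by metis
  have "c * x = x * c" unfolding x(2)[symmetric] by (rule mult.assoc)
  then have "y * x = x * y" using posD[OF x(1)]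
    by (intro y(3)) (auto simp: left_diff_distrib right_diff_distrib crnD)
  then have "(norm x)\<^sup>2 \<le> t" using x(2) y(2) posD[OF x(1)] posD[OF y(1)] assms(3)
    by (intro norm_le_of_commuting_squares[of x y]) auto
  then show ?thesis using norm_mult_ineq[of x x] x by (simp add: power2_eq_square)
qed

lemma norm_mono:
  assumes "pos c" "pos (s - c)" shows "norm c \<le> norm s"
proof (rule norm_le_if_pos_shift[OF assms(1)])
  have "s = c + (s - c)" by simp
  then have "pos s" using pos_add[OF assms] by simp
  then have "pos (norm s *\<^sub>R e - s)" using posD pos_norm_shift by blast
  from pos_add[OF this assms(2)] show "pos (norm s *\<^sub>R e - c)" by simp
qed simp

lemma pos_antisym: "pos a \<Longrightarrow> pos (- a) \<Longrightarrow> a = 0"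
  using norm_le_if_pos_shift[of a 0] by simp

text \<open>The square root \<open>r\<close> of \<open>a\<close> commutes with \<open>z\<close> as
  well, so the product is the square of the self-adjoint element \<open>z * r\<close>.\<close>

lemma pos_mult_commute: assumes "pos a" "star z = z" "crn z" "a * z = z * a" shows "pos (z * z * a)"
proof -
  obtain r where r: "pos r" "r * r = a" "r * z = z * r"
    using pos_sqrt[OF assms(1)] assms by metis
  have "pos ((z * r) * (z * r))" using posD[OF r(1)] r assms by (intro pos_square) (auto simp: star_mult)
  moreover have "(z * r) * (z * r) = z * z * a" using r by (metis mult.assoc)
  ultimately show ?thesis by simp
qed

text \<open>For \<open>z = r - b\<close> the relation \<open>z * (r + b) = 0\<close> makes the
  positive elements \<open>z * z * r\<close> and \<open>z * z * b\<close> negatives of each other.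
  So both vanish, and their difference is the cube of \<open>z\<close>.\<close>

lemma pos_sqrt_unique:
  assumes "pos r" "pos b" "r * r = b * b" "r * b = b * r" shows "r = b"
proof -
  define z where "z = r - b"
  have z: "star z = z" "crn z" unfolding z_def using assms posD by (auto simp: star_diff)
  have p: "pos (z * z * r)" "pos (z * z * b)"
    by (intro pos_mult_commute assms z; simp add: z_def algebra_simps assms)+
  have "z * (r + b) = 0" unfolding z_def using assms by (simp add: algebra_simps)
  then have "z * z * r + z * z * b = 0" by (metis distrib_left mult.assoc mult_zero_right)
  then have "z * z * b = - (z * z * r)" by (simp add: eq_neg_iff_add_eq_0 add.commute)
  then have "z * z * r = 0" "z * z * b = 0" using pos_antisym p by (metis, metis minus_minus)
  then have "z * z * z = 0" by (metis z_def right_diff_distrib diff_self)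
  then have "z = 0" using selfadj_cube_eq_0 z by blast
  then show ?thesis unfolding z_def by simp
qed

lemma rt_of_square:
  assumes "pos b" "t > 0" "norm (t *\<^sub>R e - b * b) \<le> t" shows "rt t (b * b) = b"
proof -
  note b = posD[OF assms(1)]
  have c: "crn (b * b)" "star (b * b) = b * b" using b by (auto simp: star_mult)
  show ?thesis
    by (rule pos_sqrt_unique[OF pos_rt[OF assms(2,3) c] assms(1) rt_square[OF assms(2,3) c]])
      (rule rt_intertwine[OF assms(2,3,3) c(1,1) b(2) c(2,2)], simp add: mult.assoc)
qed

text \<open>Here \<open>y y\<^sup>* \<cdot> y = - y \<cdot> (- y\<^sup>* y)\<close>, and taking square roots of the squares of both
  positive elements gives the same relation without the sign.\<close>

lemma eq_0_if_pos_neg: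
  assumes "crn y" "pos (y * star y)" "pos (- (star y * y))" shows "y = 0"
proof -
  define b c where "b = y * star y" and "c = - (star y * y)"
  have bc: "pos b" "pos c" "b * y = - (y * c)"
    using assms unfolding b_def c_def by (auto simp: mult.assoc)
  have "pos (b * b)" "pos (c * c)" using pos_square posD bc by auto
  then obtain s s' where s: "s \<ge> 0" "norm (s *\<^sub>R e - b * b) \<le> s" "s' \<ge> 0" "norm (s' *\<^sub>R e - c * c) \<le> s'"
    unfolding pos_def by blast
  \<comment> \<open>One positive scale for both roots, as \<open>rt_intertwine\<close> asks.\<close>
  define t where "t = s + s' + 1"
  have t: "t > 0" "norm (t *\<^sub>R e - b * b) \<le> t" "norm (t *\<^sub>R e - c * c) \<le> t"
    using s norm_shift_mono[OF s(2), of t] norm_shift_mono[OF s(4), of t] by (auto simp: t_def)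
  have "b * b * y = b * (b * y)" by (rule mult.assoc)
  also have "\<dots> = - (b * y * c)" by (subst bc(3)) (simp add: mult.assoc)
  also have "\<dots> = y * (c * c)" by (subst bc(3)) (simp add: mult.assoc)
  finally have "rt t (b * b) * y = y * rt t (c * c)"
    using posD[OF bc(1)] posD[OF bc(2)] assms(1) by (intro rt_intertwine t) (auto simp: star_mult)
  then have "b * y = y * c" using rt_of_square bc t by simp
  then have "b * y = - (b * y)" using bc(3) by metis
  then have "2 *\<^sub>R (b * y) = 0" by (metis scaleR_2 add.right_inverse)
  then have "b * y = 0" by simp
  then have "(star y * y) * (star y * y) = 0" unfolding b_def by (metis mult.assoc mult_zero_right)
  moreover have "star (star y * y) = star y * y" by (simp add: star_mult)
  ultimately have "star y * y = 0" using selfadj_square_eq_0 by blast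
  then show ?thesis by simp
qed

text \<open>With \<open>r\<close> the absolute value of the self-adjoint
  \<open>a = star x * x\<close>, the element \<open>n = r - a\<close> is twice the negative part of
  \<open>a\<close>. For \<open>y = x * n\<close> the product \<open>star y * y = n * a * n\<close>
  is minus a square. Then \<open>y * star y\<close> is positive, because
  \<open>y * star y + star y * y\<close> is up to a positive factor a sum of squares of self-adjoint
  elements. Hence \<open>y = 0\<close>, which forces \<open>r * n = 0\<close>, then
  \<open>n * n = 0\<close>, and \<open>a = r\<close> is positive.\<close>

lemma pos_star_mult_self: assumes "crn x" shows "pos (star x * x)"
proof -
  define a where "a = star x * x"
  have a: "star a = a" "crn a" unfolding a_def using assms by (auto simp: star_mult)
  obtain r where r: "pos r" "r * r = a * a" "\<And>z. crn z \<Longrightarrow> (a * a) * z = z * (a * a) \<Longrightarrow> r * z = z * r"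
    using pos_sqrt[OF pos_square[OF a]] by metis
  have ra: "r * a = a * r" using a by (intro r(3)) (auto simp: mult.assoc)
  obtain k where k: "pos k" "k * k = r" "\<And>z. crn z \<Longrightarrow> r * z = z * r \<Longrightarrow> k * z = z * k"
    using pos_sqrt[OF r(1)] by metis
  define n where "n = r - a"
  have n: "star n = n" "crn n" unfolding n_def using posD[OF r(1)] a by (auto simp: star_diff)
  have rn: "r * n = n * r" unfolding n_def using ra by (simp add: algebra_simps)
  have kn: "k * n = n * k" using k(3)[OF n(2) rn] .
  define y where "y = x * n"
  have y: "crn y" unfolding y_def using n assms by auto
  have "star y * y = n * a * n" unfolding y_def a_def using n by (simp add: star_mult mult.assoc)
  also have "n * a = - (r * n)" unfolding n_def using r(2) ra by (simp add: algebra_simps)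
  finally have yy: "star y * y = - ((k * n) * (k * n))" using k kn by (metis mult.assoc mult_minus_left)
  have knp: "pos ((k * n) * (k * n))"
    using kn posD[OF k(1)] n by (intro pos_square) (auto simp: star_mult)
  \<comment> \<open>Up to the factors 2 and -2 these are the real and imaginary parts of
    \<open>y\<close>.\<close>
  define U V where "U = y + star y" and "V = \<i> *\<^sub>C (y - star y)"
  have "star U = U" "crn U" "star V = V" "crn V"
    unfolding U_def V_def using y by (auto simp: star_add star_diff scaleC_diff_right)
  then have "pos (U * U + V * V)" using pos_square pos_add by blast
  then have "pos ((1/2) *\<^sub>R (U * U + V * V))" by (intro pos_scaleR) auto
  moreover have "(1/2) *\<^sub>R (U * U + V * V) = y * star y + star y * y"
    unfolding U_def V_def
    by (simp add: algebra_simps scaleC_diff_right scaleC_add_right scaleR_2[symmetric])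
  ultimately have "pos (y * star y + star y * y + (k * n) * (k * n))" using knp pos_add by metis
  then have "pos (y * star y)" using yy by simp
  then have "y = 0" using eq_0_if_pos_neg[OF y] yy knp by simp
  then have "(k * n) * (k * n) = 0" using yy by simp
  moreover have "star (k * n) = k * n" by (simp add: star_mult kn posD[OF k(1)] n)
  ultimately have "k * n = 0" using selfadj_square_eq_0 by blast
  moreover have "r * n = k * (k * n)" using k(2) by (simp flip: mult.assoc)
  ultimately have rn0: "r * n = 0" by simp
  have "n * n = r * n - a * n" unfolding n_def by (simp add: algebra_simps)
  moreover have "a * n = - (r * n)" unfolding n_def using r(2) ra by (simp add: algebra_simps)
  ultimately have "n * n = 0" using rn0 by simp
  then have "n = 0" using selfadj_square_eq_0 n by blast
  then have "a = r" unfolding n_def by simp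
  then show ?thesis using r unfolding a_def by simp
qed

text \<open>Being a contraction becomes an algebraic relation, which *-homomorphisms preserve;
  \<open>norm_le_1_if_complement\<close> reads it backwards in the target.\<close>

lemma sqrt_complement:
  assumes "crn x" "norm x \<le> 1"
  obtains d where "crn d" "star d = d" "d * d = e - star x * x"
proof -
  have "norm (star x * x) \<le> 1" using assms norm_star_mult_self[of x] by (simp add: abs_square_le_1)
  then have "norm (1 *\<^sub>R e - (e - star x * x)) \<le> 1" by simp
  moreover have "crn (e - star x * x)" "star (e - star x * x) = e - star x * x"
    using assms by (auto simp: star_diff star_mult)
  ultimately show thesis using that[of "rt 1 (e - star x * x)"] crn_rt star_rt rt_square by simp
qed

lemma norm_le_1_if_complement:
  assumes "crn x" "crn d" "star x * x + star d * d = e" shows "norm x \<le> 1"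
proof -
  have "e - star x * x = star d * d" using assms(3) by (simp add: algebra_simps)
  then have "norm (star x * x) \<le> norm e"
    using norm_mono[of "star x * x" e] pos_star_mult_self assms by simp
  then have "(norm x)\<^sup>2 \<le> 1" using norm_star_mult_self[of x] norm_e_le by simp
  then show ?thesis by (simp add: abs_square_le_1)
qed

text \<open>Completing the square: for \<open>z i = w i - v i * a\<close> the sum of
  \<open>star (z i) * z i\<close> is \<open>Wt - 2 star a * a + star a * V * a\<close>, and it is
  positive. So is \<open>star a * a - star a * V * a\<close>, being
  \<open>star (d * a) * (d * a)\<close> for the square root \<open>d\<close> of
  \<open>e - V\<close>. Adding the two leaves \<open>Wt - star a * a\<close>.\<close>

lemma cauchy_schwarz_unit:
  assumes v: "\<And>i. i \<in> I \<Longrightarrow> crn (v i)" and w: "\<And>i. i \<in> I \<Longrightarrow> crn (w i)"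
    and 1: "norm (\<Sum>i\<in>I. star (v i) * v i) \<le> 1"
  shows "(norm (\<Sum>i\<in>I. star (v i) * w i))\<^sup>2 \<le> norm (\<Sum>i\<in>I. star (w i) * w i)"
proof -
  define a where "a = (\<Sum>i\<in>I. star (v i) * w i)"
  define V where "V = (\<Sum>i\<in>I. star (v i) * v i)"
  define Wt where "Wt = (\<Sum>i\<in>I. star (w i) * w i)"
  have ca: "crn a" and cV: "crn V" and sV: "star V = V"
    unfolding a_def V_def using v w by (auto intro!: crn_sum simp: star_sum star_mult)
  have "norm (1 *\<^sub>R e - (e - V)) \<le> 1" using 1 unfolding V_def by simp
  moreover have "crn (e - V)" "star (e - V) = e - V" using cV sV by (auto simp: star_diff)
  ultimately obtain d where d: "crn d" "star d = d" "d * d = e - V"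
    using crn_rt[of 1] star_rt[of 1] rt_square[of 1] by (metis zero_less_one)
  define z where "z i = w i - v i * a" for i
  have sa: "(\<Sum>i\<in>I. star (w i) * v i) = star a" unfolding a_def by (simp add: star_sum star_mult)
  have zz: "(\<Sum>i\<in>I. star (z i) * z i) = Wt - star a * a - star a * a + star a * V * a"
  proof -
    have "star (z i) * z i = star (w i) * w i - star (w i) * v i * a - star a * (star (v i) * w i)
        + star a * (star (v i) * v i) * a" for i
      unfolding z_def by (simp add: star_diff star_mult algebra_simps)
    then have "(\<Sum>i\<in>I. star (z i) * z i) = Wt - (\<Sum>i\<in>I. star (w i) * v i * a)
        - (\<Sum>i\<in>I. star a * (star (v i) * w i)) + (\<Sum>i\<in>I. star a * (star (v i) * v i) * a)"
      unfolding Wt_def by (simp only: sum.distrib sum_subtractf)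
    moreover have "(\<Sum>i\<in>I. star (w i) * v i * a) = star a * a"
      unfolding sa[symmetric] by (rule sum_distrib_right[symmetric])
    moreover have "(\<Sum>i\<in>I. star a * (star (v i) * w i)) = star a * a"
      by (subst (2) a_def) (rule sum_distrib_left[symmetric])
    moreover have "(\<Sum>i\<in>I. star a * (star (v i) * v i) * a) = star a * V * a"
      unfolding V_def by (simp only: sum_distrib_right sum_distrib_left)
    ultimately show ?thesis by simp
  qed

  have "star (d * a) * (d * a) = star a * a - star a * V * a"
  proof -
    have "star (d * a) * (d * a) = star a * (d * d) * a" using d(2) by (simp add: star_mult mult.assoc)
    then show ?thesis using d(3) ca by (simp add: algebra_simps crnD)
  qed
  then have "Wt - star a * a = star (d * a) * (d * a) + (\<Sum>i\<in>I. star (z i) * z i)"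
    unfolding zz by simp
  moreover have "pos (star (d * a) * (d * a) + (\<Sum>i\<in>I. star (z i) * z i))"
    using d ca v w unfolding z_def by (intro pos_add pos_sum pos_star_mult_self) auto
  ultimately have "norm (star a * a) \<le> norm Wt" using norm_mono pos_star_mult_self ca by metis
  then show ?thesis using norm_star_mult_self[of a] unfolding a_def Wt_def by simp
qed

lemma cauchy_schwarz:
  assumes v: "\<And>i. i \<in> I \<Longrightarrow> crn (v i)" and w: "\<And>i. i \<in> I \<Longrightarrow> crn (w i)"
  shows "(norm (\<Sum>i\<in>I. star (v i) * w i))\<^sup>2
    \<le> norm (\<Sum>i\<in>I. star (v i) * v i) * norm (\<Sum>i\<in>I. star (w i) * w i)"
    (is "?a \<le> ?V * ?W")
proof (rule field_le_epsilon)
  fix d :: real assume d: "d > 0"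
  \<comment> \<open>The family \<open>v\<close> is divided by the square root of \<open>T\<close>.
    The excess over \<open>?V\<close> avoids division by 0 and is chosen to cost at most
    \<open>d\<close> after multiplication by \<open>?W\<close>.\<close>
  define T where "T = ?V + d / (?W + 1)"
  have W: "?W + 1 > 0" by (simp add: add_nonneg_pos)
  have T: "T > 0" "?V \<le> T" unfolding T_def using d W by (auto intro: add_nonneg_pos)
  define c where "c = inverse (sqrt T)"
  have cc: "c * c = inverse T" unfolding c_def using T by (simp flip: inverse_mult_distrib)
  have c: "crn (c *\<^sub>R v i)" if "i \<in> I" for i using v[OF that] by auto
  have "(\<Sum>i\<in>I. star (c *\<^sub>R v i) * (c *\<^sub>R v i)) = inverse T *\<^sub>R (\<Sum>i\<in>I. star (v i) * v i)"
    by (simp add: cc scaleR_sum_right)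
  then have "norm (\<Sum>i\<in>I. star (c *\<^sub>R v i) * (c *\<^sub>R v i)) \<le> 1"
    using T by (simp add: divide_simps)
  from cauchy_schwarz_unit[OF c w this]
  have "(norm (c *\<^sub>R (\<Sum>i\<in>I. star (v i) * w i)))\<^sup>2 \<le> ?W" by (simp add: scaleR_sum_right)
  moreover have "\<bar>c\<bar>\<^sup>2 = inverse T" using cc by (simp add: power2_eq_square)
  ultimately have "inverse T * ?a \<le> ?W" by (simp add: power_mult_distrib)
  then have "?a \<le> T * ?W" using T by (simp add: field_simps)
  also have "\<dots> = ?V * ?W + d * (?W / (?W + 1))" unfolding T_def by (simp add: algebra_simps)
  also have "\<dots> \<le> ?V * ?W + d"
    using d W by (intro add_left_mono mult_left_le) (auto simp: divide_simps)
  finally show "?a \<le> ?V * ?W + d" .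
qed

end

section \<open>The product of all C*-algebras on a type\<close>

lemma complex_alg_simps [simp]:
  "carrier complex_alg = UNIV" "x \<otimes>\<^bsub>complex_alg\<^esub> y = x * y" "x \<oplus>\<^bsub>complex_alg\<^esub> y = x + y"
  "\<one>\<^bsub>complex_alg\<^esub> = 1" "\<zero>\<^bsub>complex_alg\<^esub> = 0" "c \<odot>\<^bsub>complex_alg\<^esub> x = c * x"
  "adj complex_alg x = cnj x" "cnorm complex_alg x = cmod x"
  by (simp_all add: complex_alg_def)

lemma cring_complex_alg: "cring complex_alg"
  by (intro cringI abelian_groupI comm_monoidI) (auto simp: algebra_simps intro: exI[of _ "- _"])

context star_algebra
begin

lemma smult_cl [simp, intro]: "x \<in> carrier A \<Longrightarrow> c \<odot>\<^bsub>A\<^esub> x \<in> carrier A"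
  using smult_closed[of c x] by simp

lemma smult_zero_left [simp]: "x \<in> carrier A \<Longrightarrow> 0 \<odot>\<^bsub>A\<^esub> x = \<zero>\<^bsub>A\<^esub>"
  using smult_l_null[of x] by simp

lemma smult_zero_right [simp]: "c \<odot>\<^bsub>A\<^esub> \<zero>\<^bsub>A\<^esub> = \<zero>\<^bsub>A\<^esub>"
  using smult_r_null[of c] by simp

lemma smult_one_left [simp]: "x \<in> carrier A \<Longrightarrow> 1 \<odot>\<^bsub>A\<^esub> x = x"
  using smult_one[of x] by simp

lemma smult_add_left: "x \<in> carrier A \<Longrightarrow> (c + d) \<odot>\<^bsub>A\<^esub> x = c \<odot>\<^bsub>A\<^esub> x \<oplus>\<^bsub>A\<^esub> d \<odot>\<^bsub>A\<^esub> x"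
  using smult_l_distr[of c d x] by simp

lemma smult_add_right: "x \<in> carrier A \<Longrightarrow> y \<in> carrier A \<Longrightarrow>
    c \<odot>\<^bsub>A\<^esub> (x \<oplus>\<^bsub>A\<^esub> y) = c \<odot>\<^bsub>A\<^esub> x \<oplus>\<^bsub>A\<^esub> c \<odot>\<^bsub>A\<^esub> y"
  using smult_r_distr[of c x y] by simp

lemma smult_smult: "x \<in> carrier A \<Longrightarrow> c \<odot>\<^bsub>A\<^esub> (d \<odot>\<^bsub>A\<^esub> x) = (c * d) \<odot>\<^bsub>A\<^esub> x"
  using smult_assoc1[of c d x] by simp

text \<open>Negatives are traded for scalar multiples, since the axioms of the algebras and the
  definition of \<open>star_hom\<close> speak about scalars.\<close>

lemma uminus_eq_smult: assumes "x \<in> carrier A" shows "\<ominus>\<^bsub>A\<^esub> x = (-1) \<odot>\<^bsub>A\<^esub> x"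
proof -
  have "(-1) \<odot>\<^bsub>A\<^esub> x \<oplus>\<^bsub>A\<^esub> x = (-1 + 1) \<odot>\<^bsub>A\<^esub> x"
    using assms by (simp only: smult_add_left smult_one_left)
  also have "\<dots> = \<zero>\<^bsub>A\<^esub>" using assms by simp
  finally show ?thesis using assms by (intro M.minus_equality) auto
qed

lemma minus_eq_smult:
  "x \<in> carrier A \<Longrightarrow> y \<in> carrier A \<Longrightarrow> x \<ominus>\<^bsub>A\<^esub> y = x \<oplus>\<^bsub>A\<^esub> (-1) \<odot>\<^bsub>A\<^esub> y"
  by (simp add: a_minus_def uminus_eq_smult)

declare mult_closed [simp, intro] adj_closed [simp, intro]

lemma mult_zero [simp]:
  assumes "x \<in> carrier A" shows "\<zero>\<^bsub>A\<^esub> \<otimes>\<^bsub>A\<^esub> x = \<zero>\<^bsub>A\<^esub>" "x \<otimes>\<^bsub>A\<^esub> \<zero>\<^bsub>A\<^esub> = \<zero>\<^bsub>A\<^esub>"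
  using smult_mult_left[of x x 0] smult_mult_right[of x x 0] assms by auto

lemma adj_zero [simp]: "adj A \<zero>\<^bsub>A\<^esub> = \<zero>\<^bsub>A\<^esub>"
  using adj_smult[of "\<zero>\<^bsub>A\<^esub>" 0] by simp

end

lemma cstar_seminormD:
  assumes "cstar_seminorm A p" "x \<in> carrier A"
  shows "0 \<le> p x" "y \<in> carrier A \<Longrightarrow> p (x \<oplus>\<^bsub>A\<^esub> y) \<le> p x + p y" "p (c \<odot>\<^bsub>A\<^esub> x) = cmod c * p x"
    "y \<in> carrier A \<Longrightarrow> p (x \<otimes>\<^bsub>A\<^esub> y) \<le> p x * p y" "p (adj A x \<otimes>\<^bsub>A\<^esub> x) = (p x)\<^sup>2"
  using assms unfolding cstar_seminorm_def by auto

context star_algebra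
begin

context
  fixes p assumes p: "cstar_seminorm A p"
begin

lemma seminorm_zero: "p \<zero>\<^bsub>A\<^esub> = 0"
  using cstar_seminormD(3)[OF p, of "\<zero>\<^bsub>A\<^esub>" 0] by simp

lemma seminorm_minus_commute:
  assumes "x \<in> carrier A" "y \<in> carrier A" shows "p (x \<ominus>\<^bsub>A\<^esub> y) = p (y \<ominus>\<^bsub>A\<^esub> x)"
proof -
  have "(-1) \<odot>\<^bsub>A\<^esub> (y \<ominus>\<^bsub>A\<^esub> x) = x \<ominus>\<^bsub>A\<^esub> y"
    using assms by (simp add: minus_eq_smult smult_add_right smult_smult M.a_comm)
  then show ?thesis
    using cstar_seminormD(3)[OF p, of "y \<ominus>\<^bsub>A\<^esub> x" "-1"] assms by simp
qed

lemma seminorm_minus_triangle: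
  assumes "x \<in> carrier A" "y \<in> carrier A" "z \<in> carrier A"
  shows "p (x \<ominus>\<^bsub>A\<^esub> z) \<le> p (x \<ominus>\<^bsub>A\<^esub> y) + p (y \<ominus>\<^bsub>A\<^esub> z)"
proof -
  have "x \<ominus>\<^bsub>A\<^esub> z = (x \<ominus>\<^bsub>A\<^esub> y) \<oplus>\<^bsub>A\<^esub> (y \<ominus>\<^bsub>A\<^esub> z)"
    using assms by (simp add: a_minus_def M.a_assoc M.r_neg1)
  then show ?thesis using cstar_seminormD(2)[OF p] assms by simp
qed

lemma seminorm_diff_le:
  assumes "x \<in> carrier A" "y \<in> carrier A"
  shows "p x - p y \<le> p (x \<ominus>\<^bsub>A\<^esub> y)"
proof -
  have "x = (x \<ominus>\<^bsub>A\<^esub> y) \<oplus>\<^bsub>A\<^esub> y" using assms by (simp add: a_minus_def M.a_assoc M.l_neg)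
  then show ?thesis using cstar_seminormD(2)[OF p, of "x \<ominus>\<^bsub>A\<^esub> y" y] assms by simp
qed

lemma seminorm_adj: assumes "x \<in> carrier A" shows "p (adj A x) = p x"
proof -
  have "p y \<le> p (adj A y)" if "y \<in> carrier A" for y
  proof (cases "p y = 0")
    case True
    then show ?thesis using cstar_seminormD(1)[OF p] that by simp
  next
    case False
    have "p y * p y \<le> p (adj A y) * p y"
      using cstar_seminormD(4,5)[OF p] that by (metis adj_closed power2_eq_square)
    then show ?thesis using False cstar_seminormD(1)[OF p that] by (simp add: mult_le_cancel_right)
  qed
  from this[of x] this[of "adj A x"] show ?thesis using assms by (simp add: adj_adj)
qed

end

end

context cstar_algebra
begin

lemmas cnorm_ge_0 = cstar_seminormD(1)[OF seminorm]
  and cnorm_triangle = cstar_seminormD(2)[OF seminorm]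
  and cnorm_smult = cstar_seminormD(3)[OF seminorm]
  and cnorm_mult = cstar_seminormD(4)[OF seminorm]
  and cnorm_cstar = cstar_seminormD(5)[OF seminorm]
  and cnorm_zero [simp] = seminorm_zero[OF seminorm]
  and cnorm_adj [simp] = seminorm_adj[OF seminorm]

end

text \<open>A type cannot depend on an algebra fixed in a locale, but this one type, the bounded
  families with an entry for each C*-algebra on \<open>'a\<close>, contains all of them. The fixed
  value off the C*-algebras makes an element determined by its entries, and the bound makes the
  supremum norm finite.\<close>

typedef 'a univ = "{F :: 'a cstar \<Rightarrow> 'a. (\<forall>A. if cstar_algebra A then F A \<in> carrier A else F A = undefined) \<and>
    (\<exists>B. \<forall>A. cstar_algebra A \<longrightarrow> cnorm A (F A) \<le> B)}"
proof (rule exI[of _ "\<lambda>A. if cstar_algebra A then \<zero>\<^bsub>A\<^esub> else undefined"], safe)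
  fix A :: "'a cstar"
  show "if cstar_algebra A then (if cstar_algebra A then \<zero>\<^bsub>A\<^esub> else undefined) \<in> carrier A
    else (if cstar_algebra A then \<zero>\<^bsub>A\<^esub> else undefined) = undefined"
  proof (cases "cstar_algebra A")
    case True
    then interpret cstar_algebra A .
    show ?thesis by simp
  qed simp
next
  have "cnorm A \<zero>\<^bsub>A\<^esub> \<le> 0" if "cstar_algebra A" for A :: "'a cstar"
  proof -
    interpret cstar_algebra A by fact
    show ?thesis by simp
  qed
  then show "\<exists>B. \<forall>A :: 'a cstar. cstar_algebra A \<longrightarrow> cnorm A (if cstar_algebra A then \<zero>\<^bsub>A\<^esub> else undefined) \<le> B"
    by (intro exI[of _ 0]) auto
qed

definition ev :: "'a cstar \<Rightarrow> 'a univ \<Rightarrow> 'a" where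
  "ev A x = Rep_univ x A"

definition family :: "('a cstar \<Rightarrow> 'a) \<Rightarrow> 'a univ" where
  "family f = Abs_univ (\<lambda>A. if cstar_algebra A then f A else undefined)"

lemma ev_closed [simp, intro]: "cstar_algebra A \<Longrightarrow> ev A x \<in> carrier A"
  using Rep_univ[of x] unfolding ev_def by auto

lemma univ_eqI: assumes "\<And>A. cstar_algebra A \<Longrightarrow> ev A x = ev A y" shows "x = y"
proof -
  have "Rep_univ x A = Rep_univ y A" for A
    using assms[of A] Rep_univ[of x] Rep_univ[of y] unfolding ev_def
    by (cases "cstar_algebra A") (blast, metis (mono_tags, lifting) mem_Collect_eq)
  then show ?thesis by (metis Rep_univ_inject ext)
qed

lemma ev_family:
  assumes "\<And>A. cstar_algebra A \<Longrightarrow> f A \<in> carrier A" "\<And>A. cstar_algebra A \<Longrightarrow> cnorm A (f A) \<le> B"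
    and "cstar_algebra A"
  shows "ev A (family f) = f A"
  unfolding ev_def family_def
  using assms by (subst Abs_univ_inverse) (auto intro!: exI[of _ B])

lemma ev_bounded: "\<exists>B. \<forall>A. cstar_algebra A \<longrightarrow> cnorm A (ev A x) \<le> B"
  using Rep_univ[of x] unfolding ev_def by auto

instantiation univ :: (type) real_normed_algebra
begin

definition zero_univ :: "'a univ" where "0 = family (\<lambda>A. \<zero>\<^bsub>A\<^esub>)"
definition plus_univ :: "'a univ \<Rightarrow> 'a univ \<Rightarrow> 'a univ" where
  "x + y = family (\<lambda>A. ev A x \<oplus>\<^bsub>A\<^esub> ev A y)"
definition uminus_univ :: "'a univ \<Rightarrow> 'a univ" where
  "- x = family (\<lambda>A. \<ominus>\<^bsub>A\<^esub> ev A x)"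
definition minus_univ :: "'a univ \<Rightarrow> 'a univ \<Rightarrow> 'a univ" where
  "x - y = x + - (y :: 'a univ)"
definition times_univ :: "'a univ \<Rightarrow> 'a univ \<Rightarrow> 'a univ" where
  "x * y = family (\<lambda>A. ev A x \<otimes>\<^bsub>A\<^esub> ev A y)"
definition scaleR_univ :: "real \<Rightarrow> 'a univ \<Rightarrow> 'a univ" where
  "r *\<^sub>R x = family (\<lambda>A. complex_of_real r \<odot>\<^bsub>A\<^esub> ev A x)"
text \<open>The inserted 0 keeps the set nonempty without exhibiting a C*-algebra on the
  type.\<close>

definition norm_univ :: "'a univ \<Rightarrow> real" where
  "norm x = Sup (insert 0 {cnorm A (ev A x) | A. cstar_algebra A})"
definition dist_univ :: "'a univ \<Rightarrow> 'a univ \<Rightarrow> real" where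
  "dist x y = norm (x - y :: 'a univ)"
definition sgn_univ :: "'a univ \<Rightarrow> 'a univ" where
  "sgn x = inverse (norm x) *\<^sub>R (x :: 'a univ)"
definition uniformity_univ :: "('a univ \<times> 'a univ) filter" where
  "uniformity_univ = (INF e\<in>{0 <..}. principal {(x, y). dist x y < e})"
definition open_univ :: "'a univ set \<Rightarrow> bool" where
  "open_univ U = (\<forall>x\<in>U. \<forall>\<^sub>F (x', y) in uniformity. x' = x \<longrightarrow> y \<in> U)"

lemma cnorm_ev_le_norm: "cstar_algebra A \<Longrightarrow> cnorm A (ev A x) \<le> norm x"
  unfolding norm_univ_def
proof (rule cSup_upper)
  obtain B where "\<forall>A. cstar_algebra A \<longrightarrow> cnorm A (ev A x) \<le> B" using ev_bounded by blast
  then show "bdd_above (insert 0 {cnorm A (ev A x) |A. cstar_algebra A})"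
    by (auto intro!: bdd_aboveI[of _ B])
qed auto

lemma norm_univ_le: "0 \<le> B \<Longrightarrow> (\<And>A. cstar_algebra A \<Longrightarrow> cnorm A (ev A x) \<le> B) \<Longrightarrow> norm (x::'a univ) \<le> B"
  unfolding norm_univ_def by (rule cSup_least) auto

lemma norm_univ_ge_0: "0 \<le> norm (x::'a univ)"
  unfolding norm_univ_def
proof (rule cSup_upper)
  obtain B where "\<forall>A. cstar_algebra A \<longrightarrow> cnorm A (ev A x) \<le> B" using ev_bounded by blast
  then show "bdd_above (insert 0 {cnorm A (ev A x) |A. cstar_algebra A})"
    by (auto intro!: bdd_aboveI[of _ "max 0 B"] simp: max.coboundedI2)
qed auto

context
  fixes A :: "'a cstar" assumes A: "cstar_algebra A"
begin

interpretation cstar_algebra A by (rule A)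

lemma ev_zero [simp]: "ev A 0 = \<zero>\<^bsub>A\<^esub>"
  unfolding zero_univ_def
proof (rule ev_family[OF _ _ A, of _ 0])
  fix B :: "'a cstar" assume "cstar_algebra B"
  then interpret B: cstar_algebra B .
  show "\<zero>\<^bsub>B\<^esub> \<in> carrier B" "cnorm B \<zero>\<^bsub>B\<^esub> \<le> 0" by auto
qed

lemma ev_add [simp]: "ev A (x + y) = ev A x \<oplus>\<^bsub>A\<^esub> ev A y"
  unfolding plus_univ_def
proof (rule ev_family[OF _ _ A, of _ "norm x + norm y"])
  fix B :: "'a cstar" assume B: "cstar_algebra B"
  then interpret B: cstar_algebra B .
  show "ev B x \<oplus>\<^bsub>B\<^esub> ev B y \<in> carrier B" using B by auto
  show "cnorm B (ev B x \<oplus>\<^bsub>B\<^esub> ev B y) \<le> norm x + norm y"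
    using B.cnorm_triangle[of "ev B x" "ev B y"] cnorm_ev_le_norm[OF B, of x] cnorm_ev_le_norm[OF B, of y] B
    by auto
qed

lemma ev_scale_aux:
  fixes c :: complex shows "ev A (family (\<lambda>A. c \<odot>\<^bsub>A\<^esub> ev A x)) = c \<odot>\<^bsub>A\<^esub> ev A x"
proof (rule ev_family[OF _ _ A, of _ "cmod c * norm x"])
  fix B :: "'a cstar" assume B: "cstar_algebra B"
  then interpret B: cstar_algebra B .
  show "c \<odot>\<^bsub>B\<^esub> ev B x \<in> carrier B" using B by auto
  show "cnorm B (c \<odot>\<^bsub>B\<^esub> ev B x) \<le> cmod c * norm x"
    using B.cnorm_smult[of "ev B x" c] cnorm_ev_le_norm[OF B, of x] B by (simp add: mult_left_mono)
qed

lemma ev_scaleR [simp]: "ev A (r *\<^sub>R x) = complex_of_real r \<odot>\<^bsub>A\<^esub> ev A x"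
  unfolding scaleR_univ_def by (rule ev_scale_aux)

lemma ev_uminus [simp]: "ev A (- x) = (-1) \<odot>\<^bsub>A\<^esub> ev A x"
proof -
  have "- x = family (\<lambda>A. (-1) \<odot>\<^bsub>A\<^esub> ev A x)"
    unfolding uminus_univ_def family_def
    by (rule arg_cong[of _ _ Abs_univ]) (auto simp: fun_eq_iff cstar_algebra_def star_algebra.uminus_eq_smult)
  then show ?thesis by (simp add: ev_scale_aux)
qed

lemma ev_diff [simp]: "ev A (x - y) = ev A x \<ominus>\<^bsub>A\<^esub> ev A y"
  unfolding minus_univ_def using A by (simp add: minus_eq_smult)

lemma ev_mult [simp]: "ev A (x * y) = ev A x \<otimes>\<^bsub>A\<^esub> ev A y"
  unfolding times_univ_def
proof (rule ev_family[OF _ _ A, of _ "norm x * norm y"])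
  fix B :: "'a cstar" assume B: "cstar_algebra B"
  then interpret B: cstar_algebra B .
  show "ev B x \<otimes>\<^bsub>B\<^esub> ev B y \<in> carrier B" using B by auto
  have "cnorm B (ev B x \<otimes>\<^bsub>B\<^esub> ev B y) \<le> cnorm B (ev B x) * cnorm B (ev B y)"
    using B by (intro B.cnorm_mult) auto
  also have "\<dots> \<le> norm x * norm y"
    using B by (intro mult_mono cnorm_ev_le_norm B.cnorm_ge_0 norm_univ_ge_0) auto
  finally show "cnorm B (ev B x \<otimes>\<^bsub>B\<^esub> ev B y) \<le> norm x * norm y" .
qed

end

instance
proof
  fix x y z :: "'a univ" and a b :: real
  have am: "abelian_monoid A" if "cstar_algebra A" for A :: "'a cstar"
  proof -
    interpret cstar_algebra A by fact
    show ?thesis ..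
  qed
  show "x + y + z = x + (y + z)" "x + y = y + x" "0 + x = x"
    by (rule univ_eqI; simp add: am abelian_monoid.a_assoc abelian_monoid.a_comm abelian_monoid.l_zero)+
  show "- x + x = 0"
  proof (rule univ_eqI)
    fix A :: "'a cstar" assume A: "cstar_algebra A"
    then interpret cstar_algebra A .
    show "ev A (- x + x) = ev A 0" using A by (simp add: M.l_neg flip: uminus_eq_smult)
  qed
  show "x - y = x + - y" by (simp add: minus_univ_def)
  show "x * y * z = x * (y * z)"
    by (rule univ_eqI) (simp add: star_algebra.mult_assoc cstar_algebra.axioms(1))
  show "(x + y) * z = x * z + y * z" "x * (y + z) = x * y + x * z"
    by (rule univ_eqI; simp add: star_algebra.distrib_left star_algebra.distrib_right cstar_algebra.axioms(1))+
  show "a *\<^sub>R (x + y) = a *\<^sub>R x + a *\<^sub>R y" "(a + b) *\<^sub>R x = a *\<^sub>R x + b *\<^sub>R x"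
    "a *\<^sub>R b *\<^sub>R x = (a * b) *\<^sub>R x" "1 *\<^sub>R x = x"
    by (rule univ_eqI; simp add: star_algebra.smult_add_left star_algebra.smult_add_right
        star_algebra.smult_smult star_algebra.smult_one_left cstar_algebra.axioms(1))+
  show "a *\<^sub>R x * y = a *\<^sub>R (x * y)" "x * a *\<^sub>R y = a *\<^sub>R (x * y)"
    by (rule univ_eqI; simp add: star_algebra.smult_mult_left star_algebra.smult_mult_right
        cstar_algebra.axioms(1))+
  show "dist x y = norm (x - y)" "sgn x = inverse (norm x) *\<^sub>R x"
    by (simp_all add: dist_univ_def sgn_univ_def)
  show "(uniformity :: ('a univ \<times> 'a univ) filter) = (INF e\<in>{0 <..}. principal {(x, y). dist x y < e})"
    by (rule uniformity_univ_def)
  show "open U = (\<forall>x\<in>U. \<forall>\<^sub>F (x', y) in uniformity. x' = x \<longrightarrow> y \<in> U)" for U :: "'a univ set"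
    by (rule open_univ_def)
  show "norm x = 0 \<longleftrightarrow> x = 0"
  proof
    assume 0: "norm x = 0"
    show "x = 0"
    proof (rule univ_eqI)
      fix A :: "'a cstar" assume A: "cstar_algebra A"
      then interpret cstar_algebra A .
      have "cnorm A (ev A x) \<le> 0" using cnorm_ev_le_norm[OF A, of x] 0 by simp
      then show "ev A x = ev A 0" using A cnorm_ge_0[of "ev A x"] by (auto intro: definite)
    qed
  next
    assume "x = 0"
    moreover have "norm (0::'a univ) \<le> 0"
      by (rule norm_univ_le) (auto simp: star_algebra.seminorm_zero[OF cstar_algebra.axioms(1)
            cstar_algebra.seminorm])
    ultimately show "norm x = 0" using norm_univ_ge_0[of x] by simp
  qed
  show "norm (x + y) \<le> norm x + norm y"
  proof (rule norm_univ_le)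
    fix A :: "'a cstar" assume A: "cstar_algebra A"
    then interpret cstar_algebra A .
    show "cnorm A (ev A (x + y)) \<le> norm x + norm y"
      using A cnorm_triangle[of "ev A x" "ev A y"] cnorm_ev_le_norm[OF A, of x] cnorm_ev_le_norm[OF A, of y]
      by simp
  qed (simp add: norm_univ_ge_0)
  show "norm (x * y) \<le> norm x * norm y"
  proof (rule norm_univ_le)
    fix A :: "'a cstar" assume A: "cstar_algebra A"
    then interpret cstar_algebra A .
    have "cnorm A (ev A (x * y)) \<le> cnorm A (ev A x) * cnorm A (ev A y)"
      using A by (simp add: cnorm_mult)
    also have "\<dots> \<le> norm x * norm y"
      using A by (intro mult_mono cnorm_ev_le_norm cnorm_ge_0 norm_univ_ge_0) auto
    finally show "cnorm A (ev A (x * y)) \<le> norm x * norm y" .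
  qed (simp add: norm_univ_ge_0)
  have le: "norm (c *\<^sub>R v) \<le> \<bar>c\<bar> * norm v" for c and v :: "'a univ"
  proof (rule norm_univ_le)
    fix A :: "'a cstar" assume A: "cstar_algebra A"
    then interpret cstar_algebra A .
    show "cnorm A (ev A (c *\<^sub>R v)) \<le> \<bar>c\<bar> * norm v"
      using A cnorm_ev_le_norm[OF A, of v] by (simp add: cnorm_smult mult_left_mono)
  qed (simp add: norm_univ_ge_0)
  show "norm (a *\<^sub>R x) = \<bar>a\<bar> * norm x"
  proof (rule antisym[OF le])
    show "\<bar>a\<bar> * norm x \<le> norm (a *\<^sub>R x)"
    proof (cases "a = 0")
      case False
      have "inverse a *\<^sub>R a *\<^sub>R x = x" using False
        by (intro univ_eqI) (simp add: star_algebra.smult_smult star_algebra.smult_one_left cstar_algebra.axioms(1)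
            flip: of_real_mult of_real_inverse)
      then have "norm x \<le> \<bar>inverse a\<bar> * norm (a *\<^sub>R x)" using le[of "inverse a" "a *\<^sub>R x"] by simp
      then show ?thesis using False by (simp add: field_simps)
    qed (simp add: norm_univ_ge_0)
  qed
qed

end

instance univ :: (type) complete_space
proof
  fix X :: "nat \<Rightarrow> 'a univ" assume X: "Cauchy X"
  then obtain K where K: "\<And>n. norm (X n) \<le> K" using Cauchy_Bseq[OF X] unfolding Bseq_def by blast
  have "\<exists>L. L \<in> carrier A \<and> (\<lambda>n. cnorm A (ev A (X n) \<ominus>\<^bsub>A\<^esub> L)) \<longlonglongrightarrow> 0"
    if A: "cstar_algebra A" for A
  proof -
    interpret cstar_algebra A by (rule A)
    have "cauchy_in A (cnorm A) (\<lambda>n. ev A (X n))"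
      unfolding cauchy_in_def
    proof (intro conjI allI impI)
      show "range (\<lambda>n. ev A (X n)) \<subseteq> carrier A" using A by auto
      fix r :: real assume "r > 0"
      then obtain M where "\<forall>m\<ge>M. \<forall>n\<ge>M. norm (X m - X n) < r" using X unfolding Cauchy_iff by blast
      then have "\<forall>i\<ge>M. \<forall>j\<ge>M. cnorm A (ev A (X i - X j)) < r" using cnorm_ev_le_norm[OF A] by (meson le_less_trans)
      then show "\<exists>M. \<forall>i\<ge>M. \<forall>j\<ge>M. cnorm A (ev A (X i) \<ominus>\<^bsub>A\<^esub> ev A (X j)) < r" using A by auto
    qed
    from complete[OF this] show ?thesis by blast
  qed
  then obtain L where L: "\<And>A. cstar_algebra A \<Longrightarrow> L A \<in> carrier A"
    "\<And>A. cstar_algebra A \<Longrightarrow> (\<lambda>n. cnorm A (ev A (X n) \<ominus>\<^bsub>A\<^esub> L A)) \<longlonglongrightarrow> 0"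
    by metis
  have bound: "cnorm A (L A) \<le> K" if A: "cstar_algebra A" for A
  proof -
    interpret cstar_algebra A by (rule A)
    show ?thesis
    proof (rule field_le_epsilon)
      fix r :: real assume "r > 0"
      then obtain n where n: "cnorm A (ev A (X n) \<ominus>\<^bsub>A\<^esub> L A) < r"
        using order_tendstoD(2)[OF L(2)[OF A]] eventually_happens by fastforce
      have "cnorm A (L A) - cnorm A (ev A (X n)) \<le> cnorm A (L A \<ominus>\<^bsub>A\<^esub> ev A (X n))"
        using A L by (intro seminorm_diff_le[OF seminorm]) auto
      also have "\<dots> = cnorm A (ev A (X n) \<ominus>\<^bsub>A\<^esub> L A)"
        using A L by (intro seminorm_minus_commute[OF seminorm]) auto
      finally show "cnorm A (L A) \<le> K + r"
        using n cnorm_ev_le_norm[OF A, of "X n"] K[of n] by linarith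
    qed
  qed
  have evL: "ev A (family L) = L A" if "cstar_algebra A" for A
    using L bound that by (intro ev_family)
  have "X \<longlonglongrightarrow> family L"
  proof (rule LIMSEQ_I)
    fix r :: real assume r: "r > 0"
    \<comment> \<open>Strict bounds on all entries give only a weak bound on the supremum; two
      quarters leave room for a strict one.\<close>
    then obtain M where M: "\<And>m n. m \<ge> M \<Longrightarrow> n \<ge> M \<Longrightarrow> norm (X m - X n) < r / 4"
      using X unfolding Cauchy_iff by (metis divide_pos_pos zero_less_numeral)
    have "norm (X n - family L) < r" if n: "n \<ge> M" for n
    proof -
      have "norm (X n - family L) \<le> r / 2"
      proof (rule norm_univ_le)
        fix A :: "'a cstar" assume A: "cstar_algebra A"
        interpret cstar_algebra A by (rule A)
        have "eventually (\<lambda>m. cnorm A (ev A (X m) \<ominus>\<^bsub>A\<^esub> L A) < r / 4 \<and> m \<ge> M) sequentially"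
          using order_tendstoD(2)[OF L(2)[OF A], of "r / 4"] r
          by (intro eventually_conj eventually_ge_at_top) auto
        then obtain m where m: "cnorm A (ev A (X m) \<ominus>\<^bsub>A\<^esub> L A) < r / 4" "m \<ge> M"
          using eventually_happens by fastforce
        have "cnorm A (ev A (X n) \<ominus>\<^bsub>A\<^esub> L A)
            \<le> cnorm A (ev A (X n) \<ominus>\<^bsub>A\<^esub> ev A (X m)) + cnorm A (ev A (X m) \<ominus>\<^bsub>A\<^esub> L A)"
          using A L by (intro seminorm_minus_triangle[OF seminorm]) auto
        moreover have "cnorm A (ev A (X n - X m)) \<le> r / 4"
          using M[OF n m(2)] cnorm_ev_le_norm[OF A, of "X n - X m"] by linarith
        ultimately show "cnorm A (ev A (X n - family L)) \<le> r / 2"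
          using A m evL[OF A] by simp
      qed (use r in simp)
      then show ?thesis using r by linarith
    qed
    then show "\<exists>no. \<forall>n\<ge>no. norm (X n - family L) < r" by blast
  qed
  then show "convergent X" by (rule convergentI)
qed

instantiation univ :: (type) cstar_ring
begin

definition scaleC_univ :: "complex \<Rightarrow> 'a univ \<Rightarrow> 'a univ" where
  "c *\<^sub>C x = family (\<lambda>A. c \<odot>\<^bsub>A\<^esub> ev A x)"
definition star_univ :: "'a univ \<Rightarrow> 'a univ" where
  "star x = family (\<lambda>A. adj A (ev A x))"

lemma ev_scaleC [simp]: "cstar_algebra A \<Longrightarrow> ev A (c *\<^sub>C x) = c \<odot>\<^bsub>A\<^esub> ev A x"
  unfolding scaleC_univ_def by (rule ev_scale_aux)

lemma ev_star [simp]: assumes A: "cstar_algebra A" shows "ev A (star x) = adj A (ev A x)"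
  unfolding star_univ_def
proof (rule ev_family[OF _ _ A, of _ "norm x"])
  fix B :: "'a cstar" assume B: "cstar_algebra B"
  then interpret B: cstar_algebra B .
  show "adj B (ev B x) \<in> carrier B" using B by auto
  show "cnorm B (adj B (ev B x)) \<le> norm x" using B cnorm_ev_le_norm[OF B, of x] by simp
qed

instance
proof
  fix x y :: "'a univ" and r :: real and c d :: complex
  show "r *\<^sub>R x = complex_of_real r *\<^sub>C x" by (rule univ_eqI) simp
  show "c *\<^sub>C (x + y) = c *\<^sub>C x + c *\<^sub>C y" "(c + d) *\<^sub>C x = c *\<^sub>C x + d *\<^sub>C x"
    "c *\<^sub>C d *\<^sub>C x = (c * d) *\<^sub>C x"
    "c *\<^sub>C x * y = c *\<^sub>C (x * y)" "x * c *\<^sub>C y = c *\<^sub>C (x * y)"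
    "star (star x) = x" "star (x + y) = star x + star y" "star (x * y) = star y * star x"
    "star (c *\<^sub>C x) = cnj c *\<^sub>C star x"
    by (rule univ_eqI; simp add: star_algebra.smult_add_left star_algebra.smult_add_right
        star_algebra.smult_smult star_algebra.smult_mult_left star_algebra.smult_mult_right
        star_algebra.adj_adj star_algebra.adj_add star_algebra.adj_mult star_algebra.adj_smult
        cstar_algebra.axioms(1))+
  have le: "norm (a *\<^sub>C v) \<le> cmod a * norm v" for a and v :: "'a univ"
  proof (rule norm_univ_le)
    fix A :: "'a cstar" assume A: "cstar_algebra A"
    then interpret cstar_algebra A .
    show "cnorm A (ev A (a *\<^sub>C v)) \<le> cmod a * norm v"
      using A cnorm_ev_le_norm[OF A, of v] by (simp add: cnorm_smult mult_left_mono)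
  qed simp
  show "norm (c *\<^sub>C x) = cmod c * norm x"
  proof (rule antisym[OF le])
    show "cmod c * norm x \<le> norm (c *\<^sub>C x)"
    proof (cases "c = 0")
      case False
      have "inverse c *\<^sub>C c *\<^sub>C x = x" using False
        by (intro univ_eqI) (simp add: star_algebra.smult_smult star_algebra.smult_one_left cstar_algebra.axioms(1))
      then have "norm x \<le> inverse (cmod c) * norm (c *\<^sub>C x)"
        using le[of "inverse c" "c *\<^sub>C x"] by (simp add: norm_inverse)
      then show ?thesis using False by (simp add: field_simps)
    qed simp
  qed
  show "norm (star x * x) = (norm x)\<^sup>2"
  proof (rule antisym)
    show "norm (star x * x) \<le> (norm x)\<^sup>2"
    proof (rule norm_univ_le)
      fix A :: "'a cstar" assume A: "cstar_algebra A"
      then interpret cstar_algebra A .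
      show "cnorm A (ev A (star x * x)) \<le> (norm x)\<^sup>2"
        using A cnorm_ev_le_norm[OF A, of x] cnorm_ge_0[of "ev A x"]
        by (simp add: cnorm_cstar power_mono)
    qed simp
    have "norm x \<le> sqrt (norm (star x * x))"
    proof (rule norm_univ_le)
      fix A :: "'a cstar" assume A: "cstar_algebra A"
      then interpret cstar_algebra A .
      have "(cnorm A (ev A x))\<^sup>2 \<le> norm (star x * x)"
        using A cnorm_ev_le_norm[OF A, of "star x * x"] by (simp add: cnorm_cstar)
      then show "cnorm A (ev A x) \<le> sqrt (norm (star x * x))" by (rule real_le_rsqrt)
    qed simp
    then show "(norm x)\<^sup>2 \<le> norm (star x * x)"
      by (metis norm_ge_zero power_mono real_sqrt_pow2)
  qed
qed

end

text \<open>Extension by zero to the other factors: an isometric *-homomorphism into the product,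
  sending a unit of \<open>A\<close> to a projection and not to a unit. This is why everything takes
  place in corners.\<close>

definition emb :: "'a cstar \<Rightarrow> 'a \<Rightarrow> 'a univ" where
  "emb A x = family (\<lambda>B. if B = A then x else \<zero>\<^bsub>B\<^esub>)"

context cstar_algebra
begin

lemma is_cstar: "cstar_algebra A" ..

lemma ev_emb_gen:
  assumes "x \<in> carrier A" "cstar_algebra B"
  shows "ev B (emb A x) = (if B = A then x else \<zero>\<^bsub>B\<^esub>)"
  unfolding emb_def
proof (rule ev_family[OF _ _ assms(2), of _ "cnorm A x"])
  fix C :: "'a cstar" assume "cstar_algebra C"
  then interpret C: cstar_algebra C .
  show "(if C = A then x else \<zero>\<^bsub>C\<^esub>) \<in> carrier C" "cnorm C (if C = A then x else \<zero>\<^bsub>C\<^esub>) \<le> cnorm A x"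
    using assms(1) cnorm_ge_0[OF assms(1)] by auto
qed

lemma ev_emb [simp]: "x \<in> carrier A \<Longrightarrow> ev A (emb A x) = x"
  using ev_emb_gen is_cstar by auto

lemma emb_inj: "x \<in> carrier A \<Longrightarrow> y \<in> carrier A \<Longrightarrow> emb A x = emb A y \<longleftrightarrow> x = y"
  by (metis ev_emb)

lemma emb_hom:
  assumes x: "x \<in> carrier A"
  shows "emb A \<zero>\<^bsub>A\<^esub> = 0" "y \<in> carrier A \<Longrightarrow> emb A (x \<oplus>\<^bsub>A\<^esub> y) = emb A x + emb A y"
    "y \<in> carrier A \<Longrightarrow> emb A (x \<ominus>\<^bsub>A\<^esub> y) = emb A x - emb A y"
    "y \<in> carrier A \<Longrightarrow> emb A (x \<otimes>\<^bsub>A\<^esub> y) = emb A x * emb A y"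
    "emb A (c \<odot>\<^bsub>A\<^esub> x) = c *\<^sub>C emb A x" "emb A (adj A x) = star (emb A x)"
proof -
  have *: "\<zero>\<^bsub>B\<^esub> \<oplus>\<^bsub>B\<^esub> \<zero>\<^bsub>B\<^esub> = \<zero>\<^bsub>B\<^esub>" "\<zero>\<^bsub>B\<^esub> \<ominus>\<^bsub>B\<^esub> \<zero>\<^bsub>B\<^esub> = \<zero>\<^bsub>B\<^esub>" "\<zero>\<^bsub>B\<^esub> \<otimes>\<^bsub>B\<^esub> \<zero>\<^bsub>B\<^esub> = \<zero>\<^bsub>B\<^esub>" "c \<odot>\<^bsub>B\<^esub> \<zero>\<^bsub>B\<^esub> = \<zero>\<^bsub>B\<^esub>" "adj B \<zero>\<^bsub>B\<^esub> = \<zero>\<^bsub>B\<^esub>"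
    if "cstar_algebra B" for B :: "'a cstar" and c
  proof -
    interpret B: cstar_algebra B by fact
    show "\<zero>\<^bsub>B\<^esub> \<oplus>\<^bsub>B\<^esub> \<zero>\<^bsub>B\<^esub> = \<zero>\<^bsub>B\<^esub>" "\<zero>\<^bsub>B\<^esub> \<ominus>\<^bsub>B\<^esub> \<zero>\<^bsub>B\<^esub> = \<zero>\<^bsub>B\<^esub>" "\<zero>\<^bsub>B\<^esub> \<otimes>\<^bsub>B\<^esub> \<zero>\<^bsub>B\<^esub> = \<zero>\<^bsub>B\<^esub>"
      "c \<odot>\<^bsub>B\<^esub> \<zero>\<^bsub>B\<^esub> = \<zero>\<^bsub>B\<^esub>" "adj B \<zero>\<^bsub>B\<^esub> = \<zero>\<^bsub>B\<^esub>" by (auto simp: a_minus_def B.M.r_neg)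
  qed
  show "emb A \<zero>\<^bsub>A\<^esub> = 0" by (rule univ_eqI) (auto simp: ev_emb_gen)
  show "emb A (x \<oplus>\<^bsub>A\<^esub> y) = emb A x + emb A y" "emb A (x \<ominus>\<^bsub>A\<^esub> y) = emb A x - emb A y"
    "emb A (x \<otimes>\<^bsub>A\<^esub> y) = emb A x * emb A y" if "y \<in> carrier A"
    using that x by - (rule univ_eqI; simp add: ev_emb_gen *)+
  show "emb A (c \<odot>\<^bsub>A\<^esub> x) = c *\<^sub>C emb A x" "emb A (adj A x) = star (emb A x)"
    using x by - (rule univ_eqI; simp add: ev_emb_gen *)+
qed

lemma norm_emb [simp]: assumes x: "x \<in> carrier A" shows "norm (emb A x) = cnorm A x"
proof (rule antisym)
  show "norm (emb A x) \<le> cnorm A x"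
  proof (rule norm_univ_le)
    fix B :: "'a cstar" assume B: "cstar_algebra B"
    then interpret B: cstar_algebra B .
    show "cnorm B (ev B (emb A x)) \<le> cnorm A x" using x B cnorm_ge_0[OF x] by (auto simp: ev_emb_gen)
  qed (rule cnorm_ge_0[OF x])
  show "cnorm A x \<le> norm (emb A x)" using cnorm_ev_le_norm[OF is_cstar, of "emb A x"] x by simp
qed

lemma emb_finsum:
  assumes "\<And>i. i \<in> I \<Longrightarrow> f i \<in> carrier A"
  shows "emb A (\<Oplus>\<^bsub>A\<^esub>i\<in>I. f i) = (\<Sum>i\<in>I. emb A (f i))"
  using assms
proof (induction I rule: infinite_finite_induct)
  case (insert i I)
  then have "(\<Oplus>\<^bsub>A\<^esub>i\<in>insert i I. f i) = f i \<oplus>\<^bsub>A\<^esub> (\<Oplus>\<^bsub>A\<^esub>i\<in>I. f i)" by (intro M.finsum_insert) auto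
  then show ?case using insert by (simp add: emb_hom M.finsum_closed Pi_def)
qed (auto simp: emb_hom(1)[OF M.zero_closed] M.finsum_infinite)

end

section \<open>Automatic contractivity of *-homomorphisms\<close>

lemma star_homD:
  assumes "f \<in> star_hom A B" "x \<in> carrier A"
  shows "f x \<in> carrier B" "y \<in> carrier A \<Longrightarrow> f (x \<oplus>\<^bsub>A\<^esub> y) = f x \<oplus>\<^bsub>B\<^esub> f y"
    "f (c \<odot>\<^bsub>A\<^esub> x) = c \<odot>\<^bsub>B\<^esub> f x" "y \<in> carrier A \<Longrightarrow> f (x \<otimes>\<^bsub>A\<^esub> y) = f x \<otimes>\<^bsub>B\<^esub> f y"
    "f (adj A x) = adj B (f x)"
  using assms unfolding star_hom_def by auto

locale unital_cstar = cstar_algebra A for A :: "'a cstar" +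
  assumes one_closed [simp, intro]: "\<one>\<^bsub>A\<^esub> \<in> carrier A"
    and one_mult [simp]: "x \<in> carrier A \<Longrightarrow> \<one>\<^bsub>A\<^esub> \<otimes>\<^bsub>A\<^esub> x = x"
    and mult_one [simp]: "x \<in> carrier A \<Longrightarrow> x \<otimes>\<^bsub>A\<^esub> \<one>\<^bsub>A\<^esub> = x"
begin

lemma adj_one [simp]: "adj A \<one>\<^bsub>A\<^esub> = \<one>\<^bsub>A\<^esub>"
proof -
  have "adj A (adj A \<one>\<^bsub>A\<^esub> \<otimes>\<^bsub>A\<^esub> \<one>\<^bsub>A\<^esub>) = adj A \<one>\<^bsub>A\<^esub> \<otimes>\<^bsub>A\<^esub> adj A (adj A \<one>\<^bsub>A\<^esub>)"
    by (intro adj_mult) auto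
  then show ?thesis by (simp add: adj_adj)
qed

sublocale U: corner "emb A \<one>\<^bsub>A\<^esub>"
  by unfold_locales (simp_all flip: emb_hom)

lemma crn_emb [simp, intro]: "x \<in> carrier A \<Longrightarrow> U.crn (emb A x)"
  unfolding U.crn_def by (simp flip: emb_hom)

end

text \<open>The unit goes to a projection, not necessarily to a unit of \<open>B\<close>. The range
  of \<open>f\<close> lies in the corner of this projection, where the positivity results
  apply.\<close>

lemma star_hom_idem:
  assumes "unital_cstar A" "cstar_algebra B" "f \<in> star_hom A B"
  shows "corner (emb B (f \<one>\<^bsub>A\<^esub>))"
proof -
  interpret A: unital_cstar A by fact
  interpret B: cstar_algebra B by fact
  note f = star_homD[OF assms(3)]
  show ?thesis
  proof
    show "emb B (f \<one>\<^bsub>A\<^esub>) * emb B (f \<one>\<^bsub>A\<^esub>) = emb B (f \<one>\<^bsub>A\<^esub>)"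
      using f(4)[of "\<one>\<^bsub>A\<^esub>" "\<one>\<^bsub>A\<^esub>"] f(1) by (simp flip: B.emb_hom)
    show "star (emb B (f \<one>\<^bsub>A\<^esub>)) = emb B (f \<one>\<^bsub>A\<^esub>)"
      using f(5)[of "\<one>\<^bsub>A\<^esub>"] f(1) by (simp flip: B.emb_hom)
  qed
qed

lemma star_hom_crn:
  assumes "unital_cstar A" "cstar_algebra B" "f \<in> star_hom A B" "x \<in> carrier A"
  shows "corner.crn (emb B (f \<one>\<^bsub>A\<^esub>)) (emb B (f x))"
proof -
  interpret A: unital_cstar A by fact
  interpret B: cstar_algebra B by fact
  interpret corner "emb B (f \<one>\<^bsub>A\<^esub>)" by (rule star_hom_idem[OF assms(1-3)])
  note f = star_homD[OF assms(3)]
  show ?thesis unfolding crn_def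
    using f(4)[of "\<one>\<^bsub>A\<^esub>" x] f(4)[of x "\<one>\<^bsub>A\<^esub>"] f(1) assms(4) by (simp flip: B.emb_hom)
qed

text \<open>For a contraction \<open>y\<close> a square root \<open>c\<close> inside
  \<open>A\<close> solves \<open>star y * y + star c * c = 1\<close>. Applying \<open>f\<close>
  gives the same relation in the corner of \<open>f 1\<close>, and positivity of the second summand
  there shows that \<open>f y\<close> is a contraction. Scaling does the rest.\<close>

theorem star_hom_contractive:
  assumes A: "unital_cstar A" and B: "cstar_algebra B" and f: "f \<in> star_hom A B" and x: "x \<in> carrier A"
  shows "cnorm B (f x) \<le> cnorm A x"
proof -
  interpret A: unital_cstar A by fact
  interpret B: cstar_algebra B by fact
  interpret V: corner "emb B (f \<one>\<^bsub>A\<^esub>)" by (rule star_hom_idem[OF A B f])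
  note h = star_homD[OF f]
  have unit: "cnorm B (f y) \<le> 1" if y: "y \<in> carrier A" and n: "cnorm A y \<le> 1" for y
  proof -
    obtain d where d: "A.U.crn d" "star d = d" "d * d = emb A \<one>\<^bsub>A\<^esub> - star (emb A y) * emb A y"
      using A.U.sqrt_complement[of "emb A y"] y n by auto
    \<comment> \<open>The root \<open>d\<close> is formed in the product ring; its component at
      \<open>A\<close> solves the equation inside \<open>A\<close>.\<close>
    define c where "c = ev A d"
    have c: "c \<in> carrier A" "adj A c = c" unfolding c_def
      using d(2) A.is_cstar by (auto simp flip: ev_star)
    have "ev A (d * d) = ev A (emb A \<one>\<^bsub>A\<^esub> - star (emb A y) * emb A y)" using d(3) by simp
    then have "c \<otimes>\<^bsub>A\<^esub> c = \<one>\<^bsub>A\<^esub> \<ominus>\<^bsub>A\<^esub> adj A y \<otimes>\<^bsub>A\<^esub> y"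
      unfolding c_def using A.is_cstar y by simp
    then have "adj A y \<otimes>\<^bsub>A\<^esub> y \<oplus>\<^bsub>A\<^esub> adj A c \<otimes>\<^bsub>A\<^esub> c = \<one>\<^bsub>A\<^esub>"
      using c y by (simp add: a_minus_def A.M.a_lcomm A.M.r_neg)
    then have "f (adj A y \<otimes>\<^bsub>A\<^esub> y \<oplus>\<^bsub>A\<^esub> adj A c \<otimes>\<^bsub>A\<^esub> c) = f \<one>\<^bsub>A\<^esub>" by simp
    then have "adj B (f y) \<otimes>\<^bsub>B\<^esub> f y \<oplus>\<^bsub>B\<^esub> adj B (f c) \<otimes>\<^bsub>B\<^esub> f c = f \<one>\<^bsub>A\<^esub>"
      using y c(1) h by simp
    from arg_cong[OF this, of "emb B"]
    have "star (emb B (f y)) * emb B (f y) + star (emb B (f c)) * emb B (f c) = emb B (f \<one>\<^bsub>A\<^esub>)"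
      using y c(1) h(1) by (simp add: B.emb_hom)
    then have "norm (emb B (f y)) \<le> 1"
      using star_hom_crn[OF A B f] y c by (intro V.norm_le_1_if_complement) auto
    then show ?thesis using y h(1) by simp
  qed
  show ?thesis
  proof (rule field_le_epsilon)
    fix r :: real assume r: "r > 0"
    \<comment> \<open>The summand \<open>r\<close> keeps the divisor positive when
      \<open>cnorm A x\<close> is 0.\<close>
    define s where "s = cnorm A x + r"
    have s: "s > 0" unfolding s_def using r A.cnorm_ge_0[OF x] by simp
    define y where "y = complex_of_real (inverse s) \<odot>\<^bsub>A\<^esub> x"
    have cm: "cmod (complex_of_real (inverse s)) = inverse s" using s by (simp only: norm_of_real) simp
    have "cnorm A y = inverse s * cnorm A x" by (simp only: y_def A.cnorm_smult[OF x] cm)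
    moreover have "cnorm A x \<le> s" unfolding s_def using r by simp
    then have "inverse s * cnorm A x \<le> 1" using s by (simp add: field_simps)
    ultimately have "cnorm A y \<le> 1" by simp
    then have "cnorm B (f y) \<le> 1" using x by (intro unit) (auto simp: y_def)
    moreover have "cnorm B (f y) = inverse s * cnorm B (f x)"
      by (simp only: y_def h(3)[OF x] B.cnorm_smult[OF h(1)[OF x]] cm)
    ultimately have "inverse s * cnorm B (f x) \<le> 1" by simp
    then show "cnorm B (f x) \<le> cnorm A x + r" using s by (simp add: s_def field_simps)
  qed
qed

section \<open>Matrix algebras\<close>

context corner
begin

definition cn :: "nat \<Rightarrow> (nat \<Rightarrow> 'a) \<Rightarrow> real" where
  "cn k V = sqrt (norm (\<Sum>i<k. star (V i) * V i))"

lemma cn_ge_0: "0 \<le> cn k V" unfolding cn_def by simp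

lemma cn_square: "(cn k V)\<^sup>2 = norm (\<Sum>i<k. star (V i) * V i)" unfolding cn_def by simp

lemma cn_cong: "(\<And>i. i < k \<Longrightarrow> V i = W i) \<Longrightarrow> cn k V = cn k W"
  unfolding cn_def by (auto intro: arg_cong[of _ _ norm] sum.cong)

lemma cn_cauchy_schwarz:
  assumes "\<And>i. i < k \<Longrightarrow> crn (V i)" "\<And>i. i < k \<Longrightarrow> crn (W i)"
  shows "norm (\<Sum>i<k. star (V i) * W i) \<le> cn k V * cn k W"
proof (rule power2_le_imp_le)
  show "(norm (\<Sum>i<k. star (V i) * W i))\<^sup>2 \<le> (cn k V * cn k W)\<^sup>2"
    unfolding power_mult_distrib cn_square using assms by (intro cauchy_schwarz) auto
qed (simp add: cn_ge_0)

lemma cn_triangle: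
  assumes "\<And>i. i < k \<Longrightarrow> crn (V i)" "\<And>i. i < k \<Longrightarrow> crn (W i)"
  shows "cn k (\<lambda>i. V i + W i) \<le> cn k V + cn k W"
proof (rule power2_le_imp_le)
  have "(cn k (\<lambda>i. V i + W i))\<^sup>2 = norm ((\<Sum>i<k. star (V i) * V i) + (\<Sum>i<k. star (V i) * W i)
      + (\<Sum>i<k. star (W i) * V i) + (\<Sum>i<k. star (W i) * W i))"
    unfolding cn_square by (simp add: star_add algebra_simps sum.distrib)
  also have "\<dots> \<le> (cn k V)\<^sup>2 + cn k V * cn k W + cn k W * cn k V + (cn k W)\<^sup>2"
    unfolding cn_square
    by (intro norm_triangle_le add_mono cn_cauchy_schwarz order_refl; simp add: assms)
  also have "\<dots> = (cn k V + cn k W)\<^sup>2" by (simp add: power2_eq_square algebra_simps)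
  finally show "(cn k (\<lambda>i. V i + W i))\<^sup>2 \<le> (cn k V + cn k W)\<^sup>2" .
qed (simp add: cn_ge_0)

lemma cn_scaleC: "cn k (\<lambda>i. c *\<^sub>C V i) = cmod c * cn k V"
proof -
  have "(\<Sum>i<k. star (c *\<^sub>C V i) * (c *\<^sub>C V i)) = (cnj c * c) *\<^sub>C (\<Sum>i<k. star (V i) * V i)"
    by (simp add: scaleC_sum_right mult.commute)
  then show ?thesis unfolding cn_def by (simp add: norm_mult real_sqrt_mult)
qed

text \<open>Removing the other summands, which are positive, can only decrease the norm.\<close>

lemma norm_le_cn: assumes "\<And>i. i < k \<Longrightarrow> crn (V i)" "i < k" shows "norm (V i) \<le> cn k V"
proof (rule power2_le_imp_le)
  have "(\<Sum>i<k. star (V i) * V i) - star (V i) * V i = (\<Sum>i\<in>{..<k} - {i}. star (V i) * V i)"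
    using assms(2) by (simp add: sum_diff1)
  then have "norm (star (V i) * V i) \<le> norm (\<Sum>i<k. star (V i) * V i)"
    using assms by (intro norm_mono pos_star_mult_self) (auto intro!: pos_sum pos_star_mult_self)
  then show "(norm (V i))\<^sup>2 \<le> (cn k V)\<^sup>2" unfolding cn_square norm_star_mult_self .
qed (simp add: cn_ge_0)

lemma cn_le_sum: "cn k V \<le> (\<Sum>i<k. norm (V i))"
proof (rule power2_le_imp_le)
  have "norm (\<Sum>i<k. star (V i) * V i) \<le> (\<Sum>i<k. norm (V i) * norm (V i))"
    by (rule sum_norm_le) (simp add: norm_star_mult_self power2_eq_square)
  also have "\<dots> \<le> (\<Sum>i<k. norm (V i) * (\<Sum>i<k. norm (V i)))"
    by (intro sum_mono mult_left_mono member_le_sum) auto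
  also have "\<dots> = (\<Sum>i<k. norm (V i))\<^sup>2" by (simp add: power2_eq_square sum_distrib_right)
  finally show "(cn k V)\<^sup>2 \<le> (\<Sum>i<k. norm (V i))\<^sup>2" unfolding cn_square .
qed (simp add: sum_nonneg)

end

context unital_cstar
begin

definition mv :: "nat \<Rightarrow> (nat \<times> nat \<Rightarrow> 'a) \<Rightarrow> (nat \<Rightarrow> 'a) \<Rightarrow> nat \<Rightarrow> 'a" where
  "mv k X v = (\<lambda>i. \<Oplus>\<^bsub>A\<^esub>j\<in>{..<k}. X (i, j) \<otimes>\<^bsub>A\<^esub> v j)"

abbreviation "mats k \<equiv> {..<k} \<times> {..<k} \<rightarrow>\<^sub>E carrier A"
abbreviation "cols k \<equiv> {..<k} \<rightarrow> carrier A"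

lemma mats_entry: "X \<in> mats k \<Longrightarrow> i < k \<Longrightarrow> j < k \<Longrightarrow> X (i, j) \<in> carrier A"
  by (auto simp: PiE_def Pi_def)

lemma mats_eqI: "X \<in> mats k \<Longrightarrow> Y \<in> mats k \<Longrightarrow> (\<And>i j. i < k \<Longrightarrow> j < k \<Longrightarrow> emb A (X (i, j)) = emb A (Y (i, j))) \<Longrightarrow> X = Y"
  by (rule PiE_ext[of X "{..<k} \<times> {..<k}" "\<lambda>_. carrier A" Y])
    (auto, metis emb_inj mats_entry)

lemma mv_cols: "X \<in> mats k \<Longrightarrow> v \<in> cols k \<Longrightarrow> mv k X v \<in> cols k"
  unfolding mv_def by (auto intro!: M.finsum_closed simp: Pi_def dest: mats_entry)

lemma emb_mv: "X \<in> mats k \<Longrightarrow> v \<in> cols k \<Longrightarrow> i < k \<Longrightarrow>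
    emb A (mv k X v i) = (\<Sum>j<k. emb A (X (i, j)) * emb A (v j))"
  unfolding mv_def by (subst emb_finsum) (auto simp: mats_entry Pi_def emb_hom intro!: sum.cong)

lemma col_norm_eq: assumes "v \<in> cols k" shows "col_norm k A v = U.cn k (\<lambda>i. emb A (v i))"
proof -
  have "(\<Oplus>\<^bsub>A\<^esub>i\<in>{..<k}. adj A (v i) \<otimes>\<^bsub>A\<^esub> v i) \<in> carrier A"
    using assms by (intro M.finsum_closed) auto
  then have "cnorm A (\<Oplus>\<^bsub>A\<^esub>i\<in>{..<k}. adj A (v i) \<otimes>\<^bsub>A\<^esub> v i)
      = norm (emb A (\<Oplus>\<^bsub>A\<^esub>i\<in>{..<k}. adj A (v i) \<otimes>\<^bsub>A\<^esub> v i))" by simp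
  also have "\<dots> = norm (\<Sum>i<k. emb A (adj A (v i) \<otimes>\<^bsub>A\<^esub> v i))"
    using assms by (subst emb_finsum) auto
  also have "(\<Sum>i<k. emb A (adj A (v i) \<otimes>\<^bsub>A\<^esub> v i)) = (\<Sum>i<k. star (emb A (v i)) * emb A (v i))"
    using assms by (intro sum.cong) (auto simp: emb_hom Pi_def)
  finally show ?thesis unfolding col_norm_def U.cn_def by simp
qed

lemma crn_col: "v \<in> cols k \<Longrightarrow> i < k \<Longrightarrow> U.crn (emb A (v i))"
  by auto

lemma matrix_norm_eq: "matrix_norm k A X = Sup {col_norm k A (mv k X v) | v. v \<in> cols k \<and> col_norm k A v \<le> 1}"
  unfolding matrix_norm_def mv_def by simp

text \<open>A crude bound with two uses: it makes the supremum that defines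
  \<open>matrix_norm\<close> finite, and it bounds that supremum by the entries.\<close>

lemma col_norm_mv_le_entries:
  assumes X: "X \<in> mats k" and v: "v \<in> cols k"
  shows "col_norm k A (mv k X v) \<le> (\<Sum>i<k. \<Sum>j<k. cnorm A (X (i, j))) * col_norm k A v"
proof -
  have "col_norm k A (mv k X v) \<le> (\<Sum>i<k. norm (emb A (mv k X v i)))"
    using col_norm_eq[OF mv_cols[OF X v]] U.cn_le_sum by simp
  also have "\<dots> \<le> (\<Sum>i<k. \<Sum>j<k. cnorm A (X (i, j)) * col_norm k A v)"
  proof (rule sum_mono)
    fix i assume "i \<in> {..<k}"
    then have i: "i < k" by simp
    have "norm (emb A (X (i, j)) * emb A (v j)) \<le> cnorm A (X (i, j)) * col_norm k A v" if "j < k" for j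
    proof -
      have "norm (emb A (v j)) \<le> col_norm k A v"
        unfolding col_norm_eq[OF v] using that v by (intro U.norm_le_cn[of k "\<lambda>i. emb A (v i)"]) auto
      then have "norm (emb A (X (i, j))) * norm (emb A (v j)) \<le> cnorm A (X (i, j)) * col_norm k A v"
        using mats_entry[OF X i that] by (intro mult_mono) (auto simp: cnorm_ge_0)
      then show ?thesis using norm_mult_ineq order_trans by blast
    qed
    then show "norm (emb A (mv k X v i)) \<le> (\<Sum>j<k. cnorm A (X (i, j)) * col_norm k A v)"
      unfolding emb_mv[OF X v i] by (intro sum_norm_le) auto
  qed
  finally show ?thesis by (simp add: sum_distrib_right)
qed

lemma col_norm_ge_0: "v \<in> cols k \<Longrightarrow> 0 \<le> col_norm k A v"
  by (simp add: col_norm_eq U.cn_ge_0)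

lemma col_norm_mv_le_1:
  assumes X: "X \<in> mats k" and v: "v \<in> cols k" "col_norm k A v \<le> 1"
  shows "col_norm k A (mv k X v) \<le> matrix_norm k A X"
  unfolding matrix_norm_eq
proof (rule cSup_upper)
  let ?C = "\<Sum>i<k. \<Sum>j<k. cnorm A (X (i, j))"
  have nn: "0 \<le> ?C" using X by (intro sum_nonneg cnorm_ge_0) (auto intro: mats_entry)
  then have "col_norm k A (mv k X w) \<le> ?C" if "w \<in> cols k" "col_norm k A w \<le> 1" for w
    using col_norm_mv_le_entries[OF X that(1)] mult_left_le[OF that(2) nn] by linarith
  then show "bdd_above {col_norm k A (mv k X v) |v. v \<in> cols k \<and> col_norm k A v \<le> 1}"
    by (intro bdd_aboveI[of _ ?C]) auto
qed (use v in auto)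

lemma zero_col: "(\<lambda>_. \<zero>\<^bsub>A\<^esub>) \<in> cols k" "col_norm k A (\<lambda>_. \<zero>\<^bsub>A\<^esub>) = 0"
proof -
  show "(\<lambda>_. \<zero>\<^bsub>A\<^esub>) \<in> cols k" by auto
  then show "col_norm k A (\<lambda>_. \<zero>\<^bsub>A\<^esub>) = 0"
    by (simp add: col_norm_eq U.cn_def emb_hom(1)[OF M.zero_closed])
qed

lemma matrix_norm_leI:
  assumes "\<And>v. v \<in> cols k \<Longrightarrow> col_norm k A v \<le> 1 \<Longrightarrow> col_norm k A (mv k X v) \<le> B"
  shows "matrix_norm k A X \<le> B"
  unfolding matrix_norm_eq
proof (rule cSup_least)
  have "col_norm k A (mv k X (\<lambda>_. \<zero>\<^bsub>A\<^esub>)) \<in> {col_norm k A (mv k X v) | v. v \<in> cols k \<and> col_norm k A v \<le> 1}"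
    using zero_col[of k] by (intro CollectI exI[of _ "\<lambda>_. \<zero>\<^bsub>A\<^esub>"]) simp
  then show "{col_norm k A (mv k X v) | v. v \<in> cols k \<and> col_norm k A v \<le> 1} \<noteq> {}" by blast
next
  fix x assume "x \<in> {col_norm k A (mv k X v) | v. v \<in> cols k \<and> col_norm k A v \<le> 1}"
  then obtain v where "v \<in> cols k" "col_norm k A v \<le> 1" "x = col_norm k A (mv k X v)" by blast
  then show "x \<le> B" using assms[of v] by simp
qed

lemma matrix_norm_ge_0: "X \<in> mats k \<Longrightarrow> 0 \<le> matrix_norm k A X"
  by (rule order_trans[OF col_norm_ge_0[OF mv_cols] col_norm_mv_le_1[of X k "\<lambda>_. \<zero>\<^bsub>A\<^esub>"]])
    (simp_all add: zero_col)

lemma col_norm_smult: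
  "v \<in> cols k \<Longrightarrow> col_norm k A (\<lambda>i. c \<odot>\<^bsub>A\<^esub> v i) = cmod c * col_norm k A v"
proof -
  assume v: "v \<in> cols k"
  then have "(\<lambda>i. c \<odot>\<^bsub>A\<^esub> v i) \<in> cols k" by auto
  then have "col_norm k A (\<lambda>i. c \<odot>\<^bsub>A\<^esub> v i) = U.cn k (\<lambda>i. emb A (c \<odot>\<^bsub>A\<^esub> v i))" by (rule col_norm_eq)
  also have "\<dots> = U.cn k (\<lambda>i. c *\<^sub>C emb A (v i))"
    using v by (intro U.cn_cong) (auto simp: emb_hom Pi_def)
  finally show ?thesis using v by (simp add: U.cn_scaleC col_norm_eq)
qed

lemma mv_smult:
  assumes X: "X \<in> mats k" and v: "v \<in> cols k" and i: "i < k"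
  shows "mv k X (\<lambda>i. c \<odot>\<^bsub>A\<^esub> v i) i = c \<odot>\<^bsub>A\<^esub> mv k X v i"
proof -
  have cv: "(\<lambda>i. c \<odot>\<^bsub>A\<^esub> v i) \<in> cols k" using v by auto
  have m: "mv k X v i \<in> carrier A" "mv k X (\<lambda>i. c \<odot>\<^bsub>A\<^esub> v i) i \<in> carrier A"
    using mv_cols[OF X v] mv_cols[OF X cv] i by auto
  have "emb A (mv k X (\<lambda>i. c \<odot>\<^bsub>A\<^esub> v i) i) = emb A (c \<odot>\<^bsub>A\<^esub> mv k X v i)"
    using emb_mv[OF X v i] emb_mv[OF X cv i] m v
    by (simp add: emb_hom scaleC_sum_right) (auto simp: emb_hom Pi_def intro!: sum.cong)
  then show ?thesis using m emb_inj smult_cl by blast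
qed

lemma col_norm_cong: "(\<And>i. i < k \<Longrightarrow> v i = w i) \<Longrightarrow> v \<in> cols k \<Longrightarrow> col_norm k A v = col_norm k A w"
proof -
  assume *: "\<And>i. i < k \<Longrightarrow> v i = w i" "v \<in> cols k"
  then have w: "w \<in> cols k" by (auto simp: Pi_def)
  show ?thesis unfolding col_norm_eq[OF *(2)] col_norm_eq[OF w] using * by (intro U.cn_cong) simp
qed

lemma col_norm_mv_le:
  assumes X: "X \<in> mats k" and v: "v \<in> cols k"
  shows "col_norm k A (mv k X v) \<le> matrix_norm k A X * col_norm k A v"
proof (cases "col_norm k A v = 0")
  case True
  then show ?thesis using col_norm_mv_le_entries[OF X v] by simp
next
  case False
  then have p: "col_norm k A v > 0" using col_norm_ge_0[OF v] by simp
  define c where "c = complex_of_real (inverse (col_norm k A v))"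
  have c: "cmod c = inverse (col_norm k A v)" unfolding c_def using p by (simp only: norm_of_real) simp
  have cv: "(\<lambda>i. c \<odot>\<^bsub>A\<^esub> v i) \<in> cols k" using v by auto
  have "col_norm k A (\<lambda>i. c \<odot>\<^bsub>A\<^esub> v i) \<le> 1" using p c by (simp add: col_norm_smult[OF v])
  then have "col_norm k A (mv k X (\<lambda>i. c \<odot>\<^bsub>A\<^esub> v i)) \<le> matrix_norm k A X"
    by (rule col_norm_mv_le_1[OF X cv])
  also have "col_norm k A (mv k X (\<lambda>i. c \<odot>\<^bsub>A\<^esub> v i)) = col_norm k A (\<lambda>i. c \<odot>\<^bsub>A\<^esub> mv k X v i)"
    by (rule col_norm_cong[OF mv_smult[OF X v] mv_cols[OF X cv]])
  also have "\<dots> = inverse (col_norm k A v) * col_norm k A (mv k X v)"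
    using col_norm_smult[OF mv_cols[OF X v]] c by simp
  finally show ?thesis using p by (simp add: field_simps)
qed

text \<open>The matrix is applied to the \<open>j\<close>-th standard column, whose norm is at most
  1, and entry \<open>i\<close> of the result is read off.\<close>

lemma cnorm_le_matrix_norm:
  assumes X: "X \<in> mats k" and ij: "i < k" "j < k"
  shows "cnorm A (X (i, j)) \<le> matrix_norm k A X"
proof -
  define v where "v = (\<lambda>l. if l = j then \<one>\<^bsub>A\<^esub> else \<zero>\<^bsub>A\<^esub>)"
  have v: "v \<in> cols k" unfolding v_def by auto
  have ve: "emb A (v l) = (if l = j then emb A \<one>\<^bsub>A\<^esub> else 0)" for l
    by (simp add: v_def emb_hom(1)[OF M.zero_closed])
  have "(\<Sum>l<k. star (emb A (v l)) * emb A (v l)) = emb A \<one>\<^bsub>A\<^esub>"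
    unfolding ve using ij by (simp add: if_distrib[of star] if_distrib[of "\<lambda>x. x * _"] sum.delta cong: if_cong)
  then have 1: "col_norm k A v \<le> 1" unfolding col_norm_eq[OF v] U.cn_def using U.norm_e_le by simp
  have "emb A (mv k X v i) = emb A (X (i, j)) * emb A \<one>\<^bsub>A\<^esub>"
    unfolding emb_mv[OF X v ij(1)] ve using ij by (simp add: if_distrib[of "\<lambda>x. _ * x"] sum.delta cong: if_cong)
  also have "\<dots> = emb A (X (i, j))" using mats_entry[OF X ij] by (simp flip: emb_hom)
  finally have "cnorm A (X (i, j)) = norm (emb A (mv k X v i))" using mats_entry[OF X ij] by simp
  also have "\<dots> \<le> col_norm k A (mv k X v)"
    unfolding col_norm_eq[OF mv_cols[OF X v]] using crn_col[OF mv_cols[OF X v]] ij(1)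
    by (rule U.norm_le_cn[of k "\<lambda>i. emb A (mv k X v i)"])
  also have "\<dots> \<le> matrix_norm k A X" by (rule col_norm_mv_le_1[OF X v 1])
  finally show ?thesis .
qed

lemma matrix_norm_le_entries:
  assumes X: "X \<in> mats k" shows "matrix_norm k A X \<le> (\<Sum>i<k. \<Sum>j<k. cnorm A (X (i, j)))"
proof (rule matrix_norm_leI)
  fix v assume v: "v \<in> cols k" "col_norm k A v \<le> 1"
  have nn: "0 \<le> (\<Sum>i<k. \<Sum>j<k. cnorm A (X (i, j)))"
    using X by (intro sum_nonneg cnorm_ge_0) (auto intro: mats_entry)
  then show "col_norm k A (mv k X v) \<le> (\<Sum>i<k. \<Sum>j<k. cnorm A (X (i, j)))"
    using col_norm_mv_le_entries[OF X v(1)] mult_left_le[OF v(2) nn] by linarith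
qed

lemma matrix_alg_simps [simp]:
  "carrier (matrix_alg k A) = mats k"
  "X \<otimes>\<^bsub>matrix_alg k A\<^esub> Y = (\<lambda>(i, j)\<in>{..<k} \<times> {..<k}. \<Oplus>\<^bsub>A\<^esub>l\<in>{..<k}. X (i, l) \<otimes>\<^bsub>A\<^esub> Y (l, j))"
  "\<one>\<^bsub>matrix_alg k A\<^esub> = (\<lambda>(i, j)\<in>{..<k} \<times> {..<k}. if i = j then \<one>\<^bsub>A\<^esub> else \<zero>\<^bsub>A\<^esub>)"
  "\<zero>\<^bsub>matrix_alg k A\<^esub> = (\<lambda>ij\<in>{..<k} \<times> {..<k}. \<zero>\<^bsub>A\<^esub>)"
  "X \<oplus>\<^bsub>matrix_alg k A\<^esub> Y = (\<lambda>ij\<in>{..<k} \<times> {..<k}. X ij \<oplus>\<^bsub>A\<^esub> Y ij)"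
  "c \<odot>\<^bsub>matrix_alg k A\<^esub> X = (\<lambda>ij\<in>{..<k} \<times> {..<k}. c \<odot>\<^bsub>A\<^esub> X ij)"
  "adj (matrix_alg k A) X = (\<lambda>(i, j)\<in>{..<k} \<times> {..<k}. adj A (X (j, i)))"
  "cnorm (matrix_alg k A) X = matrix_norm k A X"
  by (simp_all add: matrix_alg_def)

abbreviation "Mat \<equiv> matrix_alg"

lemma mat_closed:
  "X \<in> mats k \<Longrightarrow> Y \<in> mats k \<Longrightarrow> X \<otimes>\<^bsub>Mat k A\<^esub> Y \<in> mats k"
  "X \<in> mats k \<Longrightarrow> Y \<in> mats k \<Longrightarrow> X \<oplus>\<^bsub>Mat k A\<^esub> Y \<in> mats k"
  "X \<in> mats k \<Longrightarrow> c \<odot>\<^bsub>Mat k A\<^esub> X \<in> mats k"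
  "X \<in> mats k \<Longrightarrow> adj (Mat k A) X \<in> mats k" "\<zero>\<^bsub>Mat k A\<^esub> \<in> mats k" "\<one>\<^bsub>Mat k A\<^esub> \<in> mats k"
  by (auto simp: mats_entry intro!: M.finsum_closed)

lemma emb_mat:
  assumes "i < k" "j < k"
  shows "X \<in> mats k \<Longrightarrow> Y \<in> mats k \<Longrightarrow>
      emb A ((X \<otimes>\<^bsub>Mat k A\<^esub> Y) (i, j)) = (\<Sum>l<k. emb A (X (i, l)) * emb A (Y (l, j)))"
    "X \<in> mats k \<Longrightarrow> Y \<in> mats k \<Longrightarrow>
      emb A ((X \<oplus>\<^bsub>Mat k A\<^esub> Y) (i, j)) = emb A (X (i, j)) + emb A (Y (i, j))"
    "X \<in> mats k \<Longrightarrow> emb A ((c \<odot>\<^bsub>Mat k A\<^esub> X) (i, j)) = c *\<^sub>C emb A (X (i, j))"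
    "X \<in> mats k \<Longrightarrow> emb A (adj (Mat k A) X (i, j)) = star (emb A (X (j, i)))"
    "emb A (\<zero>\<^bsub>Mat k A\<^esub> (i, j)) = 0"
    "emb A (\<one>\<^bsub>Mat k A\<^esub> (i, j)) = (if i = j then emb A \<one>\<^bsub>A\<^esub> else 0)"
proof -
  assume X: "X \<in> mats k"
  {
    assume Y: "Y \<in> mats k"
    have "emb A ((X \<otimes>\<^bsub>Mat k A\<^esub> Y) (i, j)) = (\<Sum>l<k. emb A (X (i, l) \<otimes>\<^bsub>A\<^esub> Y (l, j)))"
      using assms X Y by (simp, subst emb_finsum, auto simp: mats_entry)
    also have "\<dots> = (\<Sum>l<k. emb A (X (i, l)) * emb A (Y (l, j)))"
      using assms X Y by (intro sum.cong refl) (simp add: emb_hom(4) mats_entry)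
    finally show "emb A ((X \<otimes>\<^bsub>Mat k A\<^esub> Y) (i, j)) = (\<Sum>l<k. emb A (X (i, l)) * emb A (Y (l, j)))" .
    show "emb A ((X \<oplus>\<^bsub>Mat k A\<^esub> Y) (i, j)) = emb A (X (i, j)) + emb A (Y (i, j))"
      using assms X Y by (simp add: emb_hom(2) mats_entry)
  }
  show "emb A ((c \<odot>\<^bsub>Mat k A\<^esub> X) (i, j)) = c *\<^sub>C emb A (X (i, j))"
    "emb A (adj (Mat k A) X (i, j)) = star (emb A (X (j, i)))"
    using assms X by (simp_all add: emb_hom(5,6) mats_entry)
qed (use assms in \<open>simp_all add: emb_hom(1)[OF M.zero_closed]\<close>)

lemma star_algebra_matrix: "star_algebra (Mat k A)"
proof -
  note [simp del] = matrix_alg_simps(2-7)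
  note cl = mat_closed
  have add: "abelian_group (Mat k A)"
  proof (rule abelian_groupI)
    fix X assume X: "X \<in> carrier (Mat k A)"
    have "(-1) \<odot>\<^bsub>Mat k A\<^esub> X \<oplus>\<^bsub>Mat k A\<^esub> X = \<zero>\<^bsub>Mat k A\<^esub>"
      using X by (intro mats_eqI[of _ k]) (simp_all add: cl emb_mat)
    then show "\<exists>Y\<in>carrier (Mat k A). Y \<oplus>\<^bsub>Mat k A\<^esub> X = \<zero>\<^bsub>Mat k A\<^esub>" using X cl(3) by (metis matrix_alg_simps(1))
  qed (simp_all add: cl, (rule mats_eqI[of _ k]; simp add: cl emb_mat algebra_simps)+)
  have md: "module complex_alg (Mat k A)"
    by (intro moduleI cring_complex_alg add)
      (simp_all add: cl, (rule mats_eqI[of _ k]; simp add: cl emb_mat scaleC_add_left scaleC_add_right)+)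
  show ?thesis
  proof (intro star_algebra.intro md star_algebra_axioms.intro)
    fix X Y Z assume XYZ: "X \<in> carrier (Mat k A)" "Y \<in> carrier (Mat k A)" "Z \<in> carrier (Mat k A)"
    show "(X \<otimes>\<^bsub>Mat k A\<^esub> Y) \<otimes>\<^bsub>Mat k A\<^esub> Z = X \<otimes>\<^bsub>Mat k A\<^esub> (Y \<otimes>\<^bsub>Mat k A\<^esub> Z)"
    proof (rule mats_eqI[of _ k])
      fix i j assume ij: "i < k" "j < k"
      have "emb A (((X \<otimes>\<^bsub>Mat k A\<^esub> Y) \<otimes>\<^bsub>Mat k A\<^esub> Z) (i, j))
          = (\<Sum>l<k. \<Sum>m<k. emb A (X (i, m)) * emb A (Y (m, l)) * emb A (Z (l, j)))"
        using ij XYZ by (simp add: emb_mat cl sum_distrib_right)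
      also have "\<dots> = (\<Sum>m<k. \<Sum>l<k. emb A (X (i, m)) * emb A (Y (m, l)) * emb A (Z (l, j)))"
        by (rule sum.swap)
      also have "\<dots> = emb A ((X \<otimes>\<^bsub>Mat k A\<^esub> (Y \<otimes>\<^bsub>Mat k A\<^esub> Z)) (i, j))"
        using ij XYZ by (simp add: emb_mat cl sum_distrib_left mult.assoc)
      finally show "emb A (((X \<otimes>\<^bsub>Mat k A\<^esub> Y) \<otimes>\<^bsub>Mat k A\<^esub> Z) (i, j))
          = emb A ((X \<otimes>\<^bsub>Mat k A\<^esub> (Y \<otimes>\<^bsub>Mat k A\<^esub> Z)) (i, j))" .
    qed (use XYZ cl in auto)
  qed (simp_all add: cl, (rule mats_eqI[of _ k]; simp add: cl emb_mat sum.distrib ring_distribs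
      scaleC_sum_right star_add star_sum star_mult)+)
qed

text \<open>The inner product of \<open>X v\<close> with itself equals that of \<open>v\<close> with
  \<open>adj X * X * v\<close>, and Cauchy-Schwarz bounds the latter.\<close>

lemma col_norm_adjoint:
  assumes X: "X \<in> mats k" and v: "v \<in> cols k"
  shows "(col_norm k A (mv k X v))\<^sup>2 \<le> col_norm k A v * col_norm k A (mv k (adj (Mat k A) X \<otimes>\<^bsub>Mat k A\<^esub> X) v)"
proof -
  note [simp del] = matrix_alg_simps(2-7)
  note cl = mat_closed
  let ?Y = "adj (Mat k A) X \<otimes>\<^bsub>Mat k A\<^esub> X"
  have Y: "?Y \<in> mats k" using X cl by auto
  define x where "x i j = emb A (X (i, j))" for i j
  define w where "w i = emb A (v i)" for i
  have "(\<Sum>i<k. star (emb A (mv k X v i)) * emb A (mv k X v i))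
      = (\<Sum>i<k. \<Sum>l<k. \<Sum>j<k. star (w l) * star (x i l) * (x i j * w j))"
    using X v by (intro sum.cong refl)
      (simp add: emb_mv star_sum star_mult sum_product x_def w_def)
  also have "\<dots> = (\<Sum>l<k. \<Sum>i<k. \<Sum>j<k. star (w l) * star (x i l) * (x i j * w j))" by (rule sum.swap)
  also have "\<dots> = (\<Sum>l<k. \<Sum>j<k. \<Sum>i<k. star (w l) * star (x i l) * (x i j * w j))"
    by (intro sum.cong refl sum.swap)
  also have "\<dots> = (\<Sum>l<k. star (emb A (v l)) * emb A (mv k ?Y v l))"
    using X Y v by (intro sum.cong refl)
      (simp add: emb_mv emb_mat cl sum_distrib_left sum_distrib_right mult.assoc x_def w_def)
  finally have "(col_norm k A (mv k X v))\<^sup>2 = norm (\<Sum>l<k. star (emb A (v l)) * emb A (mv k ?Y v l))"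
    unfolding col_norm_eq[OF mv_cols[OF X v]] U.cn_square by simp
  also have "\<dots> \<le> col_norm k A v * col_norm k A (mv k ?Y v)"
    unfolding col_norm_eq[OF v] col_norm_eq[OF mv_cols[OF Y v]]
    using crn_col[OF v] crn_col[OF mv_cols[OF Y v]] by (rule U.cn_cauchy_schwarz)
  finally show ?thesis .
qed

text \<open>Cauchy-Schwarz enters through \<open>(norm X)^2 \<le> norm (adj X * X)\<close>. With
  submultiplicativity this gives \<open>norm X \<le> norm (adj X)\<close>, hence equality of these
  two norms, and then submultiplicativity is the opposite half of the C*-identity. Homogeneity
  combines the inequality for \<open>c\<close> with that for \<open>inverse c\<close>.\<close>

lemma matrix_seminorm: "cstar_seminorm (Mat k A) (cnorm (Mat k A))"
proof -
  note [simp del] = matrix_alg_simps(2-7)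
  note cl = mat_closed
  have ge: "0 \<le> matrix_norm k A X" if "X \<in> mats k" for X using matrix_norm_ge_0[OF that] .
  have tri: "matrix_norm k A (X \<oplus>\<^bsub>Mat k A\<^esub> Y) \<le> matrix_norm k A X + matrix_norm k A Y"
    if X: "X \<in> mats k" and Y: "Y \<in> mats k" for X Y
  proof (rule matrix_norm_leI)
    fix v assume v: "v \<in> cols k" "col_norm k A v \<le> 1"
    have XY: "X \<oplus>\<^bsub>Mat k A\<^esub> Y \<in> mats k" using cl X Y by auto
    have "col_norm k A (mv k (X \<oplus>\<^bsub>Mat k A\<^esub> Y) v) = U.cn k (\<lambda>i. emb A (mv k X v i) + emb A (mv k Y v i))"
      unfolding col_norm_eq[OF mv_cols[OF XY v(1)]] using X Y XY v
      by (intro U.cn_cong) (simp add: emb_mv emb_mat ring_distribs sum.distrib)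
    also have "\<dots> \<le> col_norm k A (mv k X v) + col_norm k A (mv k Y v)"
      unfolding col_norm_eq[OF mv_cols[OF X v(1)]] col_norm_eq[OF mv_cols[OF Y v(1)]]
      using crn_col[OF mv_cols[OF X v(1)]] crn_col[OF mv_cols[OF Y v(1)]] by (rule U.cn_triangle)
    also have "\<dots> \<le> matrix_norm k A X + matrix_norm k A Y" by (intro add_mono col_norm_mv_le_1 X Y v)
    finally show "col_norm k A (mv k (X \<oplus>\<^bsub>Mat k A\<^esub> Y) v) \<le> matrix_norm k A X + matrix_norm k A Y" .
  qed
  have sm: "matrix_norm k A (c \<odot>\<^bsub>Mat k A\<^esub> X) \<le> cmod c * matrix_norm k A X"
    if X: "X \<in> mats k" for X c
  proof (rule matrix_norm_leI)
    fix v assume v: "v \<in> cols k" "col_norm k A v \<le> 1"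
    have cX: "c \<odot>\<^bsub>Mat k A\<^esub> X \<in> mats k" using cl X by auto
    have "col_norm k A (mv k (c \<odot>\<^bsub>Mat k A\<^esub> X) v) = U.cn k (\<lambda>i. c *\<^sub>C emb A (mv k X v i))"
      unfolding col_norm_eq[OF mv_cols[OF cX v(1)]] using X cX v
      by (intro U.cn_cong) (simp add: emb_mv emb_mat scaleC_sum_right)
    also have "\<dots> = cmod c * col_norm k A (mv k X v)"
      unfolding col_norm_eq[OF mv_cols[OF X v(1)]] by (rule U.cn_scaleC)
    also have "\<dots> \<le> cmod c * matrix_norm k A X" by (intro mult_left_mono col_norm_mv_le_1 X v) auto
    finally show "col_norm k A (mv k (c \<odot>\<^bsub>Mat k A\<^esub> X) v) \<le> cmod c * matrix_norm k A X" .
  qed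
  have sme: "matrix_norm k A (c \<odot>\<^bsub>Mat k A\<^esub> X) = cmod c * matrix_norm k A X"
    if X: "X \<in> mats k" for X c
  proof (cases "c = 0")
    case True
    then show ?thesis using sm[OF X, of c] ge[OF cl(3)[OF X]] by (metis mult_zero_left norm_zero order_antisym)
  next
    case False
    have "inverse c \<odot>\<^bsub>Mat k A\<^esub> (c \<odot>\<^bsub>Mat k A\<^esub> X) = X"
      using X False by (intro mats_eqI[of _ k]) (auto simp: cl emb_mat)
    then have "matrix_norm k A X \<le> inverse (cmod c) * matrix_norm k A (c \<odot>\<^bsub>Mat k A\<^esub> X)"
      using sm[OF cl(3)[OF X], of "inverse c" c] by (simp add: norm_inverse)
    then have "cmod c * matrix_norm k A X \<le> matrix_norm k A (c \<odot>\<^bsub>Mat k A\<^esub> X)" using False by (simp add: field_simps)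
    then show ?thesis using sm[OF X, of c] by simp
  qed
  have mult: "matrix_norm k A (X \<otimes>\<^bsub>Mat k A\<^esub> Y) \<le> matrix_norm k A X * matrix_norm k A Y"
    if X: "X \<in> mats k" and Y: "Y \<in> mats k" for X Y
  proof (rule matrix_norm_leI)
    fix v assume v: "v \<in> cols k" "col_norm k A v \<le> 1"
    have XY: "X \<otimes>\<^bsub>Mat k A\<^esub> Y \<in> mats k" using cl X Y by auto
    have Yv: "mv k Y v \<in> cols k" using mv_cols[OF Y v(1)] .
    have "emb A (mv k (X \<otimes>\<^bsub>Mat k A\<^esub> Y) v i) = emb A (mv k X (mv k Y v) i)" if i: "i < k" for i
    proof -
      have "emb A (mv k (X \<otimes>\<^bsub>Mat k A\<^esub> Y) v i)
          = (\<Sum>j<k. \<Sum>l<k. emb A (X (i, l)) * emb A (Y (l, j)) * emb A (v j))"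
        using i X Y XY v by (simp add: emb_mv emb_mat sum_distrib_right)
      also have "\<dots> = (\<Sum>l<k. \<Sum>j<k. emb A (X (i, l)) * emb A (Y (l, j)) * emb A (v j))" by (rule sum.swap)
      also have "\<dots> = emb A (mv k X (mv k Y v) i)"
        using i X Y Yv v by (simp add: emb_mv sum_distrib_left mult.assoc)
      finally show ?thesis .
    qed
    then have "col_norm k A (mv k (X \<otimes>\<^bsub>Mat k A\<^esub> Y) v) = col_norm k A (mv k X (mv k Y v))"
      unfolding col_norm_eq[OF mv_cols[OF XY v(1)]] col_norm_eq[OF mv_cols[OF X Yv]] by (intro U.cn_cong)
    also have "\<dots> \<le> matrix_norm k A X * col_norm k A (mv k Y v)" by (rule col_norm_mv_le[OF X Yv])
    also have "\<dots> \<le> matrix_norm k A X * matrix_norm k A Y"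
      by (intro mult_left_mono col_norm_mv_le_1 ge X Y v)
    finally show "col_norm k A (mv k (X \<otimes>\<^bsub>Mat k A\<^esub> Y) v) \<le> matrix_norm k A X * matrix_norm k A Y" .
  qed
  have sq: "(matrix_norm k A X)\<^sup>2 \<le> matrix_norm k A (adj (Mat k A) X \<otimes>\<^bsub>Mat k A\<^esub> X)"
    if X: "X \<in> mats k" for X
  proof -
    let ?Y = "adj (Mat k A) X \<otimes>\<^bsub>Mat k A\<^esub> X"
    have Y: "?Y \<in> mats k" using cl X by auto
    have "matrix_norm k A X \<le> sqrt (matrix_norm k A ?Y)"
    proof (rule matrix_norm_leI)
      fix v assume v: "v \<in> cols k" "col_norm k A v \<le> 1"
      have "(col_norm k A (mv k X v))\<^sup>2 \<le> col_norm k A v * col_norm k A (mv k ?Y v)"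
        by (rule col_norm_adjoint[OF X v(1)])
      also have "\<dots> \<le> 1 * matrix_norm k A ?Y"
        using v Y by (intro mult_mono col_norm_mv_le_1 col_norm_ge_0 mv_cols) auto
      finally show "col_norm k A (mv k X v) \<le> sqrt (matrix_norm k A ?Y)" by (intro real_le_rsqrt) simp
    qed
    then show ?thesis by (metis ge[OF X] ge[OF Y] power_mono real_sqrt_pow2)
  qed
  have le_adj: "matrix_norm k A X \<le> matrix_norm k A (adj (Mat k A) X)" if X: "X \<in> mats k" for X
  proof (cases "matrix_norm k A X = 0")
    case True
    then show ?thesis using ge[OF cl(4)[OF X]] by simp
  next
    case False
    have "matrix_norm k A X * matrix_norm k A X \<le> matrix_norm k A (adj (Mat k A) X) * matrix_norm k A X"
      using sq[OF X] mult[OF cl(4)[OF X] X] by (simp add: power2_eq_square)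
    then show ?thesis using False ge[OF X] by (simp add: mult_le_cancel_right)
  qed
  have adjadj: "adj (Mat k A) (adj (Mat k A) X) = X" if X: "X \<in> mats k" for X
    using star_algebra.adj_adj[OF star_algebra_matrix, of X k] X by simp
  have cs: "matrix_norm k A (adj (Mat k A) X \<otimes>\<^bsub>Mat k A\<^esub> X) = (matrix_norm k A X)\<^sup>2" if X: "X \<in> mats k" for X
  proof (rule antisym[OF _ sq[OF X]])
    have "matrix_norm k A (adj (Mat k A) X) \<le> matrix_norm k A X"
      using le_adj[OF cl(4)[OF X]] adjadj[OF X] by simp
    then have "matrix_norm k A (adj (Mat k A) X) * matrix_norm k A X \<le> matrix_norm k A X * matrix_norm k A X"
      by (intro mult_right_mono ge X)
    then show "matrix_norm k A (adj (Mat k A) X \<otimes>\<^bsub>Mat k A\<^esub> X) \<le> (matrix_norm k A X)\<^sup>2"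
      using mult[OF cl(4)[OF X] X] by (simp add: power2_eq_square)
  qed
  show ?thesis unfolding cstar_seminorm_def using ge tri sme mult cs by simp
qed

text \<open>Each entry is bounded by the matrix norm, and the matrix norm by the sum of the entry
  norms; so definiteness and completeness are inherited entry by entry.\<close>

theorem unital_cstar_matrix: "unital_cstar (Mat k A)"
proof -
  note [simp del] = matrix_alg_simps(2-7)
  note cl = mat_closed
  interpret MA: star_algebra "Mat k A" by (rule star_algebra_matrix)
  have minus_entry: "(X \<ominus>\<^bsub>Mat k A\<^esub> Y) (i, j) = X (i, j) \<ominus>\<^bsub>A\<^esub> Y (i, j)"
    if "X \<in> mats k" "Y \<in> mats k" "i < k" "j < k" for X Y i j
    using that MA.minus_eq_smult[of X Y] by (simp add: minus_eq_smult mats_entry matrix_alg_simps)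
  have minus_cl: "X \<ominus>\<^bsub>Mat k A\<^esub> Y \<in> mats k" if "X \<in> mats k" "Y \<in> mats k" for X Y
    using MA.M.minus_closed[of X Y] that by simp
  show ?thesis
  proof (intro unital_cstar.intro unital_cstar_axioms.intro cstar_algebra.intro cstar_algebra_axioms.intro
      star_algebra_matrix matrix_seminorm)
    fix X assume X: "X \<in> carrier (Mat k A)" and 0: "cnorm (Mat k A) X = 0"
    have "X (i, j) = \<zero>\<^bsub>A\<^esub>" if ij: "i < k" "j < k" for i j
    proof (rule definite)
      show "X (i, j) \<in> carrier A" using X ij by (auto intro: mats_entry)
      then show "cnorm A (X (i, j)) = 0"
        using cnorm_le_matrix_norm[of X k i j] X 0 ij cnorm_ge_0[of "X (i, j)"] by simp
    qed
    then show "X = \<zero>\<^bsub>Mat k A\<^esub>" using X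
      by (intro mats_eqI[of _ k]) (auto simp: cl emb_mat emb_hom(1)[OF M.zero_closed])
  next
    fix s assume s: "cauchy_in (Mat k A) (cnorm (Mat k A)) s"
    have sm: "s n \<in> mats k" for n using s unfolding cauchy_in_def by auto
    have "\<exists>x\<in>carrier A. (\<lambda>n. cnorm A (s n (i, j) \<ominus>\<^bsub>A\<^esub> x)) \<longlonglongrightarrow> 0" if ij: "i < k" "j < k" for i j
    proof (rule complete)
      show "cauchy_in A (cnorm A) (\<lambda>n. s n (i, j))" unfolding cauchy_in_def
      proof (intro conjI allI impI)
        show "range (\<lambda>n. s n (i, j)) \<subseteq> carrier A" using sm ij mats_entry by blast
        fix r :: real assume "r > 0"
        then obtain K where K: "\<forall>m\<ge>K. \<forall>n\<ge>K. cnorm (Mat k A) (s m \<ominus>\<^bsub>Mat k A\<^esub> s n) < r"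
          using s unfolding cauchy_in_def by blast
        have "cnorm A (s m (i, j) \<ominus>\<^bsub>A\<^esub> s n (i, j)) \<le> cnorm (Mat k A) (s m \<ominus>\<^bsub>Mat k A\<^esub> s n)" for m n
          using cnorm_le_matrix_norm[OF minus_cl[OF sm sm] ij, of m n] minus_entry[OF sm sm ij] by simp
        then show "\<exists>K. \<forall>m\<ge>K. \<forall>n\<ge>K. cnorm A (s m (i, j) \<ominus>\<^bsub>A\<^esub> s n (i, j)) < r"
          using K by (meson le_less_trans)
      qed
    qed
    then obtain L where L: "\<And>i j. i < k \<Longrightarrow> j < k \<Longrightarrow> L i j \<in> carrier A"
      "\<And>i j. i < k \<Longrightarrow> j < k \<Longrightarrow> (\<lambda>n. cnorm A (s n (i, j) \<ominus>\<^bsub>A\<^esub> L i j)) \<longlonglongrightarrow> 0"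
      by metis
    define X where "X = (\<lambda>(i, j)\<in>{..<k} \<times> {..<k}. L i j)"
    have X: "X \<in> mats k" unfolding X_def using L by auto
    have Xe: "X (i, j) = L i j" if "i < k" "j < k" for i j unfolding X_def using that by simp
    have "(\<lambda>n. \<Sum>i<k. \<Sum>j<k. cnorm A (s n (i, j) \<ominus>\<^bsub>A\<^esub> L i j)) \<longlonglongrightarrow> (\<Sum>i<k. \<Sum>j<k. 0)"
      using L(2) by (intro tendsto_sum) auto
    then have lim: "(\<lambda>n. \<Sum>i<k. \<Sum>j<k. cnorm A (s n (i, j) \<ominus>\<^bsub>A\<^esub> L i j)) \<longlonglongrightarrow> 0" by simp
    have "(\<lambda>n. cnorm (Mat k A) (s n \<ominus>\<^bsub>Mat k A\<^esub> X)) \<longlonglongrightarrow> 0"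
    proof (rule tendsto_sandwich[OF _ _ tendsto_const lim])
      show "\<forall>\<^sub>F n in sequentially. 0 \<le> cnorm (Mat k A) (s n \<ominus>\<^bsub>Mat k A\<^esub> X)"
        using matrix_norm_ge_0[OF minus_cl[OF sm X]] by simp
      have "cnorm (Mat k A) (s n \<ominus>\<^bsub>Mat k A\<^esub> X) \<le> (\<Sum>i<k. \<Sum>j<k. cnorm A (s n (i, j) \<ominus>\<^bsub>A\<^esub> L i j))" for n
      proof -
        have "cnorm (Mat k A) (s n \<ominus>\<^bsub>Mat k A\<^esub> X) \<le> (\<Sum>i<k. \<Sum>j<k. cnorm A ((s n \<ominus>\<^bsub>Mat k A\<^esub> X) (i, j)))"
          using matrix_norm_le_entries[OF minus_cl[OF sm X]] by simp
        also have "\<dots> = (\<Sum>i<k. \<Sum>j<k. cnorm A (s n (i, j) \<ominus>\<^bsub>A\<^esub> L i j))"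
          by (intro sum.cong refl) (simp add: minus_entry[OF sm X] Xe)
        finally show ?thesis .
      qed
      then show "\<forall>\<^sub>F n in sequentially. cnorm (Mat k A) (s n \<ominus>\<^bsub>Mat k A\<^esub> X)
          \<le> (\<Sum>i<k. \<Sum>j<k. cnorm A (s n (i, j) \<ominus>\<^bsub>A\<^esub> L i j))" by simp
    qed
    then show "\<exists>x\<in>carrier (Mat k A). (\<lambda>n. cnorm (Mat k A) (s n \<ominus>\<^bsub>Mat k A\<^esub> x)) \<longlonglongrightarrow> 0"
      using X by auto
  next
    fix X assume X: "X \<in> carrier (Mat k A)"
    have e: "emb A \<one>\<^bsub>A\<^esub> * emb A (X (i, j)) = emb A (X (i, j))" "emb A (X (i, j)) * emb A \<one>\<^bsub>A\<^esub> = emb A (X (i, j))"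
      if "i < k" "j < k" for i j
      using that X by (simp_all add: mats_entry flip: emb_hom)
    have s: "(\<Sum>l<k. (if i = l then emb A \<one>\<^bsub>A\<^esub> else 0) * emb A (X (l, j))) = emb A (X (i, j))"
      "(\<Sum>l<k. emb A (X (i, l)) * (if l = j then emb A \<one>\<^bsub>A\<^esub> else 0)) = emb A (X (i, j))"
      if ij: "i < k" "j < k" for i j
    proof -
      have "(\<Sum>l<k. (if i = l then emb A \<one>\<^bsub>A\<^esub> else 0) * emb A (X (l, j)))
          = (\<Sum>l<k. if l = i then emb A (X (i, j)) else 0)"
        using e ij by (intro sum.cong) auto
      then show "(\<Sum>l<k. (if i = l then emb A \<one>\<^bsub>A\<^esub> else 0) * emb A (X (l, j))) = emb A (X (i, j))"
        using ij by simp
      have "(\<Sum>l<k. emb A (X (i, l)) * (if l = j then emb A \<one>\<^bsub>A\<^esub> else 0))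
          = (\<Sum>l<k. if l = j then emb A (X (i, j)) else 0)"
        using e ij by (intro sum.cong) auto
      then show "(\<Sum>l<k. emb A (X (i, l)) * (if l = j then emb A \<one>\<^bsub>A\<^esub> else 0)) = emb A (X (i, j))"
        using ij by simp
    qed
    show "\<one>\<^bsub>Mat k A\<^esub> \<otimes>\<^bsub>Mat k A\<^esub> X = X"
      using X by (intro mats_eqI[of _ k]) (simp_all add: cl emb_mat s)
    show "X \<otimes>\<^bsub>Mat k A\<^esub> \<one>\<^bsub>Mat k A\<^esub> = X"
      using X by (intro mats_eqI[of _ k]) (simp_all add: cl emb_mat s)
  qed (simp add: cl)
qed

end

section \<open>Finite direct sums\<close>

lemma direct_sum_simps [simp]:
  "carrier (direct_sum I A) = (\<Pi>\<^sub>E i\<in>I. carrier (A i))"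
  "x \<otimes>\<^bsub>direct_sum I A\<^esub> y = (\<lambda>i\<in>I. x i \<otimes>\<^bsub>A i\<^esub> y i)"
  "\<one>\<^bsub>direct_sum I A\<^esub> = (\<lambda>i\<in>I. \<one>\<^bsub>A i\<^esub>)" "\<zero>\<^bsub>direct_sum I A\<^esub> = (\<lambda>i\<in>I. \<zero>\<^bsub>A i\<^esub>)"
  "x \<oplus>\<^bsub>direct_sum I A\<^esub> y = (\<lambda>i\<in>I. x i \<oplus>\<^bsub>A i\<^esub> y i)"
  "c \<odot>\<^bsub>direct_sum I A\<^esub> x = (\<lambda>i\<in>I. c \<odot>\<^bsub>A i\<^esub> x i)"
  "adj (direct_sum I A) x = (\<lambda>i\<in>I. adj (A i) (x i))"
  "cnorm (direct_sum I A) x = Max (insert 0 ((\<lambda>i. cnorm (A i) (x i)) ` I))"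
  by (simp_all add: direct_sum_def)

lemma star_algebra_direct_sum:
  assumes A: "\<And>i. i \<in> I \<Longrightarrow> star_algebra (A i)"
  shows "star_algebra (direct_sum I A)"
proof -
  have mo: "module complex_alg (A i)" if "i \<in> I" for i using A[OF that] by (rule star_algebra.axioms)
  have ag: "abelian_group (A i)" if "i \<in> I" for i using mo[OF that] by (rule module.axioms)
  have am: "abelian_monoid (A i)" if "i \<in> I" for i using ag[OF that] by (rule abelian_group.axioms)
  note cl = abelian_monoid.a_closed[OF am] abelian_monoid.zero_closed[OF am] star_algebra.smult_cl[OF A]
    star_algebra.mult_closed[OF A] star_algebra.adj_closed[OF A]
  have add: "abelian_group (direct_sum I A)"
  proof (rule abelian_groupI)
    fix x assume x: "x \<in> carrier (direct_sum I A)"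
    have "(\<lambda>i\<in>I. \<ominus>\<^bsub>A i\<^esub> x i) \<oplus>\<^bsub>direct_sum I A\<^esub> x = \<zero>\<^bsub>direct_sum I A\<^esub>"
      using x by (auto simp: restrict_def fun_eq_iff PiE_iff abelian_group.l_neg[OF ag])
    moreover have "(\<lambda>i\<in>I. \<ominus>\<^bsub>A i\<^esub> x i) \<in> carrier (direct_sum I A)"
      using x by (auto simp: PiE_iff abelian_group.a_inv_closed[OF ag])
    ultimately show "\<exists>y\<in>carrier (direct_sum I A). y \<oplus>\<^bsub>direct_sum I A\<^esub> x = \<zero>\<^bsub>direct_sum I A\<^esub>" by blast
  qed (auto simp: PiE_iff cl extensional_def fun_eq_iff abelian_monoid.a_assoc[OF am] abelian_monoid.a_comm[OF am]
      abelian_monoid.a_lcomm[OF am] abelian_monoid.l_zero[OF am] abelian_monoid.r_zero[OF am])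
  have md: "module complex_alg (direct_sum I A)"
    by (intro moduleI cring_complex_alg add)
      (auto simp: PiE_iff cl extensional_def fun_eq_iff star_algebra.smult_add_left[OF A]
        star_algebra.smult_add_right[OF A] star_algebra.smult_smult[OF A] star_algebra.smult_one_left[OF A])
  show ?thesis
    by (intro star_algebra.intro md star_algebra_axioms.intro)
      (auto simp: PiE_iff cl extensional_def fun_eq_iff star_algebra.mult_assoc[OF A]
        star_algebra.distrib_left[OF A] star_algebra.distrib_right[OF A] star_algebra.smult_mult_left[OF A]
        star_algebra.smult_mult_right[OF A] star_algebra.adj_adj[OF A] star_algebra.adj_add[OF A]
        star_algebra.adj_smult[OF A] star_algebra.adj_mult[OF A])
qed

text \<open>Finiteness of \<open>I\<close> turns convergence of the components into convergence of
  the maximum, which the sum of the component distances dominates.\<close>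

theorem cstar_algebra_direct_sum:
  assumes I: "finite I" and A: "\<And>i. i \<in> I \<Longrightarrow> cstar_algebra (A i)"
  shows "cstar_algebra (direct_sum I A)"
proof -
  note sA = cstar_algebra.axioms(1)[OF A]
  let ?D = "direct_sum I A" let ?C = "\<Pi>\<^sub>E i\<in>I. carrier (A i)"
  interpret D: star_algebra ?D by (rule star_algebra_direct_sum) (rule sA)
  have entry: "x i \<in> carrier (A i)" if "x \<in> ?C" "i \<in> I" for x i using that by auto
  have le_iff: "cnorm ?D x \<le> B \<longleftrightarrow> 0 \<le> B \<and> (\<forall>i\<in>I. cnorm (A i) (x i) \<le> B)" for x B
    using I by (simp add: Max_le_iff)
  have ge: "cnorm (A i) (x i) \<le> cnorm ?D x" if "i \<in> I" for x i using le_iff[of x "cnorm ?D x"] that by blast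
  have ge0: "0 \<le> cnorm ?D x" for x using le_iff[of x "cnorm ?D x"] by blast
  note [simp del] = direct_sum_simps(8)
  have sm: "cnorm ?D (c \<odot>\<^bsub>?D\<^esub> x) \<le> cmod c * cnorm ?D x" if "x \<in> ?C" for x c
    unfolding le_iff using ge0 ge[of _ x] entry[OF that]
    by (auto simp: cstar_algebra.cnorm_smult[OF A] mult_left_mono)
  have semi: "cstar_seminorm ?D (cnorm ?D)"
    unfolding cstar_seminorm_def direct_sum_simps(1)
  proof (intro conjI ballI allI)
    fix x y c assume x: "x \<in> ?C"
    show "0 \<le> cnorm ?D x" by (rule ge0)
    show "cnorm ?D (x \<oplus>\<^bsub>?D\<^esub> y) \<le> cnorm ?D x + cnorm ?D y" if y: "y \<in> ?C"
      unfolding le_iff using ge0[of x] ge0[of y]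
      by (auto intro!: order_trans[OF cstar_algebra.cnorm_triangle[OF A]] add_mono ge entry x y)
    show "cnorm ?D (x \<otimes>\<^bsub>?D\<^esub> y) \<le> cnorm ?D x * cnorm ?D y" if y: "y \<in> ?C"
      unfolding le_iff using ge0[of x] ge0[of y]
      by (auto intro!: order_trans[OF cstar_algebra.cnorm_mult[OF A]] mult_mono ge entry x y
          cstar_algebra.cnorm_ge_0[OF A])
    show "cnorm ?D (c \<odot>\<^bsub>?D\<^esub> x) = cmod c * cnorm ?D x"
    proof (cases "c = 0")
      case True
      then show ?thesis using sm[OF x, of c] ge0[of "c \<odot>\<^bsub>?D\<^esub> x"] by simp
    next
      case False
      have "inverse c \<odot>\<^bsub>?D\<^esub> (c \<odot>\<^bsub>?D\<^esub> x) = x"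
        using x False D.smult_smult[of x "inverse c" c] D.smult_one_left[of x]
        by (simp del: direct_sum_simps(2-7))
      then have "cnorm ?D x \<le> inverse (cmod c) * cnorm ?D (c \<odot>\<^bsub>?D\<^esub> x)"
        using sm[of "c \<odot>\<^bsub>?D\<^esub> x" "inverse c"] D.smult_cl[of x c] x by (simp add: norm_inverse del: direct_sum_simps(2-7))
      then have "cmod c * cnorm ?D x \<le> cnorm ?D (c \<odot>\<^bsub>?D\<^esub> x)" using False by (simp add: field_simps)
      then show ?thesis using sm[OF x, of c] by simp
    qed
    have eq: "cnorm (A i) ((adj ?D x \<otimes>\<^bsub>?D\<^esub> x) i) = (cnorm (A i) (x i))\<^sup>2" if "i \<in> I" for i
      using that entry[OF x that] by (simp add: cstar_algebra.cnorm_cstar[OF A])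
    show "cnorm ?D (adj ?D x \<otimes>\<^bsub>?D\<^esub> x) = (cnorm ?D x)\<^sup>2"
    proof (rule antisym)
      show "cnorm ?D (adj ?D x \<otimes>\<^bsub>?D\<^esub> x) \<le> (cnorm ?D x)\<^sup>2"
        unfolding le_iff using eq ge by (auto intro!: power_mono cstar_algebra.cnorm_ge_0[OF A] entry x simp del: direct_sum_simps)
      have "cnorm ?D x \<le> sqrt (cnorm ?D (adj ?D x \<otimes>\<^bsub>?D\<^esub> x))"
        unfolding le_iff using eq ge[of _ "adj ?D x \<otimes>\<^bsub>?D\<^esub> x"] ge0 by (auto intro!: real_le_rsqrt simp del: direct_sum_simps) 
      then show "(cnorm ?D x)\<^sup>2 \<le> cnorm ?D (adj ?D x \<otimes>\<^bsub>?D\<^esub> x)"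
        by (metis ge0 power_mono real_sqrt_pow2)
    qed
  qed
  have minus: "(x \<ominus>\<^bsub>?D\<^esub> y) i = x i \<ominus>\<^bsub>A i\<^esub> y i" if "x \<in> ?C" "y \<in> ?C" "i \<in> I" for x y i
    using that D.minus_eq_smult[of x y]
      star_algebra.minus_eq_smult[OF sA[OF that(3)] entry[OF that(1,3)] entry[OF that(2,3)]] by simp
  show ?thesis
  proof (intro cstar_algebra.intro cstar_algebra_axioms.intro semi D.star_algebra_axioms)
    fix x assume x: "x \<in> carrier ?D" and 0: "cnorm ?D x = 0"
    have "x i = \<zero>\<^bsub>A i\<^esub>" if "i \<in> I" for i
      using ge[OF that, of x] 0 entry[of x i] x that cstar_algebra.cnorm_ge_0[OF A[OF that], of "x i"]
      by (intro cstar_algebra.definite[OF A]) auto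
    then show "x = \<zero>\<^bsub>?D\<^esub>" using x by (auto simp: fun_eq_iff PiE_iff extensional_def)
  next
    fix s assume s: "cauchy_in ?D (cnorm ?D) s"
    have sm: "s n \<in> ?C" for n using s unfolding cauchy_in_def direct_sum_simps(1) by blast
    have "\<exists>x\<in>carrier (A i). (\<lambda>n. cnorm (A i) (s n i \<ominus>\<^bsub>A i\<^esub> x)) \<longlonglongrightarrow> 0" if i: "i \<in> I" for i
    proof (rule cstar_algebra.complete[OF A[OF i]])
      show "cauchy_in (A i) (cnorm (A i)) (\<lambda>n. s n i)" unfolding cauchy_in_def
      proof (intro conjI allI impI)
        show "range (\<lambda>n. s n i) \<subseteq> carrier (A i)" using entry[OF sm i] by auto
        fix r :: real assume "r > 0"
        then obtain K where K: "\<forall>m\<ge>K. \<forall>n\<ge>K. cnorm ?D (s m \<ominus>\<^bsub>?D\<^esub> s n) < r"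
          using s unfolding cauchy_in_def by blast
        have "cnorm (A i) (s m i \<ominus>\<^bsub>A i\<^esub> s n i) \<le> cnorm ?D (s m \<ominus>\<^bsub>?D\<^esub> s n)" for m n
          using ge[OF i, of "s m \<ominus>\<^bsub>?D\<^esub> s n"] minus[OF sm sm i] by simp
        then show "\<exists>K. \<forall>m\<ge>K. \<forall>n\<ge>K. cnorm (A i) (s m i \<ominus>\<^bsub>A i\<^esub> s n i) < r"
          using K by (meson le_less_trans)
      qed
    qed
    then obtain L where L: "\<And>i. i \<in> I \<Longrightarrow> L i \<in> carrier (A i)"
      "\<And>i. i \<in> I \<Longrightarrow> (\<lambda>n. cnorm (A i) (s n i \<ominus>\<^bsub>A i\<^esub> L i)) \<longlonglongrightarrow> 0"
      by metis
    define x where "x = (\<lambda>i\<in>I. L i)"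
    have x: "x \<in> ?C" unfolding x_def using L by auto
    have "(\<lambda>n. \<Sum>i\<in>I. cnorm (A i) (s n i \<ominus>\<^bsub>A i\<^esub> L i)) \<longlonglongrightarrow> (\<Sum>i\<in>I. 0)"
      using L(2) by (intro tendsto_sum) auto
    then have lim: "(\<lambda>n. \<Sum>i\<in>I. cnorm (A i) (s n i \<ominus>\<^bsub>A i\<^esub> L i)) \<longlonglongrightarrow> 0" by simp
    have nn: "0 \<le> cnorm (A i) (s n i \<ominus>\<^bsub>A i\<^esub> L i)" if "i \<in> I" for n i
      using abelian_group.minus_closed[OF module.axioms(2)[OF star_algebra.axioms(1)[OF sA[OF that]]]]
        entry[OF sm that] L(1)[OF that] by (intro cstar_algebra.cnorm_ge_0[OF A[OF that]]) auto
    have "cnorm ?D (s n \<ominus>\<^bsub>?D\<^esub> x) \<le> (\<Sum>i\<in>I. cnorm (A i) (s n i \<ominus>\<^bsub>A i\<^esub> L i))" for n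
      unfolding le_iff
    proof (intro conjI ballI)
      show "0 \<le> (\<Sum>i\<in>I. cnorm (A i) (s n i \<ominus>\<^bsub>A i\<^esub> L i))" by (intro sum_nonneg nn)
      fix i assume i: "i \<in> I"
      have "(s n \<ominus>\<^bsub>?D\<^esub> x) i = s n i \<ominus>\<^bsub>A i\<^esub> L i" using minus[OF sm x i] i by (simp add: x_def)
      then show "cnorm (A i) ((s n \<ominus>\<^bsub>?D\<^esub> x) i) \<le> (\<Sum>i\<in>I. cnorm (A i) (s n i \<ominus>\<^bsub>A i\<^esub> L i))"
        using member_le_sum[OF i, of "\<lambda>i. cnorm (A i) (s n i \<ominus>\<^bsub>A i\<^esub> L i)"] nn I by simp
    qed
    then have "(\<lambda>n. cnorm ?D (s n \<ominus>\<^bsub>?D\<^esub> x)) \<longlonglongrightarrow> 0"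
      using ge0 by (intro tendsto_sandwich[OF _ _ tendsto_const lim]) auto
    then show "\<exists>x\<in>carrier ?D. (\<lambda>n. cnorm ?D (s n \<ominus>\<^bsub>?D\<^esub> x)) \<longlonglongrightarrow> 0"
      using x unfolding direct_sum_simps(1) by blast
  qed
qed

lemma unital_cstar_complex: "unital_cstar complex_alg"
proof -
  have add: "abelian_group complex_alg" using cring_complex_alg by (simp add: cring_def ring_def)
  have md: "module complex_alg complex_alg"
    by (intro moduleI cring_complex_alg add) (auto simp: algebra_simps)
  have sa: "star_algebra complex_alg"
    by (intro star_algebra.intro md star_algebra_axioms.intro) (auto simp: algebra_simps)
  interpret star_algebra complex_alg by (rule sa)
  have semi: "cstar_seminorm complex_alg (cnorm complex_alg)"
    unfolding cstar_seminorm_def by (auto simp: norm_triangle_ineq norm_mult power2_eq_square)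
  have minus: "x \<ominus>\<^bsub>complex_alg\<^esub> y = x - y" for x y using minus_eq_smult[of x y] by simp
  show ?thesis
  proof (intro unital_cstar.intro cstar_algebra.intro cstar_algebra_axioms.intro unital_cstar_axioms.intro sa semi)
    fix s assume "cauchy_in complex_alg (cnorm complex_alg) s"
    then have "Cauchy s" unfolding cauchy_in_def minus Cauchy_iff by simp
    then obtain l where "s \<longlonglongrightarrow> l" using Cauchy_convergent convergent_def by blast
    then show "\<exists>x\<in>carrier complex_alg. (\<lambda>n. cnorm complex_alg (s n \<ominus>\<^bsub>complex_alg\<^esub> x)) \<longlonglongrightarrow> 0"
      unfolding minus by (auto intro!: exI[of _ l] simp: LIM_zero tendsto_norm_zero)
  qed auto
qed

section \<open>Direct sums of matrix algebras\<close>

text \<open>The elementary tensor of a matrix unit with \<open>x\<close>, placed in the summand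
  \<open>i\<close>.\<close>

definition munit :: "'i set \<Rightarrow> ('i \<Rightarrow> nat) \<Rightarrow> ('i \<Rightarrow> 'a cstar) \<Rightarrow> 'i \<Rightarrow> nat \<Rightarrow> nat \<Rightarrow> 'a \<Rightarrow> 'i \<Rightarrow> nat \<times> nat \<Rightarrow> 'a" where
  "munit I k A i a b x = (\<lambda>j\<in>I. \<lambda>cd\<in>{..<k j} \<times> {..<k j}. if j = i \<and> cd = (a, b) then x else \<zero>\<^bsub>A j\<^esub>)"

locale matrix_sum =
  fixes I :: "'i set" and k :: "'i \<Rightarrow> nat" and A :: "'i \<Rightarrow> 'a cstar"
  assumes fin: "finite I" and unital: "\<And>i. i \<in> I \<Longrightarrow> unital_cstar (A i)"
begin

definition DM :: "('i \<Rightarrow> nat \<times> nat \<Rightarrow> 'a) cstar" where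
  "DM = direct_sum I (\<lambda>i. matrix_alg (k i) (A i))"

lemma cst: "i \<in> I \<Longrightarrow> cstar_algebra (A i)"
  using unital by (auto simp: unital_cstar_def)

lemma cstar_DM: "cstar_algebra DM"
  unfolding DM_def
  by (rule cstar_algebra_direct_sum[OF fin]) (rule unital_cstar.axioms[OF unital_cstar.unital_cstar_matrix[OF unital]])

sublocale D: cstar_algebra DM by (rule cstar_DM)

lemma carrier_DM: "carrier DM = (\<Pi>\<^sub>E i\<in>I. {..<k i} \<times> {..<k i} \<rightarrow>\<^sub>E carrier (A i))"
  unfolding DM_def by (auto simp: matrix_alg_def)

lemma DM_entry: "x \<in> carrier DM \<Longrightarrow> i \<in> I \<Longrightarrow> a < k i \<Longrightarrow> b < k i \<Longrightarrow> x i (a, b) \<in> carrier (A i)"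
  unfolding carrier_DM by (auto simp: PiE_iff)

lemma DM_eqI:
  assumes "x \<in> carrier DM" "y \<in> carrier DM"
    and "\<And>i a b. i \<in> I \<Longrightarrow> a < k i \<Longrightarrow> b < k i \<Longrightarrow> x i (a, b) = y i (a, b)"
  shows "x = y"
proof (rule PiE_ext[of x I _ y])
  show "x \<in> (\<Pi>\<^sub>E i\<in>I. {..<k i} \<times> {..<k i} \<rightarrow>\<^sub>E carrier (A i))" "y \<in> (\<Pi>\<^sub>E i\<in>I. {..<k i} \<times> {..<k i} \<rightarrow>\<^sub>E carrier (A i))"
    using assms(1,2) unfolding carrier_DM .
  fix i assume i: "i \<in> I"
  have "x i \<in> {..<k i} \<times> {..<k i} \<rightarrow>\<^sub>E carrier (A i)" "y i \<in> {..<k i} \<times> {..<k i} \<rightarrow>\<^sub>E carrier (A i)"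
    using assms(1,2) i unfolding carrier_DM by (auto elim!: PiE_mem)
  then show "x i = y i" using assms(3)[OF i] by (intro PiE_ext[of "x i" _ _ "y i"]) auto
qed

lemma DM_entries:
  assumes "i \<in> I" "a < k i" "b < k i"
  shows "(x \<oplus>\<^bsub>DM\<^esub> y) i (a, b) = x i (a, b) \<oplus>\<^bsub>A i\<^esub> y i (a, b)"
    "(c \<odot>\<^bsub>DM\<^esub> x) i (a, b) = c \<odot>\<^bsub>A i\<^esub> x i (a, b)"
    "adj DM x i (a, b) = adj (A i) (x i (b, a))"
    "\<zero>\<^bsub>DM\<^esub> i (a, b) = \<zero>\<^bsub>A i\<^esub>"
    "(x \<otimes>\<^bsub>DM\<^esub> y) i (a, b) = (\<Oplus>\<^bsub>A i\<^esub>l\<in>{..<k i}. x i (a, l) \<otimes>\<^bsub>A i\<^esub> y i (l, b))"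
  using assms unfolding DM_def by (simp_all add: matrix_alg_def)

abbreviation "E \<equiv> munit I k A"

lemma E_entry: "j \<in> I \<Longrightarrow> c < k j \<Longrightarrow> d < k j \<Longrightarrow>
    E i a b x j (c, d) = (if j = i \<and> c = a \<and> d = b then x else \<zero>\<^bsub>A j\<^esub>)"
  by (simp add: munit_def)

lemma zero_cl: "i \<in> I \<Longrightarrow> \<zero>\<^bsub>A i\<^esub> \<in> carrier (A i)"
  using cstar_algebra.axioms(1)[OF cst] star_algebra.axioms(1) module.axioms(2)
  by (metis abelian_group.axioms(1) abelian_monoid.zero_closed)

lemma E_closed [simp, intro]: "i \<in> I \<Longrightarrow> x \<in> carrier (A i) \<Longrightarrow> E i a b x \<in> carrier DM"
  unfolding carrier_DM munit_def using zero_cl by (auto simp: PiE_iff)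

lemma E_add:
  assumes "i \<in> I" "x \<in> carrier (A i)" "y \<in> carrier (A i)"
  shows "E i a b (x \<oplus>\<^bsub>A i\<^esub> y) = E i a b x \<oplus>\<^bsub>DM\<^esub> E i a b y"
proof (rule DM_eqI)
  interpret unital_cstar "A i" using unital assms by blast
  show "E i a b (x \<oplus>\<^bsub>A i\<^esub> y) \<in> carrier DM" "E i a b x \<oplus>\<^bsub>DM\<^esub> E i a b y \<in> carrier DM"
    using assms by (auto intro!: D.M.a_closed)
  fix j c d assume j: "j \<in> I" "c < k j" "d < k j"
  interpret j: unital_cstar "A j" using unital j by blast
  show "E i a b (x \<oplus>\<^bsub>A i\<^esub> y) j (c, d) = (E i a b x \<oplus>\<^bsub>DM\<^esub> E i a b y) j (c, d)"
    using j by (simp add: DM_entries E_entry)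
qed

lemma E_smult:
  assumes "i \<in> I" "x \<in> carrier (A i)"
  shows "E i a b (c \<odot>\<^bsub>A i\<^esub> x) = c \<odot>\<^bsub>DM\<^esub> E i a b x"
proof (rule DM_eqI)
  interpret unital_cstar "A i" using unital assms by blast
  show "E i a b (c \<odot>\<^bsub>A i\<^esub> x) \<in> carrier DM" "c \<odot>\<^bsub>DM\<^esub> E i a b x \<in> carrier DM"
    using assms by auto
  fix j l d assume j: "j \<in> I" "l < k j" "d < k j"
  interpret j: unital_cstar "A j" using unital j by blast
  show "E i a b (c \<odot>\<^bsub>A i\<^esub> x) j (l, d) = (c \<odot>\<^bsub>DM\<^esub> E i a b x) j (l, d)"
    using j by (simp add: DM_entries E_entry)
qed

lemma E_adj:
  assumes "i \<in> I" "x \<in> carrier (A i)"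
  shows "adj DM (E i a b x) = E i b a (adj (A i) x)"
proof (rule DM_eqI)
  interpret unital_cstar "A i" using unital assms by blast
  show "E i b a (adj (A i) x) \<in> carrier DM" "adj DM (E i a b x) \<in> carrier DM"
    using assms by auto
  fix j c d assume j: "j \<in> I" "c < k j" "d < k j"
  interpret j: unital_cstar "A j" using unital j by blast
  show "adj DM (E i a b x) j (c, d) = E i b a (adj (A i) x) j (c, d)"
    using j by (simp add: DM_entries E_entry)
qed

lemma E_mult:
  assumes "i \<in> I" "x \<in> carrier (A i)" "b < k i" "j \<in> I" "y \<in> carrier (A j)" "c < k j"
  shows "E i a b x \<otimes>\<^bsub>DM\<^esub> E j c d y = (if i = j \<and> b = c then E i a d (x \<otimes>\<^bsub>A i\<^esub> y) else \<zero>\<^bsub>DM\<^esub>)"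
proof (rule DM_eqI)
  interpret unital_cstar "A i" using unital assms by blast
  show "E i a b x \<otimes>\<^bsub>DM\<^esub> E j c d y \<in> carrier DM" using assms by auto
  show "(if i = j \<and> b = c then E i a d (x \<otimes>\<^bsub>A i\<^esub> y) else \<zero>\<^bsub>DM\<^esub>) \<in> carrier DM"
  proof (cases "i = j \<and> b = c")
    case True
    then have "y \<in> carrier (A i)" using assms by simp
    then show ?thesis using True E_closed[OF assms(1) mult_closed[OF assms(2)]] by simp
  qed auto
  fix l f g assume l: "l \<in> I" "f < k l" "g < k l"
  interpret l: unital_cstar "A l" using unital l by blast
  define z where "z = (if l = i \<and> l = j \<and> f = a \<and> g = d \<and> b = c then x \<otimes>\<^bsub>A i\<^esub> y else \<zero>\<^bsub>A l\<^esub>)"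
  have "i = j \<Longrightarrow> x \<otimes>\<^bsub>A i\<^esub> y \<in> carrier (A i)" using assms by (metis mult_closed)
  then have zc: "z \<in> carrier (A l)" unfolding z_def using assms by auto
  have "(\<Oplus>\<^bsub>A l\<^esub>t\<in>{..<k l}. E i a b x l (f, t) \<otimes>\<^bsub>A l\<^esub> E j c d y l (t, g))
      = (\<Oplus>\<^bsub>A l\<^esub>t\<in>{..<k l}. if b = t then z else \<zero>\<^bsub>A l\<^esub>)"
    using assms l zc by (intro l.M.finsum_cong')
      (auto simp: E_entry z_def star_algebra.mult_zero[OF cstar_algebra.axioms(1)[OF cst]])
  also have "\<dots> = z"
  proof (cases "b < k l")
    case True
    then show ?thesis using zc l.M.finsum_singleton[of b "{..<k l}" "\<lambda>_. z"] by simp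
  next
    case False
    then have "z = \<zero>\<^bsub>A l\<^esub>" using assms unfolding z_def by auto
    then show ?thesis using l.M.finsum_zero by (simp cong: if_cong)
  qed
  finally show "(E i a b x \<otimes>\<^bsub>DM\<^esub> E j c d y) l (f, g)
      = (if i = j \<and> b = c then E i a d (x \<otimes>\<^bsub>A i\<^esub> y) else \<zero>\<^bsub>DM\<^esub>) l (f, g)"
    unfolding DM_entries(5)[OF l] using l by (auto simp: z_def E_entry DM_entries)
qed

text \<open>An element is the sum of its entries put at their positions: \<open>tr S\<close> keeps
  the entries at the positions in \<open>S\<close>, and \<open>S\<close> grows by one position at a
  time.\<close>

lemma DM_induct [consumes 1, case_names zero add unit]:
  assumes x: "x \<in> carrier DM" and 0: "P \<zero>\<^bsub>DM\<^esub>"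
    and add: "\<And>x y. x \<in> carrier DM \<Longrightarrow> y \<in> carrier DM \<Longrightarrow> P x \<Longrightarrow> P y \<Longrightarrow> P (x \<oplus>\<^bsub>DM\<^esub> y)"
    and unit: "\<And>i a b z. i \<in> I \<Longrightarrow> a < k i \<Longrightarrow> b < k i \<Longrightarrow> z \<in> carrier (A i) \<Longrightarrow> P (E i a b z)"
  shows "P x"
proof -
  define J where "J = (SIGMA i:I. {..<k i} \<times> {..<k i})"
  define tr where "tr S = (\<lambda>i\<in>I. \<lambda>ab\<in>{..<k i} \<times> {..<k i}. if (i, ab) \<in> S then x i ab else \<zero>\<^bsub>A i\<^esub>)" for S
  have tc: "tr S \<in> carrier DM" for S
    unfolding carrier_DM tr_def using zero_cl DM_entry[OF x] by (auto simp: PiE_iff)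
  have "finite J" unfolding J_def using fin by auto
  moreover have "P (tr S)" if "finite S" "S \<subseteq> J" for S
    using that
  proof (induction S rule: finite_induct)
    case empty
    have "tr {} = \<zero>\<^bsub>DM\<^esub>" by (rule DM_eqI[OF tc D.M.zero_closed]) (simp add: tr_def DM_entries)
    then show ?case using 0 by simp
  next
    case (insert s S)
    obtain i a b where s: "s = (i, a, b)" "i \<in> I" "a < k i" "b < k i" using insert unfolding J_def by auto
    have z: "x i (a, b) \<in> carrier (A i)" using DM_entry[OF x] s by auto
    have "tr (insert s S) = tr S \<oplus>\<^bsub>DM\<^esub> E i a b (x i (a, b))"
    proof (rule DM_eqI)
      show "tr (insert s S) \<in> carrier DM" by (rule tc)
      show "tr S \<oplus>\<^bsub>DM\<^esub> E i a b (x i (a, b)) \<in> carrier DM" using tc z s by auto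
      fix j c d assume j: "j \<in> I" "c < k j" "d < k j"
      interpret j: unital_cstar "A j" using unital j by blast
      interpret i: unital_cstar "A i" using unital s(2) by blast
      show "tr (insert s S) j (c, d) = (tr S \<oplus>\<^bsub>DM\<^esub> E i a b (x i (a, b))) j (c, d)"
        using j s insert.hyps DM_entry[OF x j] by (auto simp: tr_def DM_entries E_entry)
    qed
    then show ?case using add[OF tc E_closed[OF s(2) z] insert.IH unit[OF s(2-4) z]] insert.prems by simp
  qed
  moreover have "tr J = x" by (rule DM_eqI[OF tc x]) (simp add: tr_def J_def)
  ultimately show ?thesis by (metis order_refl)
qed

end

section \<open>Homomorphisms out of direct sums of matrix algebras\<close>

context cstar_algebra
begin

text \<open>Membership in the image of \<open>A\<close>, as a fixed point equation. It allows maps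
  into \<open>A\<close> to be given by formulas in the product ring and brought back with
  \<open>ev\<close>.\<close>

definition inr :: "'a univ \<Rightarrow> bool" where "inr u \<longleftrightarrow> emb A (ev A u) = u"

lemma inr_emb [simp, intro]: "x \<in> carrier A \<Longrightarrow> inr (emb A x)"
  unfolding inr_def by simp

lemma inr_intros [simp, intro]:
  "inr 0" "inr u \<Longrightarrow> inr v \<Longrightarrow> inr (u + v)" "inr u \<Longrightarrow> inr v \<Longrightarrow> inr (u * v)"
  "inr u \<Longrightarrow> inr (star u)" "inr u \<Longrightarrow> inr (c *\<^sub>C u)"
  unfolding inr_def using is_cstar by (simp_all add: emb_hom emb_hom(1)[OF M.zero_closed])

lemma inr_sum: "(\<And>i. i \<in> J \<Longrightarrow> inr (f i)) \<Longrightarrow> inr (sum f J)"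
  by (induction J rule: infinite_finite_induct) auto

lemma star_hom_of_typed:
  assumes "\<And>x. x \<in> carrier B \<Longrightarrow> inr (H x)"
    and "\<And>x y. x \<in> carrier B \<Longrightarrow> y \<in> carrier B \<Longrightarrow> H (x \<oplus>\<^bsub>B\<^esub> y) = H x + H y"
    and "\<And>c x. x \<in> carrier B \<Longrightarrow> H (c \<odot>\<^bsub>B\<^esub> x) = c *\<^sub>C H x"
    and "\<And>x y. x \<in> carrier B \<Longrightarrow> y \<in> carrier B \<Longrightarrow> H (x \<otimes>\<^bsub>B\<^esub> y) = H x * H y"
    and "\<And>x. x \<in> carrier B \<Longrightarrow> H (adj B x) = star (H x)"
  shows "(\<lambda>x. ev A (H x)) \<in> star_hom B A"
  using assms is_cstar unfolding star_hom_def by auto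

end

lemma emb_star_hom:
  assumes "cstar_algebra B" "f \<in> star_hom A B" "x \<in> carrier A"
  shows "emb B (f x) \<in> range (emb B)" "y \<in> carrier A \<Longrightarrow> emb B (f (x \<oplus>\<^bsub>A\<^esub> y)) = emb B (f x) + emb B (f y)"
    "emb B (f (c \<odot>\<^bsub>A\<^esub> x)) = c *\<^sub>C emb B (f x)"
    "y \<in> carrier A \<Longrightarrow> emb B (f (x \<otimes>\<^bsub>A\<^esub> y)) = emb B (f x) * emb B (f y)"
    "emb B (f (adj A x)) = star (emb B (f x))"
  using star_homD[OF assms(2)] assms(3) cstar_algebra.emb_hom[OF assms(1)] by auto

text \<open>A system of partial isometries \<open>w\<close> onto the units of the corners \<open>\<pi> i (A i)\<close> spreads the
  representations \<open>\<pi> i\<close> to the matrix algebras.\<close>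

locale matrix_sum_rep = matrix_sum I k A + X: cstar_algebra X
  for I :: "'i set" and k and A :: "'i \<Rightarrow> 'a cstar" and X :: "'x cstar" +
  fixes \<pi> :: "'i \<Rightarrow> 'a \<Rightarrow> 'x" and w :: "'i \<Rightarrow> nat \<Rightarrow> 'x univ"
  assumes rep: "\<And>i. i \<in> I \<Longrightarrow> \<pi> i \<in> star_hom (A i) X"
    and w: "\<And>i a. i \<in> I \<Longrightarrow> a < k i \<Longrightarrow> X.inr (w i a)"
    and ww: "\<And>i a j b. i \<in> I \<Longrightarrow> a < k i \<Longrightarrow> j \<in> I \<Longrightarrow> b < k j \<Longrightarrow>
      w i a * star (w j b) = (if i = j \<and> a = b then emb X (\<pi> i \<one>\<^bsub>A i\<^esub>) else 0)"
begin

definition H :: "('i \<Rightarrow> nat \<times> nat \<Rightarrow> 'a) \<Rightarrow> 'x univ" where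
  "H x = (\<Sum>i\<in>I. \<Sum>a<k i. \<Sum>b<k i. star (w i a) * emb X (\<pi> i (x i (a, b))) * w i b)"

lemma H_inr: "x \<in> carrier DM \<Longrightarrow> X.inr (H x)"
  unfolding H_def using w star_homD(1)[OF rep] DM_entry
  by (intro X.inr_sum X.inr_intros) auto

lemma H_add: assumes "x \<in> carrier DM" "y \<in> carrier DM" shows "H (x \<oplus>\<^bsub>DM\<^esub> y) = H x + H y"
  unfolding H_def sum.distrib[symmetric]
  using assms by (intro sum.cong refl)
    (simp add: DM_entries emb_star_hom(2)[OF X.is_cstar rep] DM_entry ring_distribs)

lemma H_smult: assumes "x \<in> carrier DM" shows "H (c \<odot>\<^bsub>DM\<^esub> x) = c *\<^sub>C H x"
  unfolding H_def scaleC_sum_right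
  using assms by (intro sum.cong refl)
    (simp add: DM_entries emb_star_hom(3)[OF X.is_cstar rep] DM_entry)

lemma emb_rep_zero: assumes i: "i \<in> I" shows "emb X (\<pi> i \<zero>\<^bsub>A i\<^esub>) = 0"
  using emb_star_hom(3)[OF X.is_cstar rep[OF i] zero_cl[OF i], of 0]
    star_algebra.smult_zero_left[OF cstar_algebra.axioms(1)[OF cst[OF i]] zero_cl[OF i]]
  by simp

lemma H_zero: "H \<zero>\<^bsub>DM\<^esub> = 0"
  using H_smult[OF D.M.zero_closed, of 0] by simp

lemma H_E:
  assumes "i \<in> I" "a < k i" "b < k i" "z \<in> carrier (A i)"
  shows "H (E i a b z) = star (w i a) * emb X (\<pi> i z) * w i b"
proof -
  have "H (E i a b z) = (\<Sum>j\<in>I. \<Sum>c<k j. \<Sum>d<k j. if d = b then if c = a then if j = i then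
      star (w i a) * emb X (\<pi> i z) * w i b else 0 else 0 else 0)"
    unfolding H_def by (intro sum.cong refl) (auto simp: E_entry emb_rep_zero)
  also have "\<dots> = (\<Sum>j\<in>I. if j = i then star (w i a) * emb X (\<pi> i z) * w i b else 0)"
    using assms by (intro sum.cong refl) (auto simp: sum.delta cong del: if_weak_cong)
  also have "\<dots> = star (w i a) * emb X (\<pi> i z) * w i b" using assms fin by simp
  finally show ?thesis .
qed

lemma rep_unit:
  assumes "i \<in> I" "z \<in> carrier (A i)"
  shows "emb X (\<pi> i \<one>\<^bsub>A i\<^esub>) * emb X (\<pi> i z) = emb X (\<pi> i z)" "emb X (\<pi> i z) * emb X (\<pi> i \<one>\<^bsub>A i\<^esub>) = emb X (\<pi> i z)"
proof -
  interpret unital_cstar "A i" using unital assms by blast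
  show "emb X (\<pi> i \<one>\<^bsub>A i\<^esub>) * emb X (\<pi> i z) = emb X (\<pi> i z)" "emb X (\<pi> i z) * emb X (\<pi> i \<one>\<^bsub>A i\<^esub>) = emb X (\<pi> i z)"
    using assms by (simp_all flip: emb_star_hom(4)[OF X.is_cstar rep])
qed

text \<open>Both sides are additive in each argument, so matrix units suffice. For these the inner
  factor \<open>w i b * star (w j c)\<close> is either 0 or the image of the unit of
  \<open>A i\<close>, which is absorbed by the image of \<open>z\<close>.\<close>

lemma H_mult:
  assumes "x \<in> carrier DM" "y \<in> carrier DM" shows "H (x \<otimes>\<^bsub>DM\<^esub> y) = H x * H y"
  using assms
proof (induction x rule: DM_induct)
  case zero
  then show ?case by (simp add: H_zero)
next
  case (add x x')
  then show ?case by (simp add: D.distrib_right H_add ring_distribs)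
next
  case (unit i a b z)
  from unit(5) show ?case
  proof (induction y rule: DM_induct)
    case zero
    then show ?case using unit by (simp add: H_zero)
  next
    case (add y y')
    then show ?case using unit by (simp add: D.distrib_left H_add ring_distribs)
  next
    case (unit j c d z')
    interpret i: unital_cstar "A i" using unital \<open>i \<in> I\<close> by blast
    note i = \<open>i \<in> I\<close> \<open>a < k i\<close> \<open>b < k i\<close> \<open>z \<in> carrier (A i)\<close>
    have "H (E i a b z) * H (E j c d z')
        = star (w i a) * emb X (\<pi> i z) * (w i b * star (w j c)) * emb X (\<pi> j z') * w j d"
      using unit i by (simp add: H_E mult.assoc)
    also have "\<dots> = (if i = j \<and> b = c then star (w i a) * (emb X (\<pi> i z) * emb X (\<pi> i z')) * w i d else 0)"
      using unit i rep_unit(2)[OF i(1,4)] by (auto simp: ww mult.assoc) (metis mult.assoc)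
    also have "\<dots> = H (E i a b z \<otimes>\<^bsub>DM\<^esub> E j c d z')"
    proof (cases "i = j \<and> b = c")
      case True
      then have "z' \<in> carrier (A i)" using unit by simp
      moreover from this have "z \<otimes>\<^bsub>A i\<^esub> z' \<in> carrier (A i)" using i by auto
      ultimately show ?thesis
        using True unit i H_E[OF i(1,2), of d "z \<otimes>\<^bsub>A i\<^esub> z'"] emb_star_hom(4)[OF X.is_cstar rep[OF i(1)] i(4), of z']
        by (simp add: E_mult)
    next
      case False
      then show ?thesis using unit i by (auto simp: E_mult H_zero)
    qed
    finally show ?case by simp
  qed
qed

lemma H_adj:
  assumes "x \<in> carrier DM" shows "H (adj DM x) = star (H x)"
  using assms
proof (induction x rule: DM_induct)
  case zero
  then show ?case by (simp add: H_zero)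
next
  case (add x x')
  then show ?case by (simp add: D.adj_add H_add star_add)
next
  case (unit i a b z)
  interpret i: unital_cstar "A i" using unital unit(1) by blast
  show ?case using unit by (simp add: E_adj H_E star_mult emb_star_hom(5)[OF X.is_cstar rep] mult.assoc)
qed

definition h :: "('i \<Rightarrow> nat \<times> nat \<Rightarrow> 'a) \<Rightarrow> 'x" where "h x = ev X (H x)"

lemma h_star_hom: "h \<in> star_hom DM X"
  unfolding h_def by (intro X.star_hom_of_typed H_inr H_add H_smult H_mult H_adj)

lemma emb_h: "x \<in> carrier DM \<Longrightarrow> emb X (h x) = H x"
  unfolding h_def using H_inr unfolding X.inr_def by blast

end

lemma (in matrix_sum) star_hom_eqI:
  assumes "f \<in> star_hom DM X" "g \<in> star_hom DM X" "x \<in> carrier DM" and X: "cstar_algebra X"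
    and "\<And>i a b z. i \<in> I \<Longrightarrow> a < k i \<Longrightarrow> b < k i \<Longrightarrow> z \<in> carrier (A i) \<Longrightarrow> f (E i a b z) = g (E i a b z)"
  shows "f x = g x"
  using assms(3)
proof (induction x rule: DM_induct)
  case zero
  interpret X: cstar_algebra X by (rule X)
  show ?case using star_homD(1,3)[OF assms(1) D.M.zero_closed] star_homD(1,3)[OF assms(2) D.M.zero_closed]
    by (metis D.smult_zero_right X.smult_zero_left)
next
  case (add x y)
  then show ?case using star_homD(2)[OF assms(1)] star_homD(2)[OF assms(2)] by simp
qed (use assms(5) in blast)

section \<open>Separated completions\<close>

context cstar_algebra
begin

text \<open>The map \<open>ev A\<close> followed by \<open>emb A\<close> decreases norms, so its set
  of fixed points is closed.\<close>

lemma inr_lim: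
  assumes "\<And>n. inr (u n)" "u \<longlonglongrightarrow> l" shows "inr l"
proof -
  have "norm (emb A (ev A l) - l) \<le> 2 * norm (u n - l)" for n
  proof -
    have "emb A (ev A l) - l = emb A (ev A (l - u n)) + (u n - l)"
      using assms(1)[of n] is_cstar unfolding inr_def by (simp add: emb_hom)
    then have "norm (emb A (ev A l) - l) \<le> norm (emb A (ev A (l - u n))) + norm (u n - l)"
      by (metis norm_triangle_ineq)
    also have "norm (emb A (ev A (l - u n))) \<le> norm (u n - l)"
      using cnorm_ev_le_norm[OF is_cstar, of "l - u n"] is_cstar
      by (simp only: norm_emb[OF ev_closed[OF is_cstar]] norm_minus_commute)
    finally show ?thesis by simp
  qed
  moreover have "(\<lambda>n. 2 * norm (u n - l)) \<longlonglongrightarrow> 2 * 0"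
    using assms(2) by (intro tendsto_intros) (simp add: tendsto_norm_zero LIM_zero)
  ultimately have "norm (emb A (ev A l) - l) \<le> 0"
    using LIMSEQ_le_const by fastforce
  then show ?thesis unfolding inr_def by simp
qed

end

locale seminormed_alg = star_algebra A for A :: "'a star_alg" +
  fixes p :: "'a \<Rightarrow> real"
  assumes p: "cstar_seminorm A p"
begin

abbreviation "Cs \<equiv> {s. cauchy_in A p s}"
abbreviation "cls s \<equiv> seminorm_equiv A p `` {s}"
abbreviation "Cp \<equiv> seminorm_completion A p"

lemmas p_ge_0 = cstar_seminormD(1)[OF p]
  and p_add = cstar_seminormD(2)[OF p]
  and p_smult = cstar_seminormD(3)[OF p]
  and p_mult = cstar_seminormD(4)[OF p]
  and p_cstar = cstar_seminormD(5)[OF p]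
  and p_zero = seminorm_zero[OF p]
  and p_minus_commute = seminorm_minus_commute[OF p]
  and p_triangle = seminorm_minus_triangle[OF p]
  and p_diff_le = seminorm_diff_le[OF p]
  and p_adj = seminorm_adj[OF p]

lemma cauchy_closed: "cauchy_in A p s \<Longrightarrow> s n \<in> carrier A"
  unfolding cauchy_in_def by auto

lemma cauchy_inI:
  assumes "\<And>n. s n \<in> carrier A" "\<And>r. r > 0 \<Longrightarrow> \<exists>M. \<forall>i\<ge>M. \<forall>j\<ge>M. p (s i \<ominus>\<^bsub>A\<^esub> s j) < r"
  shows "cauchy_in A p s"
  using assms unfolding cauchy_in_def by auto

lemma cauchy_inD:
  assumes "cauchy_in A p s" "r > 0"
  obtains M where "\<And>i j. i \<ge> M \<Longrightarrow> j \<ge> M \<Longrightarrow> p (s i \<ominus>\<^bsub>A\<^esub> s j) < r"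
proof -
  obtain M where "\<forall>i\<ge>M. \<forall>j\<ge>M. p (s i \<ominus>\<^bsub>A\<^esub> s j) < r"
    using assms unfolding cauchy_in_def by blast
  then show thesis using that by blast
qed

lemma p_abs_diff: "x \<in> carrier A \<Longrightarrow> y \<in> carrier A \<Longrightarrow> \<bar>p x - p y\<bar> \<le> p (x \<ominus>\<^bsub>A\<^esub> y)"
  using p_diff_le[of x y] p_diff_le[of y x] p_minus_commute[of x y] by linarith

lemma cauchy_p: assumes "cauchy_in A p s" shows "Cauchy (\<lambda>n. p (s n))"
  unfolding Cauchy_iff
proof (intro allI impI)
  fix r :: real assume "r > 0"
  then obtain M where "\<And>i j. i \<ge> M \<Longrightarrow> j \<ge> M \<Longrightarrow> p (s i \<ominus>\<^bsub>A\<^esub> s j) < r" using cauchy_inD[OF assms] by metis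
  then show "\<exists>M. \<forall>i\<ge>M. \<forall>j\<ge>M. norm (p (s i) - p (s j)) < r"
    using p_abs_diff[OF cauchy_closed[OF assms] cauchy_closed[OF assms]] unfolding real_norm_def
    by (meson le_less_trans)
qed

lemma cauchy_bounded: assumes "cauchy_in A p s" obtains B where "0 < B" "\<And>n. p (s n) \<le> B"
proof -
  obtain B where B: "B > 0" "\<And>n. norm (p (s n)) \<le> B"
    using Cauchy_Bseq[OF cauchy_p[OF assms]] unfolding Bseq_def by blast
  have "p (s n) \<le> B" for n using B(2)[of n] by simp
  then show thesis using that B(1) by blast
qed

lemma minus_add_minus:
  "x \<in> carrier A \<Longrightarrow> y \<in> carrier A \<Longrightarrow> x' \<in> carrier A \<Longrightarrow> y' \<in> carrier A \<Longrightarrow>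
    (x \<oplus>\<^bsub>A\<^esub> y) \<ominus>\<^bsub>A\<^esub> (x' \<oplus>\<^bsub>A\<^esub> y') = (x \<ominus>\<^bsub>A\<^esub> x') \<oplus>\<^bsub>A\<^esub> (y \<ominus>\<^bsub>A\<^esub> y')"
  by (simp add: minus_eq_smult smult_add_right M.a_ac)

lemma smult_minus: "x \<in> carrier A \<Longrightarrow> y \<in> carrier A \<Longrightarrow>
    c \<odot>\<^bsub>A\<^esub> x \<ominus>\<^bsub>A\<^esub> c \<odot>\<^bsub>A\<^esub> y = c \<odot>\<^bsub>A\<^esub> (x \<ominus>\<^bsub>A\<^esub> y)"
  by (simp add: minus_eq_smult smult_add_right smult_smult)

lemma adj_minus: "x \<in> carrier A \<Longrightarrow> y \<in> carrier A \<Longrightarrow> adj A x \<ominus>\<^bsub>A\<^esub> adj A y = adj A (x \<ominus>\<^bsub>A\<^esub> y)"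
  by (simp add: minus_eq_smult adj_add adj_smult)

lemma mult_minus_mult:
  assumes "x \<in> carrier A" "y \<in> carrier A" "x' \<in> carrier A" "y' \<in> carrier A"
  shows "x \<otimes>\<^bsub>A\<^esub> y \<ominus>\<^bsub>A\<^esub> x' \<otimes>\<^bsub>A\<^esub> y' = (x \<ominus>\<^bsub>A\<^esub> x') \<otimes>\<^bsub>A\<^esub> y \<oplus>\<^bsub>A\<^esub> x' \<otimes>\<^bsub>A\<^esub> (y \<ominus>\<^bsub>A\<^esub> y')"
proof -
  have "x' \<otimes>\<^bsub>A\<^esub> y \<oplus>\<^bsub>A\<^esub> (-1) \<odot>\<^bsub>A\<^esub> (x' \<otimes>\<^bsub>A\<^esub> y) = \<zero>\<^bsub>A\<^esub>"
    using assms M.r_neg[of "x' \<otimes>\<^bsub>A\<^esub> y"] uminus_eq_smult[of "x' \<otimes>\<^bsub>A\<^esub> y"] by simp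
  moreover have "(x \<ominus>\<^bsub>A\<^esub> x') \<otimes>\<^bsub>A\<^esub> y \<oplus>\<^bsub>A\<^esub> x' \<otimes>\<^bsub>A\<^esub> (y \<ominus>\<^bsub>A\<^esub> y')
      = (x \<otimes>\<^bsub>A\<^esub> y \<ominus>\<^bsub>A\<^esub> x' \<otimes>\<^bsub>A\<^esub> y') \<oplus>\<^bsub>A\<^esub> (x' \<otimes>\<^bsub>A\<^esub> y \<oplus>\<^bsub>A\<^esub> (-1) \<odot>\<^bsub>A\<^esub> (x' \<otimes>\<^bsub>A\<^esub> y))"
    using assms by (simp add: minus_eq_smult distrib_right distrib_left smult_mult_left smult_mult_right M.a_ac)
  ultimately show ?thesis using assms by simp
qed

lemma p_mult_minus:
  assumes "x \<in> carrier A" "y \<in> carrier A" "x' \<in> carrier A" "y' \<in> carrier A"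
  shows "p (x \<otimes>\<^bsub>A\<^esub> y \<ominus>\<^bsub>A\<^esub> x' \<otimes>\<^bsub>A\<^esub> y') \<le> p (x \<ominus>\<^bsub>A\<^esub> x') * p y + p x' * p (y \<ominus>\<^bsub>A\<^esub> y')"
  unfolding mult_minus_mult[OF assms] using assms
  by (intro order_trans[OF p_add] add_mono p_mult) auto

lemma cauchy_const [intro]: "x \<in> carrier A \<Longrightarrow> cauchy_in A p (\<lambda>_. x)"
  by (rule cauchy_inI) (auto simp: a_minus_def M.r_neg p_zero)

lemma cauchy_add [intro]:
  assumes s: "cauchy_in A p s" and t: "cauchy_in A p t"
  shows "cauchy_in A p (\<lambda>n. s n \<oplus>\<^bsub>A\<^esub> t n)"
proof (rule cauchy_inI)
  note cl = cauchy_closed[OF s] cauchy_closed[OF t]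
  show "s n \<oplus>\<^bsub>A\<^esub> t n \<in> carrier A" for n using cl by simp
  fix r :: real assume r: "r > 0"
  obtain M where M: "\<And>i j. i \<ge> M \<Longrightarrow> j \<ge> M \<Longrightarrow> p (s i \<ominus>\<^bsub>A\<^esub> s j) < r / 2"
    using cauchy_inD[OF s, of "r / 2"] r by auto
  obtain K where K: "\<And>i j. i \<ge> K \<Longrightarrow> j \<ge> K \<Longrightarrow> p (t i \<ominus>\<^bsub>A\<^esub> t j) < r / 2"
    using cauchy_inD[OF t, of "r / 2"] r by auto
  have "p ((s i \<oplus>\<^bsub>A\<^esub> t i) \<ominus>\<^bsub>A\<^esub> (s j \<oplus>\<^bsub>A\<^esub> t j)) < r" if "i \<ge> max M K" "j \<ge> max M K" for i j
    using M[of i j] K[of i j] that p_add[of "s i \<ominus>\<^bsub>A\<^esub> s j" "t i \<ominus>\<^bsub>A\<^esub> t j"] cl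
    by (simp add: minus_add_minus)
  then show "\<exists>M. \<forall>i\<ge>M. \<forall>j\<ge>M. p ((s i \<oplus>\<^bsub>A\<^esub> t i) \<ominus>\<^bsub>A\<^esub> (s j \<oplus>\<^bsub>A\<^esub> t j)) < r" by blast
qed

lemma cauchy_smult [intro]:
  assumes s: "cauchy_in A p s" shows "cauchy_in A p (\<lambda>n. c \<odot>\<^bsub>A\<^esub> s n)"
proof (rule cauchy_inI)
  note cl = cauchy_closed[OF s]
  show "c \<odot>\<^bsub>A\<^esub> s n \<in> carrier A" for n using cl by simp
  fix r :: real assume r: "r > 0"
  obtain M where M: "\<And>i j. i \<ge> M \<Longrightarrow> j \<ge> M \<Longrightarrow> p (s i \<ominus>\<^bsub>A\<^esub> s j) < r / (cmod c + 1)"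
    using cauchy_inD[OF s, of "r / (cmod c + 1)"] r by (auto simp: add_nonneg_pos)
  have "p (c \<odot>\<^bsub>A\<^esub> s i \<ominus>\<^bsub>A\<^esub> c \<odot>\<^bsub>A\<^esub> s j) < r" if "i \<ge> M" "j \<ge> M" for i j
  proof -
    have "cmod c * p (s i \<ominus>\<^bsub>A\<^esub> s j) \<le> (cmod c + 1) * p (s i \<ominus>\<^bsub>A\<^esub> s j)"
      using cl p_ge_0 by (intro mult_right_mono) auto
    also have "\<dots> < r" using M[OF that] by (simp add: pos_less_divide_eq add_nonneg_pos mult.commute)
    finally show ?thesis using cl by (simp add: smult_minus p_smult)
  qed
  then show "\<exists>M. \<forall>i\<ge>M. \<forall>j\<ge>M. p (c \<odot>\<^bsub>A\<^esub> s i \<ominus>\<^bsub>A\<^esub> c \<odot>\<^bsub>A\<^esub> s j) < r" by blast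
qed

lemma cauchy_adj [intro]:
  assumes s: "cauchy_in A p s" shows "cauchy_in A p (\<lambda>n. adj A (s n))"
proof (rule cauchy_inI)
  note cl = cauchy_closed[OF s]
  show "adj A (s n) \<in> carrier A" for n using cl by simp
  fix r :: real assume r: "r > 0"
  show "\<exists>M. \<forall>i\<ge>M. \<forall>j\<ge>M. p (adj A (s i) \<ominus>\<^bsub>A\<^esub> adj A (s j)) < r"
    using cauchy_inD[OF s r] cl by (simp add: adj_minus p_adj) metis
qed

lemma cauchy_mult [intro]:
  assumes s: "cauchy_in A p s" and t: "cauchy_in A p t"
  shows "cauchy_in A p (\<lambda>n. s n \<otimes>\<^bsub>A\<^esub> t n)"
proof (rule cauchy_inI)
  note cl = cauchy_closed[OF s] cauchy_closed[OF t]
  show "s n \<otimes>\<^bsub>A\<^esub> t n \<in> carrier A" for n using cl by simp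
  fix r :: real assume r: "r > 0"
  obtain B where B: "B > 0" "\<And>n. p (s n) \<le> B" using cauchy_bounded[OF s] by blast
  obtain C where C: "C > 0" "\<And>n. p (t n) \<le> C" using cauchy_bounded[OF t] by blast
  obtain M where M: "\<And>i j. i \<ge> M \<Longrightarrow> j \<ge> M \<Longrightarrow> p (s i \<ominus>\<^bsub>A\<^esub> s j) < r / (2 * C)"
    using cauchy_inD[OF s, of "r / (2 * C)"] r C by auto
  obtain K where K: "\<And>i j. i \<ge> K \<Longrightarrow> j \<ge> K \<Longrightarrow> p (t i \<ominus>\<^bsub>A\<^esub> t j) < r / (2 * B)"
    using cauchy_inD[OF t, of "r / (2 * B)"] r B by auto
  have "p (s i \<otimes>\<^bsub>A\<^esub> t i \<ominus>\<^bsub>A\<^esub> s j \<otimes>\<^bsub>A\<^esub> t j) < r" if "i \<ge> max M K" "j \<ge> max M K" for i j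
  proof -
    have "p (s i \<ominus>\<^bsub>A\<^esub> s j) * p (t i) \<le> p (s i \<ominus>\<^bsub>A\<^esub> s j) * C"
      using C cl p_ge_0 by (intro mult_left_mono) auto
    also have "\<dots> < r / 2" using M[of i j] that C by (simp add: field_simps)
    finally have 1: "p (s i \<ominus>\<^bsub>A\<^esub> s j) * p (t i) < r / 2" .
    have "p (s j) * p (t i \<ominus>\<^bsub>A\<^esub> t j) \<le> B * p (t i \<ominus>\<^bsub>A\<^esub> t j)"
      using B cl p_ge_0 by (intro mult_right_mono) auto
    also have "\<dots> < r / 2" using K[of i j] that B by (simp add: field_simps)
    finally show ?thesis using 1 p_mult_minus[of "s i" "t i" "s j" "t j"] cl by simp
  qed
  then show "\<exists>M. \<forall>i\<ge>M. \<forall>j\<ge>M. p (s i \<otimes>\<^bsub>A\<^esub> t i \<ominus>\<^bsub>A\<^esub> s j \<otimes>\<^bsub>A\<^esub> t j) < r" by blast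
qed

lemma equiv_iff: "(s, t) \<in> seminorm_equiv A p \<longleftrightarrow>
    cauchy_in A p s \<and> cauchy_in A p t \<and> (\<lambda>n. p (s n \<ominus>\<^bsub>A\<^esub> t n)) \<longlonglongrightarrow> 0"
  unfolding seminorm_equiv_def by simp

lemma null_seqI:
  assumes "\<And>n. 0 \<le> (f n :: real)" "\<And>n. f n \<le> g n" "g \<longlonglongrightarrow> 0" shows "f \<longlonglongrightarrow> 0"
  using assms by (intro tendsto_sandwich[OF _ _ tendsto_const assms(3)]) auto

lemma equiv_rel: "equiv Cs (seminorm_equiv A p)"
proof (rule equivI)
  show "seminorm_equiv A p \<subseteq> Cs \<times> Cs" unfolding seminorm_equiv_def by auto
  show "refl_on Cs (seminorm_equiv A p)"
    unfolding refl_on_def seminorm_equiv_def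
    by (auto simp: a_minus_def M.r_neg p_zero cauchy_closed)
  show "sym (seminorm_equiv A p)"
  proof (rule symI)
    fix s t assume "(s, t) \<in> seminorm_equiv A p"
    then have *: "cauchy_in A p s" "cauchy_in A p t" "(\<lambda>n. p (s n \<ominus>\<^bsub>A\<^esub> t n)) \<longlonglongrightarrow> 0"
      unfolding equiv_iff by auto
    have "p (s n \<ominus>\<^bsub>A\<^esub> t n) = p (t n \<ominus>\<^bsub>A\<^esub> s n)" for n
      by (intro p_minus_commute cauchy_closed *)
    then show "(t, s) \<in> seminorm_equiv A p" using * unfolding equiv_iff by simp
  qed
  show "trans (seminorm_equiv A p)"
  proof (rule transI)
    fix s t u assume "(s, t) \<in> seminorm_equiv A p" "(t, u) \<in> seminorm_equiv A p"
    then have *: "cauchy_in A p s" "cauchy_in A p t" "cauchy_in A p u"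
      "(\<lambda>n. p (s n \<ominus>\<^bsub>A\<^esub> t n)) \<longlonglongrightarrow> 0" "(\<lambda>n. p (t n \<ominus>\<^bsub>A\<^esub> u n)) \<longlonglongrightarrow> 0"
      unfolding equiv_iff by auto
    note cl = cauchy_closed[OF *(1)] cauchy_closed[OF *(2)] cauchy_closed[OF *(3)]
    have "(\<lambda>n. p (s n \<ominus>\<^bsub>A\<^esub> u n)) \<longlonglongrightarrow> 0"
    proof (rule null_seqI)
      show "0 \<le> p (s n \<ominus>\<^bsub>A\<^esub> u n)" for n using cl by (intro p_ge_0) auto
      show "p (s n \<ominus>\<^bsub>A\<^esub> u n) \<le> p (s n \<ominus>\<^bsub>A\<^esub> t n) + p (t n \<ominus>\<^bsub>A\<^esub> u n)" for n
        using cl by (intro p_triangle) auto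
      show "(\<lambda>n. p (s n \<ominus>\<^bsub>A\<^esub> t n) + p (t n \<ominus>\<^bsub>A\<^esub> u n)) \<longlonglongrightarrow> 0"
        using tendsto_add[OF *(4,5)] by simp
    qed
    then show "(s, u) \<in> seminorm_equiv A p" using * unfolding equiv_iff by auto
  qed
qed

lemma cls_eq_iff: "cauchy_in A p s \<Longrightarrow> cauchy_in A p t \<Longrightarrow>
    cls s = cls t \<longleftrightarrow> (\<lambda>n. p (s n \<ominus>\<^bsub>A\<^esub> t n)) \<longlonglongrightarrow> 0"
  using eq_equiv_class_iff[OF equiv_rel, of s t] equiv_iff by auto

lemma cls_closed [simp, intro]: "cauchy_in A p s \<Longrightarrow> cls s \<in> carrier Cp"
  unfolding seminorm_completion_def by (auto intro: quotientI)

lemma cls_cases: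
  assumes "S \<in> carrier Cp" obtains s where "cauchy_in A p s" "S = cls s"
  using assms unfolding seminorm_completion_def by (auto elim: quotientE)

text \<open>In the record the operations are unions over all representatives. Congruence makes all
  members of the union the same class, so that the union collapses.\<close>

lemma Cp_add:
  assumes "cauchy_in A p s" "cauchy_in A p t"
  shows "cls s \<oplus>\<^bsub>Cp\<^esub> cls t = cls (\<lambda>n. s n \<oplus>\<^bsub>A\<^esub> t n)"
proof -
  have "congruent2 (seminorm_equiv A p) (seminorm_equiv A p) (\<lambda>s t. cls (\<lambda>n. s n \<oplus>\<^bsub>A\<^esub> t n))"
  proof (rule congruent2I')
    fix s s' t t' assume "(s, s') \<in> seminorm_equiv A p" "(t, t') \<in> seminorm_equiv A p"
    then have *: "cauchy_in A p s" "cauchy_in A p s'" "cauchy_in A p t" "cauchy_in A p t'"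
      "(\<lambda>n. p (s n \<ominus>\<^bsub>A\<^esub> s' n)) \<longlonglongrightarrow> 0" "(\<lambda>n. p (t n \<ominus>\<^bsub>A\<^esub> t' n)) \<longlonglongrightarrow> 0"
      unfolding equiv_iff by auto
    note cl = cauchy_closed[OF *(1)] cauchy_closed[OF *(2)] cauchy_closed[OF *(3)] cauchy_closed[OF *(4)]
    have "(\<lambda>n. p ((s n \<oplus>\<^bsub>A\<^esub> t n) \<ominus>\<^bsub>A\<^esub> (s' n \<oplus>\<^bsub>A\<^esub> t' n))) \<longlonglongrightarrow> 0"
    proof (rule null_seqI)
      show "0 \<le> p ((s n \<oplus>\<^bsub>A\<^esub> t n) \<ominus>\<^bsub>A\<^esub> (s' n \<oplus>\<^bsub>A\<^esub> t' n))" for n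
        using cl by (intro p_ge_0) auto
      show "p ((s n \<oplus>\<^bsub>A\<^esub> t n) \<ominus>\<^bsub>A\<^esub> (s' n \<oplus>\<^bsub>A\<^esub> t' n)) \<le> p (s n \<ominus>\<^bsub>A\<^esub> s' n) + p (t n \<ominus>\<^bsub>A\<^esub> t' n)" for n
        using cl by (simp add: minus_add_minus p_add)
      show "(\<lambda>n. p (s n \<ominus>\<^bsub>A\<^esub> s' n) + p (t n \<ominus>\<^bsub>A\<^esub> t' n)) \<longlonglongrightarrow> 0"
        using tendsto_add[OF *(5,6)] by simp
    qed
    then show "cls (\<lambda>n. s n \<oplus>\<^bsub>A\<^esub> t n) = cls (\<lambda>n. s' n \<oplus>\<^bsub>A\<^esub> t' n)"
      using * by (subst cls_eq_iff) auto
  qed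
  from UN_equiv_class2[OF equiv_rel equiv_rel this] show ?thesis
    using assms unfolding seminorm_completion_def by simp
qed

lemma Cp_mult:
  assumes "cauchy_in A p s" "cauchy_in A p t"
  shows "cls s \<otimes>\<^bsub>Cp\<^esub> cls t = cls (\<lambda>n. s n \<otimes>\<^bsub>A\<^esub> t n)"
proof -
  have "congruent2 (seminorm_equiv A p) (seminorm_equiv A p) (\<lambda>s t. cls (\<lambda>n. s n \<otimes>\<^bsub>A\<^esub> t n))"
  proof (rule congruent2I')
    fix s s' t t' assume "(s, s') \<in> seminorm_equiv A p" "(t, t') \<in> seminorm_equiv A p"
    then have *: "cauchy_in A p s" "cauchy_in A p s'" "cauchy_in A p t" "cauchy_in A p t'"
      "(\<lambda>n. p (s n \<ominus>\<^bsub>A\<^esub> s' n)) \<longlonglongrightarrow> 0" "(\<lambda>n. p (t n \<ominus>\<^bsub>A\<^esub> t' n)) \<longlonglongrightarrow> 0"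
      unfolding equiv_iff by auto
    note cl = cauchy_closed[OF *(1)] cauchy_closed[OF *(2)] cauchy_closed[OF *(3)] cauchy_closed[OF *(4)]
    obtain B where B: "B > 0" "\<And>n. p (s' n) \<le> B" using cauchy_bounded[OF *(2)] by blast
    obtain C where C: "C > 0" "\<And>n. p (t n) \<le> C" using cauchy_bounded[OF *(3)] by blast
    have "(\<lambda>n. p (s n \<otimes>\<^bsub>A\<^esub> t n \<ominus>\<^bsub>A\<^esub> s' n \<otimes>\<^bsub>A\<^esub> t' n)) \<longlonglongrightarrow> 0"
    proof (rule null_seqI)
      show "0 \<le> p (s n \<otimes>\<^bsub>A\<^esub> t n \<ominus>\<^bsub>A\<^esub> s' n \<otimes>\<^bsub>A\<^esub> t' n)" for n
        using cl by (intro p_ge_0) auto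
      show "p (s n \<otimes>\<^bsub>A\<^esub> t n \<ominus>\<^bsub>A\<^esub> s' n \<otimes>\<^bsub>A\<^esub> t' n) \<le> p (s n \<ominus>\<^bsub>A\<^esub> s' n) * C + B * p (t n \<ominus>\<^bsub>A\<^esub> t' n)" for n
        using B C cl by (intro order_trans[OF p_mult_minus] add_mono mult_left_mono mult_right_mono p_ge_0) auto
      show "(\<lambda>n. p (s n \<ominus>\<^bsub>A\<^esub> s' n) * C + B * p (t n \<ominus>\<^bsub>A\<^esub> t' n)) \<longlonglongrightarrow> 0"
        using tendsto_add[OF tendsto_mult_right[OF *(5), of C] tendsto_mult_left[OF *(6), of B]] by simp
    qed
    then show "cls (\<lambda>n. s n \<otimes>\<^bsub>A\<^esub> t n) = cls (\<lambda>n. s' n \<otimes>\<^bsub>A\<^esub> t' n)"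
      using * by (subst cls_eq_iff) auto
  qed
  from UN_equiv_class2[OF equiv_rel equiv_rel this] show ?thesis
    using assms unfolding seminorm_completion_def by simp
qed

lemma Cp_smult:
  assumes "cauchy_in A p s" shows "c \<odot>\<^bsub>Cp\<^esub> cls s = cls (\<lambda>n. c \<odot>\<^bsub>A\<^esub> s n)"
proof -
  have "congruent (seminorm_equiv A p) (\<lambda>s. cls (\<lambda>n. c \<odot>\<^bsub>A\<^esub> s n))"
  proof (rule congruentI)
    fix s s' assume "(s, s') \<in> seminorm_equiv A p"
    then have *: "cauchy_in A p s" "cauchy_in A p s'" "(\<lambda>n. p (s n \<ominus>\<^bsub>A\<^esub> s' n)) \<longlonglongrightarrow> 0"
      unfolding equiv_iff by auto
    have "(\<lambda>n. p (c \<odot>\<^bsub>A\<^esub> s n \<ominus>\<^bsub>A\<^esub> c \<odot>\<^bsub>A\<^esub> s' n)) \<longlonglongrightarrow> 0"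
      using tendsto_mult_left[OF *(3), of "cmod c"] cauchy_closed[OF *(1)] cauchy_closed[OF *(2)]
      by (simp add: smult_minus p_smult)
    then show "cls (\<lambda>n. c \<odot>\<^bsub>A\<^esub> s n) = cls (\<lambda>n. c \<odot>\<^bsub>A\<^esub> s' n)"
      using * by (subst cls_eq_iff) auto
  qed
  from UN_equiv_class[OF equiv_rel this] show ?thesis
    using assms unfolding seminorm_completion_def by simp
qed

lemma Cp_adj:
  assumes "cauchy_in A p s" shows "adj Cp (cls s) = cls (\<lambda>n. adj A (s n))"
proof -
  have "congruent (seminorm_equiv A p) (\<lambda>s. cls (\<lambda>n. adj A (s n)))"
  proof (rule congruentI)
    fix s s' assume "(s, s') \<in> seminorm_equiv A p"
    then have *: "cauchy_in A p s" "cauchy_in A p s'" "(\<lambda>n. p (s n \<ominus>\<^bsub>A\<^esub> s' n)) \<longlonglongrightarrow> 0"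
      unfolding equiv_iff by auto
    have "(\<lambda>n. p (adj A (s n) \<ominus>\<^bsub>A\<^esub> adj A (s' n))) \<longlonglongrightarrow> 0"
      using *(3) cauchy_closed[OF *(1)] cauchy_closed[OF *(2)] by (simp add: adj_minus p_adj)
    then show "cls (\<lambda>n. adj A (s n)) = cls (\<lambda>n. adj A (s' n))"
      using * by (subst cls_eq_iff) auto
  qed
  from UN_equiv_class[OF equiv_rel this] show ?thesis
    using assms unfolding seminorm_completion_def by simp
qed

lemma Cp_zero: "\<zero>\<^bsub>Cp\<^esub> = cls (\<lambda>_. \<zero>\<^bsub>A\<^esub>)" and Cp_one: "\<one>\<^bsub>Cp\<^esub> = cls (\<lambda>_. \<one>\<^bsub>A\<^esub>)"
  unfolding seminorm_completion_def by simp_all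

text \<open>The norm of a class is read off one representative picked by choice. Equivalent
  sequences have the same limit of \<open>p\<close>, so any representative may be used
  instead.\<close>

lemma Cp_norm:
  assumes s: "cauchy_in A p s" shows "(\<lambda>n. p (s n)) \<longlonglongrightarrow> cnorm Cp (cls s)"
proof -
  define t where "t = (SOME s'. s' \<in> cls s)"
  have "s \<in> cls s" using s equiv_class_self[OF equiv_rel] by simp
  then have "t \<in> cls s" unfolding t_def by (rule someI[of "\<lambda>s'. s' \<in> cls s"])
  then have t: "cauchy_in A p t" "(\<lambda>n. p (s n \<ominus>\<^bsub>A\<^esub> t n)) \<longlonglongrightarrow> 0" using equiv_iff by auto
  have "convergent (\<lambda>n. p (t n))" using cauchy_p[OF t(1)] by (rule Cauchy_convergent)
  then have 1: "(\<lambda>n. p (t n)) \<longlonglongrightarrow> lim (\<lambda>n. p (t n))" by (rule convergent_LIMSEQ_iff[THEN iffD1])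
  have "(\<lambda>n. \<bar>p (s n) - p (t n)\<bar>) \<longlonglongrightarrow> 0"
    by (rule null_seqI[OF _ p_abs_diff[OF cauchy_closed[OF s] cauchy_closed[OF t(1)]] t(2)]) simp
  then have "(\<lambda>n. p (s n) - p (t n)) \<longlonglongrightarrow> 0" using tendsto_rabs_zero_iff by blast
  from tendsto_add[OF this 1] show ?thesis
    unfolding seminorm_completion_def t_def by simp
qed

lemma star_algebra_Cp: "star_algebra Cp"
proof -
  have add: "abelian_group Cp"
  proof (rule abelian_groupI)
    show "\<zero>\<^bsub>Cp\<^esub> \<in> carrier Cp" unfolding Cp_zero by auto
    fix S T U assume "S \<in> carrier Cp" "T \<in> carrier Cp" "U \<in> carrier Cp"
    then obtain s t u where s: "cauchy_in A p s" "S = cls s" and t: "cauchy_in A p t" "T = cls t"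
      and u: "cauchy_in A p u" "U = cls u" using cls_cases by metis
    note cl = cauchy_closed[OF s(1)] cauchy_closed[OF t(1)] cauchy_closed[OF u(1)]
    show "S \<oplus>\<^bsub>Cp\<^esub> T \<in> carrier Cp" using s t by (auto simp: Cp_add)
    show "S \<oplus>\<^bsub>Cp\<^esub> T \<oplus>\<^bsub>Cp\<^esub> U = S \<oplus>\<^bsub>Cp\<^esub> (T \<oplus>\<^bsub>Cp\<^esub> U)"
      using s t u cl by (simp add: Cp_add cauchy_add M.a_assoc)
    show "S \<oplus>\<^bsub>Cp\<^esub> T = T \<oplus>\<^bsub>Cp\<^esub> S" using s t cl by (simp add: Cp_add M.a_comm)
  next
    fix S assume "S \<in> carrier Cp"
    then obtain s where s: "cauchy_in A p s" "S = cls s" using cls_cases by metis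
    note cl = cauchy_closed[OF s(1)]
    show "\<zero>\<^bsub>Cp\<^esub> \<oplus>\<^bsub>Cp\<^esub> S = S" unfolding Cp_zero using s cl by (simp add: Cp_add cauchy_const)
    have "(-1) \<odot>\<^bsub>A\<^esub> s n \<oplus>\<^bsub>A\<^esub> s n = \<zero>\<^bsub>A\<^esub>" for n
      using cl[of n] M.l_neg[of "s n"] by (simp add: uminus_eq_smult)
    then have "cls (\<lambda>n. (-1) \<odot>\<^bsub>A\<^esub> s n) \<oplus>\<^bsub>Cp\<^esub> S = \<zero>\<^bsub>Cp\<^esub>"
      using s by (simp add: Cp_add cauchy_smult Cp_zero)
    then show "\<exists>T\<in>carrier Cp. T \<oplus>\<^bsub>Cp\<^esub> S = \<zero>\<^bsub>Cp\<^esub>" using cauchy_smult[OF s(1)] by blast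
  qed
  have md: "module complex_alg Cp"
  proof (rule moduleI[OF cring_complex_alg add])
    fix c d :: complex and S T assume "S \<in> carrier Cp" "T \<in> carrier Cp"
    then obtain s t where s: "cauchy_in A p s" "S = cls s" and t: "cauchy_in A p t" "T = cls t"
      using cls_cases by metis
    note cl = cauchy_closed[OF s(1)] cauchy_closed[OF t(1)]
    show "c \<odot>\<^bsub>Cp\<^esub> (S \<oplus>\<^bsub>Cp\<^esub> T) = c \<odot>\<^bsub>Cp\<^esub> S \<oplus>\<^bsub>Cp\<^esub> c \<odot>\<^bsub>Cp\<^esub> T"
      using s t cl by (simp add: Cp_add Cp_smult cauchy_add cauchy_smult smult_add_right)
  next
    fix c d :: complex and S assume "S \<in> carrier Cp"
    then obtain s where s: "cauchy_in A p s" "S = cls s" using cls_cases by metis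
    note cl = cauchy_closed[OF s(1)]
    show "c \<odot>\<^bsub>Cp\<^esub> S \<in> carrier Cp" using s by (auto simp: Cp_smult)
    show "(c \<oplus>\<^bsub>complex_alg\<^esub> d) \<odot>\<^bsub>Cp\<^esub> S = c \<odot>\<^bsub>Cp\<^esub> S \<oplus>\<^bsub>Cp\<^esub> d \<odot>\<^bsub>Cp\<^esub> S"
      using s cl by (simp add: Cp_add Cp_smult cauchy_smult smult_add_left)
    show "(c \<otimes>\<^bsub>complex_alg\<^esub> d) \<odot>\<^bsub>Cp\<^esub> S = c \<odot>\<^bsub>Cp\<^esub> (d \<odot>\<^bsub>Cp\<^esub> S)"
      using s cl by (simp add: Cp_smult cauchy_smult smult_smult)
    show "\<one>\<^bsub>complex_alg\<^esub> \<odot>\<^bsub>Cp\<^esub> S = S" using s cl by (simp add: Cp_smult)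
  qed
  show ?thesis
  proof (intro star_algebra.intro md star_algebra_axioms.intro)
    fix S T U assume "S \<in> carrier Cp" "T \<in> carrier Cp" "U \<in> carrier Cp"
    then obtain s t u where s: "cauchy_in A p s" "S = cls s" and t: "cauchy_in A p t" "T = cls t"
      and u: "cauchy_in A p u" "U = cls u" using cls_cases by metis
    note cl = cauchy_closed[OF s(1)] cauchy_closed[OF t(1)] cauchy_closed[OF u(1)]
    show "S \<otimes>\<^bsub>Cp\<^esub> T \<otimes>\<^bsub>Cp\<^esub> U = S \<otimes>\<^bsub>Cp\<^esub> (T \<otimes>\<^bsub>Cp\<^esub> U)"
      "(S \<oplus>\<^bsub>Cp\<^esub> T) \<otimes>\<^bsub>Cp\<^esub> U = S \<otimes>\<^bsub>Cp\<^esub> U \<oplus>\<^bsub>Cp\<^esub> T \<otimes>\<^bsub>Cp\<^esub> U"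
      "S \<otimes>\<^bsub>Cp\<^esub> (T \<oplus>\<^bsub>Cp\<^esub> U) = S \<otimes>\<^bsub>Cp\<^esub> T \<oplus>\<^bsub>Cp\<^esub> S \<otimes>\<^bsub>Cp\<^esub> U"
      using s t u cl by (simp_all add: Cp_add Cp_mult cauchy_mult cauchy_add mult_assoc distrib_left distrib_right)
  next
    fix c S T assume "S \<in> carrier Cp" "T \<in> carrier Cp"
    then obtain s t where s: "cauchy_in A p s" "S = cls s" and t: "cauchy_in A p t" "T = cls t"
      using cls_cases by metis
    note cl = cauchy_closed[OF s(1)] cauchy_closed[OF t(1)]
    show "S \<otimes>\<^bsub>Cp\<^esub> T \<in> carrier Cp" using s t by (auto simp: Cp_mult)
    show "(c \<odot>\<^bsub>Cp\<^esub> S) \<otimes>\<^bsub>Cp\<^esub> T = c \<odot>\<^bsub>Cp\<^esub> (S \<otimes>\<^bsub>Cp\<^esub> T)" "S \<otimes>\<^bsub>Cp\<^esub> (c \<odot>\<^bsub>Cp\<^esub> T) = c \<odot>\<^bsub>Cp\<^esub> (S \<otimes>\<^bsub>Cp\<^esub> T)"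
      "adj Cp (S \<oplus>\<^bsub>Cp\<^esub> T) = adj Cp S \<oplus>\<^bsub>Cp\<^esub> adj Cp T" "adj Cp (S \<otimes>\<^bsub>Cp\<^esub> T) = adj Cp T \<otimes>\<^bsub>Cp\<^esub> adj Cp S"
      using s t cl by (simp_all add: Cp_add Cp_mult Cp_smult Cp_adj cauchy_mult cauchy_add cauchy_smult cauchy_adj
          smult_mult_left smult_mult_right adj_add adj_mult)
  next
    fix c S assume "S \<in> carrier Cp"
    then obtain s where s: "cauchy_in A p s" "S = cls s" using cls_cases by metis
    note cl = cauchy_closed[OF s(1)]
    show "adj Cp S \<in> carrier Cp" using s by (auto simp: Cp_adj)
    show "adj Cp (adj Cp S) = S" "adj Cp (c \<odot>\<^bsub>Cp\<^esub> S) = cnj c \<odot>\<^bsub>Cp\<^esub> adj Cp S"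
      using s cl by (simp_all add: Cp_smult Cp_adj cauchy_smult cauchy_adj adj_adj adj_smult)
  qed
qed

sublocale Q: star_algebra Cp by (rule star_algebra_Cp)

lemma Cp_minus:
  assumes "cauchy_in A p s" "cauchy_in A p t"
  shows "cls s \<ominus>\<^bsub>Cp\<^esub> cls t = cls (\<lambda>n. s n \<ominus>\<^bsub>A\<^esub> t n)"
  using assms cauchy_closed[OF assms(1)] cauchy_closed[OF assms(2)]
  by (simp add: Q.minus_eq_smult minus_eq_smult Cp_smult Cp_add cauchy_smult)

lemma Cp_seminorm: "cstar_seminorm Cp (cnorm Cp)"
  unfolding cstar_seminorm_def
proof (intro conjI ballI allI)
  fix S T c assume "S \<in> carrier Cp"
  then obtain s where s: "cauchy_in A p s" "S = cls s" using cls_cases by metis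
  note cl = cauchy_closed[OF s(1)]
  note sl = Cp_norm[OF s(1), folded s(2)]
  show "0 \<le> cnorm Cp S" using sl p_ge_0[OF cl] by (intro LIMSEQ_le_const[OF sl]) auto
  have "(\<lambda>n. p (c \<odot>\<^bsub>A\<^esub> s n)) \<longlonglongrightarrow> cnorm Cp (c \<odot>\<^bsub>Cp\<^esub> S)"
    using Cp_norm[OF cauchy_smult[OF s(1)]] s by (simp add: Cp_smult)
  moreover have "(\<lambda>n. p (c \<odot>\<^bsub>A\<^esub> s n)) \<longlonglongrightarrow> cmod c * cnorm Cp S"
    using tendsto_mult_left[OF sl] cl by (simp add: p_smult)
  ultimately show "cnorm Cp (c \<odot>\<^bsub>Cp\<^esub> S) = cmod c * cnorm Cp S" using LIMSEQ_unique by blast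
  have "(\<lambda>n. p (adj A (s n) \<otimes>\<^bsub>A\<^esub> s n)) \<longlonglongrightarrow> cnorm Cp (adj Cp S \<otimes>\<^bsub>Cp\<^esub> S)"
    using Cp_norm[OF cauchy_mult[OF cauchy_adj[OF s(1)] s(1)]] s by (simp add: Cp_mult Cp_adj cauchy_adj)
  moreover have "(\<lambda>n. p (adj A (s n) \<otimes>\<^bsub>A\<^esub> s n)) \<longlonglongrightarrow> (cnorm Cp S)\<^sup>2"
    using tendsto_power[OF sl, of 2] cl by (simp add: p_cstar)
  ultimately show "cnorm Cp (adj Cp S \<otimes>\<^bsub>Cp\<^esub> S) = (cnorm Cp S)\<^sup>2" using LIMSEQ_unique by blast
  assume "T \<in> carrier Cp"
  then obtain t where t: "cauchy_in A p t" "T = cls t" using cls_cases by metis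
  note clt = cauchy_closed[OF t(1)]
  note tl = Cp_norm[OF t(1), folded t(2)]
  have "(\<lambda>n. p (s n \<oplus>\<^bsub>A\<^esub> t n)) \<longlonglongrightarrow> cnorm Cp (S \<oplus>\<^bsub>Cp\<^esub> T)"
    using Cp_norm[OF cauchy_add[OF s(1) t(1)]] s t by (simp add: Cp_add)
  then show "cnorm Cp (S \<oplus>\<^bsub>Cp\<^esub> T) \<le> cnorm Cp S + cnorm Cp T"
    using p_add[OF cl clt] by (intro LIMSEQ_le[OF _ tendsto_add[OF sl tl]]) auto
  have "(\<lambda>n. p (s n \<otimes>\<^bsub>A\<^esub> t n)) \<longlonglongrightarrow> cnorm Cp (S \<otimes>\<^bsub>Cp\<^esub> T)"
    using Cp_norm[OF cauchy_mult[OF s(1) t(1)]] s t by (simp add: Cp_mult)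
  then show "cnorm Cp (S \<otimes>\<^bsub>Cp\<^esub> T) \<le> cnorm Cp S * cnorm Cp T"
    using p_mult[OF cl clt] by (intro LIMSEQ_le[OF _ tendsto_mult[OF sl tl]]) auto
qed

lemma norm_diff_const:
  assumes s: "cauchy_in A p s" and M: "\<And>i j. i \<ge> M \<Longrightarrow> j \<ge> M \<Longrightarrow> p (s i \<ominus>\<^bsub>A\<^esub> s j) < r" and n: "n \<ge> M"
  shows "cnorm Cp (cls s \<ominus>\<^bsub>Cp\<^esub> cls (\<lambda>_. s n)) \<le> r"
proof -
  have c: "cauchy_in A p (\<lambda>_. s n)" using cauchy_closed[OF s] by blast
  have d: "cauchy_in A p (\<lambda>m. s m \<ominus>\<^bsub>A\<^esub> s n)"
    using cauchy_add[OF s cauchy_smult[OF c, of "-1"]] cauchy_closed[OF s] by (simp add: minus_eq_smult)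
  have "(\<lambda>m. p (s m \<ominus>\<^bsub>A\<^esub> s n)) \<longlonglongrightarrow> cnorm Cp (cls s \<ominus>\<^bsub>Cp\<^esub> cls (\<lambda>_. s n))"
    using Cp_norm[OF d] by (simp add: Cp_minus[OF s c])
  then show ?thesis using M n by (intro LIMSEQ_le_const2) (auto intro!: exI[of _ M] less_imp_le)
qed

lemma dense:
  assumes "S \<in> carrier Cp" "r > 0"
  obtains a where "a \<in> carrier A" "cnorm Cp (S \<ominus>\<^bsub>Cp\<^esub> cls (\<lambda>_. a)) \<le> r"
proof -
  obtain s where s: "cauchy_in A p s" "S = cls s" using assms(1) cls_cases by metis
  obtain M where "\<And>i j. i \<ge> M \<Longrightarrow> j \<ge> M \<Longrightarrow> p (s i \<ominus>\<^bsub>A\<^esub> s j) < r" using cauchy_inD[OF s(1) assms(2)] by metis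
  from norm_diff_const[OF s(1) this order_refl] show thesis
    using that cauchy_closed[OF s(1)] s(2) by blast
qed

lemma norm_const: "a \<in> carrier A \<Longrightarrow> cnorm Cp (cls (\<lambda>_. a)) = p a"
  using Cp_norm[OF cauchy_const, of a] LIMSEQ_unique[OF tendsto_const] by metis

text \<open>The \<open>n\<close>-th term of a Cauchy sequence of classes is approximated by a
  constant sequence \<open>a n\<close> up to \<open>1 / (n + 1)\<close>. Then \<open>a\<close> is a
  Cauchy sequence of the original algebra, and its class is the limit.\<close>

theorem cstar_Cp: "cstar_algebra Cp"
proof (intro cstar_algebra.intro cstar_algebra_axioms.intro star_algebra_Cp Cp_seminorm)
  fix S assume S: "S \<in> carrier Cp" "cnorm Cp S = 0"
  obtain s where s: "cauchy_in A p s" "S = cls s" using S(1) cls_cases by metis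
  have "(\<lambda>n. p (s n)) \<longlonglongrightarrow> 0" using Cp_norm[OF s(1)] s(2) S(2) by simp
  then show "S = \<zero>\<^bsub>Cp\<^esub>" unfolding s(2) Cp_zero using s(1) cauchy_closed[OF s(1)]
    by (subst cls_eq_iff) (auto simp: minus_eq_smult)
next
  fix S assume S: "cauchy_in Cp (cnorm Cp) S"
  have Sc: "S n \<in> carrier Cp" for n using S unfolding cauchy_in_def by auto
  have "\<exists>a\<in>carrier A. cnorm Cp (S n \<ominus>\<^bsub>Cp\<^esub> cls (\<lambda>_. a)) \<le> 1 / real (Suc n)" for n
    using dense[OF Sc[of n], of "1 / real (Suc n)"] by (metis zero_less_divide_1_iff of_nat_0_less_iff zero_less_Suc)
  then obtain a where a: "\<And>n. a n \<in> carrier A" "\<And>n. cnorm Cp (S n \<ominus>\<^bsub>Cp\<^esub> cls (\<lambda>_. a n)) \<le> 1 / real (Suc n)"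
    by metis
  note ca = cauchy_const[OF a(1)]
  have tri: "cnorm Cp (U \<ominus>\<^bsub>Cp\<^esub> W) \<le> cnorm Cp (U \<ominus>\<^bsub>Cp\<^esub> V) + cnorm Cp (V \<ominus>\<^bsub>Cp\<^esub> W)"
    if "U \<in> carrier Cp" "V \<in> carrier Cp" "W \<in> carrier Cp" for U V W
    using Q.seminorm_minus_triangle[OF Cp_seminorm that] .
  have comm: "cnorm Cp (U \<ominus>\<^bsub>Cp\<^esub> V) = cnorm Cp (V \<ominus>\<^bsub>Cp\<^esub> U)"
    if "U \<in> carrier Cp" "V \<in> carrier Cp" for U V using Q.seminorm_minus_commute[OF Cp_seminorm that] .
  have small: "\<exists>M. \<forall>n\<ge>M. 1 / real (Suc n) < r" if r: "r > 0" for r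
  proof -
    obtain M where "inverse (real (Suc M)) < r" using reals_Archimedean[OF r] by blast
    moreover have "1 / real (Suc n) \<le> inverse (real (Suc M))" if "n \<ge> M" for n
      unfolding inverse_eq_divide using that by (intro divide_left_mono) auto
    ultimately have "1 / real (Suc n) < r" if "n \<ge> M" for n using that by (meson le_less_trans)
    then show ?thesis by blast
  qed
  have "cauchy_in A p a"
  proof (rule cauchy_inI[OF a(1)])
    fix r :: real assume r: "r > 0"
    obtain M where M: "\<And>i. i \<ge> M \<Longrightarrow> 1 / real (Suc i) < r / 3" using small[of "r / 3"] r by auto
    obtain K where K: "\<And>i j. i \<ge> K \<Longrightarrow> j \<ge> K \<Longrightarrow> cnorm Cp (S i \<ominus>\<^bsub>Cp\<^esub> S j) < r / 3"
      using S r unfolding cauchy_in_def by (metis divide_pos_pos zero_less_numeral)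
    have "p (a i \<ominus>\<^bsub>A\<^esub> a j) < r" if ij: "i \<ge> max M K" "j \<ge> max M K" for i j
    proof -
      have "p (a i \<ominus>\<^bsub>A\<^esub> a j) = cnorm Cp (cls (\<lambda>_. a i) \<ominus>\<^bsub>Cp\<^esub> cls (\<lambda>_. a j))"
        using norm_const[of "a i \<ominus>\<^bsub>A\<^esub> a j"] a(1) by (simp add: Cp_minus[OF ca ca])
      also have "\<dots> \<le> cnorm Cp (cls (\<lambda>_. a i) \<ominus>\<^bsub>Cp\<^esub> S i) + cnorm Cp (S i \<ominus>\<^bsub>Cp\<^esub> cls (\<lambda>_. a j))"
        using Sc ca by (intro tri) auto
      also have "\<dots> \<le> cnorm Cp (S i \<ominus>\<^bsub>Cp\<^esub> cls (\<lambda>_. a i)) + (cnorm Cp (S i \<ominus>\<^bsub>Cp\<^esub> S j) + cnorm Cp (S j \<ominus>\<^bsub>Cp\<^esub> cls (\<lambda>_. a j)))"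
        using Sc ca by (intro add_mono tri) (auto simp: comm)
      also have "\<dots> < r" using M[of i] M[of j] K[of i j] a(2)[of i] a(2)[of j] ij by linarith
      finally show ?thesis .
    qed
    then show "\<exists>M. \<forall>i\<ge>M. \<forall>j\<ge>M. p (a i \<ominus>\<^bsub>A\<^esub> a j) < r" by blast
  qed
  note a' = this
  have "(\<lambda>n. cnorm Cp (S n \<ominus>\<^bsub>Cp\<^esub> cls a)) \<longlonglongrightarrow> 0"
  proof (rule LIMSEQ_I)
    fix r :: real assume r: "r > 0"
    obtain M where M: "\<And>i. i \<ge> M \<Longrightarrow> 1 / real (Suc i) < r / 3" using small[of "r / 3"] r by auto
    obtain K where K: "\<And>i j. i \<ge> K \<Longrightarrow> j \<ge> K \<Longrightarrow> p (a i \<ominus>\<^bsub>A\<^esub> a j) < r / 3"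
      using cauchy_inD[OF a', of "r / 3"] r by auto
    have "norm (cnorm Cp (S n \<ominus>\<^bsub>Cp\<^esub> cls a) - 0) < r" if n: "n \<ge> max M K" for n
    proof -
      have "cnorm Cp (S n \<ominus>\<^bsub>Cp\<^esub> cls a) \<le> cnorm Cp (S n \<ominus>\<^bsub>Cp\<^esub> cls (\<lambda>_. a n)) + cnorm Cp (cls (\<lambda>_. a n) \<ominus>\<^bsub>Cp\<^esub> cls a)"
        using Sc ca a' by (intro tri) auto
      also have "cnorm Cp (cls (\<lambda>_. a n) \<ominus>\<^bsub>Cp\<^esub> cls a) = cnorm Cp (cls a \<ominus>\<^bsub>Cp\<^esub> cls (\<lambda>_. a n))"
        using ca a' by (intro comm) auto
      also have "\<dots> \<le> r / 3" using n by (intro norm_diff_const[OF a' K]) auto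
      finally have "cnorm Cp (S n \<ominus>\<^bsub>Cp\<^esub> cls a) < r" using a(2)[of n] M[of n] n r by simp
      moreover have "0 \<le> cnorm Cp (S n \<ominus>\<^bsub>Cp\<^esub> cls a)"
        using Sc a' by (intro cstar_seminormD(1)[OF Cp_seminorm]) auto
      ultimately show ?thesis by simp
    qed
    then show "\<exists>M. \<forall>n\<ge>M. norm (cnorm Cp (S n \<ominus>\<^bsub>Cp\<^esub> cls a) - 0) < r" by blast
  qed
  then show "\<exists>x\<in>carrier Cp. (\<lambda>n. cnorm Cp (S n \<ominus>\<^bsub>Cp\<^esub> x)) \<longlonglongrightarrow> 0" using a' by blast
qed

lemma unital_Cp:
  assumes "\<one>\<^bsub>A\<^esub> \<in> carrier A" "\<And>x. x \<in> carrier A \<Longrightarrow> \<one>\<^bsub>A\<^esub> \<otimes>\<^bsub>A\<^esub> x = x" "\<And>x. x \<in> carrier A \<Longrightarrow> x \<otimes>\<^bsub>A\<^esub> \<one>\<^bsub>A\<^esub> = x"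
  shows "unital_cstar Cp"
proof (intro unital_cstar.intro cstar_Cp unital_cstar_axioms.intro)
  show "\<one>\<^bsub>Cp\<^esub> \<in> carrier Cp" unfolding Cp_one using assms(1) by auto
  fix S assume "S \<in> carrier Cp"
  then obtain s where s: "cauchy_in A p s" "S = cls s" using cls_cases by metis
  then show "\<one>\<^bsub>Cp\<^esub> \<otimes>\<^bsub>Cp\<^esub> S = S" "S \<otimes>\<^bsub>Cp\<^esub> \<one>\<^bsub>Cp\<^esub> = S"
    unfolding Cp_one using assms cauchy_closed[OF s(1)] by (simp_all add: Cp_mult cauchy_const)
qed

text \<open>The bound by \<open>p\<close> makes \<open>\<phi>\<close> send Cauchy sequences to
  Cauchy sequences of the complete product ring, and the limits stay in \<open>X\<close> because its
  image is closed. \<open>L\<close> uses one chosen representative; every other one has the same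
  limit.\<close>

lemma completion_extension:
  fixes \<phi> :: "'a \<Rightarrow> 'x univ"
  assumes X: "cstar_algebra X"
    and inr: "\<And>a. a \<in> carrier A \<Longrightarrow> cstar_algebra.inr X (\<phi> a)"
    and add: "\<And>a b. a \<in> carrier A \<Longrightarrow> b \<in> carrier A \<Longrightarrow> \<phi> (a \<oplus>\<^bsub>A\<^esub> b) = \<phi> a + \<phi> b"
    and smult: "\<And>c a. a \<in> carrier A \<Longrightarrow> \<phi> (c \<odot>\<^bsub>A\<^esub> a) = c *\<^sub>C \<phi> a"
    and mult: "\<And>a b. a \<in> carrier A \<Longrightarrow> b \<in> carrier A \<Longrightarrow> \<phi> (a \<otimes>\<^bsub>A\<^esub> b) = \<phi> a * \<phi> b"
    and adj: "\<And>a. a \<in> carrier A \<Longrightarrow> \<phi> (adj A a) = star (\<phi> a)"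
    and bound: "\<And>a. a \<in> carrier A \<Longrightarrow> norm (\<phi> a) \<le> p a"
  obtains \<pi> where "\<pi> \<in> star_hom Cp X" "\<And>a. a \<in> carrier A \<Longrightarrow> emb X (\<pi> (cls (\<lambda>_. a))) = \<phi> a"
proof -
  interpret X: cstar_algebra X by (rule X)
  have minus: "\<phi> (a \<ominus>\<^bsub>A\<^esub> b) = \<phi> a - \<phi> b" if "a \<in> carrier A" "b \<in> carrier A" for a b
    using that by (simp add: minus_eq_smult add smult)
  define L where "L S = lim (\<lambda>n. \<phi> ((SOME s. s \<in> S) n))" for S
  have L: "(\<lambda>n. \<phi> (s n)) \<longlonglongrightarrow> L (cls s)" if s: "cauchy_in A p s" for s
  proof -
    define t where "t = (SOME s'. s' \<in> cls s)"
    have "s \<in> cls s" using s equiv_class_self[OF equiv_rel] by simp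
    then have "t \<in> cls s" unfolding t_def by (rule someI[of "\<lambda>s'. s' \<in> cls s"])
    then have t: "cauchy_in A p t" "(\<lambda>n. p (s n \<ominus>\<^bsub>A\<^esub> t n)) \<longlonglongrightarrow> 0" using equiv_iff by auto
    note cl = cauchy_closed[OF s] cauchy_closed[OF t(1)]
    have "Cauchy (\<lambda>n. \<phi> (t n))" unfolding Cauchy_iff
    proof (intro allI impI)
      fix r :: real assume "r > 0"
      then obtain M where M: "\<And>i j. i \<ge> M \<Longrightarrow> j \<ge> M \<Longrightarrow> p (t i \<ominus>\<^bsub>A\<^esub> t j) < r" using cauchy_inD[OF t(1)] by metis
      have "norm (\<phi> (t i) - \<phi> (t j)) \<le> p (t i \<ominus>\<^bsub>A\<^esub> t j)" for i j
        using bound[of "t i \<ominus>\<^bsub>A\<^esub> t j"] cl by (simp add: minus)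
      then show "\<exists>M. \<forall>i\<ge>M. \<forall>j\<ge>M. norm (\<phi> (t i) - \<phi> (t j)) < r" using M by (meson le_less_trans)
    qed
    then have "convergent (\<lambda>n. \<phi> (t n))" by (rule Cauchy_convergent)
    then have 1: "(\<lambda>n. \<phi> (t n)) \<longlonglongrightarrow> L (cls s)"
      unfolding L_def t_def[symmetric] by (rule convergent_LIMSEQ_iff[THEN iffD1])
    have "norm (\<phi> (s n) - \<phi> (t n)) \<le> p (s n \<ominus>\<^bsub>A\<^esub> t n)" for n
      using bound[of "s n \<ominus>\<^bsub>A\<^esub> t n"] cl by (simp add: minus)
    then have "(\<lambda>n. norm (\<phi> (s n) - \<phi> (t n))) \<longlonglongrightarrow> 0" by (intro null_seqI[OF _ _ t(2)]) auto
    then have "(\<lambda>n. \<phi> (s n) - \<phi> (t n)) \<longlonglongrightarrow> 0" by (rule tendsto_norm_zero_cancel)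
    from tendsto_add[OF this 1] show ?thesis by simp
  qed
  have "(\<lambda>S. ev X (L S)) \<in> star_hom Cp X"
  proof (rule X.star_hom_of_typed)
    fix S T c assume "S \<in> carrier Cp"
    then obtain s where s: "cauchy_in A p s" "S = cls s" using cls_cases by metis
    note cl = cauchy_closed[OF s(1)]
    note sl = L[OF s(1), folded s(2)]
    show "X.inr (L S)" using inr cl by (intro X.inr_lim[OF _ sl]) auto
    have "bounded_linear (\<lambda>x::'x univ. c *\<^sub>C x)"
      by (rule bounded_linear_intro[of _ "cmod c"]) (auto simp: scaleC_add_right scaleR_scaleC mult.commute)
    from bounded_linear.tendsto[OF this sl]
    have "(\<lambda>n. \<phi> (c \<odot>\<^bsub>A\<^esub> s n)) \<longlonglongrightarrow> c *\<^sub>C L S" using cl by (simp add: smult)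
    moreover have "(\<lambda>n. \<phi> (c \<odot>\<^bsub>A\<^esub> s n)) \<longlonglongrightarrow> L (c \<odot>\<^bsub>Cp\<^esub> S)"
      using L[OF cauchy_smult[OF s(1)]] s by (simp add: Cp_smult)
    ultimately show "L (c \<odot>\<^bsub>Cp\<^esub> S) = c *\<^sub>C L S" using LIMSEQ_unique by blast
    have "(\<lambda>n. \<phi> (adj A (s n))) \<longlonglongrightarrow> star (L S)" using tendsto_star[OF sl] cl by (simp add: adj)
    moreover have "(\<lambda>n. \<phi> (adj A (s n))) \<longlonglongrightarrow> L (adj Cp S)"
      using L[OF cauchy_adj[OF s(1)]] s by (simp add: Cp_adj)
    ultimately show "L (adj Cp S) = star (L S)" using LIMSEQ_unique by blast
    assume "T \<in> carrier Cp"
    then obtain t where t: "cauchy_in A p t" "T = cls t" using cls_cases by metis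
    note clt = cauchy_closed[OF t(1)]
    note tl = L[OF t(1), folded t(2)]
    have "(\<lambda>n. \<phi> (s n \<oplus>\<^bsub>A\<^esub> t n)) \<longlonglongrightarrow> L S + L T" using tendsto_add[OF sl tl] cl clt by (simp add: add)
    moreover have "(\<lambda>n. \<phi> (s n \<oplus>\<^bsub>A\<^esub> t n)) \<longlonglongrightarrow> L (S \<oplus>\<^bsub>Cp\<^esub> T)"
      using L[OF cauchy_add[OF s(1) t(1)]] s t by (simp add: Cp_add)
    ultimately show "L (S \<oplus>\<^bsub>Cp\<^esub> T) = L S + L T" using LIMSEQ_unique by blast
    have "(\<lambda>n. \<phi> (s n \<otimes>\<^bsub>A\<^esub> t n)) \<longlonglongrightarrow> L S * L T" using tendsto_mult[OF sl tl] cl clt by (simp add: mult)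
    moreover have "(\<lambda>n. \<phi> (s n \<otimes>\<^bsub>A\<^esub> t n)) \<longlonglongrightarrow> L (S \<otimes>\<^bsub>Cp\<^esub> T)"
      using L[OF cauchy_mult[OF s(1) t(1)]] s t by (simp add: Cp_mult)
    ultimately show "L (S \<otimes>\<^bsub>Cp\<^esub> T) = L S * L T" using LIMSEQ_unique by blast
  qed
  moreover have "emb X (ev X (L (cls (\<lambda>_. a)))) = \<phi> a" if a: "a \<in> carrier A" for a
  proof -
    have "L (cls (\<lambda>_. a)) = \<phi> a" using L[OF cauchy_const[OF a]] LIMSEQ_unique[OF tendsto_const] by metis
    then show ?thesis using inr[OF a] unfolding X.inr_def by simp
  qed
  ultimately show thesis using that by blast
qed

text \<open>The constant sequences are dense, and *-homomorphisms out of the unital algebra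
  \<open>Cp\<close> are contractive, hence continuous.\<close>

lemma star_hom_completion_eqI:
  assumes Cu: "unital_cstar Cp" and X: "cstar_algebra X" and f: "f \<in> star_hom Cp X" and g: "g \<in> star_hom Cp X"
    and eq: "\<And>a. a \<in> carrier A \<Longrightarrow> f (cls (\<lambda>_. a)) = g (cls (\<lambda>_. a))" and S: "S \<in> carrier Cp"
  shows "f S = g S"
proof -
  interpret X: cstar_algebra X by (rule X)
  have le: "norm (emb X (f S) - emb X (g S)) \<le> 2 * r" if r: "r > 0" for r
  proof -
    obtain a where a: "a \<in> carrier A" "cnorm Cp (S \<ominus>\<^bsub>Cp\<^esub> cls (\<lambda>_. a)) \<le> r" using dense[OF S r] by blast
    let ?a = "cls (\<lambda>_. a)" let ?d = "S \<ominus>\<^bsub>Cp\<^esub> ?a"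
    have ac: "?a \<in> carrier Cp" using a by auto
    have dc: "?d \<in> carrier Cp" using ac S by auto
    have "emb X (h ?d) = emb X (h S) - emb X (h ?a)" if "h \<in> star_hom Cp X" for h
      using S ac emb_star_hom(2,3)[OF X that] by (simp add: Q.minus_eq_smult scaleC_minus_one)
    note d = this[OF f] this[OF g]
    have "norm (emb X (h ?d)) \<le> r" if "h \<in> star_hom Cp X" for h
      using star_hom_contractive[OF Cu X that dc] a(2) star_homD(1)[OF that dc] by simp
    note n = this[OF f] this[OF g]
    have "emb X (f S) - emb X (g S) = emb X (f ?d) - emb X (g ?d)" using d eq[OF a(1)] by simp
    then show ?thesis using n norm_triangle_ineq4[of "emb X (f ?d)" "emb X (g ?d)"] by simp
  qed
  have "norm (emb X (f S) - emb X (g S)) \<le> 0"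
  proof (rule field_le_epsilon)
    fix r :: real assume "r > 0"
    then show "norm (emb X (f S) - emb X (g S)) \<le> 0 + r" using le[of "r / 2"] by simp
  qed
  then show ?thesis using X.emb_inj star_homD(1)[OF f S] star_homD(1)[OF g S] by simp
qed

end

section \<open>Group algebras\<close>

lemma group_algebra_simps [simp]:
  "carrier (group_algebra G) = {a. finite {g. a g \<noteq> 0} \<and> {g. a g \<noteq> 0} \<subseteq> carrier G}"
  "\<one>\<^bsub>group_algebra G\<^esub> = (\<lambda>g. if g = \<one>\<^bsub>G\<^esub> then 1 else 0)"
  "\<zero>\<^bsub>group_algebra G\<^esub> = (\<lambda>g. 0)"
  "a \<oplus>\<^bsub>group_algebra G\<^esub> b = (\<lambda>g. a g + b g)"
  "c \<odot>\<^bsub>group_algebra G\<^esub> a = (\<lambda>g. c * a g)"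
  "adj (group_algebra G) a = (\<lambda>g. if g \<in> carrier G then cnj (a (inv\<^bsub>G\<^esub> g)) else 0)"
  by (simp_all add: group_algebra_def)

definition single :: "'g \<Rightarrow> 'g \<Rightarrow> complex" where
  "single g = (\<lambda>h. if h = g then 1 else 0)"

locale discrete_group = group G for G :: "'a monoid" (structure)
begin

abbreviation "GA \<equiv> group_algebra G"

lemma GA_support: "a \<in> carrier GA \<Longrightarrow> finite {g. a g \<noteq> 0}" "a \<in> carrier GA \<Longrightarrow> a g \<noteq> 0 \<Longrightarrow> g \<in> carrier G"
  by auto

text \<open>Convolution sums over the support of the left factor, which changes with that factor;
  over a common finite superset two convolutions can be added termwise.\<close>

lemma GA_mult_superset:
  assumes "finite S" "{h. a h \<noteq> 0} \<subseteq> S" "g \<in> carrier G"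
  shows "(a \<otimes>\<^bsub>GA\<^esub> b) g = (\<Sum>h\<in>S. a h * b (inv h \<otimes> g))"
proof -
  have "(\<Sum>h | a h \<noteq> 0. a h * b (inv h \<otimes> g)) = (\<Sum>h\<in>S. a h * b (inv h \<otimes> g))"
    using assms by (intro sum.mono_neutral_left) auto
  then show ?thesis using assms(3) by (simp add: group_algebra_def)
qed

lemma GA_mult_outside: "g \<notin> carrier G \<Longrightarrow> (a \<otimes>\<^bsub>GA\<^esub> b) g = 0"
  by (simp add: group_algebra_def)

lemma GA_add_closed: assumes "a \<in> carrier GA" "b \<in> carrier GA" shows "a \<oplus>\<^bsub>GA\<^esub> b \<in> carrier GA"
proof -
  have "{g. a g + b g \<noteq> 0} \<subseteq> {g. a g \<noteq> 0} \<union> {g. b g \<noteq> 0}" by auto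
  then show ?thesis using assms by (auto intro: finite_subset)
qed

lemma GA_smult_closed: "a \<in> carrier GA \<Longrightarrow> c \<odot>\<^bsub>GA\<^esub> a \<in> carrier GA"
  by (auto elim: rev_finite_subset)

lemma GA_mult_closed: assumes "a \<in> carrier GA" "b \<in> carrier GA" shows "a \<otimes>\<^bsub>GA\<^esub> b \<in> carrier GA"
proof -
  let ?S = "{g. a g \<noteq> 0}" let ?T = "{g. b g \<noteq> 0}"
  have "{g. (a \<otimes>\<^bsub>GA\<^esub> b) g \<noteq> 0} \<subseteq> (\<lambda>(h, k). h \<otimes> k) ` (?S \<times> ?T)"
  proof
    fix g assume "g \<in> {g. (a \<otimes>\<^bsub>GA\<^esub> b) g \<noteq> 0}"
    then have ne: "(a \<otimes>\<^bsub>GA\<^esub> b) g \<noteq> 0" by simp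
    then have g: "g \<in> carrier G" using GA_mult_outside by blast
    have "(\<Sum>h\<in>?S. a h * b (inv h \<otimes> g)) \<noteq> 0" using ne GA_mult_superset[of ?S a g b] assms g by simp
    then obtain h where h: "a h \<noteq> 0" "b (inv h \<otimes> g) \<noteq> 0" by (metis (no_types, lifting) mem_Collect_eq mult_not_zero sum.neutral)
    then have "g = h \<otimes> (inv h \<otimes> g)" using assms g by (auto simp flip: m_assoc)
    then have "g = (case (h, inv h \<otimes> g) of (h, k) \<Rightarrow> h \<otimes> k)" unfolding prod.case .
    then show "g \<in> (\<lambda>(h, k). h \<otimes> k) ` (?S \<times> ?T)" by (rule image_eqI) (use h in simp)
  qed
  moreover have "finite ((\<lambda>(h, k). h \<otimes> k) ` (?S \<times> ?T))" using assms by auto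
  ultimately have "finite {g. (a \<otimes>\<^bsub>GA\<^esub> b) g \<noteq> 0}" by (rule finite_subset)
  then show ?thesis using GA_mult_outside by auto
qed

lemma GA_adj_closed: assumes "a \<in> carrier GA" shows "adj GA a \<in> carrier GA"
proof -
  have "{g. adj GA a g \<noteq> 0} \<subseteq> (\<lambda>g. inv g) ` {g. a g \<noteq> 0}"
    by (auto intro!: image_eqI[of _ _ "inv _"] split: if_splits)
  from finite_subset[OF this finite_imageI[OF GA_support(1)[OF assms]]]
  show ?thesis by (auto split: if_splits)
qed

lemma single_closed [simp, intro]: "g \<in> carrier G \<Longrightarrow> single g \<in> carrier GA"
  by (auto simp: single_def)

lemma GA_induct [consumes 1, case_names zero add single]:
  assumes a: "a \<in> carrier GA" and 0: "P \<zero>\<^bsub>GA\<^esub>"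
    and add: "\<And>a b. a \<in> carrier GA \<Longrightarrow> b \<in> carrier GA \<Longrightarrow> P a \<Longrightarrow> P b \<Longrightarrow> P (a \<oplus>\<^bsub>GA\<^esub> b)"
    and single: "\<And>c g. g \<in> carrier G \<Longrightarrow> P (c \<odot>\<^bsub>GA\<^esub> single g)"
  shows "P a"
proof -
  define tr where "tr S = (\<lambda>g. if g \<in> S then a g else 0)" for S
  have "tr S \<in> carrier GA \<and> P (tr S)" if "finite S" "S \<subseteq> carrier G" for S
    using that
  proof (induction S rule: finite_induct)
    case empty
    then show ?case using 0 by (simp add: tr_def)
  next
    case (insert g S)
    have "tr (insert g S) = tr S \<oplus>\<^bsub>GA\<^esub> (a g \<odot>\<^bsub>GA\<^esub> single g)"
      using insert.hyps by (auto simp: tr_def single_def)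
    moreover have "a g \<odot>\<^bsub>GA\<^esub> single g \<in> carrier GA" using insert.prems by (intro GA_smult_closed single_closed) simp
    ultimately show ?case using insert add[of "tr S" "a g \<odot>\<^bsub>GA\<^esub> single g"] single[of g "a g"]
      GA_add_closed[of "tr S" "a g \<odot>\<^bsub>GA\<^esub> single g"] by simp
  qed
  moreover have "tr {g. a g \<noteq> 0} = a" by (auto simp: tr_def)
  ultimately show ?thesis using a by fastforce
qed

lemma GA_distrib:
  assumes "a \<in> carrier GA" "b \<in> carrier GA" "d \<in> carrier GA"
  shows "(a \<oplus>\<^bsub>GA\<^esub> b) \<otimes>\<^bsub>GA\<^esub> d = a \<otimes>\<^bsub>GA\<^esub> d \<oplus>\<^bsub>GA\<^esub> b \<otimes>\<^bsub>GA\<^esub> d"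
    "d \<otimes>\<^bsub>GA\<^esub> (a \<oplus>\<^bsub>GA\<^esub> b) = d \<otimes>\<^bsub>GA\<^esub> a \<oplus>\<^bsub>GA\<^esub> d \<otimes>\<^bsub>GA\<^esub> b"
proof -
  let ?S = "{g. a g \<noteq> 0} \<union> {g. b g \<noteq> 0}"
  have S: "finite ?S" using assms by auto
  have D: "finite {g. d g \<noteq> 0}" using assms by auto
  have sub: "{h. (a \<oplus>\<^bsub>GA\<^esub> b) h \<noteq> 0} \<subseteq> ?S" by auto
  show "(a \<oplus>\<^bsub>GA\<^esub> b) \<otimes>\<^bsub>GA\<^esub> d = a \<otimes>\<^bsub>GA\<^esub> d \<oplus>\<^bsub>GA\<^esub> b \<otimes>\<^bsub>GA\<^esub> d"
  proof
    fix g show "((a \<oplus>\<^bsub>GA\<^esub> b) \<otimes>\<^bsub>GA\<^esub> d) g = (a \<otimes>\<^bsub>GA\<^esub> d \<oplus>\<^bsub>GA\<^esub> b \<otimes>\<^bsub>GA\<^esub> d) g"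
    proof (cases "g \<in> carrier G")
      case True
      have "((a \<oplus>\<^bsub>GA\<^esub> b) \<otimes>\<^bsub>GA\<^esub> d) g = (\<Sum>h\<in>?S. (a h + b h) * d (inv h \<otimes> g))"
        using GA_mult_superset[OF S sub True, of d] by simp
      then show ?thesis
        using GA_mult_superset[OF S _ True, of a d] GA_mult_superset[OF S _ True, of b d]
        by (simp add: ring_distribs sum.distrib)
    qed (simp add: GA_mult_outside)
  qed
  show "d \<otimes>\<^bsub>GA\<^esub> (a \<oplus>\<^bsub>GA\<^esub> b) = d \<otimes>\<^bsub>GA\<^esub> a \<oplus>\<^bsub>GA\<^esub> d \<otimes>\<^bsub>GA\<^esub> b"
  proof
    fix g show "(d \<otimes>\<^bsub>GA\<^esub> (a \<oplus>\<^bsub>GA\<^esub> b)) g = (d \<otimes>\<^bsub>GA\<^esub> a \<oplus>\<^bsub>GA\<^esub> d \<otimes>\<^bsub>GA\<^esub> b) g"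
      using GA_mult_superset[OF D order_refl, of g] GA_mult_outside[of g]
      by (cases "g \<in> carrier G") (simp_all add: ring_distribs sum.distrib)
  qed
qed

lemma GA_scale:
  assumes "a \<in> carrier GA" "d \<in> carrier GA"
  shows "(c \<odot>\<^bsub>GA\<^esub> a) \<otimes>\<^bsub>GA\<^esub> d = c \<odot>\<^bsub>GA\<^esub> (a \<otimes>\<^bsub>GA\<^esub> d)"
    "a \<otimes>\<^bsub>GA\<^esub> (c \<odot>\<^bsub>GA\<^esub> d) = c \<odot>\<^bsub>GA\<^esub> (a \<otimes>\<^bsub>GA\<^esub> d)"
proof -
  have D: "finite {g. d g \<noteq> 0}" "finite {g. a g \<noteq> 0}" using assms by auto
  show "a \<otimes>\<^bsub>GA\<^esub> (c \<odot>\<^bsub>GA\<^esub> d) = c \<odot>\<^bsub>GA\<^esub> (a \<otimes>\<^bsub>GA\<^esub> d)"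
  proof
    fix g show "(a \<otimes>\<^bsub>GA\<^esub> (c \<odot>\<^bsub>GA\<^esub> d)) g = (c \<odot>\<^bsub>GA\<^esub> (a \<otimes>\<^bsub>GA\<^esub> d)) g"
      using GA_mult_superset[OF D(2) order_refl, of g] GA_mult_outside[of g]
      by (cases "g \<in> carrier G") (simp_all add: sum_distrib_left mult.left_commute)
  qed
  show "(c \<odot>\<^bsub>GA\<^esub> a) \<otimes>\<^bsub>GA\<^esub> d = c \<odot>\<^bsub>GA\<^esub> (a \<otimes>\<^bsub>GA\<^esub> d)"
  proof
    fix g show "((c \<odot>\<^bsub>GA\<^esub> a) \<otimes>\<^bsub>GA\<^esub> d) g = (c \<odot>\<^bsub>GA\<^esub> (a \<otimes>\<^bsub>GA\<^esub> d)) g"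
    proof (cases "g \<in> carrier G")
      case True
      have "{h. (c \<odot>\<^bsub>GA\<^esub> a) h \<noteq> 0} \<subseteq> {h. a h \<noteq> 0}" by auto
      then show ?thesis
        using GA_mult_superset[OF D(2) _ True, of "c \<odot>\<^bsub>GA\<^esub> a" d] GA_mult_superset[OF D(2) order_refl True, of d]
        by (simp add: sum_distrib_left mult.assoc)
    qed (simp add: GA_mult_outside)
  qed
qed

lemma single_mult:
  assumes "g \<in> carrier G" "h \<in> carrier G"
  shows "single g \<otimes>\<^bsub>GA\<^esub> single h = single (g \<otimes> h)"
proof
  fix k show "(single g \<otimes>\<^bsub>GA\<^esub> single h) k = single (g \<otimes> h) k"
  proof (cases "k \<in> carrier G")
    case True
    have "inv g \<otimes> k = h \<longleftrightarrow> k = g \<otimes> h"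
      using assms True by (metis inv_closed inv_solve_left)
    then show ?thesis
      using GA_mult_superset[of "{g}" "single g" k "single h"] True by (auto simp: single_def)
  next
    case False
    then show ?thesis using assms by (auto simp: GA_mult_outside single_def)
  qed
qed

lemma GA_zero_mult: "a \<in> carrier GA \<Longrightarrow> \<zero>\<^bsub>GA\<^esub> \<otimes>\<^bsub>GA\<^esub> a = \<zero>\<^bsub>GA\<^esub>" "a \<in> carrier GA \<Longrightarrow> a \<otimes>\<^bsub>GA\<^esub> \<zero>\<^bsub>GA\<^esub> = \<zero>\<^bsub>GA\<^esub>"
  by (auto simp: group_algebra_def)

lemma GA_adj_single: "g \<in> carrier G \<Longrightarrow> adj GA (single g) = single (inv g)"
  by (auto simp: single_def fun_eq_iff)

text \<open>The laws are linear or conjugate linear in each argument, so \<open>GA_induct\<close>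
  reduces associativity and the rule for adjoints of products to group elements, where they are
  group laws; multiple convolution sums never have to be rearranged.\<close>

lemma star_algebra_GA: "star_algebra GA"
proof -
  note [simp del] = group_algebra_simps
  note cl = GA_add_closed GA_smult_closed GA_mult_closed GA_adj_closed
  have z: "\<zero>\<^bsub>GA\<^esub> \<in> carrier GA" by (simp add: group_algebra_simps)
  have add: "abelian_group GA"
  proof (rule abelian_groupI)
    fix a assume a: "a \<in> carrier GA"
    have "(-1) \<odot>\<^bsub>GA\<^esub> a \<oplus>\<^bsub>GA\<^esub> a = \<zero>\<^bsub>GA\<^esub>" by (simp add: group_algebra_simps)
    then show "\<exists>b\<in>carrier GA. b \<oplus>\<^bsub>GA\<^esub> a = \<zero>\<^bsub>GA\<^esub>" using GA_smult_closed[OF a] by blast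
  qed (simp_all add: z cl, simp_all add: group_algebra_simps algebra_simps)
  have md: "module complex_alg GA"
    by (intro moduleI cring_complex_alg add) (simp_all add: cl, simp_all add: group_algebra_simps algebra_simps)
  have scal: "c \<odot>\<^bsub>GA\<^esub> (d \<odot>\<^bsub>GA\<^esub> a) = (c * d) \<odot>\<^bsub>GA\<^esub> a" for c d a by (simp add: group_algebra_simps algebra_simps)
  have assoc: "(a \<otimes>\<^bsub>GA\<^esub> b) \<otimes>\<^bsub>GA\<^esub> d = a \<otimes>\<^bsub>GA\<^esub> (b \<otimes>\<^bsub>GA\<^esub> d)"
    if a: "a \<in> carrier GA" and b: "b \<in> carrier GA" and d: "d \<in> carrier GA" for a b d
    using a
  proof (induction a rule: GA_induct)
    case zero
    then show ?case using b d by (simp add: GA_zero_mult cl)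
  next
    case (add a a')
    then show ?case using b d by (simp add: GA_distrib cl)
  next
    case (single c g)
    have s: "single g \<in> carrier GA" using single by simp
    show ?case using b
    proof (induction b rule: GA_induct)
      case zero
      then show ?case using d s by (simp add: GA_zero_mult cl)
    next
      case (add b b')
      then show ?case using d s by (simp add: GA_distrib cl)
    next
      case b: (single c' h)
      have s': "single h \<in> carrier GA" using b by simp
      show ?case using d
      proof (induction d rule: GA_induct)
        case zero
        then show ?case using s s' by (simp add: GA_zero_mult cl)
      next
        case (add d d')
        then show ?case using s s' by (simp add: GA_distrib cl)
      next
        case d: (single c'' k)
        then show ?case using single b s s' by (simp add: GA_scale cl single_mult scal m_assoc mult.commute mult.left_commute)
      qed
    qed
  qed
  have adj_add: "adj GA (a \<oplus>\<^bsub>GA\<^esub> b) = adj GA a \<oplus>\<^bsub>GA\<^esub> adj GA b" for a b by (auto simp: group_algebra_simps)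
  have adj_smult: "adj GA (c \<odot>\<^bsub>GA\<^esub> a) = cnj c \<odot>\<^bsub>GA\<^esub> adj GA a" for c a by (auto simp: group_algebra_simps)
  have adj_zero: "adj GA \<zero>\<^bsub>GA\<^esub> = \<zero>\<^bsub>GA\<^esub>" by (auto simp: group_algebra_simps)
  have adj_mult: "adj GA (a \<otimes>\<^bsub>GA\<^esub> b) = adj GA b \<otimes>\<^bsub>GA\<^esub> adj GA a"
    if a: "a \<in> carrier GA" and b: "b \<in> carrier GA" for a b
    using a
  proof (induction a rule: GA_induct)
    case zero
    then show ?case using b by (simp add: GA_zero_mult cl adj_zero)
  next
    case (add a a')
    then show ?case using b by (simp add: GA_distrib cl adj_add)
  next
    case (single c g)
    have s: "single g \<in> carrier GA" using single by simp
    show ?case using b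
    proof (induction b rule: GA_induct)
      case zero
      then show ?case using s by (simp add: GA_zero_mult cl adj_zero)
    next
      case (add b b')
      then show ?case using s by (simp add: GA_distrib cl adj_add)
    next
      case b: (single c' h)
      then show ?case using single s
        by (simp add: GA_scale cl single_mult scal adj_smult GA_adj_single inv_mult_group mult.commute)
    qed
  qed
  have adj_adj: "adj GA (adj GA a) = a" if "a \<in> carrier GA" for a
  proof
    fix g show "adj GA (adj GA a) g = a g"
      using that GA_support(2)[OF that, of g] by (cases "g \<in> carrier G") (auto simp: group_algebra_simps(6))
  qed
  show ?thesis
    by (intro star_algebra.intro md star_algebra_axioms.intro)
      (simp_all add: cl assoc GA_distrib GA_scale adj_add adj_smult adj_mult adj_adj)
qed

lemma GA_one: "\<one>\<^bsub>GA\<^esub> = single \<one>"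
  by (simp add: single_def)

lemma GA_one_mult:
  assumes "a \<in> carrier GA" shows "\<one>\<^bsub>GA\<^esub> \<otimes>\<^bsub>GA\<^esub> a = a" "a \<otimes>\<^bsub>GA\<^esub> \<one>\<^bsub>GA\<^esub> = a"
proof -
  interpret star_algebra GA by (rule star_algebra_GA)
  note [simp del] = group_algebra_simps
  have s: "single \<one> \<in> carrier GA" by simp
  have "\<one>\<^bsub>GA\<^esub> \<otimes>\<^bsub>GA\<^esub> a = a \<and> a \<otimes>\<^bsub>GA\<^esub> \<one>\<^bsub>GA\<^esub> = a"
    unfolding GA_one using assms
  proof (induction a rule: GA_induct)
    case (add a b)
    then show ?case using s by (simp add: GA_distrib(1,2))
  next
    case (single c g)
    then show ?case using s by (simp add: GA_scale single_mult)
  qed (use s in simp)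
  then show "\<one>\<^bsub>GA\<^esub> \<otimes>\<^bsub>GA\<^esub> a = a" "a \<otimes>\<^bsub>GA\<^esub> \<one>\<^bsub>GA\<^esub> = a" by auto
qed

text \<open>The C*-identity makes the square of \<open>p\<close> at a group element equal to
  \<open>p (single \<one>)\<close>. At the neutral element this is an equation whose only solutions
  are 0 and 1.\<close>

lemma seminorm_single_le:
  assumes p: "cstar_seminorm GA p" and g: "g \<in> carrier G" shows "p (single g) \<le> 1"
proof -
  note [simp del] = group_algebra_simps
  have sq: "(p (single h))\<^sup>2 = p (single \<one>)" if "h \<in> carrier G" for h
    using cstar_seminormD(5)[OF p single_closed[OF that]] that by (simp add: GA_adj_single single_mult)
  have "p (single \<one>) = 0 \<or> p (single \<one>) = 1" using sq[of \<one>] by (simp add: power2_eq_square)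
  then have "(p (single g))\<^sup>2 \<le> 1" using sq[OF g] by auto
  then show ?thesis by (simp add: abs_square_le_1)
qed

lemma seminorms_bounded:
  assumes "a \<in> carrier GA" shows "\<exists>B. \<forall>p. cstar_seminorm GA p \<longrightarrow> p a \<le> B"
  using assms
proof (induction a rule: GA_induct)
  case zero
  have "p \<zero>\<^bsub>GA\<^esub> \<le> 0" if "cstar_seminorm GA p" for p
    using star_algebra.seminorm_zero[OF star_algebra_GA that] by simp
  then show ?case by blast
next
  case (add a b)
  then obtain B C where BC: "\<And>p. cstar_seminorm GA p \<Longrightarrow> p a \<le> B" "\<And>p. cstar_seminorm GA p \<Longrightarrow> p b \<le> C" by blast
  have "p (a \<oplus>\<^bsub>GA\<^esub> b) \<le> B + C" if "cstar_seminorm GA p" for p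
    using cstar_seminormD(2)[OF that add(1,2)] BC[OF that] by linarith
  then show ?case by blast
next
  case (single c g)
  have "p (c \<odot>\<^bsub>GA\<^esub> single g) \<le> cmod c" if "cstar_seminorm GA p" for p
    using cstar_seminormD(3)[OF that single_closed[OF single], of c] seminorm_single_le[OF that single]
    by (simp add: mult_left_le)
  then show ?case by blast
qed

lemma zero_seminorm: "cstar_seminorm GA (\<lambda>_. 0)"
  unfolding cstar_seminorm_def by simp

lemma le_max_seminorm: "cstar_seminorm GA p \<Longrightarrow> a \<in> carrier GA \<Longrightarrow> p a \<le> max_cstar_seminorm GA a"
  unfolding max_cstar_seminorm_def using seminorms_bounded[of a]
  by (intro cSup_upper) (auto simp: bdd_above_def)

lemma max_seminorm_le: "(\<And>p. cstar_seminorm GA p \<Longrightarrow> p a \<le> B) \<Longrightarrow> max_cstar_seminorm GA a \<le> B"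
  unfolding max_cstar_seminorm_def using zero_seminorm by (intro cSup_least) auto

text \<open>The axioms pass to the supremum one by one: the C*-identity by comparing with square
  roots, homogeneity by using the inequality for \<open>c\<close> and for
  \<open>inverse c\<close>.\<close>

lemma max_seminorm: "cstar_seminorm GA (max_cstar_seminorm GA)"
proof -
  note [simp del] = group_algebra_simps
  interpret star_algebra GA by (rule star_algebra_GA)
  let ?M = "max_cstar_seminorm GA"
  have ge: "0 \<le> ?M a" if "a \<in> carrier GA" for a using le_max_seminorm[OF zero_seminorm that] .
  have sm: "?M (c \<odot>\<^bsub>GA\<^esub> a) \<le> cmod c * ?M a" if a: "a \<in> carrier GA" for c a
    by (intro max_seminorm_le) (simp add: cstar_seminormD(3)[OF _ a] mult_left_mono le_max_seminorm[OF _ a])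
  show ?thesis
    unfolding cstar_seminorm_def
  proof (intro conjI ballI allI)
    fix a b c assume a: "a \<in> carrier GA"
    show "0 \<le> ?M a" by (rule ge[OF a])
    show "?M (c \<odot>\<^bsub>GA\<^esub> a) = cmod c * ?M a"
    proof (cases "c = 0")
      case True
      have "?M (c \<odot>\<^bsub>GA\<^esub> a) \<le> 0" using sm[OF a, of c] True by simp
      then show ?thesis using ge[OF smult_cl[OF a, of c]] True by simp
    next
      case False
      have "inverse c \<odot>\<^bsub>GA\<^esub> (c \<odot>\<^bsub>GA\<^esub> a) = a" using False a by (simp add: smult_smult)
      then have "?M a \<le> inverse (cmod c) * ?M (c \<odot>\<^bsub>GA\<^esub> a)"
        using sm[OF smult_cl[OF a], of "inverse c" c] by (simp add: norm_inverse)
      then have "cmod c * ?M a \<le> ?M (c \<odot>\<^bsub>GA\<^esub> a)" using False by (simp add: field_simps)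
      then show ?thesis using sm[OF a, of c] by simp
    qed
    show "?M (adj GA a \<otimes>\<^bsub>GA\<^esub> a) = (?M a)\<^sup>2"
    proof (rule antisym)
      show "?M (adj GA a \<otimes>\<^bsub>GA\<^esub> a) \<le> (?M a)\<^sup>2"
        by (intro max_seminorm_le) (simp add: cstar_seminormD(1,5)[OF _ a] le_max_seminorm[OF _ a] power_mono)
      have aa: "adj GA a \<otimes>\<^bsub>GA\<^esub> a \<in> carrier GA" using a by auto
      have "?M a \<le> sqrt (?M (adj GA a \<otimes>\<^bsub>GA\<^esub> a))"
      proof (rule max_seminorm_le)
        fix p assume p: "cstar_seminorm GA p"
        show "p a \<le> sqrt (?M (adj GA a \<otimes>\<^bsub>GA\<^esub> a))"
          using le_max_seminorm[OF p aa] cstar_seminormD(5)[OF p a] by (intro real_le_rsqrt) simp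
      qed
      then show "(?M a)\<^sup>2 \<le> ?M (adj GA a \<otimes>\<^bsub>GA\<^esub> a)"
        by (metis ge[OF a] ge[OF aa] power_mono real_sqrt_pow2)
    qed
    assume b: "b \<in> carrier GA"
    show "?M (a \<oplus>\<^bsub>GA\<^esub> b) \<le> ?M a + ?M b"
    proof (rule max_seminorm_le)
      fix p assume p: "cstar_seminorm GA p"
      show "p (a \<oplus>\<^bsub>GA\<^esub> b) \<le> ?M a + ?M b"
        using cstar_seminormD(2)[OF p a b] le_max_seminorm[OF p a] le_max_seminorm[OF p b] by linarith
    qed
    show "?M (a \<otimes>\<^bsub>GA\<^esub> b) \<le> ?M a * ?M b"
    proof (rule max_seminorm_le)
      fix p assume p: "cstar_seminorm GA p"
      show "p (a \<otimes>\<^bsub>GA\<^esub> b) \<le> ?M a * ?M b"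
        using cstar_seminormD(1)[OF p a] cstar_seminormD(1)[OF p b] le_max_seminorm[OF p a] le_max_seminorm[OF p b]
        by (intro order_trans[OF cstar_seminormD(4)[OF p a b]] mult_mono ge a) auto
    qed
  qed
qed

sublocale C: seminormed_alg GA "max_cstar_seminorm GA"
  by (intro seminormed_alg.intro star_algebra_GA seminormed_alg_axioms.intro max_seminorm)

lemma full_group_cstar_eq: "full_group_cstar G = C.Cp"
  by (simp add: full_group_cstar_def)

definition ug :: "'a \<Rightarrow> (nat \<Rightarrow> 'a \<Rightarrow> complex) set" where
  "ug g = C.cls (\<lambda>_. single g)"

lemma unital_full_group: "unital_cstar (full_group_cstar G)"
  unfolding full_group_cstar_eq
  by (rule C.unital_Cp) (use GA_one_mult GA_one in \<open>simp_all del: group_algebra_simps\<close>)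

lemma ug_closed [simp, intro]: "g \<in> carrier G \<Longrightarrow> ug g \<in> carrier (full_group_cstar G)"
  unfolding full_group_cstar_eq ug_def using single_closed by blast

lemma ug_one: "ug \<one> = \<one>\<^bsub>full_group_cstar G\<^esub>"
  unfolding full_group_cstar_eq ug_def C.Cp_one GA_one ..

lemma ug_mult: "g \<in> carrier G \<Longrightarrow> h \<in> carrier G \<Longrightarrow> ug g \<otimes>\<^bsub>full_group_cstar G\<^esub> ug h = ug (g \<otimes> h)"
  unfolding full_group_cstar_eq ug_def by (simp add: C.Cp_mult C.cauchy_const single_closed single_mult del: group_algebra_simps)

lemma ug_adj: "g \<in> carrier G \<Longrightarrow> adj (full_group_cstar G) (ug g) = ug (inv g)"
  unfolding full_group_cstar_eq ug_def by (simp add: C.Cp_adj C.cauchy_const single_closed GA_adj_single del: group_algebra_simps)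

lemma full_group_eqI:
  assumes X: "cstar_algebra X" and f: "f \<in> star_hom (full_group_cstar G) X" and f': "f' \<in> star_hom (full_group_cstar G) X"
    and eq: "\<And>g. g \<in> carrier G \<Longrightarrow> f (ug g) = f' (ug g)" and S: "S \<in> carrier (full_group_cstar G)"
  shows "f S = f' S"
proof -
  interpret X: cstar_algebra X by (rule X)
  note [simp del] = group_algebra_simps
  note ff = f[unfolded full_group_cstar_eq] f'[unfolded full_group_cstar_eq]
  have h: "h (C.cls (\<lambda>_. a \<oplus>\<^bsub>GA\<^esub> b)) = h (C.cls (\<lambda>_. a)) \<oplus>\<^bsub>X\<^esub> h (C.cls (\<lambda>_. b))"
    "h (C.cls (\<lambda>_. c \<odot>\<^bsub>GA\<^esub> a)) = c \<odot>\<^bsub>X\<^esub> h (C.cls (\<lambda>_. a))"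
    if "h \<in> star_hom C.Cp X" "a \<in> carrier GA" "b \<in> carrier GA" for h a b c
    using star_homD(2,3)[OF that(1) C.cls_closed[OF C.cauchy_const[OF that(2)]]] C.cls_closed[OF C.cauchy_const[OF that(3)]]
      C.Cp_add[OF C.cauchy_const C.cauchy_const, OF that(2,3)] C.Cp_smult[OF C.cauchy_const, OF that(2)]
    by metis+
  have "f (C.cls (\<lambda>_. a)) = f' (C.cls (\<lambda>_. a))" if "a \<in> carrier GA" for a
    using that
  proof (induction a rule: GA_induct)
    case zero
    have z: "\<zero>\<^bsub>GA\<^esub> = 0 \<odot>\<^bsub>GA\<^esub> single \<one>" by (simp add: group_algebra_simps)
    show ?case unfolding z using h(2)[OF ff(1)] h(2)[OF ff(2)] eq[of \<one>] unfolding ug_def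
      by (metis one_closed single_closed)
  next
    case (add a b)
    then show ?case using h(1)[OF ff(1)] h(1)[OF ff(2)] by metis
  next
    case (single c g)
    then show ?case using h(2)[OF ff(1)] h(2)[OF ff(2)] eq[of g] unfolding ug_def
      by (metis single_closed)
  qed
  then show ?thesis
    using C.star_hom_completion_eqI[OF unital_full_group[unfolded full_group_cstar_eq] X ff] S
    unfolding full_group_cstar_eq by blast
qed

text \<open>The linear extension of \<open>U\<close> is a *-homomorphism on the group algebra, so
  its norm is a C*-seminorm and the maximal one dominates it; this is the bound needed to extend to
  the completion. The hypotheses make \<open>U \<one>\<close> a projection, which is the image of
  the unit.\<close>

lemma full_group_rep:
  fixes U :: "'a \<Rightarrow> 'x univ"
  assumes X: "cstar_algebra X" and inr: "\<And>g. g \<in> carrier G \<Longrightarrow> cstar_algebra.inr X (U g)"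
    and mult: "\<And>g h. g \<in> carrier G \<Longrightarrow> h \<in> carrier G \<Longrightarrow> U (g \<otimes> h) = U g * U h"
    and star: "\<And>g. g \<in> carrier G \<Longrightarrow> star (U g) = U (inv g)"
  obtains \<pi> where "\<pi> \<in> star_hom (full_group_cstar G) X" "\<And>g. g \<in> carrier G \<Longrightarrow> emb X (\<pi> (ug g)) = U g"
proof -
  interpret X: cstar_algebra X by (rule X)
  note [simp del] = group_algebra_simps
  define \<phi> where "\<phi> a = (\<Sum>g | a g \<noteq> 0. a g *\<^sub>C U g)" for a
  have sup: "\<phi> a = (\<Sum>g\<in>S. a g *\<^sub>C U g)" if "finite S" "{g. a g \<noteq> 0} \<subseteq> S" for a S
    unfolding \<phi>_def using that by (intro sum.mono_neutral_left) auto
  have inr\<phi>: "X.inr (\<phi> a)" if "a \<in> carrier GA" for a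
    unfolding \<phi>_def using that inr by (intro X.inr_sum X.inr_intros) (auto simp: group_algebra_simps)
  have \<phi>_add: "\<phi> (a \<oplus>\<^bsub>GA\<^esub> b) = \<phi> a + \<phi> b" if "a \<in> carrier GA" "b \<in> carrier GA" for a b
  proof -
    let ?S = "{g. a g \<noteq> 0} \<union> {g. b g \<noteq> 0}"
    have S: "finite ?S" using GA_support(1) that by blast
    have sub: "{h. (a \<oplus>\<^bsub>GA\<^esub> b) h \<noteq> 0} \<subseteq> ?S" by (auto simp: group_algebra_simps)
    show ?thesis
      using sup[OF S, of a] sup[OF S, of b] sup[OF S sub]
      by (simp add: group_algebra_simps scaleC_add_left sum.distrib)
  qed
  have smult: "\<phi> (c \<odot>\<^bsub>GA\<^esub> a) = c *\<^sub>C \<phi> a" if "a \<in> carrier GA" for c a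
    using sup[OF GA_support(1)[OF that], of "c \<odot>\<^bsub>GA\<^esub> a"] unfolding \<phi>_def[of a]
    by (auto simp: group_algebra_simps scaleC_sum_right)
  have sgl: "\<phi> (single g) = U g" for g
    using sup[of "{g}" "single g"] by (auto simp: single_def)
  have \<phi>_zero: "\<phi> \<zero>\<^bsub>GA\<^esub> = 0" unfolding \<phi>_def by (simp add: group_algebra_simps)
  have mult\<phi>: "\<phi> (a \<otimes>\<^bsub>GA\<^esub> b) = \<phi> a * \<phi> b" if a: "a \<in> carrier GA" and b: "b \<in> carrier GA" for a b
    using a
  proof (induction a rule: GA_induct)
    case zero
    then show ?case using b by (simp add: \<phi>_zero)
  next
    case (add a a')
    then show ?case using b by (simp add: GA_distrib(1) \<phi>_add ring_distribs)
  next
    case (single c g)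
    have s: "single g \<in> carrier GA" using single by simp
    show ?case using b
    proof (induction b rule: GA_induct)
      case zero
      then show ?case using s by (simp add: \<phi>_zero)
    next
      case (add b b')
      then show ?case using s by (simp add: GA_distrib(2) \<phi>_add ring_distribs)
    next
      case b: (single c' h)
      then show ?case using single s by (simp add: GA_scale single_mult smult sgl mult)
    qed
  qed
  have adj: "\<phi> (adj GA a) = star (\<phi> a)" if a: "a \<in> carrier GA" for a
    using a
  proof (induction a rule: GA_induct)
    case zero
    then show ?case by (simp add: \<phi>_zero)
  next
    case (add a b)
    then show ?case by (simp add: C.adj_add \<phi>_add star_add)
  next
    case (single c g)
    then show ?case by (simp add: C.adj_smult smult GA_adj_single sgl star)
  qed
  have "cstar_seminorm GA (\<lambda>a. norm (\<phi> a))"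
    unfolding cstar_seminorm_def
    by (simp add: \<phi>_add smult mult\<phi> adj norm_triangle_ineq norm_mult_ineq norm_star_mult_self)
  then have bound: "norm (\<phi> a) \<le> max_cstar_seminorm GA a" if "a \<in> carrier GA" for a
    using le_max_seminorm that by blast
  obtain \<pi> where \<pi>: "\<pi> \<in> star_hom C.Cp X" "\<And>a. a \<in> carrier GA \<Longrightarrow> emb X (\<pi> (C.cls (\<lambda>_. a))) = \<phi> a"
    using C.completion_extension[OF X inr\<phi> \<phi>_add smult mult\<phi> adj bound] by blast
  show thesis
  proof (rule that[of \<pi>])
    show "\<pi> \<in> star_hom (full_group_cstar G) X" using \<pi>(1) unfolding full_group_cstar_eq .
    show "emb X (\<pi> (ug g)) = U g" if "g \<in> carrier G" for g
      unfolding ug_def using \<pi>(2)[OF single_closed[OF that]] sgl by simp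
  qed
qed

end

section \<open>Free groups\<close>

definition flip :: "nat \<times> bool \<Rightarrow> nat \<times> bool" where "flip x = (fst x, \<not> snd x)"

lemma reduce_Nil [simp]: "reduce [] = []" and reduce_Cons [simp]: "reduce (x # w) = push_letter x (reduce w)"
  by (simp_all add: reduce_def)

lemma foldr_push_reduce: "reduce (u @ v) = foldr push_letter u (reduce v)"
  by (simp add: reduce_def)

text \<open>Provides rule induction for reduced words; \<open>red_reduce\<close> and
  \<open>reduce_red\<close> identify them with the fixed points of \<open>reduce\<close>.\<close>

inductive red :: "word \<Rightarrow> bool" where
  red_Nil: "red []"
| red_single: "red [x]"
| red_Cons: "red (y # w) \<Longrightarrow> y \<noteq> flip x \<Longrightarrow> red (x # y # w)"

inductive_cases red_ConsE: "red (x # w)"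

lemma cancel_iff: "fst x = fst y \<and> snd x \<noteq> snd y \<longleftrightarrow> y = flip x"
  by (cases x; cases y) (auto simp: flip_def)

lemma flip_flip [simp]: "flip (flip x) = x" by (simp add: flip_def)

lemma push_simp [simp]: "push_letter x (y # w) = (if y = flip x then w else x # y # w)"
  using cancel_iff[of x y] by auto

declare push_letter.simps(2) [simp del]

lemma red_tl: "red (x # w) \<Longrightarrow> red w"
  by (erule red_ConsE) (auto intro: red.intros)

lemma red_push: "red w \<Longrightarrow> red (push_letter x w)"
  by (cases w) (auto intro: red.intros dest: red_tl)

lemma red_reduce: "red (reduce w)"
  by (induction w) (auto intro: red.intros red_push)

lemma reduce_red: "red w \<Longrightarrow> reduce w = w"
  by (induction w rule: red.induct) auto

text \<open>Van der Waerden's argument: letters act on reduced words by pushing, and the inverse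
  letter undoes this, so they act as permutations. The action of a word then depends only on its
  reduction, which is what associativity of the group needs.\<close>

lemma push_flip: "red w \<Longrightarrow> push_letter (flip x) (push_letter x w) = w"
  by (cases w) (auto elim: red_ConsE)

lemma red_foldr: "red z \<Longrightarrow> red (foldr push_letter u z)"
  by (induction u) (auto intro: red_push)

lemma foldr_push_letter:
  assumes "red z" shows "foldr push_letter (push_letter x u) z = push_letter x (foldr push_letter u z)"
proof (cases u)
  case (Cons y u')
  then show ?thesis
    using push_flip[OF red_foldr[OF assms], of "flip x" u'] by auto
qed auto

lemma foldr_reduce: "red z \<Longrightarrow> foldr push_letter (reduce u) z = foldr push_letter u z"
  by (induction u) (auto simp: foldr_push_letter)

lemma reduce_append: "reduce (reduce u @ v) = reduce (u @ v)" "reduce (u @ reduce v) = reduce (u @ v)"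
  by (simp_all add: foldr_push_reduce foldr_reduce red_reduce reduce_red)

lemma set_reduce: "set (reduce w) \<subseteq> set w"
proof (induction w)
  case (Cons x w)
  have "set (push_letter x v) \<subseteq> insert x (set v)" for v by (cases v) auto
  then show ?case using Cons by fastforce
qed simp

definition winv :: "word \<Rightarrow> word" where "winv w = rev (map flip w)"

lemma reduce_winv_left: "reduce (winv w @ w) = []"
proof (induction w)
  case (Cons x w)
  have "reduce (winv (x # w) @ x # w) = foldr push_letter (winv w) (push_letter (flip x) (push_letter x (reduce w)))"
    by (simp add: winv_def foldr_push_reduce)
  then show ?case using Cons by (simp add: push_flip red_reduce foldr_push_reduce)
qed (simp add: winv_def)

lemma free_group_simps [simp]:
  "w \<in> carrier (free_group q) \<longleftrightarrow> fst ` set w \<subseteq> {..<q} \<and> reduce w = w"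
  "u \<otimes>\<^bsub>free_group q\<^esub> v = reduce (u @ v)" "\<one>\<^bsub>free_group q\<^esub> = []"
  by (simp_all add: free_group_def)

lemma reduce_closed: "fst ` set w \<subseteq> {..<q} \<Longrightarrow> reduce w \<in> carrier (free_group q)"
  using set_reduce[of w] by (auto simp: reduce_red red_reduce)

lemma fst_winv: "fst ` set (winv w) = fst ` set w"
  by (auto simp: winv_def flip_def image_image)

lemma group_free_group: "group (free_group q)"
proof (rule groupI)
  fix u v w assume "u \<in> carrier (free_group q)" "v \<in> carrier (free_group q)" "w \<in> carrier (free_group q)"
  then show "u \<otimes>\<^bsub>free_group q\<^esub> v \<in> carrier (free_group q)"
    using reduce_closed[of "u @ v" q] by (simp add: image_Un)
  show "u \<otimes>\<^bsub>free_group q\<^esub> v \<otimes>\<^bsub>free_group q\<^esub> w = u \<otimes>\<^bsub>free_group q\<^esub> (v \<otimes>\<^bsub>free_group q\<^esub> w)"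
    by (simp add: reduce_append)
next
  fix w assume w: "w \<in> carrier (free_group q)"
  then show "\<one>\<^bsub>free_group q\<^esub> \<otimes>\<^bsub>free_group q\<^esub> w = w" by simp
  have "reduce (winv w) \<otimes>\<^bsub>free_group q\<^esub> w = \<one>\<^bsub>free_group q\<^esub>"
    by (simp add: reduce_append reduce_winv_left)
  moreover have "reduce (winv w) \<in> carrier (free_group q)" using w fst_winv by (intro reduce_closed) auto
  ultimately show "\<exists>v\<in>carrier (free_group q). v \<otimes>\<^bsub>free_group q\<^esub> w = \<one>\<^bsub>free_group q\<^esub>" by blast
qed simp

lemma discrete_group_free: "discrete_group (free_group q)"
  by (intro discrete_group.intro group_free_group)

lemma inv_free_group: "w \<in> carrier (free_group q) \<Longrightarrow> inv\<^bsub>free_group q\<^esub> w = reduce (winv w)"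
proof -
  assume w: "w \<in> carrier (free_group q)"
  interpret group "free_group q" by (rule group_free_group)
  have "reduce (winv w) \<in> carrier (free_group q)" using w fst_winv by (intro reduce_closed) auto
  then show ?thesis using w by (intro inv_equality) (simp_all add: reduce_append reduce_winv_left)
qed

definition gen :: "nat \<Rightarrow> word" where "gen j = [(j, True)]"

definition fgen :: "nat \<Rightarrow> nat \<Rightarrow> free_cstar_elem" where
  "fgen q j = discrete_group.ug (free_group q) (gen j)"

lemma gen_closed: "j < q \<Longrightarrow> gen j \<in> carrier (free_group q)"
  by (simp add: gen_def)

lemma unital_full_free: "unital_cstar (full_group_cstar (free_group q))"
  by (rule discrete_group.unital_full_group[OF discrete_group_free])

lemma fgen_closed: "j < q \<Longrightarrow> fgen q j \<in> carrier (full_group_cstar (free_group q))"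
  unfolding fgen_def by (intro discrete_group.ug_closed[OF discrete_group_free] gen_closed)

lemma fgen_unitary:
  assumes "j < q"
  shows "adj (full_group_cstar (free_group q)) (fgen q j) \<otimes>\<^bsub>full_group_cstar (free_group q)\<^esub> fgen q j
      = \<one>\<^bsub>full_group_cstar (free_group q)\<^esub>"
    "fgen q j \<otimes>\<^bsub>full_group_cstar (free_group q)\<^esub> adj (full_group_cstar (free_group q)) (fgen q j)
      = \<one>\<^bsub>full_group_cstar (free_group q)\<^esub>"
proof -
  interpret discrete_group "free_group q" by (rule discrete_group_free)
  note [simp del] = free_group_simps
  show "adj (full_group_cstar (free_group q)) (fgen q j) \<otimes>\<^bsub>full_group_cstar (free_group q)\<^esub> fgen q j
      = \<one>\<^bsub>full_group_cstar (free_group q)\<^esub>"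
    "fgen q j \<otimes>\<^bsub>full_group_cstar (free_group q)\<^esub> adj (full_group_cstar (free_group q)) (fgen q j)
      = \<one>\<^bsub>full_group_cstar (free_group q)\<^esub>"
    using gen_closed[OF assms] unfolding fgen_def by (simp_all add: ug_adj ug_mult ug_one)
qed

text \<open>Agreement at the unit is a separate hypothesis because *-homomorphisms may send it to
  any projection; for \<open>q = 0\<close> it is the only condition on values. Words are then
  handled letter by letter, inverse letters being adjoints.\<close>

lemma full_free_eqI:
  assumes X: "cstar_algebra X" and f: "f \<in> star_hom (full_group_cstar (free_group q)) X"
    and f': "f' \<in> star_hom (full_group_cstar (free_group q)) X"
    and one: "f \<one>\<^bsub>full_group_cstar (free_group q)\<^esub> = f' \<one>\<^bsub>full_group_cstar (free_group q)\<^esub>"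
    and eq: "\<And>j. j < q \<Longrightarrow> f (fgen q j) = f' (fgen q j)" and S: "S \<in> carrier (full_group_cstar (free_group q))"
  shows "f S = f' S"
proof -
  interpret F: discrete_group "free_group q" by (rule discrete_group_free)
  interpret X: cstar_algebra X by (rule X)
  let ?F = "full_group_cstar (free_group q)"
  note [simp del] = free_group_simps
  have letter: "f (F.ug [x]) = f' (F.ug [x])" if x: "fst x < q" for x
  proof (cases "snd x")
    case True
    then have "[x] = gen (fst x)" by (cases x) (simp add: gen_def)
    then show ?thesis using eq[OF x] unfolding fgen_def by simp
  next
    case False
    then have "[x] = reduce (winv (gen (fst x)))" by (cases x) (simp add: gen_def winv_def flip_def)
    also have "\<dots> = inv\<^bsub>free_group q\<^esub> (gen (fst x))" using inv_free_group[OF gen_closed[OF x]] by simp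
    finally have "F.ug [x] = adj ?F (fgen q (fst x))" unfolding fgen_def using F.ug_adj[OF gen_closed[OF x]] by simp
    then show ?thesis using eq[OF x] star_homD(5)[OF f fgen_closed[OF x]] star_homD(5)[OF f' fgen_closed[OF x]] by simp
  qed
  have "red w \<Longrightarrow> fst ` set w \<subseteq> {..<q} \<Longrightarrow> f (F.ug w) = f' (F.ug w)" for w
  proof (induction w rule: red.induct)
    case red_Nil
    have "F.ug [] = \<one>\<^bsub>?F\<^esub>" using F.ug_one by (simp add: free_group_simps)
    then show ?case using one by simp
  next
    case (red_single x)
    then show ?case using letter by simp
  next
    case (red_Cons y w x)
    have r: "red (x # y # w)" using red_Cons by (auto intro: red.intros)
    have c: "[x] \<in> carrier (free_group q)" "y # w \<in> carrier (free_group q)"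
      using red_Cons.prems reduce_red[OF red_Cons.hyps(1)] by (auto simp: free_group_simps)
    have "[x] \<otimes>\<^bsub>free_group q\<^esub> (y # w) = x # y # w" using reduce_red[OF r] by (simp add: free_group_simps)
    then have "F.ug (x # y # w) = F.ug [x] \<otimes>\<^bsub>?F\<^esub> F.ug (y # w)" using F.ug_mult[OF c] by simp
    then show ?case
      using star_homD(4)[OF f F.ug_closed F.ug_closed, OF c] star_homD(4)[OF f' F.ug_closed F.ug_closed, OF c]
        red_Cons letter[of x] by simp
  qed
  then have "f (F.ug g) = f' (F.ug g)" if "g \<in> carrier (free_group q)" for g
    using that red_reduce[of g] by (simp add: free_group_simps)
  then show ?thesis using F.full_group_eqI[OF X f f'] S by blast
qed

text \<open>The unitaries are multiplied along a word, with \<open>e\<close> for the empty word.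
  Cancelling a letter against its inverse leaves the product unchanged, since \<open>e\<close> is
  absorbed by the rest; so the product is multiplicative on reduced words.\<close>

lemma full_free_rep:
  fixes u :: "nat \<Rightarrow> 'x univ"
  assumes X: "cstar_algebra X" and e: "e * e = e" "star e = e" "cstar_algebra.inr X e"
    and u: "\<And>j. j < q \<Longrightarrow> cstar_algebra.inr X (u j)" "\<And>j. j < q \<Longrightarrow> e * u j = u j" "\<And>j. j < q \<Longrightarrow> u j * e = u j"
      "\<And>j. j < q \<Longrightarrow> star (u j) * u j = e" "\<And>j. j < q \<Longrightarrow> u j * star (u j) = e"
  obtains \<pi> where "\<pi> \<in> star_hom (full_group_cstar (free_group q)) X"
    "emb X (\<pi> \<one>\<^bsub>full_group_cstar (free_group q)\<^esub>) = e" "\<And>j. j < q \<Longrightarrow> emb X (\<pi> (fgen q j)) = u j"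
proof -
  interpret X: cstar_algebra X by (rule X)
  interpret F: discrete_group "free_group q" by (rule discrete_group_free)
  interpret corner e by (standard; fact)
  define l where "l x = (if snd x then u (fst x) else star (u (fst x)))" for x :: "nat \<times> bool"
  define U where "U w = foldr (\<lambda>x z. l x * z) w e" for w :: word
  have cu: "crn (u j)" if "j < q" for j using u(2,3)[OF that] unfolding crn_def by simp
  have lq: "crn (l x)" "X.inr (l x)" "l (flip x) * l x = e" "l x * l (flip x) = e" "star (l x) = l (flip x)" if "fst x < q" for x
    using that cu u unfolding l_def flip_def by (auto intro!: crn_intros(9))
  have cU: "crn (U w) \<and> X.inr (U w)" if "fst ` set w \<subseteq> {..<q}" for w
    using that unfolding U_def by (induction w) (use lq e in auto)
  have app: "U (v @ w) = U v * U w" if "fst ` set v \<subseteq> {..<q}" "fst ` set w \<subseteq> {..<q}" for v w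
    using that(1)
  proof (induction v)
    case Nil
    then show ?case using cU[OF that(2)] unfolding U_def crn_def by simp
  qed (simp add: U_def mult.assoc)
  have push: "U (push_letter x w) = l x * U w" if x: "fst x < q" and w: "fst ` set w \<subseteq> {..<q}" for x w
  proof (cases w)
    case (Cons y v)
    show ?thesis
    proof (cases "y = flip x")
      case True
      have "l x * U w = (l x * l (flip x)) * U v" using Cons True by (simp add: U_def mult.assoc)
      also have "\<dots> = U v" using lq(4)[OF x] cU[of v] w Cons unfolding crn_def by simp
      finally show ?thesis using Cons True by simp
    qed (use Cons in \<open>simp add: U_def\<close>)
  qed (simp add: U_def)
  have reduce: "U (reduce w) = U w" if "fst ` set w \<subseteq> {..<q}" for w
    using that
  proof (induction w)
    case (Cons x w)
    then show ?case using push[of x "reduce w"] set_reduce[of w] by (auto simp: U_def)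
  qed simp
  have starU: "star (U w) = U (winv w)" if "fst ` set w \<subseteq> {..<q}" for w
    using that
  proof (induction w)
    case Nil
    then show ?case by (simp add: U_def winv_def e)
  next
    case (Cons x w)
    have "U (winv (x # w)) = U (winv w) * U [flip x]"
      using app[of "winv w" "[flip x]"] Cons.prems fst_winv[of w] by (simp add: winv_def flip_def)
    also have "U [flip x] = l (flip x)" using lq(1)[of "flip x"] Cons.prems by (simp add: U_def crn_def flip_def)
    finally show ?case using Cons lq(5)[of x] by (simp add: U_def star_mult)
  qed
  obtain \<pi> where \<pi>: "\<pi> \<in> star_hom (full_group_cstar (free_group q)) X"
    "\<And>g. g \<in> carrier (free_group q) \<Longrightarrow> emb X (\<pi> (F.ug g)) = U g"
  proof (rule F.full_group_rep[OF X, of U])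
    show "X.inr (U g)" if "g \<in> carrier (free_group q)" for g using cU that by simp
    show "U (g \<otimes>\<^bsub>free_group q\<^esub> h) = U g * U h" if "g \<in> carrier (free_group q)" "h \<in> carrier (free_group q)" for g h
      using that reduce[of "g @ h"] app[of g h] by (simp add: image_Un)
    show "star (U g) = U (inv\<^bsub>free_group q\<^esub> g)" if "g \<in> carrier (free_group q)" for g
      using that starU[of g] reduce[of "winv g"] fst_winv[of g] inv_free_group[OF that] by simp
  qed blast
  show thesis
  proof (rule that[OF \<pi>(1)])
    have "F.ug [] = \<one>\<^bsub>full_group_cstar (free_group q)\<^esub>" using F.ug_one by simp
    then show "emb X (\<pi> \<one>\<^bsub>full_group_cstar (free_group q)\<^esub>) = e" using \<pi>(2)[of "[]"] by (simp add: U_def)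
    show "emb X (\<pi> (fgen q j)) = u j" if "j < q" for j
      using \<pi>(2)[OF gen_closed[OF that]] u(3)[OF that] unfolding fgen_def by (simp add: U_def gen_def l_def)
  qed
qed

section \<open>Spanning trees\<close>

text \<open>The confinement to \<open>S\<close> keeps a vertex outside \<open>S\<close> off the
  path, so that the path can be extended or closed up through that vertex.\<close>

definition tree_path :: "('v, 'e) multigraph \<Rightarrow> 'e set \<Rightarrow> 'v set \<Rightarrow> 'v list \<Rightarrow> 'e list \<Rightarrow> bool" where
  "tree_path G T S vs es \<longleftrightarrow> distinct vs \<and> set vs \<subseteq> S \<and> set es \<subseteq> T \<and> length vs = Suc (length es) \<and>
     (\<forall>i<length es. ends G (es ! i) = {vs ! i, vs ! Suc i})"

lemma tree_path_mono: "tree_path G T S vs es \<Longrightarrow> S \<subseteq> S' \<Longrightarrow> tree_path G T S' vs es"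
  unfolding tree_path_def by auto

lemma tree_path_snoc:
  assumes "tree_path G T S vs es" "a \<in> T" "ends G a = {last vs, v}" "v \<notin> S"
  shows "tree_path G T (insert v S) (vs @ [v]) (es @ [a])"
proof -
  have ne: "vs \<noteq> []" "length vs = Suc (length es)" using assms(1) unfolding tree_path_def by auto
  then have l: "last vs = vs ! length es" by (simp add: last_conv_nth)
  have "ends G ((es @ [a]) ! i) = {(vs @ [v]) ! i, (vs @ [v]) ! Suc i}" if "i < length (es @ [a])" for i
  proof (cases "i < length es")
    case True
    then show ?thesis using assms(1) ne unfolding tree_path_def by (simp add: nth_append)
  next
    case False
    then have "i = length es" using that by simp
    then show ?thesis using assms(3) ne l by (simp add: nth_append)
  qed
  then show ?thesis using assms ne unfolding tree_path_def by auto
qed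

lemma tree_path_rev:
  assumes "tree_path G T S vs es" shows "tree_path G T S (rev vs) (rev es)"
proof -
  have l: "length vs = Suc (length es)" using assms unfolding tree_path_def by auto
  have "ends G (rev es ! i) = {rev vs ! i, rev vs ! Suc i}" if i: "i < length (rev es)" for i
  proof -
    define j where "j = length es - Suc i"
    have j: "j < length es" "rev es ! i = es ! j" "rev vs ! i = vs ! Suc j" "rev vs ! Suc i = vs ! j"
      using i l unfolding j_def by (auto simp: rev_nth Suc_diff_Suc)
    then show ?thesis using assms unfolding tree_path_def by auto
  qed
  then show ?thesis using assms unfolding tree_path_def by auto
qed

lemma tree_path_distinct:
  assumes "tree_path G T S vs es" shows "distinct es"
proof -
  have l: "length vs = Suc (length es)" "distinct vs" using assms unfolding tree_path_def by auto
  have ne: "es ! i \<noteq> es ! j" if "i < j" "j < length es" for i j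
  proof
    assume "es ! i = es ! j"
    then have "{vs ! i, vs ! Suc i} = {vs ! j, vs ! Suc j}"
      using assms that unfolding tree_path_def by (metis less_trans)
    then have "vs ! i = vs ! j \<or> vs ! i = vs ! Suc j" by auto
    then show False using l that by (auto simp: nth_eq_iff_index_eq)
  qed
  show ?thesis unfolding distinct_conv_nth using ne by (metis linorder_neqE_nat)
qed

text \<open>The path is closed by two edges through the outside vertex \<open>v\<close>. If it has
  no edges, then \<open>a\<close> and \<open>b\<close> are parallel and the cycle has length
  2.\<close>

lemma tree_path_closes_cycle:
  assumes path: "tree_path G T S vs es" and S: "S \<subseteq> verts G" "v \<in> verts G" "v \<notin> S"
    and a: "a \<in> T" "ends G a = {last vs, v}" and b: "b \<in> T" "ends G b = {hd vs, v}" and ab: "a \<noteq> b"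
  shows "is_cycle (G\<lparr>edges := T\<rparr>) (vs @ [v]) (es @ [a, b])"
proof -
  have l: "length vs = Suc (length es)" "distinct vs" "set vs \<subseteq> S" "set es \<subseteq> T" "vs \<noteq> []"
    using path unfolding tree_path_def by auto
  have es: "ends G x \<subseteq> S" if "x \<in> set es" for x
  proof -
    obtain i where i: "i < length es" "x = es ! i" using \<open>x \<in> set es\<close> by (metis in_set_conv_nth)
    then have "ends G x = {vs ! i, vs ! Suc i}" using path unfolding tree_path_def by simp
    moreover have "vs ! i \<in> set vs" "vs ! Suc i \<in> set vs" using i l(1) by (auto intro: nth_mem)
    ultimately show ?thesis using l(3) by auto
  qed
  have "a \<notin> set es" "b \<notin> set es" using es a(2) b(2) S(3) by auto
  then have d: "distinct (es @ [a, b])" using tree_path_distinct[OF path] ab by auto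
  have last: "last vs = vs ! length es" and hd: "hd vs = vs ! 0" using l by (simp_all add: last_conv_nth hd_conv_nth)
  have "ends G ((es @ [a, b]) ! i) = {(vs @ [v]) ! i, (vs @ [v]) ! (Suc i mod length (es @ [a, b]))}"
    if i: "i < length (es @ [a, b])" for i
  proof -
    consider "i < length es" | "i = length es" | "i = Suc (length es)" using i by fastforce
    then show ?thesis
    proof cases
      case 1
      then show ?thesis using path l unfolding tree_path_def by (simp add: nth_append)
    next
      case 2
      then show ?thesis using a(2) l last by (simp add: nth_append)
    next
      case 3
      then show ?thesis using b(2) l hd by (auto simp: nth_append)
    qed
  qed
  then show ?thesis unfolding is_cycle_def using l d S a b by auto
qed

lemma crossing_edge:
  assumes "(x, y) \<in> (adjacent G)\<^sup>*" "x \<in> S" "y \<notin> S"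
  obtains u v a where "u \<in> S" "v \<notin> S" "a \<in> edges G" "ends G a = {u, v}"
proof -
  have "\<exists>u v. u \<in> S \<and> v \<notin> S \<and> (u, v) \<in> adjacent G"
    using assms by (induction rule: rtrancl_induct) auto
  then show thesis using that unfolding adjacent_def by blast
qed

text \<open>\<open>Fam v \<phi>\<close> says that \<open>\<phi>\<close> is an admissible choice at the vertex \<open>v\<close>. A choice at one end of
  a tree edge determines one at the other end, and since the tree has no cycles, the choices made
  along the tree fit together.\<close>

lemma spanning_tree_gauge:
  assumes fin: "finite (verts G)" and tree: "spanning_tree G T" and v0: "v0 \<in> verts G" "Fam v0 \<phi>0"
    and ends: "\<And>a. a \<in> T \<Longrightarrow> ends G a \<subseteq> verts G"
    and ext: "\<And>a u v \<phi>. a \<in> T \<Longrightarrow> ends G a = {u, v} \<Longrightarrow> u \<noteq> v \<Longrightarrow> Fam u \<phi> \<Longrightarrow> \<exists>\<psi>. Fam v \<psi> \<and> \<psi> a = \<phi> a"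
  obtains \<Phi> where "\<And>v. v \<in> verts G \<Longrightarrow> Fam v (\<Phi> v)"
    "\<And>a u v. a \<in> T \<Longrightarrow> ends G a = {u, v} \<Longrightarrow> \<Phi> u a = \<Phi> v a"
proof -
  \<comment> \<open>Sets of vertices on which the choices already fit together. The paths inside
    \<open>S\<close> belong to the invariant because they will close the forbidden cycle.\<close>
  define good where "good S \<longleftrightarrow> v0 \<in> S \<and> S \<subseteq> verts G \<and>
    (\<exists>\<Phi>. (\<forall>v\<in>S. Fam v (\<Phi> v)) \<and> (\<forall>a\<in>T. \<forall>u\<in>S. \<forall>v\<in>S. ends G a = {u, v} \<longrightarrow> \<Phi> u a = \<Phi> v a)) \<and>
    (\<forall>x\<in>S. \<forall>y\<in>S. \<exists>vs es. tree_path G T S vs es \<and> hd vs = x \<and> last vs = y)" for S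
  have "tree_path G T {v0} [v0] []" unfolding tree_path_def by simp
  then have "good {v0}" unfolding good_def using v0
    by (intro conjI exI[of _ "\<lambda>_. \<phi>0"] ballI exI[of _ "[v0]"] exI[of _ "[]"]) auto
  moreover have "{S. good S} \<subseteq> Pow (verts G)" unfolding good_def by auto
  then have "finite {S. good S}" using fin finite_subset by blast
  ultimately obtain S where S: "good S" and max: "\<And>S'. good S' \<Longrightarrow> S \<subseteq> S' \<Longrightarrow> S = S'"
    using finite_has_maximal[of "{S. good S}"] by blast
  obtain \<Phi> where \<Phi>: "\<And>v. v \<in> S \<Longrightarrow> Fam v (\<Phi> v)"
    "\<And>a u v. a \<in> T \<Longrightarrow> u \<in> S \<Longrightarrow> v \<in> S \<Longrightarrow> ends G a = {u, v} \<Longrightarrow> \<Phi> u a = \<Phi> v a"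
    using S unfolding good_def by blast
  have path: "\<exists>vs es. tree_path G T S vs es \<and> hd vs = x \<and> last vs = y" if "x \<in> S" "y \<in> S" for x y
    using S that unfolding good_def by blast
  have Sv: "v0 \<in> S" "S \<subseteq> verts G" using S unfolding good_def by auto
  have "S = verts G"
  proof (rule ccontr)
    assume "S \<noteq> verts G"
    then obtain y where y: "y \<in> verts G" "y \<notin> S" using Sv by auto
    have "(v0, y) \<in> (adjacent (G\<lparr>edges := T\<rparr>))\<^sup>*"
      using tree y(1) v0(1) unfolding spanning_tree_def connected_graph_def by auto
    then obtain u v a where e: "u \<in> S" "v \<notin> S" "a \<in> T" "ends G a = {u, v}"
      using crossing_edge[OF _ Sv(1) y(2), of "G\<lparr>edges := T\<rparr>"] by auto
    have uv: "u \<noteq> v" "v \<in> verts G" using e ends[OF e(3)] by auto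
    obtain \<psi> where \<psi>: "Fam v \<psi>" "\<psi> a = \<Phi> u a" using ext[OF e(3,4) uv(1) \<Phi>(1)[OF e(1)]] by blast
    define \<Phi>' where "\<Phi>' = \<Phi>(v := \<psi>)"
    \<comment> \<open>A second tree edge from \<open>S\<close> to \<open>v\<close> would form a
      cycle with \<open>a\<close> and a path inside \<open>S\<close>. So the condition
      \<open>\<psi> a = \<Phi> u a\<close> is the only one that the new choice has to meet.\<close>
    have only: "b = a \<and> x = u" if b: "b \<in> T" "ends G b = {x, v}" "x \<in> S" for b x
    proof (rule ccontr)
      assume neg: "\<not> (b = a \<and> x = u)"
      then have ne: "a \<noteq> b" using b e uv by (auto simp: doubleton_eq_iff)
      obtain vs es where p: "tree_path G T S vs es" "hd vs = x" "last vs = u" using path[OF b(3) e(1)] by blast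
      have "is_cycle (G\<lparr>edges := T\<rparr>) (vs @ [v]) (es @ [a, b])"
        using tree_path_closes_cycle[OF p(1) Sv(2) uv(2) e(2,3) _ b(1) _ ne] p e b by simp
      then show False using tree unfolding spanning_tree_def by blast
    qed
    have "good (insert v S)" unfolding good_def
    proof (intro conjI)
      show "v0 \<in> insert v S" "insert v S \<subseteq> verts G" using Sv uv by auto
      have "\<Phi>' x b = \<Phi>' z b" if b: "b \<in> T" "x \<in> insert v S" "z \<in> insert v S" "ends G b = {x, z}" for x z b
      proof (cases "x = v"; cases "z = v")
        assume "x = v" "z \<noteq> v"
        then have "b = a \<and> z = u" using only[of b z] b by (auto simp: insert_commute)
        then show ?thesis using \<psi>(2) \<open>x = v\<close> \<open>z \<noteq> v\<close> by (simp add: \<Phi>'_def)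
      next
        assume "x \<noteq> v" "z = v"
        then have "b = a \<and> x = u" using only[of b x] b by auto
        then show ?thesis using \<psi>(2) \<open>z = v\<close> \<open>x \<noteq> v\<close> by (simp add: \<Phi>'_def)
      next
        assume "x = v" "z = v"
        then show ?thesis by simp
      next
        assume "x \<noteq> v" "z \<noteq> v"
        then show ?thesis using \<Phi>(2)[of b x z] b by (simp add: \<Phi>'_def)
      qed
      then show "\<exists>\<Phi>. (\<forall>w\<in>insert v S. Fam w (\<Phi> w)) \<and>
          (\<forall>a\<in>T. \<forall>u\<in>insert v S. \<forall>w\<in>insert v S. ends G a = {u, w} \<longrightarrow> \<Phi> u a = \<Phi> w a)"
        using \<Phi>(1) \<psi>(1) by (intro exI[of _ \<Phi>']) (auto simp: \<Phi>'_def)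
      have to_v: "\<exists>vs es. tree_path G T (insert v S) vs es \<and> hd vs = x \<and> last vs = v" if x: "x \<in> S" for x
      proof -
        obtain vs es where p: "tree_path G T S vs es" "hd vs = x" "last vs = u" using path[OF x e(1)] by blast
        have "tree_path G T (insert v S) (vs @ [v]) (es @ [a])" using tree_path_snoc[OF p(1) e(3) _ e(2)] p e by simp
        moreover have "vs \<noteq> []" using p(1) unfolding tree_path_def by auto
        ultimately show ?thesis using p(2) by (intro exI[of _ "vs @ [v]"] exI[of _ "es @ [a]"]) simp
      qed
      show "\<forall>x\<in>insert v S. \<forall>y\<in>insert v S. \<exists>vs es. tree_path G T (insert v S) vs es \<and> hd vs = x \<and> last vs = y"
      proof (intro ballI)
        fix x y assume xy: "x \<in> insert v S" "y \<in> insert v S"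
        show "\<exists>vs es. tree_path G T (insert v S) vs es \<and> hd vs = x \<and> last vs = y"
        proof (cases "x = v"; cases "y = v")
          assume "x = v" "y = v"
          then show ?thesis by (intro exI[of _ "[v]"] exI[of _ "[]"]) (simp add: tree_path_def)
        next
          assume "x \<noteq> v" "y = v"
          then show ?thesis using to_v xy by auto
        next
          assume xy': "x = v" "y \<noteq> v"
          then obtain vs es where p: "tree_path G T (insert v S) vs es" "hd vs = y" "last vs = v" using to_v[of y] xy by auto
          have "vs \<noteq> []" using p(1) unfolding tree_path_def by auto
          then show ?thesis using tree_path_rev[OF p(1)] p xy'
            by (intro exI[of _ "rev vs"] exI[of _ "rev es"]) (simp add: hd_rev last_rev)
        next
          assume "x \<noteq> v" "y \<noteq> v"
          then show ?thesis using path[of x y] xy tree_path_mono[of G T S _ _ "insert v S"] by blast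
        qed
      qed
    qed
    then show False using max[of "insert v S"] e(2) by blast
  qed
  then show thesis using that[of \<Phi>] \<Phi> ends by (metis insert_subset)
qed

section \<open>Multimatrix algebras\<close>

lemma offset_Suc: "offset m (Suc i) = offset m i + m i"
  by (simp add: offset_def)

lemma offset_mono: "i < j \<Longrightarrow> offset m i + m i \<le> offset m j"
proof (induction j)
  case (Suc j)
  then show ?case by (cases "i = j") (auto simp: offset_Suc)
qed simp

definition block :: "nat \<Rightarrow> (nat \<Rightarrow> nat) \<Rightarrow> nat \<Rightarrow> nat" where
  "block r m e = (THE i. i < r \<and> offset m i \<le> e \<and> e < offset m i + m i)"

definition place :: "nat \<Rightarrow> (nat \<Rightarrow> nat) \<Rightarrow> nat \<Rightarrow> nat" where
  "place r m e = e - offset m (block r m e)"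

lemma block_unique: "i < r \<Longrightarrow> offset m i \<le> e \<Longrightarrow> e < offset m i + m i \<Longrightarrow> block r m e = i"
  unfolding block_def
proof (rule the_equality, simp)
  fix j assume i: "i < r" "offset m i \<le> e" "e < offset m i + m i" and j: "j < r \<and> offset m j \<le> e \<and> e < offset m j + m j"
  show "j = i" using i j offset_mono[of i j m] offset_mono[of j i m] by (cases i j rule: linorder_cases) auto
qed

lemma block_exists: "e < offset m r \<Longrightarrow> \<exists>i<r. offset m i \<le> e \<and> e < offset m i + m i"
proof (induction r)
  case 0
  then show ?case by (simp add: offset_def)
next
  case (Suc r)
  then show ?case by (cases "e < offset m r") (auto simp: offset_Suc less_Suc_eq)
qed

lemma block_props:
  assumes "e < offset m r"
  shows "block r m e < r" "place r m e < m (block r m e)" "offset m (block r m e) + place r m e = e"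
  using block_exists[OF assms] block_unique[of _ r m e] unfolding place_def by auto

lemma offset_add_less: "i < r \<Longrightarrow> a < m i \<Longrightarrow> offset m i + a < offset m r"
  using offset_mono[of i r m] by simp

lemma block_offset_add [simp]: "i < r \<Longrightarrow> a < m i \<Longrightarrow> block r m (offset m i + a) = i"
  "i < r \<Longrightarrow> a < m i \<Longrightarrow> place r m (offset m i + a) = a"
  using block_unique[of i r m "offset m i + a"] unfolding place_def by auto

lemma sum_blocks: "(\<Sum>i<r. \<Sum>a<m i. g (offset m i + a)) = (\<Sum>e<offset m r. g e :: 'a::comm_monoid_add)"
proof (induction r)
  case (Suc r)
  have "(\<Sum>e<M + n. g e) = (\<Sum>e<M. g e) + (\<Sum>a<n. g (M + a))" for M n
    by (induction n) (simp_all add: add.assoc)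
  then show ?case using Suc by (simp add: offset_Suc)
qed (simp add: offset_def)

locale block_alg =
  fixes r :: nat and m :: "nat \<Rightarrow> nat"
  assumes m_pos: "\<And>i. i < r \<Longrightarrow> m i > 0"
begin

sublocale matrix_sum "{..<r}" m "\<lambda>_. complex_alg"
  by (intro matrix_sum.intro unital_cstar_complex finite_lessThan)

abbreviation "N \<equiv> offset m r"
abbreviation "bl \<equiv> block r m"
abbreviation "pl \<equiv> place r m"

lemma DM_multimatrix: "DM = multimatrix r m"
  unfolding DM_def multimatrix_def ..

text \<open>Matrix units indexed by diagonal positions, that is, by edges of the graph; intended for
  two positions of one block.\<close>

definition PU :: "nat \<Rightarrow> nat \<Rightarrow> nat \<Rightarrow> nat \<times> nat \<Rightarrow> complex" where
  "PU e e' = E (bl e) (pl e) (pl e') 1"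

lemma PU_closed: "e < N \<Longrightarrow> PU e e' \<in> carrier DM"
  unfolding PU_def using block_props[of e] by auto

lemma PU_adj: "e < N \<Longrightarrow> e' < N \<Longrightarrow> bl e = bl e' \<Longrightarrow> adj DM (PU e e') = PU e' e"
  unfolding PU_def using block_props[of e m r] by (simp add: E_adj)

lemma PU_mult:
  assumes "e < N" "e' < N" "d < N" "d' < N" "bl e = bl e'" "bl d = bl d'"
  shows "PU e e' \<otimes>\<^bsub>DM\<^esub> PU d d' = (if e' = d then PU e d' else \<zero>\<^bsub>DM\<^esub>)"
proof -
  have "bl e = bl d \<and> pl e' = pl d \<longleftrightarrow> e' = d"
    using block_props(3)[OF assms(2)] block_props(3)[OF assms(3)] assms(5) by metis
  then show ?thesis
    unfolding PU_def using assms block_props[OF assms(1)] block_props[OF assms(2)] block_props[OF assms(3)]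
    by (subst E_mult) auto
qed

lemma E_eq_PU:
  assumes "i < r" "a < m i" "b < m i"
  shows "E i a b c = c \<odot>\<^bsub>DM\<^esub> PU (offset m i + a) (offset m i + b)"
  unfolding PU_def using assms E_smult[of i 1 a b c] by simp

text \<open>A *-homomorphism out of the multimatrix algebra, recorded by the images of matrix units
  in the product ring; \<open>unit_system_of_hom\<close> and \<open>hom_of_unit_system\<close> pass
  between the two.\<close>

definition unit_system :: "'x cstar \<Rightarrow> (nat \<Rightarrow> nat \<Rightarrow> 'x univ) \<Rightarrow> bool" where
  "unit_system X F \<longleftrightarrow>
     (\<forall>e<N. \<forall>e'<N. bl e = bl e' \<longrightarrow> cstar_algebra.inr X (F e e') \<and> star (F e e') = F e' e) \<and>
     (\<forall>e<N. \<forall>e'<N. \<forall>d<N. \<forall>d'<N. bl e = bl e' \<longrightarrow> bl d = bl d' \<longrightarrow>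
        F e e' * F d d' = (if e' = d then F e d' else 0))"

lemma unit_systemD:
  assumes "unit_system X F" "e < N" "e' < N" "bl e = bl e'"
  shows "cstar_algebra.inr X (F e e')" "star (F e e') = F e' e"
    "d < N \<Longrightarrow> d' < N \<Longrightarrow> bl d = bl d' \<Longrightarrow> F e e' * F d d' = (if e' = d then F e d' else 0)"
  using assms unfolding unit_system_def by blast+

lemma unit_system_of_hom:
  assumes X: "cstar_algebra X" and f: "f \<in> star_hom DM X"
  shows "unit_system X (\<lambda>e e'. emb X (f (PU e e')))"
proof -
  interpret X: cstar_algebra X by (rule X)
  have z: "emb X (f \<zero>\<^bsub>DM\<^esub>) = 0"
    using emb_star_hom(3)[OF X f D.M.zero_closed, of 0] by simp
  show ?thesis unfolding unit_system_def
  proof (intro conjI allI impI)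
    fix e e' d d' assume e: "e < N" "e' < N" "bl e = bl e'"
    show "X.inr (emb X (f (PU e e')))" using star_homD(1)[OF f PU_closed[OF e(1)]] by blast
    show "star (emb X (f (PU e e'))) = emb X (f (PU e' e))"
      using emb_star_hom(5)[OF X f PU_closed[OF e(1)], of e'] PU_adj[OF e] by simp
    assume d: "d < N" "d' < N" "bl d = bl d'"
    show "emb X (f (PU e e')) * emb X (f (PU d d')) = (if e' = d then emb X (f (PU e d')) else 0)"
      using emb_star_hom(4)[OF X f PU_closed[OF e(1)] PU_closed[OF d(1)], of e' d'] PU_mult[OF e(1,2) d(1,2) e(3) d(3)] z
      by (simp split: if_splits)
  qed
qed

text \<open>The first position of each block is a base point, which exists because blocks are
  nonempty. Multiples of the projection \<open>F\<close> at the base point represent the scalars,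
  and the units from the base point to the other positions are the partial isometries that spread
  this representation over the block.\<close>

lemma hom_of_unit_system:
  assumes X: "cstar_algebra X" and F: "unit_system X F"
  obtains f where "f \<in> star_hom DM X" "\<And>e e'. e < N \<Longrightarrow> e' < N \<Longrightarrow> bl e = bl e' \<Longrightarrow> emb X (f (PU e e')) = F e e'"
proof -
  interpret X: cstar_algebra X by (rule X)
  note FD = unit_systemD[OF F]
  define o0 where "o0 i = offset m i" for i
  have o0: "o0 i < N" "bl (o0 i) = i" if "i < r" for i
    unfolding o0_def using offset_add_less[of i r 0 m] block_offset_add(1)[of i r 0 m] that m_pos[OF that] by simp_all
  define \<pi> where "\<pi> i c = ev X (c *\<^sub>C F (o0 i) (o0 i))" for i c
  have e\<pi>: "emb X (\<pi> i c) = c *\<^sub>C F (o0 i) (o0 i)" if "i < r" for i c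
    using FD(1)[OF o0(1) o0(1)] that X.inr_intros(5) unfolding \<pi>_def X.inr_def by auto
  define w where "w i a = F (o0 i) (offset m i + a)" for i a
  interpret matrix_sum_rep "{..<r}" m "\<lambda>_. complex_alg" X \<pi> w
  proof (intro matrix_sum_rep.intro matrix_sum_axioms X matrix_sum_rep_axioms.intro)
    fix i assume i: "i \<in> {..<r}"
    show "\<pi> i \<in> star_hom complex_alg X"
      unfolding \<pi>_def using i FD[OF o0(1) o0(1)] FD(3)[OF o0(1) o0(1), of i i "o0 i" "o0 i"] o0(1)
      by (intro X.star_hom_of_typed) (auto simp: scaleC_add_left mult.commute)
    fix a assume a: "a < m i"
    have oa: "offset m i + a < N" "bl (offset m i + a) = i" using i a offset_add_less by auto
    show "X.inr (w i a)" unfolding w_def using i oa FD(1)[OF o0(1) oa(1)] o0(2) by auto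
    fix j b assume j: "j \<in> {..<r}" and b: "b < m j"
    have ob: "offset m j + b < N" "bl (offset m j + b) = j" using j b offset_add_less by auto
    have iff: "offset m i + a = offset m j + b \<longleftrightarrow> i = j \<and> a = b" using oa(2) ob(2) by auto
    have "w i a * star (w j b) = F (o0 i) (offset m i + a) * F (offset m j + b) (o0 j)"
      unfolding w_def using FD(2)[OF o0(1) ob(1)] o0(2) ob(2) j by simp
    also have "\<dots> = (if offset m i + a = offset m j + b then F (o0 i) (o0 j) else 0)"
      using i j oa ob o0 by (intro FD(3)) auto
    finally show "w i a * star (w j b) = (if i = j \<and> a = b then emb X (\<pi> i \<one>\<^bsub>complex_alg\<^esub>) else 0)"
      using e\<pi> i iff by auto
  qed
  have "emb X (h (PU e e')) = F e e'" if e: "e < N" "e' < N" "bl e = bl e'" for e e'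
  proof -
    note b = block_props[OF e(1)] and b' = block_props[OF e(2)]
    have "emb X (h (PU e e')) = star (w (bl e) (pl e)) * emb X (\<pi> (bl e) 1) * w (bl e) (pl e')"
      using emb_h[OF PU_closed[OF e(1)]] H_E[of "bl e" "pl e" "pl e'" 1] b b' e(3) unfolding PU_def by simp
    also have "\<dots> = F e (o0 (bl e)) * F (o0 (bl e)) (o0 (bl e)) * F (o0 (bl e)) e'"
      using e\<pi>[OF b(1)] b b' e FD(2)[OF o0(1)[OF b(1)] e(1)] o0(2)[OF b(1)] unfolding w_def by simp
    also have "\<dots> = F e e'" using e o0[OF b(1)] by (simp add: FD(3))
    finally show ?thesis .
  qed
  then show thesis using that h_star_hom by blast
qed

lemma hom_eqI:
  assumes X: "cstar_algebra X" and f: "f \<in> star_hom DM X" and g: "g \<in> star_hom DM X" and x: "x \<in> carrier DM"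
    and eq: "\<And>e e'. e < N \<Longrightarrow> e' < N \<Longrightarrow> bl e = bl e' \<Longrightarrow> f (PU e e') = g (PU e e')"
  shows "f x = g x"
proof (rule star_hom_eqI[OF f g x X])
  fix i a b z assume i: "i \<in> {..<r}" "a < m i" "b < m i"
  have o: "offset m i + a < N" "offset m i + b < N" using i offset_add_less by auto
  show "f (E i a b z) = g (E i a b z)"
    using i o eq[OF o] star_homD(3)[OF f PU_closed[OF o(1)]] star_homD(3)[OF g PU_closed[OF o(1)]]
    by (simp add: E_eq_PU)
qed

lemma hom_expand:
  assumes X: "cstar_algebra X" and f: "f \<in> star_hom DM X" and x: "x \<in> carrier DM"
  shows "emb X (f x) = (\<Sum>i<r. \<Sum>a<m i. \<Sum>b<m i. x i (a, b) *\<^sub>C emb X (f (PU (offset m i + a) (offset m i + b))))"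
  using x
proof (induction x rule: DM_induct)
  case zero
  have "emb X (f \<zero>\<^bsub>DM\<^esub>) = 0" using emb_star_hom(3)[OF X f D.M.zero_closed, of 0] by simp
  then show ?case by (simp add: DM_entries)
next
  case (add x y)
  then show ?case by (simp add: emb_star_hom(2)[OF X f] DM_entries scaleC_add_left sum.distrib)
next
  case (unit i a b z)
  have o: "offset m i + a < N" using unit offset_add_less by auto
  let ?V = "z *\<^sub>C emb X (f (PU (offset m i + a) (offset m i + b)))"
  have "emb X (f (E i a b z)) = ?V"
    using unit by (simp add: E_eq_PU emb_star_hom(3)[OF X f PU_closed[OF o]])
  moreover have "(\<Sum>j<r. \<Sum>c<m j. \<Sum>d<m j. E i a b z j (c, d) *\<^sub>C emb X (f (PU (offset m j + c) (offset m j + d))))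
      = (\<Sum>j<r. \<Sum>c<m j. \<Sum>d<m j. if d = b then if c = a then if j = i then ?V else 0 else 0 else 0)"
    by (intro sum.cong refl) (auto simp: E_entry)
  moreover have "\<dots> = (\<Sum>j<r. if j = i then ?V else 0)"
    using unit by (intro sum.cong refl) (auto simp: sum.delta cong del: if_weak_cong)
  ultimately show ?case using unit by simp
qed

lemma diag_embed_closed: "diag_embed r m d \<in> carrier DM"
  unfolding carrier_DM diag_embed_def by (auto simp: PiE_iff)

text \<open>Reduces the amalgamation condition to an equation between diagonal units, one for each
  edge.\<close>

lemma hom_diag:
  assumes X: "cstar_algebra X" and f: "f \<in> star_hom DM X"
  shows "emb X (f (diag_embed r m d)) = (\<Sum>e<N. d e *\<^sub>C emb X (f (PU e e)))"
proof -
  have "emb X (f (diag_embed r m d)) = (\<Sum>i<r. \<Sum>a<m i. \<Sum>b<m i. if b = a then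
      d (offset m i + a) *\<^sub>C emb X (f (PU (offset m i + a) (offset m i + a))) else 0)"
    unfolding hom_expand[OF X f diag_embed_closed]
    by (intro sum.cong refl) (auto simp: diag_embed_def)
  also have "\<dots> = (\<Sum>i<r. \<Sum>a<m i. d (offset m i + a) *\<^sub>C emb X (f (PU (offset m i + a) (offset m i + a))))"
    by simp
  also have "\<dots> = (\<Sum>e<N. d e *\<^sub>C emb X (f (PU e e)))" by (rule sum_blocks)
  finally show ?thesis .
qed

end

section \<open>Components of the block graph\<close>

text \<open>For \<open>y = p * x - x\<close> all terms of \<open>y * star y\<close> cancel.\<close>

lemma partial_isometry:
  fixes x :: "'a::cstar_ring"
  assumes "x * star x = p" "p * p = p" shows "p * x = x"
proof -
  have sp: "star p = p" using assms(1) by (metis star_mult star_star)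
  define y where "y = p * x - x"
  have "y * star y = p * (x * star x) * star p - p * (x * star x) - (x * star x) * star p + x * star x"
    unfolding y_def by (simp add: star_diff star_mult algebra_simps)
  also have "\<dots> = 0" using assms sp by simp
  finally have "star y = 0" using star_mult_self_eq_0_iff[of "star y"] by simp
  then have "y = 0" by (metis star_star star_zero)
  then show ?thesis unfolding y_def by simp
qed

lemma star_hom_compose: "f \<in> star_hom A B \<Longrightarrow> h \<in> star_hom B C \<Longrightarrow> (\<lambda>x. h (f x)) \<in> star_hom A C"
  unfolding star_hom_def by (auto simp: Pi_def)

lemma adjacent_sym: "(u, v) \<in> adjacent G \<Longrightarrow> (v, u) \<in> adjacent G"
  unfolding adjacent_def by (auto simp: insert_commute)

lemma adjacent_rtrancl_sym: "(u, v) \<in> (adjacent G)\<^sup>* \<Longrightarrow> (v, u) \<in> (adjacent G)\<^sup>*"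
  by (induction rule: rtrancl_induct) (auto intro: adjacent_sym converse_rtrancl_into_rtrancl)

locale amalgam = P: block_alg r m + Q: block_alg s n
  for r m s n +
  fixes p :: nat and k q :: "nat \<Rightarrow> nat"
    and W :: "nat \<Rightarrow> (nat + nat, nat) multigraph" and T :: "nat \<Rightarrow> nat set"
  assumes offset_eq: "offset n s = offset m r"
    and W: "bij_betw W {..<p} (components (block_graph (offset m r) r m s n))"
    and T: "\<And>i. i < p \<Longrightarrow> spanning_tree (W i) (T i)"
    and k: "\<And>i. i < p \<Longrightarrow> k i = card (edges (W i))"
    and q: "\<And>i. i < p \<Longrightarrow> q i = card (edges (W i) - T i)"
begin

abbreviation "N \<equiv> offset m r"
abbreviation "BG \<equiv> block_graph N r m s n"
abbreviation "bp \<equiv> block r m"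
abbreviation "bq \<equiv> block s n"

text \<open>The blocks on either side are disjoint and cover all positions, so an edge has exactly
  one vertex on each side; in particular there are no loops.\<close>

lemma ends_BG: assumes "e < N" shows "ends BG e = {Inl (bp e), Inr (bq e)}"
proof -
  have e: "e < offset n s" using assms offset_eq by simp
  have "i < r \<and> offset m i \<le> e \<and> e < offset m i + m i \<longleftrightarrow> i = bp e" for i
    using block_props[OF assms] block_unique[of i r m e] by force
  moreover have "j < s \<and> offset n j \<le> e \<and> e < offset n j + n j \<longleftrightarrow> j = bq e" for j
    using block_props[OF e] block_unique[of j s n e] by force
  ultimately show ?thesis by (simp add: block_graph_def insert_commute)
qed

lemma BG_simps: "verts BG = Inl ` {..<r} \<union> Inr ` {..<s}" "edges BG = {..<N}"
  by (simp_all add: block_graph_def)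

lemma ends_verts: "e < N \<Longrightarrow> Inl (bp e) \<in> verts BG \<and> Inr (bq e) \<in> verts BG"
  using block_props(1)[of e m r] block_props(1)[of e n s] offset_eq by (simp add: BG_simps)

lemma adjacent_BG: "e < N \<Longrightarrow> (Inl (bp e), Inr (bq e)) \<in> adjacent BG"
  unfolding adjacent_def using ends_BG by (auto simp: BG_simps)

lemma W_component: "i < p \<Longrightarrow> \<exists>v\<in>verts BG. W i = component_of BG v"
  using W unfolding bij_betw_def components_def by blast

lemma ends_W: assumes "i < p" shows "ends (W i) = ends BG"
proof -
  obtain v where "W i = component_of BG v" using W_component[OF assms] by blast
  then show ?thesis by (simp add: component_of_def Let_def)
qed

text \<open>Reachability is symmetric, so a component can be rebased at any of its vertices.\<close>

lemma verts_W:
  assumes "i < p" "v \<in> verts (W i)"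
  shows "v \<in> verts BG" "(v, w) \<in> adjacent BG \<Longrightarrow> w \<in> verts BG \<Longrightarrow> w \<in> verts (W i)" "W i = component_of BG v"
proof -
  obtain u where u: "u \<in> verts BG" "W i = component_of BG u" using W_component[OF assms(1)] by blast
  have uv: "(u, v) \<in> (adjacent BG)\<^sup>*" "v \<in> verts BG" using assms(2) u unfolding component_of_def Let_def by auto
  show "v \<in> verts BG" by (rule uv)
  show "w \<in> verts (W i)" if "(v, w) \<in> adjacent BG" "w \<in> verts BG"
    using uv that u(2) unfolding component_of_def Let_def by auto
  have "(u, w) \<in> (adjacent BG)\<^sup>* \<longleftrightarrow> (v, w) \<in> (adjacent BG)\<^sup>*" for w
    using uv(1) adjacent_rtrancl_sym[OF uv(1)] by (meson rtrancl_trans)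
  then show "W i = component_of BG v" using u(2) unfolding component_of_def by simp
qed

lemma edges_W: "i < p \<Longrightarrow> e \<in> edges (W i) \<longleftrightarrow> e < N \<and> Inl (bp e) \<in> verts (W i) \<and> Inr (bq e) \<in> verts (W i)"
  using W_component[of i] ends_BG[of e] unfolding component_of_def Let_def by (auto simp: BG_simps)

lemma edges_W_iff:
  assumes "i < p" "e < N"
  shows "e \<in> edges (W i) \<longleftrightarrow> Inl (bp e) \<in> verts (W i)" "e \<in> edges (W i) \<longleftrightarrow> Inr (bq e) \<in> verts (W i)"
proof -
  note adj = adjacent_BG[OF assms(2)] adjacent_sym[OF adjacent_BG[OF assms(2)]]
  have "Inl (bp e) \<in> verts (W i) \<longleftrightarrow> Inr (bq e) \<in> verts (W i)"
    using verts_W(2)[OF assms(1) _ adj(1)] verts_W(2)[OF assms(1) _ adj(2)] ends_verts[OF assms(2)] by blast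
  then show "e \<in> edges (W i) \<longleftrightarrow> Inl (bp e) \<in> verts (W i)" "e \<in> edges (W i) \<longleftrightarrow> Inr (bq e) \<in> verts (W i)"
    using edges_W[OF assms(1)] assms(2) by simp_all
qed

lemma edge_component: assumes "e < N" obtains i where "i < p" "e \<in> edges (W i)"
proof -
  have "component_of BG (Inl (bp e)) \<in> components BG" using ends_verts[OF assms] unfolding components_def by blast
  then obtain i where i: "i < p" "W i = component_of BG (Inl (bp e))" using W unfolding bij_betw_def by force
  have "Inl (bp e) \<in> verts (W i)" using ends_verts[OF assms] unfolding i(2) component_of_def Let_def by simp
  then show thesis using that i(1) edges_W_iff[OF i(1) assms] by blast
qed

lemma edge_component_unique:
  assumes "i < p" "j < p" "e \<in> edges (W i)" "e \<in> edges (W j)" shows "i = j"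
proof -
  have "W i = W j" using verts_W(3)[OF assms(1)] verts_W(3)[OF assms(2)] edges_W assms by metis
  then show ?thesis using W assms(1,2) unfolding bij_betw_def inj_on_def by blast
qed

definition ci :: "nat \<Rightarrow> nat" where "ci e = (SOME i. i < p \<and> e \<in> edges (W i))"

lemma ci: assumes "e < N" shows "ci e < p" "e \<in> edges (W (ci e))"
  using edge_component[OF assms] someI_ex[of "\<lambda>i. i < p \<and> e \<in> edges (W i)"] unfolding ci_def by blast+

lemma ci_eq: "i < p \<Longrightarrow> e \<in> edges (W i) \<Longrightarrow> ci e = i"
  using ci[of e] edge_component_unique edges_W by metis

lemma edges_lt: "i < p \<Longrightarrow> e \<in> edges (W i) \<Longrightarrow> e < N"
  using edges_W by blast

lemma finite_edges: assumes "i < p" shows "finite (edges (W i))"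
proof (rule finite_subset)
  show "edges (W i) \<subseteq> {..<N}" using edges_lt[OF assms] by blast
qed simp

lemma ci_block:
  assumes "e < N" "e' < N"
  shows "bp e = bp e' \<Longrightarrow> ci e = ci e'" "bq e = bq e' \<Longrightarrow> ci e = ci e'"
  using ci[OF assms(1)] edges_W_iff[OF _ assms(1)] edges_W_iff[OF _ assms(2)] ci_eq by metis+

text \<open>Blocks have positive size, so no vertex is isolated. This provides the base edge
  \<open>en i 0\<close> of each component.\<close>

lemma edges_nonempty: assumes "i < p" shows "edges (W i) \<noteq> {}"
proof -
  obtain v where v: "v \<in> verts BG" "W i = component_of BG v" using W_component[OF assms] by blast
  have vi: "v \<in> verts (W i)" using v unfolding component_of_def Let_def by simp
  show ?thesis
  proof (cases v)
    case (Inl j)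
    then have j: "j < r" using v(1) by (auto simp: BG_simps)
    then have "offset m j < N" "bp (offset m j) = j"
      using offset_add_less[of j r 0 m] block_offset_add(1)[of j r 0 m] P.m_pos[OF j] by simp_all
    then have "offset m j \<in> edges (W i)" using edges_W_iff(1)[OF assms, of "offset m j"] vi Inl by simp
    then show ?thesis by blast
  next
    case (Inr j)
    then have j: "j < s" using v(1) by (auto simp: BG_simps)
    then have "offset n j < N" "bq (offset n j) = j"
      using offset_add_less[of j s 0 n] block_offset_add(1)[of j s 0 n] Q.m_pos[OF j] offset_eq by simp_all
    then have "offset n j \<in> edges (W i)" using edges_W_iff(2)[OF assms, of "offset n j"] vi Inr by simp
    then show ?thesis by blast
  qed
qed

definition en :: "nat \<Rightarrow> nat \<Rightarrow> nat" where "en i = (SOME f. bij_betw f {..<k i} (edges (W i)))"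

lemma en: assumes "i < p" shows "bij_betw (en i) {..<k i} (edges (W i))"
proof -
  have "\<exists>f. bij_betw f {..<k i} (edges (W i))"
    using ex_bij_betw_nat_finite[OF finite_edges[OF assms]] k[OF assms] by (simp add: atLeast0LessThan)
  then show ?thesis unfolding en_def by (rule someI_ex)
qed

definition pos :: "nat \<Rightarrow> nat" where "pos e = inv_into {..<k (ci e)} (en (ci e)) e"

lemma pos: assumes "e < N" shows "pos e < k (ci e)" "en (ci e) (pos e) = e"
proof -
  note b = en[OF ci(1)[OF assms]]
  have e: "e \<in> en (ci e) ` {..<k (ci e)}" using b ci(2)[OF assms] unfolding bij_betw_def by simp
  then show "pos e < k (ci e)" "en (ci e) (pos e) = e"
    unfolding pos_def using inv_into_into[OF e] f_inv_into_f[OF e] by simp_all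
qed

lemma en_props:
  assumes "i < p" "a < k i"
  shows "en i a \<in> edges (W i)" "en i a < N" "ci (en i a) = i" "pos (en i a) = a"
proof -
  note b = en[OF assms(1)]
  show e: "en i a \<in> edges (W i)" using b assms(2) unfolding bij_betw_def by blast
  show "en i a < N" using edges_lt[OF assms(1) e] .
  show c: "ci (en i a) = i" using ci_eq[OF assms(1) e] .
  show "pos (en i a) = a" unfolding pos_def c using b assms(2) unfolding bij_betw_def by (simp add: inv_into_f_f)
qed

lemma k_pos: "i < p \<Longrightarrow> 0 < k i"
  using k edges_nonempty finite_edges by (simp add: card_gt_0_iff)

definition gn :: "nat \<Rightarrow> nat \<Rightarrow> nat" where "gn i = (SOME f. bij_betw f {..<q i} (edges (W i) - T i))"

lemma gn: assumes "i < p" shows "bij_betw (gn i) {..<q i} (edges (W i) - T i)"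
proof -
  have "\<exists>f. bij_betw f {..<q i} (edges (W i) - T i)"
    using ex_bij_betw_nat_finite[of "edges (W i) - T i"] finite_edges[OF assms] q[OF assms] by (simp add: atLeast0LessThan)
  then show ?thesis unfolding gn_def by (rule someI_ex)
qed

section \<open>The target algebra, holonomies and the two systems of matrix units\<close>

abbreviation "A i \<equiv> full_group_cstar (free_group (q i))"

definition hol :: "nat \<Rightarrow> free_cstar_elem" where
  "hol e = (if e \<in> T (ci e) then \<one>\<^bsub>A (ci e)\<^esub> else fgen (q (ci e)) (inv_into {..<q (ci e)} (gn (ci e)) e))"

lemma gn_props:
  assumes "i < p" "j < q i"
  shows "gn i j \<in> edges (W i)" "gn i j \<notin> T i" "gn i j < N" "hol (gn i j) = fgen (q i) j"
proof -
  note b = gn[OF assms(1)]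
  show e: "gn i j \<in> edges (W i)" "gn i j \<notin> T i" using b assms(2) unfolding bij_betw_def by blast+
  show "gn i j < N" using edges_lt[OF assms(1) e(1)] .
  have "inv_into {..<q i} (gn i) (gn i j) = j" using b assms(2) unfolding bij_betw_def by (simp add: inv_into_f_f)
  then show "hol (gn i j) = fgen (q i) j" unfolding hol_def ci_eq[OF assms(1) e(1)] using e(2) by simp
qed

lemma hol_tree: "i < p \<Longrightarrow> e \<in> edges (W i) \<Longrightarrow> e \<in> T i \<Longrightarrow> hol e = \<one>\<^bsub>A i\<^esub>"
  unfolding hol_def using ci_eq by simp

lemma non_tree: assumes "i < p" "e \<in> edges (W i)" "e \<notin> T i" obtains j where "j < q i" "e = gn i j"
  using gn[OF assms(1)] assms(2,3) unfolding bij_betw_def by blast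

lemma hol_unitary:
  assumes "e < N"
  shows "hol e \<in> carrier (A (ci e))" "adj (A (ci e)) (hol e) \<otimes>\<^bsub>A (ci e)\<^esub> hol e = \<one>\<^bsub>A (ci e)\<^esub>"
    "hol e \<otimes>\<^bsub>A (ci e)\<^esub> adj (A (ci e)) (hol e) = \<one>\<^bsub>A (ci e)\<^esub>"
proof -
  interpret unital_cstar "A (ci e)" by (rule unital_full_free)
  have "hol e \<in> carrier (A (ci e)) \<and> adj (A (ci e)) (hol e) \<otimes>\<^bsub>A (ci e)\<^esub> hol e = \<one>\<^bsub>A (ci e)\<^esub> \<and>
    hol e \<otimes>\<^bsub>A (ci e)\<^esub> adj (A (ci e)) (hol e) = \<one>\<^bsub>A (ci e)\<^esub>"
  proof (cases "e \<in> T (ci e)")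
    case True
    then show ?thesis using hol_tree[OF ci[OF assms]] by simp
  next
    case False
    then obtain j where "j < q (ci e)" "e = gn (ci e) j" using non_tree[OF ci[OF assms]] by blast
    then show ?thesis using gn_props(4)[OF ci(1)[OF assms]] fgen_closed fgen_unitary by metis
  qed
  then show "hol e \<in> carrier (A (ci e))" "adj (A (ci e)) (hol e) \<otimes>\<^bsub>A (ci e)\<^esub> hol e = \<one>\<^bsub>A (ci e)\<^esub>"
    "hol e \<otimes>\<^bsub>A (ci e)\<^esub> adj (A (ci e)) (hol e) = \<one>\<^bsub>A (ci e)\<^esub>" by auto
qed

sublocale R: matrix_sum "{..<p}" k A
  by (intro matrix_sum.intro unital_full_free finite_lessThan)

definition EE :: "nat \<Rightarrow> nat \<Rightarrow> free_cstar_elem \<Rightarrow> nat \<Rightarrow> nat \<times> nat \<Rightarrow> free_cstar_elem" where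
  "EE e e' z = R.E (ci e) (pos e) (pos e') z"

lemma EE_closed: "e < N \<Longrightarrow> z \<in> carrier (A (ci e)) \<Longrightarrow> EE e e' z \<in> carrier R.DM"
  unfolding EE_def using ci(1) by auto

lemma EE_adj: "e < N \<Longrightarrow> e' < N \<Longrightarrow> ci e = ci e' \<Longrightarrow> z \<in> carrier (A (ci e)) \<Longrightarrow>
    adj R.DM (EE e e' z) = EE e' e (adj (A (ci e)) z)"
  unfolding EE_def using ci(1)[of e] by (simp add: R.E_adj)

lemma EE_mult:
  assumes "e < N" "e' < N" "d < N" "d' < N" "ci e = ci e'" "ci d = ci d'" "x \<in> carrier (A (ci e))" "y \<in> carrier (A (ci d))"
  shows "EE e e' x \<otimes>\<^bsub>R.DM\<^esub> EE d d' y = (if e' = d then EE e d' (x \<otimes>\<^bsub>A (ci e)\<^esub> y) else \<zero>\<^bsub>R.DM\<^esub>)"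
proof -
  have "ci e = ci d \<and> pos e' = pos d \<longleftrightarrow> e' = d"
    using pos(2)[OF assms(2)] pos(2)[OF assms(3)] assms(5) by metis
  then show ?thesis
    unfolding EE_def using assms ci(1)[OF assms(1)] ci(1)[OF assms(3)] pos(1)[OF assms(2)] pos(1)[OF assms(3)]
    by (subst R.E_mult) auto
qed

lemma E_eq_EE: "i < p \<Longrightarrow> a < k i \<Longrightarrow> b < k i \<Longrightarrow> R.E i a b z = EE (en i a) (en i b) z"
  unfolding EE_def by (simp add: en_props)

text \<open>A coboundary of the holonomies. Its rule \<open>tw e e' * tw e' d = tw e d\<close> is
  what makes the twisted units a system of matrix units.\<close>

definition tw :: "nat \<Rightarrow> nat \<Rightarrow> free_cstar_elem" where
  "tw e e' = adj (A (ci e)) (hol e) \<otimes>\<^bsub>A (ci e)\<^esub> hol e'"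

lemma tw:
  assumes "e < N" "e' < N" "ci e = ci e'"
  shows "tw e e' \<in> carrier (A (ci e))" "adj (A (ci e)) (tw e e') = tw e' e" "tw e e = \<one>\<^bsub>A (ci e)\<^esub>"
    "d < N \<Longrightarrow> ci e = ci d \<Longrightarrow> tw e e' \<otimes>\<^bsub>A (ci e)\<^esub> tw e' d = tw e d"
proof -
  interpret unital_cstar "A (ci e)" by (rule unital_full_free)
  note h = hol_unitary[OF assms(1)] hol_unitary[OF assms(2), folded assms(3)]
  show "tw e e' \<in> carrier (A (ci e))" "adj (A (ci e)) (tw e e') = tw e' e" "tw e e = \<one>\<^bsub>A (ci e)\<^esub>"
    unfolding tw_def using h by (simp_all add: assms(3)[symmetric] adj_mult adj_adj)
  assume d: "d < N" "ci e = ci d"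
  note hd = hol_unitary[OF d(1), folded d(2)]
  have assoc: "(a \<otimes>\<^bsub>A (ci e)\<^esub> b) \<otimes>\<^bsub>A (ci e)\<^esub> (c \<otimes>\<^bsub>A (ci e)\<^esub> z) = a \<otimes>\<^bsub>A (ci e)\<^esub> ((b \<otimes>\<^bsub>A (ci e)\<^esub> c) \<otimes>\<^bsub>A (ci e)\<^esub> z)"
    if "a \<in> carrier (A (ci e))" "b \<in> carrier (A (ci e))" "c \<in> carrier (A (ci e))" "z \<in> carrier (A (ci e))" for a b c z
    using that by (simp add: mult_assoc)
  have adj: "adj (A (ci e)) (hol e) \<in> carrier (A (ci e))" "adj (A (ci e)) (hol e') \<in> carrier (A (ci e))" using h by simp_all
  show "tw e e' \<otimes>\<^bsub>A (ci e)\<^esub> tw e' d = tw e d"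
    unfolding tw_def assms(3)[symmetric] assoc[OF adj(1) h(4) adj(2) hd(1)] h(6) using hd by simp
qed

definition FP :: "nat \<Rightarrow> nat \<Rightarrow> (nat \<Rightarrow> nat \<times> nat \<Rightarrow> free_cstar_elem) univ" where
  "FP e e' = emb R.DM (EE e e' \<one>\<^bsub>A (ci e)\<^esub>)"

definition FQ :: "nat \<Rightarrow> nat \<Rightarrow> (nat \<Rightarrow> nat \<times> nat \<Rightarrow> free_cstar_elem) univ" where
  "FQ e e' = emb R.DM (EE e e' (tw e e'))"

lemma EE_unit_relations:
  assumes e: "e < N" "e' < N" "ci e = ci e'"
    and z: "z \<in> carrier (A (ci e))"
  shows "R.D.inr (emb R.DM (EE e e' z))" "star (emb R.DM (EE e e' z)) = emb R.DM (EE e' e (adj (A (ci e)) z))"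
    "d < N \<Longrightarrow> d' < N \<Longrightarrow> ci d = ci d' \<Longrightarrow> y \<in> carrier (A (ci d)) \<Longrightarrow> emb R.DM (EE e e' z) * emb R.DM (EE d d' y) =
      (if e' = d then emb R.DM (EE e d' (z \<otimes>\<^bsub>A (ci e)\<^esub> y)) else 0)"
  using EE_closed[OF e(1) z] EE_adj[OF e z] EE_mult[OF e(1,2) _ _ e(3) _ z] EE_closed[of d y]
    R.D.emb_hom(1)[OF EE_closed[OF e(1) z]]
  by (auto simp flip: R.D.emb_hom(4,6))

lemma FP: "P.unit_system R.DM FP"
  unfolding P.unit_system_def
proof (intro conjI allI impI)
  fix e e' d d' assume e: "e < N" "e' < N" "bp e = bp e'"
  interpret unital_cstar "A (ci e)" by (rule unital_full_free)
  note c = ci_block(1)[OF e]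
  show "R.D.inr (FP e e')" "star (FP e e') = FP e' e"
    unfolding FP_def using EE_unit_relations(1,2)[OF e(1,2) c one_closed] by (simp_all flip: c)
  assume d: "d < N" "d' < N" "bp d = bp d'"
  interpret d: unital_cstar "A (ci d)" by (rule unital_full_free)
  show "FP e e' * FP d d' = (if e' = d then FP e d' else 0)"
    unfolding FP_def using EE_unit_relations(3)[OF e(1,2) c one_closed d(1,2) ci_block(1)[OF d] d.one_closed] c by auto
qed

lemma FQ: "Q.unit_system R.DM FQ"
  unfolding Q.unit_system_def offset_eq
proof (intro conjI allI impI)
  fix e e' d d' assume e: "e < N" "e' < N" "bq e = bq e'"
  note c = ci_block(2)[OF e]
  show "R.D.inr (FQ e e')" "star (FQ e e') = FQ e' e"
    unfolding FQ_def using EE_unit_relations[OF e(1,2) c tw(1)[OF e(1,2) c]] tw(2)[OF e(1,2) c] by simp_all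
  assume d: "d < N" "d' < N" "bq d = bq d'"
  note c' = ci_block(2)[OF d]
  show "FQ e e' * FQ d d' = (if e' = d then FQ e d' else 0)"
    unfolding FQ_def
    using EE_unit_relations(3)[OF e(1,2) c tw(1)[OF e(1,2) c] d(1,2) c' tw(1)[OF d(1,2) c']] tw(4)[OF e(1,2) c d(2)] c c' by auto
qed

text \<open>Holonomies are unitary, so the twist is trivial on the diagonal; this is the
  amalgamation condition for the structure maps.\<close>

lemma FP_eq_FQ: "e < N \<Longrightarrow> FP e e = FQ e e"
  unfolding FP_def FQ_def using tw(3)[of e e] by simp

subsection \<open>Uniqueness\<close>

text \<open>The two ends of \<open>e\<close> are different vertices, so the paths joining them in
  the tree have a first edge at either end.\<close>

lemma tree_edge_at:
  assumes "i < p" "e \<in> edges (W i)"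
  obtains b c where "b \<in> T i" "bp b = bp e" "c \<in> T i" "bq c = bq e"
proof -
  let ?G = "W i\<lparr>edges := T i\<rparr>"
  have Te: "T i \<subseteq> edges (W i)" using T[OF assms(1)] unfolding spanning_tree_def by simp
  have v: "Inl (bp e) \<in> verts (W i)" "Inr (bq e) \<in> verts (W i)" using edges_W[OF assms(1)] assms(2) by auto
  then have "(Inl (bp e), Inr (bq e)) \<in> (adjacent ?G)\<^sup>*" "(Inr (bq e), Inl (bp e)) \<in> (adjacent ?G)\<^sup>*"
    using T[OF assms(1)] unfolding spanning_tree_def connected_graph_def by simp_all
  moreover have "Inl (bp e) \<noteq> Inr (bq e)" by simp
  ultimately obtain x y where "(Inl (bp e), x) \<in> adjacent ?G" "(Inr (bq e), y) \<in> adjacent ?G"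
    by (metis converse_rtranclE)
  then obtain b c where b: "b \<in> T i" "ends BG b = {Inl (bp e), x}" and c: "c \<in> T i" "ends BG c = {Inr (bq e), y}"
    unfolding adjacent_def using ends_W[OF assms(1)] by auto
  have "b < N" "c < N" using b c Te edges_lt[OF assms(1)] by auto
  then have "bp b = bp e" "bq c = bq e" using ends_BG b(2) c(2) by (auto simp: doubleton_eq_iff)
  then show thesis using that b c by blast
qed

lemma hom_R_eqI:
  assumes X: "cstar_algebra X" and h: "h \<in> star_hom R.DM X" and h': "h' \<in> star_hom R.DM X"
    and eP: "\<And>e e'. e < N \<Longrightarrow> e' < N \<Longrightarrow> bp e = bp e' \<Longrightarrow> h (EE e e' \<one>\<^bsub>A (ci e)\<^esub>) = h' (EE e e' \<one>\<^bsub>A (ci e)\<^esub>)"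
    and eQ: "\<And>e e'. e < N \<Longrightarrow> e' < N \<Longrightarrow> bq e = bq e' \<Longrightarrow> h (EE e e' (tw e e')) = h' (EE e e' (tw e e'))"
    and x: "x \<in> carrier R.DM"
  shows "h x = h' x"
proof -
  interpret X: cstar_algebra X by (rule X)
  \<comment> \<open>Agreement is bundled with membership in the carrier, which makes it stable under
    products without side conditions.\<close>
  define eq where "eq y \<longleftrightarrow> y \<in> carrier R.DM \<and> h y = h' y" for y
  have eq_mult: "eq y \<Longrightarrow> eq z \<Longrightarrow> eq (y \<otimes>\<^bsub>R.DM\<^esub> z)" for y z
    unfolding eq_def using star_homD(4)[OF h] star_homD(4)[OF h'] by simp
  have "h (R.E i a b z) = h' (R.E i a b z)" if i: "i < p" and ab: "a < k i" "b < k i" and z: "z \<in> carrier (A i)" for i a b z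
  proof -
    interpret unital_cstar "A i" by (rule unital_full_free)
    have Te: "T i \<subseteq> edges (W i)" using T[OF i] unfolding spanning_tree_def by simp
    note lt = edges_lt[OF i] and cc = ci_eq[OF i]
    define rel where "rel e e' \<longleftrightarrow> eq (EE e e' \<one>\<^bsub>A i\<^esub>)" for e e'
    have relP: "rel e e'" if "e \<in> edges (W i)" "e' \<in> edges (W i)" "bp e = bp e'" for e e'
      unfolding rel_def eq_def using eP[OF lt lt, of e e'] EE_closed[OF lt, of e "\<one>\<^bsub>A i\<^esub>" e'] that cc by auto
    \<comment> \<open>Between tree edges the twist is trivial, so at a Q-vertex they are joined by
      the plain unit.\<close>
    have relQ: "rel e e'" if "e \<in> T i" "e' \<in> T i" "bq e = bq e'" for e e'
    proof -
      have ee: "e \<in> edges (W i)" "e' \<in> edges (W i)" using that Te by auto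
      have "tw e e' = \<one>\<^bsub>A i\<^esub>" unfolding tw_def using hol_tree[OF i] that ee cc by simp
      then show ?thesis
        unfolding rel_def eq_def using eQ[OF lt lt, of e e'] EE_closed[OF lt, of e "\<one>\<^bsub>A i\<^esub>" e'] that ee cc by auto
    qed
    have rel_trans: "rel e e''" if "rel e e'" "rel e' e''" "e \<in> edges (W i)" "e' \<in> edges (W i)" "e'' \<in> edges (W i)" for e e' e''
      using eq_mult[of "EE e e' \<one>\<^bsub>A i\<^esub>" "EE e' e'' \<one>\<^bsub>A i\<^esub>"] that lt cc EE_mult[of e e' e' e'' "\<one>\<^bsub>A i\<^esub>" "\<one>\<^bsub>A i\<^esub>"]
      unfolding rel_def by auto
    have relT: "rel a b" if a: "a \<in> T i" and b: "b \<in> T i" for a b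
    proof -
      have bound: "e \<in> T i \<Longrightarrow> e < N" for e using Te lt by auto
      have share: "rel e e'" if "e \<in> T i" "e' \<in> T i" "v \<in> ends BG e" "v \<in> ends BG e'" for e e' v
        using that relP[of e e'] relQ[of e e'] Te ends_BG[OF bound] by auto
      have "(Inl (bp a), Inl (bp b)) \<in> (adjacent (W i\<lparr>edges := T i\<rparr>))\<^sup>*"
        using T[OF i] edges_W[OF i, of a] edges_W[OF i, of b] subsetD[OF Te a] subsetD[OF Te b]
        unfolding spanning_tree_def connected_graph_def by simp
      \<comment> \<open>Induction along a path in the tree. The claim is about all tree edges at the
        vertex reached so far; the edge to the next vertex is one of them and meets all tree edges
        there.\<close>
      then have "\<forall>c\<in>T i. Inl (bp b) \<in> ends BG c \<longrightarrow> rel a c"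
      proof (induction rule: rtrancl_induct)
        case base
        then show ?case using share[OF a] ends_BG[OF bound[OF a]] by blast
      next
        case (step v w)
        then obtain c where c: "c \<in> T i" "ends BG c = {v, w}" unfolding adjacent_def using ends_W[OF i] by auto
        have ac: "rel a c" using step.IH c by auto
        show ?case
        proof (intro ballI impI)
          fix d assume d: "d \<in> T i" "w \<in> ends BG d"
          then have "rel c d" using share[OF c(1) d(1), of w] c(2) by auto
          then show "rel a d" using rel_trans[OF ac] a c d Te by blast
        qed
      qed
      then show ?thesis using b ends_BG[OF bound[OF b]] by blast
    qed
    \<comment> \<open>Each edge shares its P-vertex with a tree edge, and at P-vertices the
      structure map gives plain units for all edges.\<close>
    have rel_all: "rel e e'" if e: "e \<in> edges (W i)" "e' \<in> edges (W i)" for e e'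
    proof -
      obtain b where b: "b \<in> T i" "bp b = bp e" using tree_edge_at[OF i e(1)] by blast
      obtain b' where b': "b' \<in> T i" "bp b' = bp e'" using tree_edge_at[OF i e(2)] by blast
      have "rel e b" "rel b b'" "rel b' e'" using relP relT b b' e Te by auto
      then show ?thesis using rel_trans b b' e Te by (meson subsetD)
    qed
    define e0 where "e0 = en i 0"
    have e0: "e0 \<in> edges (W i)" "e0 < N" "ci e0 = i" unfolding e0_def using en_props[OF i k_pos[OF i]] by auto
    have conj: "EE e e0 \<one>\<^bsub>A i\<^esub> \<otimes>\<^bsub>R.DM\<^esub> EE e0 e0 y \<otimes>\<^bsub>R.DM\<^esub> EE e0 e' \<one>\<^bsub>A i\<^esub> = EE e e' y"
      "EE e0 e \<one>\<^bsub>A i\<^esub> \<otimes>\<^bsub>R.DM\<^esub> EE e e' y \<otimes>\<^bsub>R.DM\<^esub> EE e' e0 \<one>\<^bsub>A i\<^esub> = EE e0 e0 y"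
      if "e \<in> edges (W i)" "e' \<in> edges (W i)" "y \<in> carrier (A i)" for e e' y
      using that e0 lt cc by (simp_all add: EE_mult)
    \<comment> \<open>The tree edge \<open>c\<close> at the same Q-vertex has holonomy 1, so the
      twisted unit from \<open>c\<close> to \<open>gn i j\<close> carries exactly the
      \<open>j\<close>-th generator. Plain units move it to the base position.\<close>
    have gens: "eq (EE e0 e0 (fgen (q i) j))" if j: "j < q i" for j
    proof -
      note g = gn_props[OF i j]
      obtain c where c: "c \<in> T i" "bq c = bq (gn i j)" using tree_edge_at[OF i g(1)] by blast
      have ce: "c \<in> edges (W i)" "c < N" "ci c = i" using c Te lt cc by auto
      have "tw c (gn i j) = fgen (q i) j"
        unfolding tw_def using hol_tree[OF i ce(1) c(1)] ce g(4) fgen_closed[OF j] by simp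
      then have "eq (EE c (gn i j) (fgen (q i) j))"
        using eQ[OF ce(2) g(3) c(2)] EE_closed[OF ce(2), of "fgen (q i) j" "gn i j"] fgen_closed[OF j] ce(3)
        unfolding eq_def by auto
      then have "eq (EE e0 c \<one>\<^bsub>A i\<^esub> \<otimes>\<^bsub>R.DM\<^esub> EE c (gn i j) (fgen (q i) j) \<otimes>\<^bsub>R.DM\<^esub> EE (gn i j) e0 \<one>\<^bsub>A i\<^esub>)"
        using rel_all[OF e0(1) ce(1)] rel_all[OF g(1) e0(1)] unfolding rel_def by (intro eq_mult)
      then show ?thesis using conj(2)[OF ce(1) g(1) fgen_closed[OF j]] by simp
    qed
    \<comment> \<open>The base position holds a copy of the group C*-algebra, where agreement on the
      unit and on the generators suffices; plain units then carry the agreement to all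
      positions.\<close>
    have corner_hom: "(\<lambda>y. EE e0 e0 y) \<in> star_hom (A i) R.DM"
      unfolding star_hom_def using e0 i
      by (auto simp: EE_closed EE_mult EE_adj) (auto simp: EE_def R.E_add R.E_smult)
    have "h (EE e0 e0 y) = h' (EE e0 e0 y)" if y: "y \<in> carrier (A i)" for y
    proof (rule full_free_eqI[OF X star_hom_compose[OF corner_hom h] star_hom_compose[OF corner_hom h'] _ _ y])
      show "h (EE e0 e0 \<one>\<^bsub>A i\<^esub>) = h' (EE e0 e0 \<one>\<^bsub>A i\<^esub>)" using rel_all[OF e0(1,1)] unfolding rel_def eq_def by simp
      show "h (EE e0 e0 (fgen (q i) j)) = h' (EE e0 e0 (fgen (q i) j))" if "j < q i" for j
        using gens[OF that] unfolding eq_def by simp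
    qed
    then have "eq (EE e0 e0 z)" unfolding eq_def using z e0 EE_closed by simp
    then have "eq (EE (en i a) e0 \<one>\<^bsub>A i\<^esub> \<otimes>\<^bsub>R.DM\<^esub> EE e0 e0 z \<otimes>\<^bsub>R.DM\<^esub> EE e0 (en i b) \<one>\<^bsub>A i\<^esub>)"
      using rel_all[OF en_props(1)[OF i ab(1)] e0(1)] rel_all[OF e0(1) en_props(1)[OF i ab(2)]]
      unfolding rel_def by (intro eq_mult)
    then have "eq (EE (en i a) (en i b) z)"
      using conj(1)[OF en_props(1)[OF i ab(1)] en_props(1)[OF i ab(2)] z] by simp
    then show ?thesis unfolding eq_def E_eq_EE[OF i ab] by simp
  qed
  then show ?thesis by (intro R.star_hom_eqI[OF h h' x X]) auto
qed

subsection \<open>Existence\<close>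

text \<open>At each vertex a family of partial isometries with range projection
  \<open>F (en i 0) (en i 0)\<close> is chosen that realises the matrix units of this vertex.
  \<open>V\<close> reads the family at the P-end of an edge and \<open>Z\<close> the one at the
  Q-end; they coincide on tree edges because the choices are matched there.\<close>

lemma gauge:
  assumes X: "cstar_algebra X" and F: "P.unit_system X F" and G: "Q.unit_system X G"
    and FG: "\<And>e. e < N \<Longrightarrow> F e e = G e e" and i: "i < p"
  shows "\<exists>V Z. (\<forall>e\<in>edges (W i). cstar_algebra.inr X (V e) \<and> cstar_algebra.inr X (Z e) \<and>
      V e * star (V e) = F (en i 0) (en i 0) \<and> Z e * star (Z e) = F (en i 0) (en i 0) \<and> (e \<in> T i \<longrightarrow> V e = Z e)) \<and>
    (\<forall>e\<in>edges (W i). \<forall>e'\<in>edges (W i). (bp e = bp e' \<longrightarrow> star (V e) * V e' = F e e') \<and>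
      (bq e = bq e' \<longrightarrow> star (Z e) * Z e' = G e e'))"
proof -
  interpret X: cstar_algebra X by (rule X)
  define e0 where "e0 = en i 0"
  have e0: "e0 \<in> edges (W i)" "e0 < N" unfolding e0_def using en_props[OF i k_pos[OF i]] by auto
  define M where "M v = (case v of Inl _ \<Rightarrow> F | Inr _ \<Rightarrow> G)" for v :: "nat + nat"
  have inc: "v \<in> ends BG e \<longleftrightarrow> v = Inl (bp e) \<or> v = Inr (bq e)" if "e < N" for v e using ends_BG[OF that] by auto
  \<comment> \<open>The last claim links the two ends of an edge: the diagonal projection is the
    same at both, by agreement of \<open>F\<close> and \<open>G\<close> on the diagonal.\<close>
  have M: "X.inr (M v e e')" "star (M v e e') = M v e' e" "d < N \<Longrightarrow> v \<in> ends BG d \<Longrightarrow> M v e e' * M v e' d = M v e d"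
    "M v e e = F e e"
    if vv: "e < N" "e' < N" "v \<in> ends BG e" "v \<in> ends BG e'" for v e e' d
  proof -
    consider "v = Inl (bp e)" "bp e = bp e'" | "v = Inr (bq e)" "bq e = bq e'"
      using vv(3,4) inc[OF vv(1)] inc[OF vv(2)] by auto
    then have "X.inr (M v e e') \<and> star (M v e e') = M v e' e \<and>
      (d < N \<longrightarrow> v \<in> ends BG d \<longrightarrow> M v e e' * M v e' d = M v e d) \<and> M v e e = F e e"
    proof cases
      case 1
      then show ?thesis using P.unit_systemD[OF F vv(1,2)] vv inc[of d] by (auto simp: M_def)
    next
      case 2
      then show ?thesis using Q.unit_systemD[OF G, unfolded offset_eq, OF vv(1,2)] vv inc[of d] FG[OF vv(1)]
        by (auto simp: M_def)
    qed
    then show "X.inr (M v e e')" "star (M v e e') = M v e' e" "d < N \<Longrightarrow> v \<in> ends BG d \<Longrightarrow> M v e e' * M v e' d = M v e d"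
      "M v e e = F e e" by auto
  qed
  define p0 where "p0 = F e0 e0"
  have p0: "p0 * p0 = p0" unfolding p0_def using P.unit_systemD(3)[OF F e0(2) e0(2)] e0 by simp
  define Fam where "Fam v \<phi> \<longleftrightarrow> (\<forall>e<N. v \<in> ends BG e \<longrightarrow> X.inr (\<phi> e) \<and> \<phi> e * star (\<phi> e) = p0 \<and>
    (\<forall>e'<N. v \<in> ends BG e' \<longrightarrow> star (\<phi> e) * \<phi> e' = M v e e'))" for v \<phi>
  \<comment> \<open>A single partial isometry at the edge \<open>a\<close> extends to all edges at
    \<open>v\<close> by composition with the units \<open>M v a e\<close>, and at \<open>a\<close>
    the extension gives it back.\<close>
  have step: "Fam v (\<lambda>e. \<phi> * M v a e) \<and> \<phi> * M v a a = \<phi>"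
    if a: "a < N" "v \<in> ends BG a" and \<phi>: "X.inr \<phi>" "\<phi> * star \<phi> = p0" "star \<phi> * \<phi> = F a a" for \<phi> v a
  proof
    have pi: "p0 * \<phi> = \<phi>" using partial_isometry[OF \<phi>(2) p0] .
    show "\<phi> * M v a a = \<phi>" using pi \<phi> M(4)[OF a(1,1,2,2)] by (metis mult.assoc)
    show "Fam v (\<lambda>e. \<phi> * M v a e)" unfolding Fam_def
    proof (intro allI impI conjI)
      fix e assume e: "e < N" "v \<in> ends BG e"
      show "X.inr (\<phi> * M v a e)" using \<phi>(1) M(1)[OF a(1) e(1) a(2) e(2)] by blast
      have "\<phi> * M v a e * star (\<phi> * M v a e) = \<phi> * (M v a e * M v e a) * star \<phi>"
        using M(2)[OF a(1) e(1) a(2) e(2)] by (simp add: star_mult mult.assoc)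
      also have "\<dots> = \<phi> * (star \<phi> * \<phi>) * star \<phi>"
        using M(3)[OF a(1) e(1) a(2) e(2) a] M(4)[OF a(1,1,2,2)] \<phi>(3) by simp
      also have "\<dots> = p0" using \<phi>(2) p0 by (metis mult.assoc)
      finally show "\<phi> * M v a e * star (\<phi> * M v a e) = p0" .
      fix e' assume e': "e' < N" "v \<in> ends BG e'"
      have "star (\<phi> * M v a e) * (\<phi> * M v a e') = M v e a * ((star \<phi> * \<phi>) * M v a e')"
        using M(2)[OF a(1) e(1) a(2) e(2)] by (simp add: star_mult mult.assoc)
      also have "\<dots> = M v e a * (M v a a * M v a e')" using \<phi>(3) M(4)[OF a(1,1,2,2)] by simp
      also have "\<dots> = M v e e'"
        using M(3)[OF a(1,1) a(2,2) e'] M(3)[OF e(1) a(1) e(2) a(2) e'] by simp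
      finally show "star (\<phi> * M v a e) * (\<phi> * M v a e') = M v e e'" .
    qed
  qed
  have Te: "T i \<subseteq> edges (W i)" using T[OF i] unfolding spanning_tree_def by simp
  have fin: "finite (verts (W i))"
    by (rule finite_subset[of _ "verts BG"]) (use verts_W(1)[OF i] in \<open>auto simp: BG_simps\<close>)
  have v0: "Inl (bp e0) \<in> verts (W i)" using edges_W[OF i] e0 by blast
  \<comment> \<open>The start is \<open>p0\<close> itself, a partial isometry whose initial and
    range projections both equal \<open>F e0 e0\<close>.\<close>
  have base: "Fam (Inl (bp e0)) (\<lambda>e. p0 * M (Inl (bp e0)) e0 e)"
  proof (rule step[THEN conjunct1, OF e0(2)])
    show "Inl (bp e0) \<in> ends BG e0" using inc[OF e0(2)] by simp
    show "X.inr p0" unfolding p0_def using P.unit_systemD(1)[OF F e0(2,2)] by simp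
    have "star p0 = p0" unfolding p0_def using P.unit_systemD(2)[OF F e0(2,2)] by simp
    then show "p0 * star p0 = p0" "star p0 * p0 = F e0 e0" using p0 by (simp_all add: p0_def)
  qed
  have sub: "ends (W i) a \<subseteq> verts (W i)" if "a \<in> T i" for a
    using that Te edges_W[OF i, of a] ends_BG[of a] ends_W[OF i] by auto
  \<comment> \<open>Both ends of \<open>a\<close> have the same diagonal projection there, so the
    value \<open>\<phi> a\<close> from one end can seed the family at the other.\<close>
  have ext: "\<exists>\<psi>. Fam v \<psi> \<and> \<psi> a = \<phi> a"
    if a: "a \<in> T i" "ends (W i) a = {u, v}" "u \<noteq> v" and \<phi>: "Fam u \<phi>" for a u v \<phi>
  proof -
    have aN: "a < N" "u \<in> ends BG a" "v \<in> ends BG a" using a Te edges_lt[OF i] ends_W[OF i] by auto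
    have "X.inr (\<phi> a)" "\<phi> a * star (\<phi> a) = p0" "star (\<phi> a) * \<phi> a = M u a a" using \<phi> aN unfolding Fam_def by blast+
    then show ?thesis using step[OF aN(1,3), of "\<phi> a"] M(4)[OF aN(1,1,2,2)] by auto
  qed
  have "\<exists>\<Phi>. (\<forall>v\<in>verts (W i). Fam v (\<Phi> v)) \<and> (\<forall>a\<in>T i. \<forall>u v. ends (W i) a = {u, v} \<longrightarrow> \<Phi> u a = \<Phi> v a)"
    by (rule spanning_tree_gauge[where Fam = Fam, OF fin T[OF i] v0 base]) (fact sub, fact ext, blast)
  then obtain \<Phi> where \<Phi>: "\<And>v. v \<in> verts (W i) \<Longrightarrow> Fam v (\<Phi> v)"
    "\<And>a u v. a \<in> T i \<Longrightarrow> ends (W i) a = {u, v} \<Longrightarrow> \<Phi> u a = \<Phi> v a"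
    by blast
  define V where "V e = \<Phi> (Inl (bp e)) e" for e
  define Z where "Z e = \<Phi> (Inr (bq e)) e" for e
  show ?thesis unfolding e0_def[symmetric] p0_def[symmetric]
  proof (rule exI[of _ V], rule exI[of _ Z], intro conjI ballI impI)
    fix e assume e: "e \<in> edges (W i)"
    then have eN: "e < N" "Inl (bp e) \<in> verts (W i)" "Inr (bq e) \<in> verts (W i)" using edges_W[OF i] by auto
    have ie: "Inl (bp e) \<in> ends BG e" "Inr (bq e) \<in> ends BG e" using inc[OF eN(1)] by auto
    show "X.inr (V e)" "V e * star (V e) = p0" "X.inr (Z e)" "Z e * star (Z e) = p0"
      using \<Phi>(1)[OF eN(2)] \<Phi>(1)[OF eN(3)] eN(1) ie unfolding Fam_def V_def Z_def by blast+
    show "V e = Z e" if "e \<in> T i"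
      using \<Phi>(2)[OF that, of "Inl (bp e)" "Inr (bq e)"] ends_W[OF i] ends_BG[OF eN(1)] unfolding V_def Z_def by simp
    fix e' assume e': "e' \<in> edges (W i)"
    then have eN': "e' < N" using edges_W[OF i] by auto
    have ie': "Inl (bp e') \<in> ends BG e'" "Inr (bq e') \<in> ends BG e'" using inc[OF eN'] by auto
    show "star (V e) * V e' = F e e'" if b: "bp e = bp e'"
      using \<Phi>(1)[OF eN(2)] eN(1) eN' ie(1) ie'(1) b unfolding Fam_def V_def by (simp add: M_def)
    show "star (Z e) * Z e' = G e e'" if b: "bq e = bq e'"
      using \<Phi>(1)[OF eN(3)] eN(1) eN' ie(2) ie'(2) b unfolding Fam_def Z_def by (simp add: M_def)
  qed
qed

text \<open>Plain units go to \<open>star (V i e) * V i e'\<close> and the generators to the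
  unitaries \<open>u i e = Z i e * star (V i e)\<close>. Since \<open>u i e * V i e = Z i e\<close>,
  the twisted unit of \<open>e\<close> and \<open>e'\<close> goes to
  \<open>star (Z i e) * Z i e'\<close>, which is the required \<open>G e e'\<close> at a
  Q-vertex.\<close>

lemma hom_R_exists:
  assumes X: "cstar_algebra X" and F: "P.unit_system X F" and G: "Q.unit_system X G"
    and FG: "\<And>e. e < N \<Longrightarrow> F e e = G e e"
  obtains h where "h \<in> star_hom R.DM X"
    "\<And>e e'. e < N \<Longrightarrow> e' < N \<Longrightarrow> bp e = bp e' \<Longrightarrow> emb X (h (EE e e' \<one>\<^bsub>A (ci e)\<^esub>)) = F e e'"
    "\<And>e e'. e < N \<Longrightarrow> e' < N \<Longrightarrow> bq e = bq e' \<Longrightarrow> emb X (h (EE e e' (tw e e'))) = G e e'"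
proof -
  interpret X: cstar_algebra X by (rule X)
  define p0 where "p0 i = F (en i 0) (en i 0)" for i
  have "\<forall>i. \<exists>V Z. i < p \<longrightarrow> (\<forall>e\<in>edges (W i). X.inr (V e) \<and> X.inr (Z e) \<and>
      V e * star (V e) = p0 i \<and> Z e * star (Z e) = p0 i \<and> (e \<in> T i \<longrightarrow> V e = Z e)) \<and>
    (\<forall>e\<in>edges (W i). \<forall>e'\<in>edges (W i). (bp e = bp e' \<longrightarrow> star (V e) * V e' = F e e') \<and>
      (bq e = bq e' \<longrightarrow> star (Z e) * Z e' = G e e'))"
    using gauge[OF X F G FG] unfolding p0_def by blast
  then obtain V Z where VZ: "\<forall>i<p. (\<forall>e\<in>edges (W i). X.inr (V i e) \<and> X.inr (Z i e) \<and>
      V i e * star (V i e) = p0 i \<and> Z i e * star (Z i e) = p0 i \<and> (e \<in> T i \<longrightarrow> V i e = Z i e)) \<and>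
    (\<forall>e\<in>edges (W i). \<forall>e'\<in>edges (W i). (bp e = bp e' \<longrightarrow> star (V i e) * V i e' = F e e') \<and>
      (bq e = bq e' \<longrightarrow> star (Z i e) * Z i e' = G e e'))"
    by metis
  have VZ1: "X.inr (V i e)" "X.inr (Z i e)" "V i e * star (V i e) = p0 i" "Z i e * star (Z i e) = p0 i"
    "e \<in> T i \<Longrightarrow> V i e = Z i e" if "i < p" "e \<in> edges (W i)" for i e
    using VZ that by blast+
  have VZ2: "bp e = bp e' \<Longrightarrow> star (V i e) * V i e' = F e e'" "bq e = bq e' \<Longrightarrow> star (Z i e) * Z i e' = G e e'"
    if "i < p" "e \<in> edges (W i)" "e' \<in> edges (W i)" for i e e'
    using VZ that by blast+
  have p0: "p0 i * p0 i = p0 i" "star (p0 i) = p0 i" "X.inr (p0 i)" if "i < p" for i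
    unfolding p0_def using P.unit_systemD[OF F en_props(2,2)[OF that k_pos[OF that]]] en_props(2)[OF that k_pos[OF that]] by auto
  have pV: "p0 i * V i e = V i e" "p0 i * Z i e = Z i e" "star (V i e) * p0 i = star (V i e)" "star (Z i e) * p0 i = star (Z i e)"
    if "i < p" "e \<in> edges (W i)" for i e
  proof -
    show a: "p0 i * V i e = V i e" "p0 i * Z i e = Z i e"
      using partial_isometry[OF VZ1(3)[OF that] p0(1)[OF that(1)]] partial_isometry[OF VZ1(4)[OF that] p0(1)[OF that(1)]] by auto
    show "star (V i e) * p0 i = star (V i e)" "star (Z i e) * p0 i = star (Z i e)"
      using arg_cong[OF a(1), of star] arg_cong[OF a(2), of star] p0(2)[OF that(1)] by (simp_all add: star_mult)
  qed
  \<comment> \<open>\<open>V i e\<close> and \<open>Z i e\<close> have the same range projection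
    \<open>p0 i\<close> and, as \<open>F\<close> and \<open>G\<close> agree on the diagonal, the
    same initial projection. So this is a unitary of the corner of \<open>p0 i\<close>.\<close>
  define u where "u i e = Z i e * star (V i e)" for i e
  have VV: "star (V i e) * V i e = star (Z i e) * Z i e" if "i < p" "e \<in> edges (W i)" for i e
    using VZ2[OF that that(2)] FG[OF edges_lt[OF that]] by simp
  have uV: "u i e * V i e = Z i e" "u i e * star (u i e) = p0 i" "star (u i e) * u i e = p0 i"
    "p0 i * u i e = u i e" "u i e * p0 i = u i e" "X.inr (u i e)" if ie: "i < p" "e \<in> edges (W i)" for i e
  proof -
    show "u i e * V i e = Z i e"
      unfolding u_def mult.assoc VV[OF ie] using VZ1(4)[OF ie] pV(2)[OF ie] by (simp flip: mult.assoc)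
    have "u i e * star (u i e) = Z i e * (star (V i e) * V i e) * star (Z i e)"
      unfolding u_def by (simp add: star_mult mult.assoc)
    also have "\<dots> = (Z i e * star (Z i e)) * (Z i e * star (Z i e))" unfolding VV[OF ie] by (simp add: mult.assoc)
    finally show "u i e * star (u i e) = p0 i" using VZ1(4)[OF ie] p0(1)[OF ie(1)] by simp
    have "star (u i e) * u i e = V i e * (star (Z i e) * Z i e) * star (V i e)"
      unfolding u_def by (simp add: star_mult mult.assoc)
    also have "\<dots> = (V i e * star (V i e)) * (V i e * star (V i e))" unfolding VV[OF ie, symmetric] by (simp add: mult.assoc)
    finally show "star (u i e) * u i e = p0 i" using VZ1(3)[OF ie] p0(1)[OF ie(1)] by simp
    show "p0 i * u i e = u i e" "u i e * p0 i = u i e" unfolding u_def using pV[OF ie] by (simp_all flip: mult.assoc) (simp add: mult.assoc pV[OF ie])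
    show "X.inr (u i e)" unfolding u_def using VZ1[OF ie] by blast
  qed
  have "\<forall>i. \<exists>\<pi>. i < p \<longrightarrow> \<pi> \<in> star_hom (A i) X \<and> emb X (\<pi> \<one>\<^bsub>A i\<^esub>) = p0 i \<and> (\<forall>j<q i. emb X (\<pi> (fgen (q i) j)) = u i (gn i j))"
  proof
    fix i show "\<exists>\<pi>. i < p \<longrightarrow> \<pi> \<in> star_hom (A i) X \<and> emb X (\<pi> \<one>\<^bsub>A i\<^esub>) = p0 i \<and> (\<forall>j<q i. emb X (\<pi> (fgen (q i) j)) = u i (gn i j))"
    proof (cases "i < p")
      case True
      note g = gn_props(1)[OF True]
      obtain \<pi> where "\<pi> \<in> star_hom (A i) X" "emb X (\<pi> \<one>\<^bsub>A i\<^esub>) = p0 i" "\<And>j. j < q i \<Longrightarrow> emb X (\<pi> (fgen (q i) j)) = u i (gn i j)"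
        using full_free_rep[OF X p0[OF True], of "q i" "\<lambda>j. u i (gn i j)"] uV[OF True g] by blast
      then show ?thesis by blast
    qed simp
  qed
  then obtain \<pi> where \<pi>: "\<And>i. i < p \<Longrightarrow> \<pi> i \<in> star_hom (A i) X" "\<And>i. i < p \<Longrightarrow> emb X (\<pi> i \<one>\<^bsub>A i\<^esub>) = p0 i"
    "\<And>i j. i < p \<Longrightarrow> j < q i \<Longrightarrow> emb X (\<pi> i (fgen (q i) j)) = u i (gn i j)"
    by metis
  \<comment> \<open>On a tree edge \<open>V\<close> and \<open>Z\<close> agree, so \<open>u\<close>
    is the unit \<open>p0 i\<close> of the corner, in accordance with holonomy 1.\<close>
  have \<pi>_hol: "emb X (\<pi> i (hol e)) = u i e" if ie: "i < p" "e \<in> edges (W i)" for i e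
  proof (cases "e \<in> T i")
    case True
    then have "u i e = p0 i" unfolding u_def using VZ1(3,5)[OF ie] by simp
    then show ?thesis using hol_tree[OF ie True] \<pi>(2)[OF ie(1)] by simp
  next
    case False
    then obtain j where j: "j < q i" "e = gn i j" using non_tree[OF ie] by blast
    then show ?thesis using gn_props(4)[OF ie(1) j(1)] \<pi>(3)[OF ie(1) j(1)] by simp
  qed
  define w where "w i a = V i (en i a)" for i a
  interpret matrix_sum_rep "{..<p}" k A X \<pi> w
  proof (intro matrix_sum_rep.intro R.matrix_sum_axioms X matrix_sum_rep_axioms.intro)
    fix i assume i: "i \<in> {..<p}"
    then show "\<pi> i \<in> star_hom (A i) X" using \<pi>(1) by simp
    fix a assume a: "a < k i"
    note ea = en_props[of i a]
    show "X.inr (w i a)" unfolding w_def using i a ea VZ1(1) by simp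
    fix j b assume j: "j \<in> {..<p}" and b: "b < k j"
    note eb = en_props[of j b]
    show "w i a * star (w j b) = (if i = j \<and> a = b then emb X (\<pi> i \<one>\<^bsub>A i\<^esub>) else 0)"
    proof (cases "en i a = en j b")
      case True
      then have "i = j" "a = b" using i j a b ea eb by auto
      then show ?thesis unfolding w_def using i a ea VZ1(3) \<pi>(2) by simp
    next
      case False
      \<comment> \<open>Each \<open>V\<close> absorbs its initial projection, and the projections
        \<open>F e e\<close> of different edges are orthogonal, also across components; so the
        product vanishes.\<close>
      have V: "V i (en i a) * (star (V i (en i a)) * V i (en i a)) = V i (en i a)"
        using i a ea VZ1(3) pV(1) by (simp flip: mult.assoc)
      have V': "star (V j (en j b)) = (star (V j (en j b)) * V j (en j b)) * star (V j (en j b))"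
        using j b eb VZ1(3) pV(3) by (simp add: mult.assoc)
      have "w i a * star (w j b) = V i (en i a) * (F (en i a) (en i a) * F (en j b) (en j b)) * star (V j (en j b))"
        unfolding w_def using V V' VZ2(1)[of i "en i a" "en i a"] VZ2(1)[of j "en j b" "en j b"] i j a b ea eb
        by (metis lessThan_iff mult.assoc)
      also have "F (en i a) (en i a) * F (en j b) (en j b) = 0"
        using P.unit_systemD(3)[OF F, of "en i a" "en i a" "en j b" "en j b"] i j a b ea eb False by simp
      finally show ?thesis using False by auto
    qed
  qed
  have hE: "emb X (h (EE e e' z)) = star (V i e) * emb X (\<pi> i z) * V i e'"
    if e: "e < N" "e' < N" "ci e = i" "ci e' = i" and z: "z \<in> carrier (A i)" for e e' i z
    using emb_h[OF EE_closed[OF e(1), of z e']] H_E[of i "pos e" "pos e'" z] ci(1)[OF e(1)] pos[OF e(1)] pos[OF e(2)] e z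
    unfolding EE_def w_def by simp
  show thesis
  proof (rule that[OF h_star_hom])
    fix e e' assume e: "e < N" "e' < N"
    interpret unital_cstar "A (ci e)" by (rule unital_full_free)
    note ce = ci[OF e(1)]
    {
      assume b: "bp e = bp e'"
      have c: "ci e' = ci e" "e' \<in> edges (W (ci e))" using ci_block(1)[OF e b] ci[OF e(2)] by auto
      show "emb X (h (EE e e' \<one>\<^bsub>A (ci e)\<^esub>)) = F e e'"
        using hE[OF e refl c(1) one_closed] \<pi>(2)[OF ce(1)] pV(3)[OF ce] VZ2(1)[OF ce c(2) b] by simp
    next
      assume b: "bq e = bq e'"
      have c: "ci e' = ci e" "e' \<in> edges (W (ci e))" using ci_block(2)[OF e b] ci[OF e(2)] by auto
      note hc = hol_unitary(1)[OF e(1)] hol_unitary(1)[OF e(2), unfolded c(1)]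
      have "emb X (\<pi> (ci e) (tw e e')) = star (u (ci e) e) * u (ci e) e'"
        unfolding tw_def using emb_star_hom(4)[OF X \<pi>(1)[OF ce(1)] adj_closed[OF hc(1)] hc(2)]
          emb_star_hom(5)[OF X \<pi>(1)[OF ce(1)] hc(1)] \<pi>_hol[OF ce] \<pi>_hol[OF ce(1) c(2)] by simp
      then have "emb X (h (EE e e' (tw e e'))) = star (V (ci e) e) * (star (u (ci e) e) * u (ci e) e') * V (ci e) e'"
        using hE[OF e refl c(1) tw(1)[OF e c(1)[symmetric]]] by simp
      also have "\<dots> = star (u (ci e) e * V (ci e) e) * (u (ci e) e' * V (ci e) e')"
        by (simp add: star_mult mult.assoc)
      also have "\<dots> = G e e'" using uV(1)[OF ce] uV(1)[OF ce(1) c(2)] VZ2(2)[OF ce c(2) b] by simp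
      finally show "emb X (h (EE e e' (tw e e'))) = G e e'" .
    }
  qed
qed

subsection \<open>The pushout\<close>

text \<open>Obtained before the universal property, so that the same maps serve for every test type.\<close>

lemma structure_maps:
  obtains f g where "f \<in> star_hom P.DM R.DM" "g \<in> star_hom Q.DM R.DM"
    "\<And>e e'. e < N \<Longrightarrow> e' < N \<Longrightarrow> bp e = bp e' \<Longrightarrow> emb R.DM (f (P.PU e e')) = FP e e'"
    "\<And>e e'. e < N \<Longrightarrow> e' < N \<Longrightarrow> bq e = bq e' \<Longrightarrow> emb R.DM (g (Q.PU e e')) = FQ e e'"
  using P.hom_of_unit_system[OF R.cstar_DM FP] Q.hom_of_unit_system[OF R.cstar_DM FQ, unfolded offset_eq] by metis

lemma pushout:
  assumes f: "f \<in> star_hom P.DM R.DM" "\<And>e e'. e < N \<Longrightarrow> e' < N \<Longrightarrow> bp e = bp e' \<Longrightarrow> emb R.DM (f (P.PU e e')) = FP e e'"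
    and g: "g \<in> star_hom Q.DM R.DM" "\<And>e e'. e < N \<Longrightarrow> e' < N \<Longrightarrow> bq e = bq e' \<Longrightarrow> emb R.DM (g (Q.PU e e')) = FQ e e'"
  shows "cstar_pushout TYPE('t) (diagonal_alg N) P.DM Q.DM (diag_embed r m) (diag_embed s n) R.DM f g"
proof -
  have f': "f (P.PU e e') = EE e e' \<one>\<^bsub>A (ci e)\<^esub>" if "e < N" "e' < N" "bp e = bp e'" for e e'
  proof -
    interpret unital_cstar "A (ci e)" by (rule unital_full_free)
    show ?thesis using f(2)[OF that] star_homD(1)[OF f(1) P.PU_closed[OF that(1)]] EE_closed[OF that(1) one_closed]
      unfolding FP_def by (simp add: R.D.emb_inj)
  qed
  have g': "g (Q.PU e e') = EE e e' (tw e e')" if "e < N" "e' < N" "bq e = bq e'" for e e'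
    using g(2)[OF that] star_homD(1)[OF g(1) Q.PU_closed[unfolded offset_eq, OF that(1)]]
      EE_closed[OF that(1) tw(1)[OF that(1,2) ci_block(2)[OF that]]]
    unfolding FQ_def by (simp add: R.D.emb_inj)
  have "f (diag_embed r m d) = g (diag_embed s n d)" for d
  proof -
    have "emb R.DM (f (diag_embed r m d)) = emb R.DM (g (diag_embed s n d))"
      unfolding P.hom_diag[OF R.cstar_DM f(1)] Q.hom_diag[OF R.cstar_DM g(1)] offset_eq
      by (intro sum.cong refl) (simp add: f(2) g(2) FP_eq_FQ)
    then show ?thesis
      using R.D.emb_inj star_homD(1)[OF f(1) P.diag_embed_closed] star_homD(1)[OF g(1) Q.diag_embed_closed] by blast
  qed
  moreover have "\<exists>h\<in>star_hom R.DM X. (\<forall>x\<in>carrier P.DM. h (f x) = f1 x) \<and> (\<forall>y\<in>carrier Q.DM. h (g y) = g1 y) \<and>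
      (\<forall>h'\<in>star_hom R.DM X. (\<forall>x\<in>carrier P.DM. h' (f x) = f1 x) \<and> (\<forall>y\<in>carrier Q.DM. h' (g y) = g1 y) \<longrightarrow>
        (\<forall>a\<in>carrier R.DM. h' a = h a))"
    if X: "cstar_algebra X" and f1: "f1 \<in> star_hom P.DM X" and g1: "g1 \<in> star_hom Q.DM X"
      and eq: "\<forall>d\<in>carrier (diagonal_alg N). f1 (diag_embed r m d) = g1 (diag_embed s n d)" for X :: "'t cstar" and f1 g1
  proof -
    interpret X: cstar_algebra X by (rule X)
    define F where "F e e' = emb X (f1 (P.PU e e'))" for e e'
    define G where "G e e' = emb X (g1 (Q.PU e e'))" for e e'
    have F: "P.unit_system X F" and G: "Q.unit_system X G"
      unfolding F_def G_def by (rule P.unit_system_of_hom[OF X f1], rule Q.unit_system_of_hom[OF X g1])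
    have FG: "F e e = G e e" if e: "e < N" for e
    proof -
      \<comment> \<open>The minimal projection of the edge \<open>e\<close>, on which the
        amalgamation condition is tested.\<close>
      define d where "d = (\<lambda>i\<in>{..<N}. if i = e then 1 else 0 :: complex)"
      have "d \<in> carrier (diagonal_alg N)" unfolding d_def diagonal_alg_def by auto
      then have "emb X (f1 (diag_embed r m d)) = emb X (g1 (diag_embed s n d))" using eq by simp
      then have "(\<Sum>i<N. d i *\<^sub>C F i i) = (\<Sum>i<N. d i *\<^sub>C G i i)"
        unfolding P.hom_diag[OF X f1] Q.hom_diag[OF X g1] offset_eq F_def G_def .
      moreover have "(\<Sum>i<N. d i *\<^sub>C H i i) = H e e" for H :: "nat \<Rightarrow> nat \<Rightarrow> 't univ"
      proof -
        have "(\<Sum>i<N. d i *\<^sub>C H i i) = (\<Sum>i<N. if i = e then H e e else 0)"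
          by (intro sum.cong) (auto simp: d_def)
        then show ?thesis using e by simp
      qed
      ultimately show ?thesis by simp
    qed
    obtain h where h: "h \<in> star_hom R.DM X"
      "\<And>e e'. e < N \<Longrightarrow> e' < N \<Longrightarrow> bp e = bp e' \<Longrightarrow> emb X (h (EE e e' \<one>\<^bsub>A (ci e)\<^esub>)) = F e e'"
      "\<And>e e'. e < N \<Longrightarrow> e' < N \<Longrightarrow> bq e = bq e' \<Longrightarrow> emb X (h (EE e e' (tw e e'))) = G e e'"
      using hom_R_exists[OF X F G FG] by metis
    note hf = star_hom_compose[OF f(1) h(1)] and hg = star_hom_compose[OF g(1) h(1)]
    have 1: "h (f x) = f1 x" if "x \<in> carrier P.DM" for x
    proof (rule P.hom_eqI[OF X hf f1 that])
      fix e e' assume e: "e < N" "e' < N" "bp e = bp e'"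
      show "h (f (P.PU e e')) = f1 (P.PU e e')"
        using h(2)[OF e] star_homD(1)[OF hf P.PU_closed[OF e(1)], of e'] star_homD(1)[OF f1 P.PU_closed[OF e(1)], of e']
        unfolding F_def f'[OF e] by (simp add: X.emb_inj)
    qed
    have 2: "h (g x) = g1 x" if "x \<in> carrier Q.DM" for x
    proof (rule Q.hom_eqI[OF X hg g1 that])
      fix e e' assume e: "e < offset n s" "e' < offset n s" "bq e = bq e'"
      then have e': "e < N" "e' < N" using offset_eq by simp_all
      show "h (g (Q.PU e e')) = g1 (Q.PU e e')"
        using h(3)[OF e' e(3)] star_homD(1)[OF hg Q.PU_closed[OF e(1)], of e'] star_homD(1)[OF g1 Q.PU_closed[OF e(1)], of e']
        unfolding G_def g'[OF e' e(3)] by (simp add: X.emb_inj)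
    qed
    have 3: "h' a = h a" if h': "h' \<in> star_hom R.DM X" "\<forall>x\<in>carrier P.DM. h' (f x) = f1 x" "\<forall>y\<in>carrier Q.DM. h' (g y) = g1 y"
      and a: "a \<in> carrier R.DM" for h' a
    proof (rule hom_R_eqI[OF X h'(1) h(1) _ _ a])
      fix e e' assume e: "e < N" "e' < N"
      show "h' (EE e e' \<one>\<^bsub>A (ci e)\<^esub>) = h (EE e e' \<one>\<^bsub>A (ci e)\<^esub>)" if b: "bp e = bp e'"
        using f'[OF e b] 1[OF P.PU_closed[OF e(1)], of e'] h'(2) P.PU_closed[OF e(1), of e'] by metis
      show "h' (EE e e' (tw e e')) = h (EE e e' (tw e e'))" if b: "bq e = bq e'"
        using g'[OF e b] 2[OF Q.PU_closed[unfolded offset_eq, OF e(1)], of e'] h'(3) Q.PU_closed[unfolded offset_eq, OF e(1), of e'] by metis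
    qed
    show ?thesis using h(1) 1 2 3 by blast
  qed
  ultimately show ?thesis unfolding cstar_pushout_def using R.cstar_DM f(1) g(1) by blast
qed

end

section \<open>Uniqueness of pushouts and the isomorphism\<close>

lemma cstar_pushout_universal:
  fixes X :: "'t cstar"
  assumes A: "cstar_pushout TYPE('t) D P Q \<alpha> \<beta> A f g" and X: "cstar_algebra X" "f' \<in> star_hom P X" "g' \<in> star_hom Q X"
    and eq: "\<forall>d\<in>carrier D. f' (\<alpha> d) = g' (\<beta> d)"
  obtains h where "h \<in> star_hom A X" "\<forall>x\<in>carrier P. h (f x) = f' x" "\<forall>y\<in>carrier Q. h (g y) = g' y"
    "\<forall>h'\<in>star_hom A X. (\<forall>x\<in>carrier P. h' (f x) = f' x) \<and> (\<forall>y\<in>carrier Q. h' (g y) = g' y) \<longrightarrow>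
      (\<forall>a\<in>carrier A. h' a = h a)"
proof -
  note U = A[unfolded cstar_pushout_def, THEN conjunct2, THEN conjunct2, THEN conjunct2, THEN conjunct2]
  show thesis using U[THEN spec, THEN mp, OF X(1), THEN bspec, OF X(2), THEN bspec, OF X(3), THEN mp, OF eq] that by blast
qed

text \<open>The comparison maps compose to endomorphisms that, like the identity, solve the
  universal problem of a pushout against itself. The property is tied to the carrier type of the
  test algebra, so each pushout is tested both on the type of \<open>A\<close> and on that of
  \<open>B\<close>.\<close>

lemma pushout_unique:
  fixes A :: "'a cstar" and B :: "'b cstar"
  assumes A: "cstar_pushout TYPE('a) D P Q \<alpha> \<beta> A f g" "cstar_pushout TYPE('b) D P Q \<alpha> \<beta> A f g"
    and B: "cstar_pushout TYPE('a) D P Q \<alpha> \<beta> B f' g'" "cstar_pushout TYPE('b) D P Q \<alpha> \<beta> B f' g'"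
  shows "star_isomorphic A B"
proof -
  have cA: "cstar_algebra A" "f \<in> star_hom P A" "g \<in> star_hom Q A" "\<forall>d\<in>carrier D. f (\<alpha> d) = g (\<beta> d)"
    using A(1) unfolding cstar_pushout_def by blast+
  have cB: "cstar_algebra B" "f' \<in> star_hom P B" "g' \<in> star_hom Q B" "\<forall>d\<in>carrier D. f' (\<alpha> d) = g' (\<beta> d)"
    using B(1) unfolding cstar_pushout_def by blast+
  obtain h where h: "h \<in> star_hom A B" "\<forall>x\<in>carrier P. h (f x) = f' x" "\<forall>y\<in>carrier Q. h (g y) = g' y"
    by (rule cstar_pushout_universal[OF A(2) cB])
  obtain h' where h': "h' \<in> star_hom B A" "\<forall>x\<in>carrier P. h' (f' x) = f x" "\<forall>y\<in>carrier Q. h' (g' y) = g y"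
    by (rule cstar_pushout_universal[OF B(1) cA])
  obtain iA where iA: "\<forall>t\<in>star_hom A A. (\<forall>x\<in>carrier P. t (f x) = f x) \<and> (\<forall>y\<in>carrier Q. t (g y) = g y) \<longrightarrow>
      (\<forall>a\<in>carrier A. t a = iA a)"
    by (rule cstar_pushout_universal[OF A(1) cA])
  obtain iB where iB: "\<forall>t\<in>star_hom B B. (\<forall>x\<in>carrier P. t (f' x) = f' x) \<and> (\<forall>y\<in>carrier Q. t (g' y) = g' y) \<longrightarrow>
      (\<forall>a\<in>carrier B. t a = iB a)"
    by (rule cstar_pushout_universal[OF B(2) cB])
  have idA: "(\<lambda>x. x) \<in> star_hom A A" and idB: "(\<lambda>x. x) \<in> star_hom B B" unfolding star_hom_def by auto
  have hh: "h' (h a) = a" if "a \<in> carrier A" for a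
    using iA[rule_format, OF idA _ that] iA[rule_format, OF star_hom_compose[OF h(1) h'(1)] _ that] h h' by simp
  have hh': "h (h' b) = b" if "b \<in> carrier B" for b
    using iB[rule_format, OF idB _ that] iB[rule_format, OF star_hom_compose[OF h'(1) h(1)] _ that] h h' by simp
  have "bij_betw h (carrier A) (carrier B)"
    using star_homD(1)[OF h(1)] star_homD(1)[OF h'(1)] hh hh' by (intro bij_betwI[of _ _ _ h']) auto
  then show ?thesis unfolding star_isomorphic_def using h(1) by blast
qed

theorem theorem5:
  fixes r s N p :: nat and m n k q :: "nat \<Rightarrow> nat"
    and W :: "nat \<Rightarrow> (nat + nat, nat) multigraph" and T :: "nat \<Rightarrow> nat set"
    and D :: "(nat \<Rightarrow> complex) cstar"
    and P Q :: "(nat \<Rightarrow> nat \<times> nat \<Rightarrow> complex) cstar"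
    and R :: "(nat \<Rightarrow> nat \<times> nat \<Rightarrow> free_cstar_elem) cstar"
  assumes "\<And>i. i < r \<Longrightarrow> m i > 0" and "\<And>j. j < s \<Longrightarrow> n j > 0"
    and "(\<Sum>i<r. m i) = N" and "(\<Sum>j<s. n j) = N"
    and "bij_betw W {..<p} (components (block_graph N r m s n))"
    and "\<And>i. i < p \<Longrightarrow> spanning_tree (W i) (T i)"
    and "\<And>i. i < p \<Longrightarrow> k i = card (edges (W i))"
    and "\<And>i. i < p \<Longrightarrow> q i = card (edges (W i) - T i)"
  defines "D \<equiv> diagonal_alg N"
    and "P \<equiv> multimatrix r m"
    and "Q \<equiv> multimatrix s n"
    and "R \<equiv> direct_sum {..<p} (\<lambda>i. matrix_alg (k i) (full_group_cstar (free_group (q i))))"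
  shows "(\<exists>f g. cstar_pushout TYPE('t) D P Q (diag_embed r m) (diag_embed s n) R f g) \<and>
    (\<forall>(A :: 'a cstar) f g.
       cstar_pushout TYPE('a) D P Q (diag_embed r m) (diag_embed s n) A f g \<longrightarrow>
       cstar_pushout TYPE(nat \<Rightarrow> nat \<times> nat \<Rightarrow> free_cstar_elem) D P Q
         (diag_embed r m) (diag_embed s n) A f g \<longrightarrow>
       star_isomorphic A R)"
proof -
  have N: "offset m r = N" "offset n s = N" unfolding offset_def using assms(3,4) by simp_all
  interpret amalgam r m s n p k q W T
    by unfold_locales (use assms N in auto)
  have eqs: "D = diagonal_alg (offset m r)" "P = P.DM" "Q = Q.DM" "R = R.DM"
    unfolding D_def P_def Q_def R_def P.DM_multimatrix Q.DM_multimatrix R.DM_def N by simp_all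
  obtain f g where fg: "f \<in> star_hom P.DM R.DM" "g \<in> star_hom Q.DM R.DM"
    "\<And>e e'. e < offset m r \<Longrightarrow> e' < offset m r \<Longrightarrow> block r m e = block r m e' \<Longrightarrow> emb R.DM (f (P.PU e e')) = FP e e'"
    "\<And>e e'. e < offset m r \<Longrightarrow> e' < offset m r \<Longrightarrow> block s n e = block s n e' \<Longrightarrow> emb R.DM (g (Q.PU e e')) = FQ e e'"
    using structure_maps by blast
  show ?thesis unfolding eqs
    using pushout[OF fg(1,3,2,4)] pushout_unique[OF _ _ pushout[OF fg(1,3,2,4)] pushout[OF fg(1,3,2,4)]]
    by blast
qed

end
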